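(* Let $H$ be a fixed connected non-planar graph, let $g \geq 0$ be a constant integer, and let $m=m(n)$ be an integer-valued function with $0 \le m \leq 3n-6+6g$ for all $n$. Then \[ \mathbb{P}[S_{g}(n,m) \text{ has a component isomorphic to } H] \to 0 \quad\text{as } n \to \infty. \]
   Context: A graph has genus at most $g$ if it can be embedded without crossing edges on an orientable surface of genus $g$ (a sphere with $g$ handles attached). $\mathcal{S}^{g}(n,m)$ denotes the set of all labelled simple graphs on vertex set $[n]=\{1,\dots,n\}$ with exactly $m$ edges and genus at most $g$, and $S_{g}(n,m)$ denotes a graph chosen uniformly at random from $\mathcal{S}^{g}(n,m)$. *)

theory Defs
  imports "HOL-Analysis.Analysis"
begin

type_synonym 'a graph = "'a set \<times> 'a set set"

abbreviation verts :: "'a graph \<Rightarrow> 'a set" where "verts \<equiv> fst"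
abbreviation edges :: "'a graph \<Rightarrow> 'a set set" where "edges \<equiv> snd"

definition simple_graph :: "'a graph \<Rightarrow> bool" where
  "simple_graph G \<longleftrightarrow> finite (verts G) \<and> (\<forall>e\<in>edges G. e \<subseteq> verts G \<and> card e = 2)"

definition adj :: "'a graph \<Rightarrow> 'a rel" where
  "adj G = {(u, v). {u, v} \<in> edges G}"

definition connected_graph :: "'a graph \<Rightarrow> bool" where
  "connected_graph G \<longleftrightarrow> verts G \<noteq> {} \<and> (\<forall>u\<in>verts G. \<forall>v\<in>verts G. (u, v) \<in> (adj G)\<^sup>*)"

definition graph_components :: "'a graph \<Rightarrow> 'a graph set" where
  "graph_components G = (\<lambda>v. let C = (adj G)\<^sup>* `` {v} in (C, {e \<in> edges G. e \<subseteq> C})) ` verts G"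

definition graph_iso :: "'a graph \<Rightarrow> 'b graph \<Rightarrow> bool" where
  "graph_iso G H \<longleftrightarrow> (\<exists>f. bij_betw f (verts G) (verts H) \<and> (\<lambda>e. f ` e) ` edges G = edges H)"

definition has_component_iso :: "'a graph \<Rightarrow> 'b graph \<Rightarrow> bool" where
  "has_component_iso G H \<longleftrightarrow> (\<exists>C\<in>graph_components G. graph_iso C H)"

text \<open>An embedding without crossing edges: vertices are distinct points, every edge is a simple arc
  joining its two ends and containing no other vertex, and two different edges meet only in a
  common end (if any).\<close>

definition embeds_in :: "'a graph \<Rightarrow> 'b::topological_space set \<Rightarrow> bool" where
  "embeds_in G S \<longleftrightarrow> (\<exists>(p :: 'a \<Rightarrow> 'b) (\<gamma> :: 'a set \<Rightarrow> real \<Rightarrow> 'b).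
     inj_on p (verts G) \<and> p ` verts G \<subseteq> S \<and>
     (\<forall>e\<in>edges G. arc (\<gamma> e) \<and> path_image (\<gamma> e) \<subseteq> S \<and>
        {pathstart (\<gamma> e), pathfinish (\<gamma> e)} = p ` e \<and>
        path_image (\<gamma> e) \<inter> p ` verts G = p ` e) \<and>
     (\<forall>e\<in>edges G. \<forall>e'\<in>edges G. e \<noteq> e' \<longrightarrow>
        path_image (\<gamma> e) \<inter> path_image (\<gamma> e') = p ` (e \<inter> e')))"

definition planar :: "'a graph \<Rightarrow> bool" where
  "planar G \<longleftrightarrow> embeds_in G (UNIV :: (real \<times> real) set)"

text \<open>A concrete model in three-space of the sphere with \<open>g\<close> handles: the boundary of a rectangular
  block with \<open>g\<close> disjoint vertical tunnels bored through it. The boundary of the solid block is a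
  topological sphere; each tunnel removes one open disc from the top face and one from the bottom
  face and attaches the tunnel wall, a cylinder, along the two boundary circles. The surface is
  orientable because it bounds a solid in three-space.\<close>

definition bored_block :: "nat \<Rightarrow> (real \<times> real \<times> real) set" where
  "bored_block g = {0..2 * real g + 1} \<times> {0..3} \<times> {0..1}
     - (\<Union>i<g. {2 * real i + 1<..<2 * real i + 2} \<times> {1<..<2} \<times> UNIV)"

definition orientable_surface :: "nat \<Rightarrow> (real \<times> real \<times> real) set" where
  "orientable_surface g = frontier (bored_block g)"

definition genus_at_most :: "nat \<Rightarrow> 'a graph \<Rightarrow> bool" where
  "genus_at_most g G \<longleftrightarrow> embeds_in G (orientable_surface g)"

definition genus_graphs :: "nat \<Rightarrow> nat \<Rightarrow> nat \<Rightarrow> nat graph set" where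
  "genus_graphs g n m =
     {G. simple_graph G \<and> verts G = {1..n} \<and> card (edges G) = m \<and> genus_at_most g G}"

text \<open>The law of \<open>S\<^sub>g(n,m)\<close>. If there is no such graph (under the edge bound \<open>3n - 6 + 6g\<close> this
  happens only for small \<open>n\<close>), it is the zero measure on the empty space.\<close>

definition random_genus_graph :: "nat \<Rightarrow> nat \<Rightarrow> nat \<Rightarrow> nat graph measure" where
  "random_genus_graph g n m = uniform_count_measure (genus_graphs g n m)"

end

theory Submission imports Defs
begin

text \<open>An isolated copy of \<open>H\<close> can be attached to the rest of the graph in about \<open>n\<close> ways by moving one of
  its edges, without raising the genus. Conversely, the copy is then recognised among the \<^emph>\<open>ears\<close>,
  the connected sets of \<open>h\<close> vertices left by at most one edge that contain a cycle. Every vertex lies in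
  at most \<open>4\<^sup>h\<close> sets of this kind, since two of them that cross cover a component. If there are only few
  (less than about the square root of \<open>n\<close>) ears, the move gains a large factor. Otherwise a second move,
  which keeps the copy of \<open>H\<close> intact and instead takes an edge out of a cycle of an ear elsewhere, has many
  more choices than preimages, because a graph of genus \<open>g\<close> has at most \<open>2g\<close> disjoint non-planar
  connected parts.

  Both facts about the genus, invariance under joining two components by an edge and the bound on the number
  of disjoint non-planar parts, come from the equivalence of embeddability with a combinatorial condition:
  every component has a rotation system, and the values \<open>E - V + 2 - F\<close> sum to at most \<open>2g\<close>, where the
  number \<open>F\<close> of faces is read off a colouring of the corners. From a rotation system to
  a drawing: contract a spanning tree, reduce the resulting cyclic word by cancellations and handle
  moves, and draw while sweeping across the surface, passing one tunnel for each handle. From a drawing to a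
  rotation system: the surface carries arbitrarily fine lattices that satisfy Euler's formula, a graph drawn on
  the surface is a minor of such a lattice, and the condition is inherited by minors.\<close>

text \<open>Since \<open>m\<close> is an arbitrary function of \<open>n\<close>, nothing is known
  about the growth of the number of graphs, so both moves keep \<open>m\<close>: the edge that ties
  a copy to the rest is paid for by deleting another. Taking it from the copy may make the copy
  planar, and then it can be recognised only as an ear. A graph may have linearly many ears; this is
  the obstacle. Taking the edge from another ear leaves the copy non-planar, so it is found again
  among boundedly many candidates, and only the broken ear has to be guessed among O(n) sets. The
  threshold of order square root of n balances the two losses. An ear must contain a cycle so that
  it stays connected when it gives up an edge.

  The genus facts cannot be read off a given drawing: two components need not border a common face
  in it, and its faces need not be discs. Hence a drawing is turned into a certificate, changed
  there, and drawn afresh. The bound 2g on disjoint non-planar parts arises because each of them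
  takes at least 1 from a budget of 2g.\<close>

section \<open>Face walks and rotation systems\<close>

text \<open>The colour \<open>c x\<close> belongs to the face on one side of the dart
  \<open>x\<close>, and \<open>c (a x)\<close> to the face on its other side. A list of darts in
  rotation order is a walk when the face after \<open>x\<close> is the face before the next dart, so
  that colours are constant along faces; \<open>p\<close> is the colour of the corner where the list
  is cut open, the only corner if the list is empty. Distinct faces may share a colour, so the
  number of colours is a lower bound for the number of faces.\<close>

fun walk :: "('d \<Rightarrow> 'd) \<Rightarrow> ('d \<Rightarrow> 'c) \<Rightarrow> 'c \<Rightarrow> 'd list \<Rightarrow> 'c \<Rightarrow> bool" where
  "walk a c p [] q \<longleftrightarrow> p = q"
| "walk a c p (x # xs) q \<longleftrightarrow> c x = p \<and> walk a c (c (a x)) xs q"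

lemma walk_append: "walk a c p (u @ v) q \<longleftrightarrow> (\<exists>r. walk a c p u r \<and> walk a c r v q)"
  by (induction u arbitrary: p) auto

lemma walk_comp: "walk a c p xs q \<Longrightarrow> walk a (f \<circ> c) (f p) xs (f q)"
  by (induction xs arbitrary: p) auto

lemma walk_cong:
  "walk a c p xs q \<Longrightarrow> (\<And>x. x \<in> set xs \<Longrightarrow> c' x = c x \<and> c' (a x) = c (a x)) \<Longrightarrow> walk a c' p xs q"
  by (induction xs arbitrary: p) auto

lemma walk_end: "walk a c p xs q \<Longrightarrow> q \<in> insert p ((\<lambda>x. c (a x)) ` set xs)"
  by (induction xs arbitrary: p) auto

text \<open>Telescoping: each step moves from the colour \<open>c x\<close> to
  \<open>c (a x)\<close>. For a closed walk the two sums agree, which drives the count on one side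
  of a bridge.\<close>

lemma walk_sum:
  fixes F :: "'c \<Rightarrow> nat"
  shows "walk a c p xs q \<Longrightarrow> distinct xs \<Longrightarrow>
    F q + (\<Sum>x\<in>set xs. F (c x)) = F p + (\<Sum>x\<in>set xs. F (c (a x)))"
proof (induction xs arbitrary: p)
  case (Cons x xs)
  then have "F q + (\<Sum>x\<in>set xs. F (c x)) = F (c (a x)) + (\<Sum>x\<in>set xs. F (c (a x)))" by simp
  with Cons show ?case by simp
qed simp

section \<open>Involutions and the reduction of words\<close>

definition inv_on :: "('d \<Rightarrow> 'd) \<Rightarrow> 'd set \<Rightarrow> bool" where
  "inv_on a D \<longleftrightarrow> (\<forall>x\<in>D. a x \<in> D \<and> a (a x) = x \<and> a x \<noteq> x)"

lemma inv_onD: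
  assumes "inv_on a D" "x \<in> D" shows "a x \<in> D" "a (a x) = x" "a x \<noteq> x"
  using assms by (auto simp: inv_on_def)

lemma inv_on_sum:
  assumes "inv_on a D" shows "(\<Sum>x\<in>D. F (a x)) = sum F D"
proof -
  have inj: "inj_on a D" using assms unfolding inv_on_def inj_on_def by metis
  have "a ` D = D" using assms unfolding inv_on_def image_def by (auto; metis)
  then show ?thesis using sum.reindex[OF inj, of F] by simp
qed

lemma inv_on_image:
  assumes "inv_on a D" shows "(\<lambda>x. c (a x)) ` D = c ` D"
  using assms unfolding inv_on_def image_def by (auto; metis)

lemma inv_on_diff:
  assumes "inv_on a D" "inv_on a T" "T \<subseteq> D" shows "inv_on a (D - T)"
  using assms unfolding inv_on_def by (metis Diff_iff subsetD)

lemma inv_on_del: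
  assumes "inv_on a D" "x \<in> D" shows "inv_on a (D - {x, a x})"
  using assms unfolding inv_on_def by (metis Diff_iff insert_iff singletonD)

inductive red :: "('d \<Rightarrow> 'd) \<Rightarrow> nat \<Rightarrow> 'd list \<Rightarrow> bool" for a where
  red_nil: "red a g []"
| red_cancel: "red a g (u @ v) \<Longrightarrow> red a g (u @ [x, a x] @ v)"
| red_handle: "red a g (A @ D @ C @ B @ E) \<Longrightarrow>
    red a (Suc g) (A @ [x] @ B @ [y] @ C @ [a x] @ D @ [a y] @ E)"

lemma red_mono: "red a s w \<Longrightarrow> s \<le> g \<Longrightarrow> red a g w"
proof (induction arbitrary: g rule: red.induct)
  case (red_handle s A D C B E x y)
  then obtain g' where "g = Suc g'" "s \<le> g'" by (cases g) auto
  then show ?case using red_handle.IH by (simp only: red.red_handle)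
next
  case (red_cancel s u v x)
  then show ?case by (simp only: red.red_cancel)
qed (rule red_nil)

text \<open>Take a chord whose ends are as close as possible, with \<open>B\<close> between them. If
  \<open>B\<close> is empty, the ends are adjacent. Otherwise the first letter \<open>y\<close> of
  \<open>B\<close> cannot have its partner in \<open>B\<close>, where it would be a shorter chord,
  so the two chords cross.\<close>

lemma chord_exists:
  assumes "distinct w" "inv_on a (set w)" "w \<noteq> []"
  obtains (adjacent) u x v where "w = u @ [x, a x] @ v"
  | (crossing) A x B y C D E where "w = A @ [x] @ B @ [y] @ C @ [a x] @ D @ [a y] @ E"
proof -
  define P where "P n \<longleftrightarrow> (\<exists>u x B v. w = u @ [x] @ B @ [a x] @ v \<and> length B = n)" for n
  obtain x w' where w': "w = x # w'" using assms(3) by (cases w) auto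
  then have "a x \<in> set w'" using assms(2) unfolding inv_on_def by (metis list.set_intros(1) set_ConsD)
  then obtain B v where "w' = B @ a x # v" by (meson split_list)
  then have "w = [] @ [x] @ B @ [a x] @ v" using w' by simp
  then have "P (length B)" unfolding P_def by blast
  then have L: "P (LEAST n. P n)" by (rule LeastI)
  then obtain u x B v where w: "w = u @ [x] @ B @ [a x] @ v" and B: "length B = (LEAST n. P n)"
    unfolding P_def by blast
  have min: "\<not> P n" if "n < length B" for n using that B not_less_Least by metis
  have inv: "a z \<in> set w" "a (a z) = z" "a z \<noteq> z" if "z \<in> set w" for z
    using inv_onD[OF assms(2) that] by auto
  show ?thesis
  proof (cases B)
    case Nil
    then show ?thesis using adjacent[of u x v] w by simp
  next
    case (Cons y B2)
    have y: "y \<in> set B" "y \<in> set w" using Cons w by auto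
    have "a y \<notin> set B"
    proof
      assume "a y \<in> set B"
      then have "a y \<in> set B2" using Cons inv(3)[OF y(2)] by auto
      then obtain C D where "B2 = C @ a y # D" by (meson split_list)
      then have "w = (u @ [x]) @ [y] @ C @ [a y] @ (D @ [a x] @ v)" using w Cons by simp
      then have "P (length C)" unfolding P_def by blast
      then show False using min[of "length C"] Cons \<open>B2 = C @ a y # D\<close> by simp
    qed
    moreover have "a y \<noteq> x"
    proof
      assume "a y = x" then have "y = a x" using inv(2)[OF y(2)] by simp
      then show False using assms(1) w y by auto
    qed
    moreover have "a y \<noteq> a x"
    proof
      assume "a y = a x"
      moreover have "x \<in> set w" using w by simp
      ultimately have "y = x" using inv(2) y(2) by metis
      then show False using assms(1) w y by auto
    qed
    ultimately have "a y \<in> set u \<or> a y \<in> set v" using inv(1)[OF y(2)] w by auto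
    then show ?thesis
    proof
      assume "a y \<in> set u"
      then obtain A B0 where "u = A @ a y # B0" by (meson split_list)
      then have "w = A @ [a y] @ B0 @ [x] @ [] @ [a (a y)] @ B2 @ [a x] @ v"
        using w Cons inv(2)[OF y(2)] by simp
      then show ?thesis by (rule crossing)
    next
      assume "a y \<in> set v"
      then obtain D E where "v = D @ a y # E" by (meson split_list)
      then have "w = u @ [x] @ [] @ [y] @ B2 @ [a x] @ D @ [a y] @ E"
        using w Cons by simp
      then show ?thesis by (rule crossing)
    qed
  qed
qed

lemma insert_Un_absorb: "T \<subseteq> insert p S \<Longrightarrow> insert p (T \<union> S) = insert p S"
  by blast

text \<open>The bound is Euler's formula for a one-vertex map with \<open>length w / 2\<close> edges: each handle costs two
  faces.\<close>

lemma red_exists: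
  assumes "distinct w" "inv_on a (set w)"
  shows "\<exists>s. red a s w \<and> (\<forall>(c :: 'd \<Rightarrow> 'c) p. walk a c p w p \<longrightarrow>
    2 * card (insert p (c ` set w)) + 4 * s \<le> length w + 2)"
  using assms
proof (induction "length w" arbitrary: w rule: less_induct)
  case less
  show ?case
  proof (cases "w = []")
    case True
    then show ?thesis by (intro exI[of _ 0]) (auto intro: red_nil)
  next
    case False
    from less.prems False show ?thesis
    proof (cases rule: chord_exists)
      case (adjacent u x v)
      have x: "x \<in> set w" "a (a x) = x" using adjacent inv_onD[OF less.prems(2)] by auto
      have set': "set (u @ v) = set w - {x, a x}" using less.prems(1) adjacent by auto
      then have inv': "inv_on a (set (u @ v))" using inv_on_del[OF less.prems(2) x(1)] by simp
      obtain s where s: "red a s (u @ v)" and bd: "\<And>(c :: 'd \<Rightarrow> 'c) p. walk a c p (u @ v) p \<Longrightarrow>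
          2 * card (insert p (c ` set (u @ v))) + 4 * s \<le> length (u @ v) + 2"
        using less.hyps[of "u @ v"] less.prems(1) inv' adjacent by auto
      show ?thesis
      proof (intro exI conjI allI impI)
        show "red a s w" unfolding adjacent using s by (rule red_cancel)
        fix c :: "'d \<Rightarrow> 'c" and p assume W: "walk a c p w p"
        then have 1: "walk a c p u (c x)" "walk a c (c x) v p"
          using x unfolding adjacent walk_append by auto
        then have "walk a c p (u @ v) p" unfolding walk_append by blast
        note b = bd[OF this]
        \<comment> \<open>Of the two colours of the cancelled chord, \<open>c x\<close> survives at
          the point where the word closes up. At most \<open>c (a x)\<close> is lost, in exchange
          for two letters.\<close>
        have "c x \<in> insert p ((\<lambda>x. c (a x)) ` set (u @ v))"
          using walk_end[OF 1(1)] by auto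
        then have "c x \<in> insert p (c ` set (u @ v))" using inv_on_image[OF inv', of c] by simp
        then have "insert p (c ` set w) = insert (c (a x)) (insert p (c ` set (u @ v)))"
          unfolding adjacent by auto
        then have "card (insert p (c ` set w)) \<le> Suc (card (insert p (c ` set (u @ v))))"
          by (simp add: card_insert_le_m1 card_insert_if)
        with b show "2 * card (insert p (c ` set w)) + 4 * s \<le> length w + 2"
          unfolding adjacent by simp
      qed
    next
      case (crossing A x B y C D E)
      let ?w = "A @ D @ C @ B @ E"
      have xy: "x \<in> set w" "a (a x) = x" "y \<in> set w" "a (a y) = y"
        using crossing inv_onD[OF less.prems(2)] by auto
      have yx: "y \<in> set w - {x, a x}" using less.prems(1) crossing by auto
      have set': "set ?w = set w - {x, a x} - {y, a y}" using less.prems(1) crossing by auto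
      then have inv': "inv_on a (set ?w)"
        using inv_on_del[OF inv_on_del[OF less.prems(2) xy(1)] yx] by simp
      have d: "distinct ?w" using less.prems(1) crossing by auto
      obtain s where s: "red a s ?w" and bd: "\<And>(c :: 'd \<Rightarrow> 'c) p. walk a c p ?w p \<Longrightarrow>
          2 * card (insert p (c ` set ?w)) + 4 * s \<le> length ?w + 2"
        using less.hyps[of ?w] d inv' crossing by auto
      show ?thesis
      proof (intro exI conjI allI impI)
        show "red a (Suc s) w" unfolding crossing using s by (rule red_handle)
        fix c :: "'d \<Rightarrow> 'c" and p assume W: "walk a c p w p"
        then have 1: "walk a c p A (c x)" "walk a c (c (a x)) B (c y)" "walk a c (c (a y)) C (c (a x))"
          "walk a c (c x) D (c (a y))" "walk a c (c y) E p"
          using xy unfolding crossing walk_append by auto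
        then have "walk a c p ?w p" unfolding walk_append by blast
        note b = bd[OF this]
        \<comment> \<open>A handle loses four letters but no colour: each of the four colours at the
          ends of the chords is reached at the end of one of the blocks \<open>A\<close>,
          \<open>D\<close>, \<open>C\<close>, \<open>B\<close>, taken in this order, and an empty
          block passes on the colour before it.\<close>
        let ?I = "insert p ((\<lambda>x. c (a x)) ` set ?w)"
        have cx: "c x \<in> ?I" using walk_end[OF 1(1)] by auto
        then have cy: "c (a y) \<in> ?I" using walk_end[OF 1(4)] by auto
        then have cx': "c (a x) \<in> ?I" using walk_end[OF 1(3)] by auto
        then have cy': "c y \<in> ?I" using walk_end[OF 1(2)] by auto
        have "?I = insert p (c ` set ?w)" using inv_on_image[OF inv', of c] by simp
        then have 2: "c x \<in> insert p (c ` set ?w)" "c y \<in> insert p (c ` set ?w)"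
          "c (a x) \<in> insert p (c ` set ?w)" "c (a y) \<in> insert p (c ` set ?w)"
          using cx cy cx' cy' by (simp_all only:)
        have "set w = {x, y, a x, a y} \<union> set ?w" unfolding crossing by auto
        then have "c ` set w = {c x, c y, c (a x), c (a y)} \<union> c ` set ?w"
          by (simp only: image_Un image_insert image_empty)
        moreover have "{c x, c y, c (a x), c (a y)} \<subseteq> insert p (c ` set ?w)"
          using 2 by (simp only: insert_subset empty_subsetI simp_thms)
        ultimately have "insert p (c ` set w) = insert p (c ` set ?w)"
          by (simp only: insert_Un_absorb)
        with b show "2 * card (insert p (c ` set w)) + 4 * Suc s \<le> length w + 2"
          unfolding crossing by simp
      qed
    qed
  qed
qed

section \<open>Rotation systems and the contraction of subtrees\<close>

definition darts :: "('v \<Rightarrow> 'd list) \<Rightarrow> 'v set \<Rightarrow> 'd set" where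
  "darts \<rho> V = (\<Union>v\<in>V. set (\<rho> v))"

definition rotation :: "('d \<Rightarrow> 'd) \<Rightarrow> ('v \<Rightarrow> 'd list) \<Rightarrow> 'v set \<Rightarrow> bool" where
  "rotation a \<rho> V \<longleftrightarrow> finite V \<and> (\<forall>v\<in>V. distinct (\<rho> v)) \<and>
     (\<forall>u\<in>V. \<forall>v\<in>V. u \<noteq> v \<longrightarrow> set (\<rho> u) \<inter> set (\<rho> v) = {}) \<and> inv_on a (darts \<rho> V)"

lemma rotation_disjoint:
  assumes "rotation a \<rho> V" "W \<subseteq> V" "b \<in> V" "b \<notin> W" "x \<in> set (\<rho> b)"
  shows "x \<notin> darts \<rho> W"
proof
  assume "x \<in> darts \<rho> W"
  then obtain v where v: "v \<in> W" "x \<in> set (\<rho> v)" by (auto simp: darts_def)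
  then have "v \<in> V" "v \<noteq> b" using assms by auto
  then have "set (\<rho> v) \<inter> set (\<rho> b) = {}" using assms(1,3) by (simp add: rotation_def)
  then show False using v assms(5) by blast
qed

lemma finite_darts: "finite V \<Longrightarrow> finite (darts \<rho> V)"
  by (auto simp: darts_def)

text \<open>The word read around a subtree that has been contracted to a point.\<close>

inductive grows :: "('d \<Rightarrow> 'd) \<Rightarrow> ('v \<Rightarrow> 'd list) \<Rightarrow> 'v set \<Rightarrow> 'd list \<Rightarrow> bool" for a \<rho> where
  grows_init: "grows a \<rho> {r} (\<rho> r)"
| grows_step: "grows a \<rho> W (u @ [d] @ v) \<Longrightarrow> b \<notin> W \<Longrightarrow> \<rho> b = xs @ [a d] @ ys \<Longrightarrow>
    grows a \<rho> (insert b W) (u @ ys @ xs @ v)"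

text \<open>The darts missing from the word belong to the contracted edges: two for each vertex of
  \<open>W\<close> except the root. The equation is arranged to avoid subtraction.\<close>

lemma grows_props:
  assumes "rotation a \<rho> V"
  shows "grows a \<rho> W w \<Longrightarrow> W \<subseteq> V \<Longrightarrow> W \<noteq> {} \<and> distinct w \<and> set w \<subseteq> darts \<rho> W \<and>
    inv_on a (darts \<rho> W - set w) \<and> card (darts \<rho> W - set w) + 2 = 2 * card W"
proof (induction rule: grows.induct)
  case (grows_init r)
  with assms show ?case by (auto simp: rotation_def darts_def inv_on_def)
next
  case (grows_step W u d v b xs ys)
  let ?w = "u @ [d] @ v" let ?w' = "u @ ys @ xs @ v"
  have bV: "b \<in> V" "W \<subseteq> V" and IH: "W \<noteq> {}" "distinct ?w" "set ?w \<subseteq> darts \<rho> W"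
    "inv_on a (darts \<rho> W - set ?w)" "card (darts \<rho> W - set ?w) + 2 = 2 * card W"
    using grows_step by auto
  have fin: "finite W" using assms bV finite_subset by (auto simp: rotation_def)
  have disj: "darts \<rho> W \<inter> set (\<rho> b) = {}"
    using rotation_disjoint[OF assms bV(2,1) grows_step(2)] by blast
  have db: "distinct (\<rho> b)" using assms bV by (auto simp: rotation_def)
  have dV: "d \<in> darts \<rho> V" using IH(3) bV by (auto simp: darts_def)
  have inv: "inv_on a (darts \<rho> V)" using assms by (simp add: rotation_def)
  have ad: "a (a d) = d" "a d \<noteq> d" using inv_onD[OF inv dV] by auto
  have D: "darts \<rho> (insert b W) = darts \<rho> W \<union> set (\<rho> b)" by (auto simp: darts_def)
  have d1: "d \<in> darts \<rho> W" "a d \<notin> darts \<rho> W" using IH(3) disj grows_step(3) by auto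
  have dist: "distinct ?w'" using IH(2,3) disj db grows_step(3) by auto
  have T: "darts \<rho> (insert b W) - set ?w' = insert d (insert (a d) (darts \<rho> W - set ?w))"
    using IH(2,3) disj db grows_step(3) unfolding D by auto
  have "inv_on a (insert d (insert (a d) (darts \<rho> W - set ?w)))"
    using IH(4) ad unfolding inv_on_def by auto
  moreover have "card (insert d (insert (a d) (darts \<rho> W - set ?w))) = card (darts \<rho> W - set ?w) + 2"
    using d1 ad(2) finite_darts[OF fin, of \<rho>] by (subst card_insert_disjoint; simp)+
  moreover have "set ?w' \<subseteq> darts \<rho> (insert b W)" using IH(3) grows_step(3) unfolding D by auto
  ultimately show ?case using T dist grows_step(2) fin IH(5) by auto
qed

lemma grows_exists:
  assumes "rotation a \<rho> V" "U \<subseteq> V" "U \<noteq> {}"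
    and conn: "\<And>W. W \<subset> U \<Longrightarrow> W \<noteq> {} \<Longrightarrow> \<exists>d\<in>darts \<rho> W. a d \<in> darts \<rho> (U - W)"
  shows "\<exists>w. grows a \<rho> U w"
proof -
  have fin: "finite U" using assms(1,2) finite_subset by (auto simp: rotation_def)
  have "\<exists>W w. W \<subseteq> U \<and> card W = Suc k \<and> grows a \<rho> W w" if "k < card U" for k
    using that
  proof (induction k)
    case 0
    obtain r where "r \<in> U" using assms(3) by blast
    then show ?case by (intro exI[of _ "{r}"] exI[of _ "\<rho> r"]) (auto intro: grows_init)
  next
    case (Suc k)
    then obtain W w where W: "W \<subseteq> U" "card W = Suc k" and w: "grows a \<rho> W w" by auto
    have "W \<subset> U" "W \<noteq> {}" using W Suc.prems by auto
    then obtain d where d: "d \<in> darts \<rho> W" "a d \<in> darts \<rho> (U - W)" using conn by blast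
    then obtain b where b: "b \<in> U" "b \<notin> W" "a d \<in> set (\<rho> b)" by (auto simp: darts_def)
    note pr = grows_props[OF assms(1) w]
    have WV: "W \<subseteq> V" using W assms(2) by blast
    have "a d \<notin> darts \<rho> W" using rotation_disjoint[OF assms(1) WV _ b(2,3)] b(1) assms(2) by blast
    \<comment> \<open>Contracted darts come in pairs inside \<open>W\<close>, so a dart whose
      partner lies outside \<open>W\<close> is still in the word.\<close>
    then have "d \<in> set w" using pr[OF WV] d(1) inv_onD(1)[of a "darts \<rho> W - set w" d] by blast
    then obtain u v where uv: "w = u @ [d] @ v" by (metis append_Cons append_Nil split_list)
    obtain xs ys where xy: "\<rho> b = xs @ [a d] @ ys" using b(3) by (metis append_Cons append_Nil split_list)
    have "grows a \<rho> (insert b W) (u @ ys @ xs @ v)" using w uv xy b(2) by (auto intro: grows_step)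
    moreover have "card (insert b W) = Suc (Suc k)" using W b(2) fin finite_subset by (metis card_insert_disjoint)
    ultimately show ?case using W b by (metis insert_subset)
  qed
  moreover have "card U - 1 < card U" using fin assms(3) by (simp add: card_gt_0_iff)
  ultimately obtain W w where "W \<subseteq> U" "card W = Suc (card U - 1)" "grows a \<rho> W w" by blast
  moreover have "W = U" using calculation fin \<open>card U - 1 < card U\<close> by (metis Suc_pred' card_subset_eq less_nat_zero_code neq0_conv)
  ultimately show ?thesis by blast
qed

text \<open>Contracting an edge destroys no face. Replacing \<open>d\<close> by the rotation at
  \<open>b\<close>, cut open at \<open>a d\<close>, splices one closed walk into another, and the
  colours of \<open>d\<close> and \<open>a d\<close> still occur where the pieces meet.\<close>

lemma grows_walk:
  assumes rot: "rotation a \<rho> V" and p: "\<And>v. v \<in> V \<Longrightarrow> walk a c (p v) (\<rho> v) (p v)"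
  shows "grows a \<rho> W w \<Longrightarrow> W \<subseteq> V \<Longrightarrow> \<exists>q. walk a c q w q \<and>
    c ` darts \<rho> W \<union> p ` W \<subseteq> insert q (c ` set w \<union> (\<lambda>x. c (a x)) ` set w)"
proof (induction rule: grows.induct)
  case (grows_init r)
  then show ?case using p by (auto simp: darts_def intro!: exI[of _ "p r"])
next
  case (grows_step W u d v b xs ys)
  let ?w = "u @ [d] @ v" let ?w' = "u @ ys @ xs @ v"
  let ?J = "\<lambda>w. c ` set w \<union> (\<lambda>x. c (a x)) ` set w"
  have bV: "b \<in> V" "W \<subseteq> V" using grows_step by auto
  obtain q where q: "walk a c q ?w q" "c ` darts \<rho> W \<union> p ` W \<subseteq> insert q (?J ?w)"
    using grows_step bV by auto
  have "d \<in> darts \<rho> W" using grows_props[OF rot grows_step(1)] bV by auto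
  then have "d \<in> darts \<rho> V" using bV by (auto simp: darts_def)
  then have ad: "a (a d) = d" using rot inv_onD by (fastforce simp: rotation_def)
  have w1: "walk a c q u (c d)" "walk a c (c (a d)) v q" using q(1) unfolding walk_append by auto
  have w2: "walk a c (p b) xs (c (a d))" "walk a c (c d) ys (p b)"
    using p[OF bV(1)] ad unfolding grows_step(3) walk_append by auto
  have "walk a c q ?w' q" unfolding walk_append using w1 w2 by blast
  moreover have "c ` darts \<rho> (insert b W) \<union> p ` insert b W \<subseteq> insert q (?J ?w')"
  proof -
    have cd: "c d \<in> insert q (?J ?w')" using walk_end[OF w1(1)] by auto
    have pb: "p b \<in> insert q (?J ?w')" using walk_end[OF w2(2)] cd by auto
    have cad: "c (a d) \<in> insert q (?J ?w')" using walk_end[OF w2(1)] pb by auto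
    have "insert q (?J ?w) \<subseteq> insert (c d) (insert (c (a d)) (insert q (?J ?w')))" by auto
    also have "\<dots> = insert q (?J ?w')" using cd cad by (simp only: insert_absorb)
    finally have 1: "c ` darts \<rho> W \<union> p ` W \<subseteq> insert q (?J ?w')" using q(2) by blast
    have "darts \<rho> (insert b W) = darts \<rho> W \<union> set xs \<union> {a d} \<union> set ys"
      using grows_step(3) by (auto simp: darts_def)
    then have "c ` darts \<rho> (insert b W) \<union> p ` insert b W =
        insert (c (a d)) (insert (p b) ((c ` darts \<rho> W \<union> p ` W) \<union> (c ` set xs \<union> c ` set ys)))"
      by (simp only: image_Un image_insert image_empty) blast
    moreover have "c ` set xs \<union> c ` set ys \<subseteq> insert q (?J ?w')" by auto
    ultimately show ?thesis using 1 cad pb by (simp only: Un_least insert_subset simp_thms)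
  qed
  ultimately show ?case by blast
qed

section \<open>Deletion of edges from a coloured rotation system\<close>

lemma walk_filter:
  assumes "f (c x) = f (c (a x))" "a (a x) = x"
  shows "walk a c p xs q \<Longrightarrow> walk a (f \<circ> c) (f p) (filter (\<lambda>d. d \<noteq> x \<and> d \<noteq> a x) xs) (f q)"
proof (induction xs arbitrary: p)
  case (Cons y ys)
  then have y: "c y = p" and "walk a (f \<circ> c) (f (c (a y))) (filter (\<lambda>d. d \<noteq> x \<and> d \<noteq> a x) ys) (f q)"
    by (auto simp: comp_def)
  moreover have "f (c (a y)) = f p" if "y = x \<or> y = a x" using that assms y by auto
  ultimately show ?case by (auto simp: comp_def)
qed simp

text \<open>The face formed by merging the two sides of a deleted edge is still seen at its end,
  either at the cut corner or beside a remaining dart. So a deletion costs the one colour lost in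
  merging and no more.\<close>

lemma walk_filter_colour:
  assumes "f (c x) = f (c (a x))" "a (a x) = x"
  shows "walk a c p xs q \<Longrightarrow> x \<in> set xs \<Longrightarrow>
    f (c x) \<in> insert (f p) ((\<lambda>d. f (c (a d))) ` (set xs - {x, a x}))"
proof (induction xs arbitrary: p)
  case (Cons y ys)
  show ?case
  proof (cases "y = x \<or> y = a x")
    case True
    then show ?thesis using Cons.prems assms by auto
  next
    case False
    then have "f (c x) \<in> insert (f (c (a y))) ((\<lambda>d. f (c (a d))) ` (set ys - {x, a x}))"
      using Cons by auto
    then show ?thesis using False by auto
  qed
qed simp

lemma card_merge: "finite C \<Longrightarrow> card C \<le> Suc (card ((\<lambda>k. if k = r then s else k) ` C))"
proof -
  assume C: "finite C"
  have "C - {r} \<subseteq> (\<lambda>k. if k = r then s else k) ` C" by auto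
  then have "card (C - {r}) \<le> card ((\<lambda>k. if k = r then s else k) ` C)"
    using C by (intro card_mono) auto
  then show ?thesis using C by (simp add: card_Diff_singleton_if split: if_splits)
qed

definition del_darts :: "('d \<Rightarrow> 'd) \<Rightarrow> 'd \<Rightarrow> ('v \<Rightarrow> 'd list) \<Rightarrow> 'v \<Rightarrow> 'd list" where
  "del_darts a x \<rho> v = filter (\<lambda>d. d \<noteq> x \<and> d \<noteq> a x) (\<rho> v)"

lemma darts_del: "darts (del_darts a x \<rho>) V = darts \<rho> V - {x, a x}"
  by (auto simp: darts_def del_darts_def)

lemma rotation_del:
  assumes "rotation a \<rho> V" "x \<in> darts \<rho> V" shows "rotation a (del_darts a x \<rho>) V"
proof -
  have "inv_on a (darts (del_darts a x \<rho>) V)"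
    unfolding darts_del using assms by (intro inv_on_del) (auto simp: rotation_def)
  moreover have "set (del_darts a x \<rho> u) \<inter> set (del_darts a x \<rho> v) = {}"
    if "u \<in> V" "v \<in> V" "u \<noteq> v" for u v
  proof -
    have "set (\<rho> u) \<inter> set (\<rho> v) = {}" using assms that by (simp add: rotation_def)
    then show ?thesis by (auto simp: del_darts_def)
  qed
  moreover have "distinct (del_darts a x \<rho> v)" if "v \<in> V" for v
    using assms that by (simp add: rotation_def del_darts_def)
  ultimately show ?thesis using assms(1) by (simp add: rotation_def)
qed

text \<open>\<open>f\<close> stays general because it has two uses: for an arbitrary edge it merges
  the colours of the two sides, and for a bridge, where both sides already agree, it is the
  identity.\<close>

lemma delete_pair:
  fixes c :: "'d \<Rightarrow> 'c" and p :: "'v \<Rightarrow> 'c"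
  assumes rot: "rotation a \<rho> V" and x: "x \<in> darts \<rho> V"
    and w: "\<And>v. v \<in> V \<Longrightarrow> walk a c (p v) (\<rho> v) (p v)"
    and f: "f (c x) = f (c (a x))"
  shows "\<And>v. v \<in> V \<Longrightarrow> walk a (f \<circ> c) (f (p v)) (del_darts a x \<rho> v) (f (p v))"
    and "v \<in> V \<Longrightarrow> x \<in> set (\<rho> v) \<Longrightarrow>
      f (c x) \<in> insert (f (p v)) ((\<lambda>d. f (c (a d))) ` (set (del_darts a x \<rho> v)))"
    and "f ` (c ` darts \<rho> V \<union> p ` V) \<subseteq>
      (f \<circ> c) ` darts (del_darts a x \<rho>) V \<union> (f \<circ> p) ` V"
proof -
  have inv: "inv_on a (darts \<rho> V)" using rot by (simp add: rotation_def)
  have ax: "a (a x) = x" using inv_onD[OF inv x] by simp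
  show 1: "\<And>v. v \<in> V \<Longrightarrow> walk a (f \<circ> c) (f (p v)) (del_darts a x \<rho> v) (f (p v))"
    unfolding del_darts_def using walk_filter[of f c x a, OF f ax w] .
  have set: "set (del_darts a x \<rho> v) = set (\<rho> v) - {x, a x}" for v by (auto simp: del_darts_def)
  show 2: "f (c x) \<in> insert (f (p v)) ((\<lambda>d. f (c (a d))) ` (set (del_darts a x \<rho> v)))"
    if "v \<in> V" "x \<in> set (\<rho> v)" for v
    unfolding set using walk_filter_colour[of f c x a, OF f ax w[OF that(1)] that(2)] .
  let ?D = "darts (del_darts a x \<rho>) V"
  have inv': "inv_on a ?D" using rotation_del[OF rot x] by (simp add: rotation_def)
  obtain v where v: "v \<in> V" "x \<in> set (\<rho> v)" using x by (auto simp: darts_def)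
  have "(\<lambda>d. f (c (a d))) ` (set (del_darts a x \<rho> v)) \<subseteq> (\<lambda>d. (f \<circ> c) (a d)) ` ?D"
    using v by (auto simp: darts_def)
  also have "\<dots> = (f \<circ> c) ` ?D" by (rule inv_on_image[OF inv'])
  finally have *: "f (c x) \<in> (f \<circ> c) ` ?D \<union> (f \<circ> p) ` V" using 2[OF v] v by auto
  have "darts \<rho> V \<subseteq> insert x (insert (a x) ?D)" unfolding darts_del by blast
  with * f show "f ` (c ` darts \<rho> V \<union> p ` V) \<subseteq> (f \<circ> c) ` ?D \<union> (f \<circ> p) ` V" by auto
qed

lemma delete_pair_card:
  fixes c :: "'d \<Rightarrow> 'c" and p :: "'v \<Rightarrow> 'c"
  assumes rot: "rotation a \<rho> V" and x: "x \<in> darts \<rho> V"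
    and w: "\<And>v. v \<in> V \<Longrightarrow> walk a c (p v) (\<rho> v) (p v)"
  shows "\<exists>(c' :: 'd \<Rightarrow> 'c) p'. (\<forall>v\<in>V. walk a c' (p' v) (del_darts a x \<rho> v) (p' v)) \<and>
    card (c ` darts \<rho> V \<union> p ` V) \<le> Suc (card (c' ` darts (del_darts a x \<rho>) V \<union> p' ` V))"
proof -
  define f where "f = (\<lambda>k. if k = c (a x) then c x else k)"
  have f: "f (c x) = f (c (a x))" by (simp add: f_def)
  have fin: "finite V" using rot by (simp add: rotation_def)
  note d = delete_pair[of a \<rho> V x c p f, OF rot x w f]
  have "card (c ` darts \<rho> V \<union> p ` V) \<le> Suc (card (f ` (c ` darts \<rho> V \<union> p ` V)))"
    unfolding f_def using fin finite_darts by (intro card_merge) auto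
  also have "\<dots> \<le> Suc (card ((f \<circ> c) ` darts (del_darts a x \<rho>) V \<union> (f \<circ> p) ` V))"
    using d(3) fin by (simp add: card_mono finite_darts)
  finally show ?thesis using d(1) by (intro exI[of _ "f \<circ> c"] exI[of _ "f \<circ> p"]) auto
qed

text \<open>Every deleted edge takes two darts and at most one colour, so twice the colours minus
  the darts never drops.\<close>

lemma delete_darts:
  fixes c :: "'d \<Rightarrow> 'c" and p :: "'v \<Rightarrow> 'c"
  assumes "rotation a \<rho> V" "\<And>v. v \<in> V \<Longrightarrow> walk a c (p v) (\<rho> v) (p v)"
    and "Y \<subseteq> darts \<rho> V" "inv_on a Y"
  shows "\<exists>\<rho>' (c' :: 'd \<Rightarrow> 'c) p'. rotation a \<rho>' V \<and> (\<forall>v\<in>V. walk a c' (p' v) (\<rho>' v) (p' v)) \<and>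
    (\<forall>v\<in>V. set (\<rho>' v) = set (\<rho> v) \<inter> Y) \<and>
    2 * card (c ` darts \<rho> V \<union> p ` V) + card Y \<le> 2 * card (c' ` Y \<union> p' ` V) + card (darts \<rho> V)"
  using assms
proof (induction "card (darts \<rho> V)" arbitrary: \<rho> c p rule: less_induct)
  case less
  have fin: "finite V" and inv: "inv_on a (darts \<rho> V)" using less.prems(1) by (auto simp: rotation_def)
  show ?case
  proof (cases "darts \<rho> V = Y")
    case True
    then show ?thesis using less.prems by (intro exI[of _ \<rho>] exI[of _ c] exI[of _ p]) (auto simp: darts_def)
  next
    case False
    then obtain x where x: "x \<in> darts \<rho> V" "x \<notin> Y" using less.prems(3) by blast
    let ?\<rho> = "del_darts a x \<rho>"
    obtain c' :: "'d \<Rightarrow> 'c" and p' where c': "\<And>v. v \<in> V \<Longrightarrow> walk a c' (p' v) (?\<rho> v) (p' v)"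
      "card (c ` darts \<rho> V \<union> p ` V) \<le> Suc (card (c' ` darts ?\<rho> V \<union> p' ` V))"
      using delete_pair_card[of a \<rho> V x c p, OF less.prems(1) x(1) less.prems(2)] by blast
    have ax: "a x \<in> darts \<rho> V" "a x \<noteq> x" "a (a x) = x"
      using inv_onD[OF inv x(1)] by auto
    then have axY: "a x \<notin> Y" using inv_onD(1)[OF less.prems(4)] x by metis
    have card: "card (darts \<rho> V) = card (darts ?\<rho> V) + 2"
    proof -
      have "finite (darts ?\<rho> V)" using fin by (rule finite_darts)
      then have "card (insert x (insert (a x) (darts ?\<rho> V))) = card (darts ?\<rho> V) + 2"
        using ax(2) by (simp add: darts_del)
      moreover have "insert x (insert (a x) (darts ?\<rho> V)) = darts \<rho> V"
        unfolding darts_del using x ax by auto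
      ultimately show ?thesis by simp
    qed
    have sub: "Y \<subseteq> darts ?\<rho> V" unfolding darts_del using less.prems(3) x(2) axY by auto
    obtain \<rho>' and c'' :: "'d \<Rightarrow> 'c" and p'' where r: "rotation a \<rho>' V" "\<forall>v\<in>V. walk a c'' (p'' v) (\<rho>' v) (p'' v)"
      "\<forall>v\<in>V. set (\<rho>' v) = set (?\<rho> v) \<inter> Y"
      "2 * card (c' ` darts ?\<rho> V \<union> p' ` V) + card Y \<le> 2 * card (c'' ` Y \<union> p'' ` V) + card (darts ?\<rho> V)"
      using less.hyps[OF _ rotation_del[OF less.prems(1) x(1)] c'(1) sub less.prems(4)] card
      by (metis less_add_same_cancel1 zero_less_numeral)
    have "\<forall>v\<in>V. set (\<rho>' v) = set (\<rho> v) \<inter> Y" using r(3) x axY by (auto simp: del_darts_def)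
    moreover have "2 * card (c ` darts \<rho> V \<union> p ` V) + card Y \<le> 2 * card (c'' ` Y \<union> p'' ` V) + card (darts \<rho> V)"
      using r(4) c'(2) card by linarith
    ultimately show ?thesis using r(1,2) by (intro exI[of _ \<rho>'] exI[of _ c''] exI[of _ p'']) simp
  qed
qed

section \<open>Face colourings of graphs\<close>

lemma simple_edge:
  assumes "simple_graph G" "e \<in> edges G"
  obtains u v where "e = {u, v}" "u \<noteq> v" "u \<in> verts G" "v \<in> verts G"
  using assms by (auto simp: simple_graph_def card_2_iff dest!: bspec)

lemma adjD:
  assumes "simple_graph G" "(u, v) \<in> adj G"
  shows "u \<in> verts G" "v \<in> verts G" "u \<noteq> v" "(v, u) \<in> adj G" "{u, v} \<in> edges G"
  using assms by (auto simp: adj_def simple_graph_def insert_commute dest!: bspec)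

lemma simple_finite_edges: "simple_graph G \<Longrightarrow> finite (edges G)"
  by (rule finite_subset[of _ "Pow (verts G)"]) (auto simp: simple_graph_def)

lemma finite_adj: "simple_graph G \<Longrightarrow> finite (adj G)"
  by (rule finite_subset[of _ "verts G \<times> verts G"])
     (auto simp: simple_graph_def adj_def)

lemma simple_subgraph:
  "simple_graph G \<Longrightarrow> E \<subseteq> edges G \<Longrightarrow> simple_graph (verts G, E)"
  by (auto simp: simple_graph_def)

lemma card_adj:
  assumes G: "simple_graph G" shows "card (adj G) = 2 * card (edges G)"
proof -
  let ?A = "\<lambda>e. {(u, v). {u, v} = e}"
  have A: "finite (?A e) \<and> card (?A e) = 2" if eG: "e \<in> edges G" for e
  proof -
    obtain u v where e: "e = {u, v}" "u \<noteq> v" using simple_edge[OF G eG] by metis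
    then have "?A e = {(u, v), (v, u)}" by (auto simp: doubleton_eq_iff)
    then show ?thesis using e by simp
  qed
  have "adj G = (\<Union>e\<in>edges G. ?A e)" by (auto simp: adj_def)
  also have "card \<dots> = (\<Sum>e\<in>edges G. card (?A e))"
    using A simple_finite_edges[OF G] by (intro card_UN_disjoint) auto
  also have "\<dots> = (\<Sum>e\<in>edges G. 2)" using A by (intro sum.cong) auto
  finally show ?thesis by simp
qed

definition rot_of :: "'a graph \<Rightarrow> ('a \<Rightarrow> ('a \<times> 'a) list) \<Rightarrow> bool" where
  "rot_of G \<rho> \<longleftrightarrow> (\<forall>v\<in>verts G. distinct (\<rho> v) \<and> set (\<rho> v) = {d \<in> adj G. fst d = v})"

lemma rot_of_rotation:
  assumes "simple_graph G" "rot_of G \<rho>"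
  shows "rotation prod.swap \<rho> (verts G)" "darts \<rho> (verts G) = adj G"
proof -
  show 1: "darts \<rho> (verts G) = adj G"
    using assms by (auto simp: darts_def rot_of_def dest: adjD)
  have "inv_on prod.swap (adj G)"
    using adjD[OF assms(1)] by (auto simp: inv_on_def)
  then show "rotation prod.swap \<rho> (verts G)"
    using assms unfolding rotation_def 1 by (auto simp: rot_of_def simple_graph_def)
qed

lemma rot_of_exists:
  assumes "simple_graph G" shows "\<exists>\<rho>. rot_of G \<rho>"
proof -
  have "\<exists>xs. distinct xs \<and> set xs = {d \<in> adj G. fst d = v}" for v
    using finite_distinct_list[of "{d \<in> adj G. fst d = v}"] finite_adj[OF assms] by auto
  then show ?thesis unfolding rot_of_def by metis
qed

text \<open>A rotation system together with a colouring of its faces; \<open>t\<close> bounds \<open>E - V + 2 - F\<close>, which is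
  twice the genus for a connected graph.\<close>

definition cert :: "'a graph \<Rightarrow> int \<Rightarrow> bool" where
  "cert G t \<longleftrightarrow> (\<exists>\<rho> (c :: 'a \<times> 'a \<Rightarrow> nat) p. rot_of G \<rho> \<and>
     (\<forall>v\<in>verts G. walk prod.swap c (p v) (\<rho> v) (p v)) \<and>
     int (card (edges G)) + 2 \<le> int (card (verts G)) + int (card (c ` adj G \<union> p ` verts G)) + t)"

lemma connected_cut:
  assumes G: "connected_graph G" and W: "W \<subset> verts G" "W \<noteq> {}"
  shows "\<exists>d\<in>adj G. fst d \<in> W \<and> snd d \<in> - W"
proof (rule ccontr)
  assume no: "\<not> ?thesis"
  obtain u v where u: "u \<in> W" "v \<in> verts G" "v \<notin> W" using W by blast
  have "(u, v) \<in> (adj G)\<^sup>*" using G u W by (auto simp: connected_graph_def)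
  then have "v \<in> W" by (induction rule: rtrancl_induct) (use u no in auto)
  then show False using u by simp
qed

text \<open>A spanning tree absorbs \<open>V - 1\<close> edges; each of the other
  \<open>E - V + 1\<close> edges leaves two letters.\<close>

lemma connected_word:
  assumes G: "simple_graph G" "connected_graph G" and r: "rot_of G \<rho>"
  obtains w where "grows prod.swap \<rho> (verts G) w" "distinct w" "inv_on prod.swap (set w)"
    "length w + 2 * card (verts G) = 2 * card (edges G) + 2" "set w \<subseteq> adj G"
proof -
  note rot = rot_of_rotation[OF G(1) r]
  have "\<exists>w. grows prod.swap \<rho> (verts G) w"
  proof (rule grows_exists[OF rot(1) subset_refl])
    show "verts G \<noteq> {}" using G(2) by (simp add: connected_graph_def)
    fix W assume W: "W \<subset> verts G" "W \<noteq> {}"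
    then obtain u v where uv: "(u, v) \<in> adj G" "u \<in> W" "v \<notin> W"
      using connected_cut[OF G(2) W] by auto
    have "(u, v) \<in> set (\<rho> u)" "(v, u) \<in> set (\<rho> v)" "v \<in> verts G"
      using uv r adjD[OF G(1) uv(1)] by (auto simp: rot_of_def)
    then show "\<exists>d\<in>darts \<rho> W. prod.swap d \<in> darts \<rho> (verts G - W)"
      using uv by (intro bexI[of _ "(u, v)"]) (auto simp: darts_def)
  qed
  then obtain w where w: "grows prod.swap \<rho> (verts G) w" by blast
  note pr = grows_props[OF rot(1) w subset_refl, unfolded rot(2)]
  have inv: "inv_on prod.swap (adj G)" using rot by (simp add: rotation_def)
  have "set w = adj G - (adj G - set w)" using pr by blast
  then have "inv_on prod.swap (set w)" using inv_on_diff[OF inv, of "adj G - set w"] pr by simp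
  moreover have "length w + 2 * card (verts G) = 2 * card (edges G) + 2"
  proof -
    have "card (adj G) = card (adj G - set w) + card (set w)"
      using pr finite_adj[OF G(1)] by (metis Diff_partition add.commute card_Diff_subset card_mono finite_subset le_add_diff_inverse)
    moreover have "card (set w) = length w" using pr distinct_card by blast
    moreover have "card (adj G - set w) + 2 = 2 * card (verts G)" using pr by blast
    ultimately show ?thesis using card_adj[OF G(1)] by linarith
  qed
  ultimately show ?thesis using that w pr by blast
qed

text \<open>With \<open>F\<close> colours the bound for the word gives
  \<open>2 F + 4 s \<le> 2 E - 2 V + 4\<close>, and the certificate gives
  \<open>E - V + 2 \<le> F + t\<close>. Together \<open>2 s \<le> t \<le> 2 g\<close>.\<close>

lemma cert_word:
  assumes G: "simple_graph G" "connected_graph G" and c: "cert G t" "t \<le> 2 * int g"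
  shows "\<exists>\<rho> w. rot_of G \<rho> \<and> grows prod.swap \<rho> (verts G) w \<and> red prod.swap g w"
proof -
  obtain \<rho> p and c :: "'a \<times> 'a \<Rightarrow> nat" where r: "rot_of G \<rho>"
    and W: "\<And>v. v \<in> verts G \<Longrightarrow> walk prod.swap c (p v) (\<rho> v) (p v)"
    and k: "int (card (edges G)) + 2 \<le> int (card (verts G)) + int (card (c ` adj G \<union> p ` verts G)) + t"
    using c unfolding cert_def by blast
  obtain w where w: "grows prod.swap \<rho> (verts G) w" "distinct w" "inv_on prod.swap (set w)"
    "length w + 2 * card (verts G) = 2 * card (edges G) + 2"
    using connected_word[OF G r] by metis
  note rot = rot_of_rotation[OF G(1) r]
  obtain q where q: "walk prod.swap c q w q"
    "c ` adj G \<union> p ` verts G \<subseteq> insert q (c ` set w \<union> (\<lambda>x. c (prod.swap x)) ` set w)"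
    using grows_walk[OF rot(1), of c p, OF W w(1) subset_refl] unfolding rot(2) by blast
  have "c ` adj G \<union> p ` verts G \<subseteq> insert q (c ` set w)"
    using q(2) unfolding inv_on_image[OF w(3)] by simp
  then have k': "card (c ` adj G \<union> p ` verts G) \<le> card (insert q (c ` set w))"
    by (intro card_mono) auto
  obtain s where s0: "red prod.swap s w" "\<forall>(c :: 'a \<times> 'a \<Rightarrow> nat) p. walk prod.swap c p w p \<longrightarrow>
      2 * card (insert p (c ` set w)) + 4 * s \<le> length w + 2"
    using red_exists[where 'c = nat, OF w(2,3)] by auto
  note s = s0(1) s0(2)[rule_format, OF q(1)]
  have "s \<le> g" using s(2) k k' w(4) c(2) by presburger
  then show ?thesis using r w(1) red_mono[OF s(1)] by blast
qed

text \<open>At most one edge lies outside a spanning tree, so the word has at most two letters and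
  no crossing. This becomes the planarity of a connected graph with at most one cycle.\<close>

lemma sparse_word:
  assumes G: "simple_graph G" "connected_graph G" and le: "card (edges G) \<le> card (verts G)"
  shows "\<exists>\<rho> w. rot_of G \<rho> \<and> grows prod.swap \<rho> (verts G) w \<and> red prod.swap 0 w"
proof -
  obtain \<rho> where r: "rot_of G \<rho>" using rot_of_exists[OF G(1)] ..
  obtain w where w: "grows prod.swap \<rho> (verts G) w" "distinct w" "inv_on prod.swap (set w)"
    "length w + 2 * card (verts G) = 2 * card (edges G) + 2"
    using connected_word[OF G r] by metis
  have len: "length w \<le> 2" using w(4) le by linarith
  have "red prod.swap 0 w"
  proof (cases "w = []")
    case False
    from w(2,3) False show ?thesis
    proof (cases rule: chord_exists)
      case (adjacent u x v)
      then have "u = []" "v = []" using len by auto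
      then show ?thesis unfolding adjacent by (intro red_cancel) (auto intro: red_nil)
    next
      case (crossing A x B y C D E)
      then show ?thesis using len by simp
    qed
  qed (auto intro: red_nil)
  then show ?thesis using r w(1) by blast
qed

lemma adj_del: "adj (V, E - {{u, v}}) = adj (V, E) - {(u, v), (v, u)}"
  by (auto simp: adj_def doubleton_eq_iff)

text \<open>One edge less against at most one colour less.\<close>

lemma cert_delete:
  assumes G: "simple_graph G" and c: "cert G t" and e: "e \<in> edges G"
  shows "cert (verts G, edges G - {e}) t"
proof -
  obtain \<rho> p and c :: "'a \<times> 'a \<Rightarrow> nat" where r: "rot_of G \<rho>"
    and W: "\<And>v. v \<in> verts G \<Longrightarrow> walk prod.swap c (p v) (\<rho> v) (p v)"
    and k: "int (card (edges G)) + 2 \<le> int (card (verts G)) + int (card (c ` adj G \<union> p ` verts G)) + t"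
    using c unfolding cert_def by blast
  note rot = rot_of_rotation[OF G r]
  obtain u v where uv: "e = {u, v}" using simple_edge[OF G e] by metis
  let ?x = "(u, v)" let ?G = "(verts G, edges G - {e})"
  have x: "?x \<in> darts \<rho> (verts G)" unfolding rot(2) using e uv by (simp add: adj_def)
  have adj: "adj ?G = adj G - {?x, prod.swap ?x}" using adj_del[of "verts G" "edges G" u v] uv by simp
  obtain c' :: "'a \<times> 'a \<Rightarrow> nat" and p' where
    c': "\<forall>z\<in>verts G. walk prod.swap c' (p' z) (del_darts prod.swap ?x \<rho> z) (p' z)"
    "card (c ` adj G \<union> p ` verts G) \<le> Suc (card (c' ` adj ?G \<union> p' ` verts G))"
    using delete_pair_card[of prod.swap \<rho> "verts G" ?x c p, OF rot(1) x W] unfolding darts_del rot(2) adj by blast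
  have "rot_of ?G (del_darts prod.swap ?x \<rho>)"
    using r unfolding rot_of_def adj by (auto simp: del_darts_def)
  moreover have "card (edges G) = Suc (card (edges ?G))"
    using e simple_finite_edges[OF G] card_Suc_Diff1[of "edges G" e] by simp
  ultimately show ?thesis unfolding cert_def using c' k
    by (intro exI[of _ "del_darts prod.swap ?x \<rho>"] exI[of _ c'] exI[of _ p']) auto
qed

text \<open>Counting, for each colour, the darts on one side shows that both sides of a bridge have the same
  colour; hence the two parts together have one colour more than the whole.\<close>

lemma cert_bridge:
  assumes G: "simple_graph G" and c: "cert G t"
    and XY: "verts G = X \<union> Y" "X \<inter> Y = {}" "u \<in> X" "v \<in> Y"
    and E: "edges G = insert {u, v} (A \<union> B)" "\<And>e. e \<in> A \<Longrightarrow> e \<subseteq> X" "\<And>e. e \<in> B \<Longrightarrow> e \<subseteq> Y"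
  shows "\<exists>a b. a + b \<le> t \<and> cert (X, A) a \<and> cert (Y, B) b"
proof -
  obtain \<rho> p and c :: "'a \<times> 'a \<Rightarrow> nat" where r: "rot_of G \<rho>"
    and W: "\<And>v. v \<in> verts G \<Longrightarrow> walk prod.swap c (p v) (\<rho> v) (p v)"
    and k: "int (card (edges G)) + 2 \<le> int (card (verts G)) + int (card (c ` adj G \<union> p ` verts G)) + t"
    using c unfolding cert_def by blast
  note rot = rot_of_rotation[OF G r]
  have card2: "card e = 2" "e \<subseteq> X \<union> Y" if "e \<in> edges G" for e
    using G that XY by (auto simp: simple_graph_def)
  have fin: "finite (edges G)" "finite (X \<union> Y)" "finite (adj G)"
    using simple_finite_edges[OF G] G XY finite_adj[OF G] by (auto simp: simple_graph_def)
  have uv: "{u, v} \<notin> A \<union> B" using E(2,3) XY by blast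
  have AB: "A \<inter> B = {}"
  proof (rule ccontr)
    assume "A \<inter> B \<noteq> {}"
    then obtain e where e: "e \<in> A" "e \<in> B" by blast
    then have "e = {}" using E(2,3) XY(2) by blast
    moreover have "e \<in> edges G" using E(1) e by blast
    ultimately show False using card2(1) by fastforce
  qed
  have inX: "{a, b} \<in> A \<longleftrightarrow> {a, b} \<in> edges G \<and> (a, b) \<noteq> (u, v)" if "a \<in> X" for a b
  proof -
    have "{a, b} \<notin> B" "(a, b) \<noteq> (v, u)" using E(3)[of "{a, b}"] that XY(2,4) by auto
    then show ?thesis using uv unfolding E(1) by (auto simp: doubleton_eq_iff)
  qed
  have inY: "{a, b} \<in> B \<longleftrightarrow> {a, b} \<in> edges G \<and> (a, b) \<noteq> (v, u)" if "a \<in> Y" for a b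
  proof -
    have "{a, b} \<notin> A" "(a, b) \<noteq> (u, v)" using E(2)[of "{a, b}"] that XY(2,3) by auto
    moreover have "{v, u} \<notin> B" using uv by (simp add: insert_commute)
    ultimately show ?thesis using uv unfolding E(1)
      by (auto simp: doubleton_eq_iff)
  qed
  have adjX: "adj (X, A) = {d \<in> adj G. fst d \<in> X} - {(u, v)}"
    using inX E(2) by (fastforce simp: adj_def)
  have adjY: "adj (Y, B) = {d \<in> adj G. fst d \<in> Y} - {(v, u)}"
    using inY E(3) by (fastforce simp: adj_def)
  have uvG: "(u, v) \<in> adj G" "(v, u) \<in> adj G" using E(1) by (auto simp: adj_def insert_commute)
  have sX: "simple_graph (X, A)" and sY: "simple_graph (Y, B)"
    using card2 E fin by (auto simp: simple_graph_def)
  have same: "c (u, v) = c (v, u)"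
  proof -
    define F :: "nat \<Rightarrow> nat" where "F k = (if k = c (u, v) then 1 else 0)" for k
    let ?D = "{d \<in> adj G. fst d \<in> X}"
    have D: "?D = (\<Union>z\<in>X. set (\<rho> z))" using r XY by (auto simp: rot_of_def)
    have disj: "\<forall>i\<in>X. \<forall>j\<in>X. i \<noteq> j \<longrightarrow> set (\<rho> i) \<inter> set (\<rho> j) = {}"
      using r XY by (auto simp: rot_of_def)
    have "(\<Sum>d\<in>?D. F (c d)) = (\<Sum>z\<in>X. \<Sum>d\<in>set (\<rho> z). F (c d))"
      unfolding D using disj fin by (intro sum.UNION_disjoint) auto
    also have "\<dots> = (\<Sum>z\<in>X. \<Sum>d\<in>set (\<rho> z). F (c (prod.swap d)))"
    proof (rule sum.cong[OF refl])
      fix z assume "z \<in> X"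
      then have "z \<in> verts G" "distinct (\<rho> z)" using XY r by (auto simp: rot_of_def)
      then show "(\<Sum>d\<in>set (\<rho> z). F (c d)) = (\<Sum>d\<in>set (\<rho> z). F (c (prod.swap d)))"
        using walk_sum[OF W, of z F] by simp
    qed
    also have "\<dots> = (\<Sum>d\<in>?D. F (c (prod.swap d)))"
      unfolding D using disj fin by (intro sum.UNION_disjoint[symmetric]) auto
    finally have eq: "(\<Sum>d\<in>?D. F (c d)) = (\<Sum>d\<in>?D. F (c (prod.swap d)))" .
    \<comment> \<open>Apart from the bridge the darts on this side come in reversed pairs, whose
      contributions cancel, so the dart of the bridge must balance alone.\<close>
    have ins: "?D = insert (u, v) (adj (X, A))" unfolding adjX using uvG XY by auto
    have "inv_on prod.swap (adj (X, A))" using adjD[OF sX] by (auto simp: inv_on_def)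
    from inv_on_sum[OF this, of "\<lambda>d. F (c d)"]
    have "(\<Sum>d\<in>adj (X, A). F (c (prod.swap d))) = (\<Sum>d\<in>adj (X, A). F (c d))" .
    moreover have "(u, v) \<notin> adj (X, A)" unfolding adjX by simp
    ultimately have "F (c (u, v)) = F (c (v, u))"
      using eq finite_adj[OF sX] unfolding ins by simp
    then show ?thesis by (simp add: F_def split: if_splits)
  qed
  let ?r = "del_darts prod.swap (u, v) \<rho>"
  have x: "(u, v) \<in> darts \<rho> (verts G)" "(v, u) \<in> darts \<rho> (verts G)" unfolding rot(2) using uvG by auto
  note d1 = delete_pair[of prod.swap \<rho> "verts G" "(u, v)" c p "\<lambda>k. k", OF rot(1) x(1) W]
  note d2 = delete_pair[of prod.swap \<rho> "verts G" "(v, u)" c p "\<lambda>k. k", OF rot(1) x(2) W]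
  have r': "del_darts prod.swap (v, u) \<rho> = ?r" by (auto simp: del_darts_def fun_eq_iff intro!: filter_cong)
  have W': "walk prod.swap c (p z) (?r z) (p z)" if "z \<in> verts G" for z
    using d1(1)[of z] that same by (simp add: comp_def)
  have rX: "rot_of (X, A) ?r" "rot_of (Y, B) ?r"
    using r XY uvG unfolding rot_of_def adjX adjY by (auto simp: del_darts_def)
  let ?CX = "c ` adj (X, A) \<union> p ` X" let ?CY = "c ` adj (Y, B) \<union> p ` Y"
  have inv: "inv_on prod.swap (adj (X, A))" "inv_on prod.swap (adj (Y, B))"
    using adjD[OF sX] adjD[OF sY] by (auto simp: inv_on_def)
  have cX: "c (u, v) \<in> ?CX"
  proof -
    have "c (u, v) \<in> insert (p u) ((\<lambda>d. c (prod.swap d)) ` set (?r u))"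
      using d1(2)[of u] same XY uvG r by (auto simp: rot_of_def)
    moreover have "set (?r u) \<subseteq> adj (X, A)" using rX(1) XY by (auto simp: rot_of_def)
    ultimately have "c (u, v) \<in> insert (p u) ((\<lambda>d. c (prod.swap d)) ` adj (X, A))" by blast
    then show ?thesis unfolding inv_on_image[OF inv(1)] using XY by auto
  qed
  have cY: "c (v, u) \<in> ?CY"
  proof -
    have "c (v, u) \<in> insert (p v) ((\<lambda>d. c (prod.swap d)) ` set (?r v))"
      using d2(2)[of v] same XY uvG r unfolding r' by (auto simp: rot_of_def)
    moreover have "set (?r v) \<subseteq> adj (Y, B)" using rX(2) XY by (auto simp: rot_of_def)
    ultimately have "c (v, u) \<in> insert (p v) ((\<lambda>d. c (prod.swap d)) ` adj (Y, B))" by blast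
    then show ?thesis unfolding inv_on_image[OF inv(2)] using XY by auto
  qed
  have fC: "finite ?CX" "finite ?CY" using finite_adj[OF sX] finite_adj[OF sY] fin by auto
  have "adj G \<subseteq> insert (u, v) (insert (v, u) (adj (X, A) \<union> adj (Y, B)))"
  proof
    fix d assume d: "d \<in> adj G"
    then have "fst d \<in> X \<or> fst d \<in> Y" using adjD(1)[OF G, of "fst d" "snd d"] XY(1) by auto
    with d show "d \<in> insert (u, v) (insert (v, u) (adj (X, A) \<union> adj (Y, B)))"
      unfolding adjX adjY by blast
  qed
  then have "c ` adj G \<union> p ` verts G \<subseteq> ?CX \<union> ?CY" using cX cY XY(1) by auto
  then have "card (c ` adj G \<union> p ` verts G) \<le> card (?CX \<union> ?CY)" using fC by (intro card_mono) auto
  moreover have "card ?CX + card ?CY = card (?CX \<union> ?CY) + card (?CX \<inter> ?CY)"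
    using card_Un_Int[OF fC] by simp
  \<comment> \<open>The face along the bridge is counted for both parts; this colour and the bridge
    itself make up for the constant 2, which occurs once for the whole but once for each
    part.\<close>
  moreover have "card (?CX \<inter> ?CY) \<ge> 1"
  proof -
    have "c (u, v) \<in> ?CX \<inter> ?CY" using cX cY same by simp
    then show ?thesis using fC by (metis One_nat_def Suc_leI card_gt_0_iff empty_iff finite_Int)
  qed
  moreover have "card (verts G) = card X + card Y" using XY fin card_Un_disjoint by auto
  moreover have "card (edges G) = card A + card B + 1"
    unfolding E(1) using uv AB fin E(1) by (simp add: card_Un_disjoint)
  ultimately have ab: "(int (card A) + 2 - int (card X) - int (card ?CX)) +
     (int (card B) + 2 - int (card Y) - int (card ?CY)) \<le> t" using k by linarith
  moreover have "cert (X, A) (int (card A) + 2 - int (card X) - int (card ?CX))"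
    unfolding cert_def using rX(1) W' XY(1) by (intro exI[of _ ?r] exI[of _ c] exI[of _ p]) auto
  moreover have "cert (Y, B) (int (card B) + 2 - int (card Y) - int (card ?CY))"
    unfolding cert_def using rX(2) W' XY(1) by (intro exI[of _ ?r] exI[of _ c] exI[of _ p]) auto
  ultimately show ?thesis by blast
qed

section \<open>Additivity over components\<close>

lemma sym_adj: "sym (adj G)"
  by (auto simp: sym_def adj_def insert_commute)

lemma adj_rtrancl_verts:
  assumes "simple_graph G" "(u, v) \<in> (adj G)\<^sup>*" "u \<in> verts G" shows "v \<in> verts G"
  using assms(2,3) by (induction rule: rtrancl_induct) (auto dest: adjD[OF assms(1)])

lemma connected_fromI:
  assumes "u \<in> verts G" "\<And>v. v \<in> verts G \<Longrightarrow> (u, v) \<in> (adj G)\<^sup>*"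
  shows "connected_graph G"
  using assms sym_rtrancl[OF sym_adj[of G]] unfolding connected_graph_def sym_def
  by (metis empty_iff rtrancl_trans)

lemma adj_mono: "E \<subseteq> E' \<Longrightarrow> (adj (V, E))\<^sup>* \<subseteq> (adj (V', E'))\<^sup>*"
  by (intro rtrancl_mono) (auto simp: adj_def)

lemma component_connected:
  assumes "simple_graph G" "u \<in> verts G" "C = (adj G)\<^sup>* `` {u}"
  shows "connected_graph (C, {e \<in> edges G. e \<subseteq> C})"
proof (rule connected_fromI)
  show "u \<in> verts (C, {e \<in> edges G. e \<subseteq> C})" using assms by auto
  fix v assume "v \<in> verts (C, {e \<in> edges G. e \<subseteq> C})"
  then have "(u, v) \<in> (adj G)\<^sup>*" using assms by auto
  then show "(u, v) \<in> (adj (C, {e \<in> edges G. e \<subseteq> C}))\<^sup>*"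
  proof (induction rule: rtrancl_induct)
    case (step y z)
    then have "(y, z) \<in> adj (C, {e \<in> edges G. e \<subseteq> C})"
      using assms(3) rtrancl.rtrancl_into_rtrancl[of u y "adj G" z] by (auto simp: adj_def)
    with step show ?case by (meson rtrancl.rtrancl_into_rtrancl)
  qed simp
qed

lemma component_edges:
  assumes "simple_graph G" "C = (adj G)\<^sup>* `` {u}" "e \<in> edges G"
  shows "e \<subseteq> C \<or> e \<inter> C = {}"
proof -
  obtain a b where e: "e = {a, b}" using simple_edge[OF assms(1,3)] by metis
  have "(a, b) \<in> adj G" "(b, a) \<in> adj G" using assms(3) e by (auto simp: adj_def insert_commute)
  then have "a \<in> C \<longleftrightarrow> b \<in> C" unfolding assms(2) by (auto intro: rtrancl.rtrancl_into_rtrancl)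
  then show ?thesis using e by auto
qed

lemma connected_join:
  assumes "connected_graph (X, A)" "connected_graph (Y, B)" "u \<in> X" "v \<in> Y"
  shows "connected_graph (X \<union> Y, insert {u, v} (A \<union> B))"
proof (rule connected_fromI)
  let ?G = "(X \<union> Y, insert {u, v} (A \<union> B))"
  show "u \<in> verts ?G" using assms by simp
  have X: "(adj (X, A))\<^sup>* \<subseteq> (adj ?G)\<^sup>*" and Y: "(adj (Y, B))\<^sup>* \<subseteq> (adj ?G)\<^sup>*"
    by (intro adj_mono; blast)+
  have uv: "(u, v) \<in> (adj ?G)\<^sup>*" by (auto simp: adj_def)
  fix z assume "z \<in> verts ?G"
  then have "(u, z) \<in> (adj (X, A))\<^sup>* \<or> (v, z) \<in> (adj (Y, B))\<^sup>*"
    using assms by (auto simp: connected_graph_def)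
  then show "(u, z) \<in> (adj ?G)\<^sup>*" using X Y rtrancl_trans[OF uv] by blast
qed

lemma simple_join:
  assumes "simple_graph (X, A)" "simple_graph (Y, B)" "X \<inter> Y = {}" "u \<in> X" "v \<in> Y"
  shows "simple_graph (X \<union> Y, insert {u, v} (A \<union> B))"
proof -
  have "u \<noteq> v" using assms by blast
  then show ?thesis using assms by (auto simp: simple_graph_def)
qed

text \<open>The new edge is put into the corners of colours \<open>pX u\<close> and
  \<open>pY v\<close>, at the head of both rotations. It merges those two faces and no others: one
  edge more, one colour less, and the constant 2 once instead of twice.\<close>

lemma cert_join:
  assumes G: "simple_graph (X, A)" "simple_graph (Y, B)" and XY: "X \<inter> Y = {}" "u \<in> X" "v \<in> Y"
    and c: "cert (X, A) s" "cert (Y, B) t"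
  shows "cert (X \<union> Y, insert {u, v} (A \<union> B)) (s + t)"
proof -
  obtain rX pX and cX :: "'a \<times> 'a \<Rightarrow> nat" where rX: "rot_of (X, A) rX"
    and WX: "\<And>z. z \<in> X \<Longrightarrow> walk prod.swap cX (pX z) (rX z) (pX z)"
    and kX: "int (card A) + 2 \<le> int (card X) + int (card (cX ` adj (X, A) \<union> pX ` X)) + s"
    using c(1) unfolding cert_def by auto
  obtain rY pY and cY :: "'a \<times> 'a \<Rightarrow> nat" where rY: "rot_of (Y, B) rY"
    and WY: "\<And>z. z \<in> Y \<Longrightarrow> walk prod.swap cY (pY z) (rY z) (pY z)"
    and kY: "int (card B) + 2 \<le> int (card Y) + int (card (cY ` adj (Y, B) \<union> pY ` Y)) + t"
    using c(2) unfolding cert_def by auto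
  \<comment> \<open>Even numbers carry the colours of the first graph and odd numbers those of the
    second; only \<open>pY v\<close> is sent to an even number, the code of
    \<open>pX u\<close>.\<close>
  define f :: "nat \<Rightarrow> nat" where "f k = 2 * k" for k
  define h where "h k = (if k = pY v then 2 * pX u else 2 * k + 1)" for k
  define r where "r z = (if z = u then [(u, v)] else if z = v then [(v, u)] else []) @
    (if z \<in> X then rX z else rY z)" for z
  define c where "c d = (if d = (u, v) \<or> d = (v, u) then 2 * pX u
    else if fst d \<in> X then f (cX d) else h (cY d))" for d
  define p where "p z = (if z \<in> X then f (pX z) else h (pY z))" for z
  let ?G = "(X \<union> Y, insert {u, v} (A \<union> B))"
  have uv: "u \<notin> Y" "v \<notin> X" "u \<noteq> v" using XY by auto
  have aX: "fst d \<in> X \<and> snd d \<in> X" if "d \<in> adj (X, A)" for d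
    using adjD(1,2)[OF G(1), of "fst d" "snd d"] that by simp
  have aY: "fst d \<in> Y \<and> snd d \<in> Y" if "d \<in> adj (Y, B)" for d
    using adjD(1,2)[OF G(2), of "fst d" "snd d"] that by simp
  have adj: "adj ?G = {(u, v), (v, u)} \<union> adj (X, A) \<union> adj (Y, B)"
    by (auto simp: adj_def doubleton_eq_iff)
  have "rot_of ?G r"
    unfolding rot_of_def
  proof (intro ballI conjI)
    fix z assume z: "z \<in> verts ?G"
    have n: "(u, v) \<notin> adj (X, A)" "(v, u) \<notin> adj (Y, B)"
      using aX[of "(u, v)"] aY[of "(v, u)"] uv by auto
    show "distinct (r z)"
    proof (cases "z \<in> X")
      case True
      then have "distinct (rX z)" "set (rX z) \<subseteq> adj (X, A)" "z \<noteq> v"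
        using rX uv by (auto simp: rot_of_def)
      then show ?thesis using True n(1) by (auto simp: r_def)
    next
      case False
      then have "distinct (rY z)" "set (rY z) \<subseteq> adj (Y, B)" "z \<noteq> u"
        using rY uv z XY by (auto simp: rot_of_def)
      then show ?thesis using False n(2) by (auto simp: r_def)
    qed
    show "set (r z) = {d \<in> adj ?G. fst d = z}"
    proof (cases "z \<in> X")
      case True
      then have "z \<notin> Y" "z \<noteq> v" using XY uv by auto
      then have "{d \<in> adj ?G. fst d = z} = (if z = u then {(u, v)} else {}) \<union> {d \<in> adj (X, A). fst d = z}"
        unfolding adj using aY by auto
      then show ?thesis using True rX \<open>z \<noteq> v\<close> by (auto simp: r_def rot_of_def)
    next
      case False
      then have "z \<in> Y" "z \<noteq> u" using XY z by auto
      then have "{d \<in> adj ?G. fst d = z} = (if z = v then {(v, u)} else {}) \<union> {d \<in> adj (Y, B). fst d = z}"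
        unfolding adj using aX False by auto
      then show ?thesis using False \<open>z \<in> Y\<close> rY \<open>z \<noteq> u\<close> by (auto simp: r_def rot_of_def)
    qed
  qed
  moreover have "walk prod.swap c (p z) (r z) (p z)" if z: "z \<in> verts ?G" for z
  proof (cases "z \<in> X")
    case True
    have "walk prod.swap (f \<circ> cX) (f (pX z)) (rX z) (f (pX z))" using walk_comp[OF WX[OF True]] .
    then have "walk prod.swap c (f (pX z)) (rX z) (f (pX z))"
    proof (rule walk_cong)
      fix d assume "d \<in> set (rX z)"
      then have "d \<in> adj (X, A)" using rX True by (auto simp: rot_of_def)
      from aX[OF this] uv show "c d = (f \<circ> cX) d \<and> c (prod.swap d) = (f \<circ> cX) (prod.swap d)"
        by (auto simp: c_def prod.swap_def)
    qed
    then show ?thesis using True uv by (auto simp: r_def p_def c_def f_def)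
  next
    case False
    then have zY: "z \<in> Y" using z by simp
    have "walk prod.swap (h \<circ> cY) (h (pY z)) (rY z) (h (pY z))" using walk_comp[OF WY[OF zY]] .
    then have "walk prod.swap c (h (pY z)) (rY z) (h (pY z))"
    proof (rule walk_cong)
      fix d assume "d \<in> set (rY z)"
      then have "d \<in> adj (Y, B)" using rY zY by (auto simp: rot_of_def)
      from aY[OF this] uv XY show "c d = (h \<circ> cY) d \<and> c (prod.swap d) = (h \<circ> cY) (prod.swap d)"
        by (auto simp: c_def prod.swap_def)
    qed
    then show ?thesis using False uv XY by (auto simp: r_def p_def c_def h_def)
  qed
  moreover have "int (card (edges ?G)) + 2 \<le> int (card (verts ?G)) +
      int (card (c ` adj ?G \<union> p ` verts ?G)) + (s + t)"
  proof -
    let ?CX = "cX ` adj (X, A) \<union> pX ` X" and ?CY = "cY ` adj (Y, B) \<union> pY ` Y"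
    let ?C = "c ` adj ?G \<union> p ` verts ?G"
    have fin: "finite X" "finite Y" "finite A" "finite B" "finite ?CX" "finite ?CY" "finite ?C"
      using G simple_finite_edges[OF G(1)] simple_finite_edges[OF G(2)] finite_adj[OF G(1)] finite_adj[OF G(2)]
      unfolding adj by (auto simp: simple_graph_def)
    have "f ` ?CX \<subseteq> ?C"
    proof -
      have "f (cX d) = c d" if "d \<in> adj (X, A)" for d using aX[OF that] uv by (auto simp: c_def)
      moreover have "f (pX z) = p z" if "z \<in> X" for z using that by (simp add: p_def)
      ultimately show ?thesis unfolding adj by auto
    qed
    moreover have "h ` ?CY \<subseteq> ?C"
    proof -
      have "h (cY d) = c d" if "d \<in> adj (Y, B)" for d using aY[OF that] uv XY by (auto simp: c_def)
      moreover have "h (pY z) = p z" if "z \<in> Y" for z using that XY by (auto simp: p_def)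
      ultimately show ?thesis unfolding adj by auto
    qed
    ultimately have "card (f ` ?CX \<union> h ` ?CY) \<le> card ?C" using fin by (intro card_mono) auto
    moreover have "card (f ` ?CX) = card ?CX" by (intro card_image) (auto simp: inj_on_def f_def)
    moreover have "card (h ` ?CY) = card ?CY"
      by (intro card_image) (auto simp: inj_on_def h_def split: if_splits; presburger)
    moreover have "card (f ` ?CX \<inter> h ` ?CY) \<le> 1"
    proof -
      have "f ` ?CX \<inter> h ` ?CY \<subseteq> {2 * pX u}"
      proof
        fix k assume "k \<in> f ` ?CX \<inter> h ` ?CY"
        then obtain i j where "k = f i" "k = h j" by blast
        then show "k \<in> {2 * pX u}" by (auto simp: f_def h_def split: if_splits; presburger)
      qed
      then show ?thesis using card_mono[of "{2 * pX u}"] by auto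
    qed
    moreover have "card (f ` ?CX) + card (h ` ?CY) = card (f ` ?CX \<union> h ` ?CY) + card (f ` ?CX \<inter> h ` ?CY)"
      using fin by (intro card_Un_Int) auto
    moreover have "card (edges ?G) \<le> card A + card B + 1"
      using fin card_Un_le[of A B] card_insert_le_m1[of "Suc (card A + card B)" "A \<union> B" "{u, v}"] by simp
    moreover have "card (verts ?G) = card X + card Y" using card_Un_disjoint fin XY by auto
    ultimately show ?thesis using kX kY by linarith
  qed
  ultimately show ?thesis unfolding cert_def by blast
qed

text \<open>The number in \<open>cert\<close> measures a genus only for connected graphs: a drawing
  of a disconnected graph has faces that are not discs. So every component has its own certificate,
  and the values are added.\<close>

inductive gen :: "'a graph \<Rightarrow> int \<Rightarrow> bool" where
  gen_conn: "simple_graph G \<Longrightarrow> connected_graph G \<Longrightarrow> cert G t \<Longrightarrow> gen G t"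
| gen_union: "gen (V1, E1) s \<Longrightarrow> gen (V2, E2) t \<Longrightarrow> V1 \<inter> V2 = {} \<Longrightarrow>
    gen (V1 \<union> V2, E1 \<union> E2) (s + t)"

lemma gen_simple: "gen G t \<Longrightarrow> simple_graph G \<and> verts G \<noteq> {}"
  by (induction rule: gen.induct) (auto simp: simple_graph_def connected_graph_def)

lemma gen_connect:
  "gen G t \<Longrightarrow> \<exists>E. edges G \<subseteq> E \<and> simple_graph (verts G, E) \<and> connected_graph (verts G, E) \<and> cert (verts G, E) t"
proof (induction rule: gen.induct)
  case (gen_conn G t)
  then show ?case by (intro exI[of _ "edges G"]) simp
next
  case (gen_union V1 E1 s V2 E2 t)
  then obtain A B where
    A: "E1 \<subseteq> A" "simple_graph (V1, A)" "connected_graph (V1, A)" "cert (V1, A) s" and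
    B: "E2 \<subseteq> B" "simple_graph (V2, B)" "connected_graph (V2, B)" "cert (V2, B) t" by auto
  obtain u v where uv: "u \<in> V1" "v \<in> V2" using A(3) B(3) by (auto simp: connected_graph_def)
  show ?case
    using A(1) B(1) simple_join[OF A(2) B(2) gen_union(3) uv] connected_join[OF A(3) B(3) uv]
      cert_join[OF A(2) B(2) gen_union(3) uv A(4) B(4)]
    by (intro exI[of _ "insert {u, v} (A \<union> B)"]) auto
qed

text \<open>The two ends of \<open>e\<close> generate the two new components, and
  \<open>cert_bridge\<close> divides \<open>t\<close> between them.\<close>

lemma gen_bridge:
  assumes G: "simple_graph G" "connected_graph G" "cert G t" and e: "e \<in> edges G"
    and nc: "\<not> connected_graph (verts G, edges G - {e})"
  shows "\<exists>t'\<le>t. gen (verts G, edges G - {e}) t'"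
proof -
  let ?H = "(verts G, edges G - {e})"
  obtain u v where uv: "e = {u, v}" "u \<in> verts G" "v \<in> verts G" using simple_edge[OF G(1) e] by metis
  have H: "simple_graph ?H" using simple_subgraph[OF G(1)] by simp
  define X where "X = (adj ?H)\<^sup>* `` {u}"
  define Y where "Y = (adj ?H)\<^sup>* `` {v}"
  let ?A = "{f \<in> edges ?H. f \<subseteq> X}" and ?B = "{f \<in> edges ?H. f \<subseteq> Y}"
  have XYV: "X \<subseteq> verts G" "Y \<subseteq> verts G"
    using adj_rtrancl_verts[OF H] uv by (auto simp: X_def Y_def)
  have cover: "z \<in> X \<union> Y" if "z \<in> verts G" for z
  proof -
    have "(u, z) \<in> (adj G)\<^sup>*" using G(2) uv that by (simp add: connected_graph_def)
    then show ?thesis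
    proof (induction rule: rtrancl_induct)
      case (step y z)
      show ?case
      proof (cases "{y, z} = e")
        case True
        then show ?thesis using uv by (auto simp: X_def Y_def doubleton_eq_iff)
      next
        case False
        then have "(y, z) \<in> adj ?H" using step by (simp add: adj_def)
        with step show ?thesis by (auto simp: X_def Y_def intro: rtrancl.rtrancl_into_rtrancl)
      qed
    qed (simp add: X_def)
  qed
  have disj: "X \<inter> Y = {}"
  proof (rule ccontr)
    assume "X \<inter> Y \<noteq> {}"
    then obtain z where "(u, z) \<in> (adj ?H)\<^sup>*" "(v, z) \<in> (adj ?H)\<^sup>*" by (auto simp: X_def Y_def)
    then have "(u, v) \<in> (adj ?H)\<^sup>*" using sym_rtrancl[OF sym_adj[of ?H]] by (meson rtrancl_trans symE)
    then have "(u, z) \<in> (adj ?H)\<^sup>*" if "z \<in> verts G" for z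
      using cover[OF that] by (auto simp: X_def Y_def intro: rtrancl_trans)
    then have "connected_graph ?H" using connected_fromI[of u ?H] uv by simp
    then show False using nc by simp
  qed
  have edges: "edges ?H = ?A \<union> ?B"
  proof -
    have "f \<subseteq> X \<or> f \<subseteq> Y" if f: "f \<in> edges ?H" for f
    proof -
      have "f \<subseteq> verts G" "card f = 2" using H f by (auto simp: simple_graph_def)
      then have "f \<subseteq> verts G" "f \<noteq> {}" by auto
      then show ?thesis using component_edges[OF H X_def f] component_edges[OF H Y_def f] cover by blast
    qed
    then show ?thesis by blast
  qed
  have V: "verts G = X \<union> Y" using cover XYV by blast
  have E: "edges G = insert {u, v} (?A \<union> ?B)"
    using edges insert_Diff[OF e] uv(1) by (metis snd_conv)
  have uX: "u \<in> X" "v \<in> Y" by (auto simp: X_def Y_def)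
  obtain a b where ab: "a + b \<le> t" "cert (X, ?A) a" "cert (Y, ?B) b"
    using cert_bridge[OF G(1,3) V disj uX E] by blast
  have "connected_graph (X, ?A)" "connected_graph (Y, ?B)"
    using component_connected[OF H _ X_def] component_connected[OF H _ Y_def] uv by simp_all
  moreover have "simple_graph (X, ?A)" "simple_graph (Y, ?B)"
    using H XYV finite_subset by (auto simp: simple_graph_def)
  ultimately have "gen (X, ?A) a" "gen (Y, ?B) b" using ab by (auto intro: gen_conn)
  from gen_union[OF this disj] have "gen (X \<union> Y, ?A \<union> ?B) (a + b)" .
  then have "gen ?H (a + b)" using V edges by simp
  then show ?thesis using ab(1) by blast
qed

lemma gen_delete: "gen G t \<Longrightarrow> e \<in> edges G \<Longrightarrow> \<exists>t'\<le>t. gen (verts G, edges G - {e}) t'"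
proof (induction rule: gen.induct)
  case (gen_conn G t)
  show ?case
  proof (cases "connected_graph (verts G, edges G - {e})")
    case True
    then have "gen (verts G, edges G - {e}) t"
      using gen_conn simple_subgraph[OF gen_conn(1), of "edges G - {e}"] cert_delete[of G t e]
      by (intro gen.gen_conn) auto
    then show ?thesis by blast
  next
    case False
    then show ?thesis using gen_bridge gen_conn by blast
  qed
next
  case (gen_union V1 E1 s V2 E2 t)
  have disj: "f \<notin> E1 \<or> f \<notin> E2" for f
  proof (rule ccontr)
    assume "\<not> ?thesis"
    then have "f \<subseteq> V1" "f \<subseteq> V2" "card f = 2"
      using gen_simple[OF gen_union(1)] gen_simple[OF gen_union(2)] by (auto simp: simple_graph_def)
    then have "f = {}" using gen_union(3) by blast
    then show False using \<open>card f = 2\<close> by simp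
  qed
  show ?case
  proof (cases "e \<in> E1")
    case True
    then obtain s' where s': "s' \<le> s" "gen (V1, E1 - {e}) s'" using gen_union by auto
    have "E1 \<union> E2 - {e} = (E1 - {e}) \<union> E2" using disj[of e] True by auto
    then have "gen (V1 \<union> V2, E1 \<union> E2 - {e}) (s' + t)"
      using gen.gen_union[OF s'(2) gen_union(2,3)] by simp
    then show ?thesis using s'(1) by (intro exI[of _ "s' + t"]) simp
  next
    case False
    then obtain t' where t': "t' \<le> t" "gen (V2, E2 - {e}) t'" using gen_union by auto
    have "E1 \<union> E2 - {e} = E1 \<union> (E2 - {e})" using False by auto
    then have "gen (V1 \<union> V2, E1 \<union> E2 - {e}) (s + t')"
      using gen.gen_union[OF gen_union(1) t'(2) gen_union(3)] by simp
    then show ?thesis using t'(1) by (intro exI[of _ "s + t'"]) simp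
  qed
qed

lemma gen_subgraph:
  assumes "gen G t" "E \<subseteq> edges G"
  shows "\<exists>t'\<le>t. gen (verts G, E) t'"
proof -
  have "finite (edges G)" using gen_simple[OF assms(1)] simple_finite_edges by blast
  then have "finite (edges G - E)" by simp
  have "\<exists>t'\<le>t. gen (verts G, edges G - F) t'" if "F \<subseteq> edges G - E" "finite F" for F
    using that(2,1)
  proof (induction F rule: finite_induct)
    case empty
    then show ?case using assms(1) by auto
  next
    case (insert e F)
    then obtain t' where t': "t' \<le> t" "gen (verts G, edges G - F) t'" by auto
    moreover have "e \<in> edges G - F" using insert by auto
    ultimately obtain t'' where "t'' \<le> t'" "gen (verts G, edges G - F - {e}) t''"
      using gen_delete[OF t'(2), of e] by auto
    moreover have "edges G - F - {e} = edges G - insert e F" by auto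
    ultimately show ?case using t'(1) by (metis order_trans)
  qed
  from this[of "edges G - E"] show ?thesis using \<open>finite (edges G - E)\<close> assms(2)
    by (simp add: double_diff)
qed

text \<open>The part of \<open>gen_split\<close> that is the same for either side of a union; it is
  applied with the roles exchanged when \<open>U\<close> lies in the second graph.\<close>

lemma gen_split_step:
  assumes g: "gen (V1, E1) s" "gen (V2, E2) t" "V1 \<inter> V2 = {}" and U: "U \<subseteq> V1"
    and IH: "(U = V1 \<and> cert (V1, E1) s) \<or> (U \<noteq> V1 \<and> (\<exists>a b. a + b = s \<and>
      cert (U, {e \<in> E1. e \<subseteq> U}) a \<and> gen (V1 - U, {e \<in> E1. e \<inter> U = {}}) b))"
  shows "\<exists>a b. a + b = s + t \<and> cert (U, {e \<in> E1 \<union> E2. e \<subseteq> U}) a \<and>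
    gen (V1 \<union> V2 - U, {e \<in> E1 \<union> E2. e \<inter> U = {}}) b"
proof -
  have e1: "e \<subseteq> V1 \<and> e \<noteq> {}" if "e \<in> E1" for e
    using gen_simple[OF g(1)] that by (force simp: simple_graph_def)
  have e2: "e \<subseteq> V2 \<and> e \<noteq> {}" if "e \<in> E2" for e
    using gen_simple[OF g(2)] that by (force simp: simple_graph_def)
  have EU: "{e \<in> E1 \<union> E2. e \<subseteq> U} = {e \<in> E1. e \<subseteq> U}" using e2 U g(3) by blast
  have EV: "{e \<in> E1 \<union> E2. e \<inter> U = {}} = {e \<in> E1. e \<inter> U = {}} \<union> E2" using e2 U g(3) by blast
  from IH show ?thesis
  proof
    assume 1: "U = V1 \<and> cert (V1, E1) s"
    then have "{e \<in> E1. e \<subseteq> U} = E1" "{e \<in> E1. e \<inter> U = {}} \<union> E2 = E2" using e1 by auto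
    moreover have "V1 \<union> V2 - U = V2" using 1 g(3) by blast
    ultimately show ?thesis unfolding EU EV using 1 g(2)
      by - (rule exI[of _ s], rule exI[of _ t], simp)
  next
    assume "U \<noteq> V1 \<and> (\<exists>a b. a + b = s \<and>
      cert (U, {e \<in> E1. e \<subseteq> U}) a \<and> gen (V1 - U, {e \<in> E1. e \<inter> U = {}}) b)"
    then obtain a b where ab: "a + b = s" "cert (U, {e \<in> E1. e \<subseteq> U}) a"
      "gen (V1 - U, {e \<in> E1. e \<inter> U = {}}) b" by blast
    have "(V1 - U) \<inter> V2 = {}" using g(3) by blast
    from gen_union[OF ab(3) g(2) this]
    have "gen (V1 - U \<union> V2, {e \<in> E1. e \<inter> U = {}} \<union> E2) (b + t)" .
    moreover have "V1 - U \<union> V2 = V1 \<union> V2 - U" using U g(3) by blast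
    ultimately show ?thesis unfolding EU EV using ab
      by - (rule exI[of _ a], rule exI[of _ "b + t"], simp)
  qed
qed

text \<open>The converse of \<open>gen_union\<close> for a prescribed component. A derivation of
  \<open>gen\<close> fixes some order of unions, and \<open>U\<close>, being connected and closed
  under edges, sits at a single leaf of it.\<close>

lemma gen_split:
  "gen G t \<Longrightarrow> U \<subseteq> verts G \<Longrightarrow> connected_graph (U, {e \<in> edges G. e \<subseteq> U}) \<Longrightarrow>
   (\<And>e. e \<in> edges G \<Longrightarrow> e \<subseteq> U \<or> e \<inter> U = {}) \<Longrightarrow>
   (U = verts G \<and> cert G t) \<or> (U \<noteq> verts G \<and> (\<exists>a b. a + b = t \<and>
      cert (U, {e \<in> edges G. e \<subseteq> U}) a \<and> gen (verts G - U, {e \<in> edges G. e \<inter> U = {}}) b))"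
proof (induction rule: gen.induct)
  case (gen_conn G t)
  have "U = verts G"
  proof (rule ccontr)
    assume "U \<noteq> verts G"
    with gen_conn(4) have "U \<subset> verts G" by blast
    moreover have "U \<noteq> {}" using gen_conn by (simp add: connected_graph_def)
    ultimately obtain d where "d \<in> adj G" "fst d \<in> U" "snd d \<in> - U"
      using connected_cut[OF gen_conn(2), of U] by blast
    then obtain a b where "(a, b) \<in> adj G" "a \<in> U" "b \<notin> U" by (cases d) auto
    then show False using gen_conn(6)[of "{a, b}"] by (auto simp: adj_def)
  qed
  then show ?case using gen_conn by simp
next
  case (gen_union V1 E1 s V2 E2 t)
  let ?G = "(V1 \<union> V2, E1 \<union> E2)"
  have V: "V1 \<noteq> {}" "V2 \<noteq> {}" using gen_simple gen_union(1,2) by force+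
  have e1: "e \<subseteq> V1 \<and> e \<noteq> {}" if "e \<in> E1" for e
    using gen_simple[OF gen_union(1)] that by (force simp: simple_graph_def)
  have e2: "e \<subseteq> V2 \<and> e \<noteq> {}" if "e \<in> E2" for e
    using gen_simple[OF gen_union(2)] that by (force simp: simple_graph_def)
  have side: "U \<subseteq> V1 \<or> U \<subseteq> V2"
  proof (rule ccontr)
    assume "\<not> ?thesis"
    then have "U \<inter> V1 \<subset> U" "U \<inter> V1 \<noteq> {}" using gen_union.prems(1) by auto
    then obtain d where "d \<in> adj (U, {e \<in> edges ?G. e \<subseteq> U})" "fst d \<in> U \<inter> V1" "snd d \<in> - (U \<inter> V1)"
      using connected_cut[OF gen_union.prems(2), of "U \<inter> V1"] unfolding fst_conv by blast
    then obtain a b where ab: "(a, b) \<in> adj (U, {e \<in> edges ?G. e \<subseteq> U})" "a \<in> U \<inter> V1" "b \<notin> U \<inter> V1"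
      by (cases d) auto
    then have "{a, b} \<in> E1 \<or> {a, b} \<in> E2" "b \<in> U" by (auto simp: adj_def)
    then show False using e1[of "{a, b}"] e2[of "{a, b}"] ab gen_union(3) by auto
  qed
  then show ?case
  proof
    assume U: "U \<subseteq> V1"
    have EU: "{e \<in> E1 \<union> E2. e \<subseteq> U} = {e \<in> E1. e \<subseteq> U}" using e2 U gen_union(3) by blast
    have "(U = V1 \<and> cert (V1, E1) s) \<or> (U \<noteq> V1 \<and> (\<exists>a b. a + b = s \<and>
      cert (U, {e \<in> E1. e \<subseteq> U}) a \<and> gen (V1 - U, {e \<in> E1. e \<inter> U = {}}) b))"
      using gen_union.IH(1) U gen_union.prems EU by simp
    note st = gen_split_step[OF gen_union(1-3) U this]
    have "U \<noteq> V1 \<union> V2" using U V gen_union(3) by blast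
    with st show ?thesis unfolding fst_conv snd_conv by blast
  next
    assume U: "U \<subseteq> V2"
    have EU: "{e \<in> E1 \<union> E2. e \<subseteq> U} = {e \<in> E2. e \<subseteq> U}" using e1 U gen_union(3) by blast
    have IH: "(U = V2 \<and> cert (V2, E2) t) \<or> (U \<noteq> V2 \<and> (\<exists>a b. a + b = t \<and>
      cert (U, {e \<in> E2. e \<subseteq> U}) a \<and> gen (V2 - U, {e \<in> E2. e \<inter> U = {}}) b))"
      using gen_union.IH(2) U gen_union.prems EU by simp
    have "V2 \<inter> V1 = {}" using gen_union(3) by blast
    from gen_split_step[OF gen_union(2,1) this U IH]
    have "\<exists>a b. a + b = s + t \<and> cert (U, {e \<in> E1 \<union> E2. e \<subseteq> U}) a \<and>
      gen (V1 \<union> V2 - U, {e \<in> E1 \<union> E2. e \<inter> U = {}}) b"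
      by (simp only: Un_commute[of V2] Un_commute[of E2] add.commute[of t])
    moreover have "U \<noteq> V1 \<union> V2" using U V gen_union(3) by blast
    ultimately show ?thesis unfolding fst_conv snd_conv by blast
  qed
qed

section \<open>Partial drawings\<close>

text \<open>The first coordinate advances at constant speed. It makes the path injective whatever
  \<open>\<beta>\<close> does, and two strands over the same interval can meet only at equal
  parameters.\<close>

definition strand :: "real \<Rightarrow> real \<Rightarrow> (real \<Rightarrow> 'b) \<Rightarrow> real \<Rightarrow> real \<times> 'b" where
  "strand t t' \<beta> s = (t + s * (t' - t), \<beta> s)"

lemma strand_ends [simp]: "pathstart (strand t t' \<beta>) = (t, \<beta> 0)" "pathfinish (strand t t' \<beta>) = (t', \<beta> 1)"
  by (auto simp: pathstart_def pathfinish_def strand_def)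

lemma strand_arc:
  fixes \<beta> :: "real \<Rightarrow> 'b::topological_space"
  assumes "t < t'" "continuous_on {0..1} \<beta>" shows "arc (strand t t' \<beta>)"
proof -
  have "continuous_on {0..1} (strand t t' \<beta>)"
    unfolding strand_def using assms(2) by (intro continuous_intros)
  moreover have "inj_on (strand t t' \<beta>) {0..1}"
    using assms(1) by (auto simp: inj_on_def strand_def)
  ultimately show ?thesis by (simp add: arc_def path_def)
qed

lemma strand_image: "path_image (strand t t' \<beta>) = {(t + s * (t' - t), \<beta> s) | s. s \<in> {0..1}}"
  by (auto simp: path_image_def strand_def)

lemma strand_left:
  assumes "t < t'" "q \<in> path_image (strand t t' \<beta>)" "fst q \<le> t" shows "q = (t, \<beta> 0)"
proof -
  obtain s where s: "s \<in> {0..1}" "q = (t + s * (t' - t), \<beta> s)" using assms(2) by (auto simp: strand_image)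
  then have "s * (t' - t) \<le> 0" using assms(3) by simp
  then have "s = 0" using s(1) assms(1) by (auto simp: mult_le_0_iff)
  then show ?thesis using s by simp
qed

lemma strand_fst:
  assumes "t < t'" "q \<in> path_image (strand t t' \<beta>)" shows "t \<le> fst q" "fst q \<le> t'"
proof -
  obtain s where s: "0 \<le> s" "s \<le> 1" "q = (t + s * (t' - t), \<beta> s)" using assms(2) by (auto simp: strand_image)
  then show "t \<le> fst q" using assms(1) by simp
  have "s * (t' - t) \<le> 1 * (t' - t)" using s assms(1) by (intro mult_right_mono) auto
  then show "fst q \<le> t'" using s by simp
qed

lemma strand_meet:
  assumes "t < t'" "q \<in> path_image (strand t t' \<beta>)" "q \<in> path_image (strand t t' \<beta>')"
  obtains s where "s \<in> {0..1}" "q = (t + s * (t' - t), \<beta> s)" "\<beta> s = \<beta>' s"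
proof -
  obtain s s' where s: "s \<in> {0..1}" "s' \<in> {0..1}" "q = (t + s * (t' - t), \<beta> s)" "q = (t + s' * (t' - t), \<beta>' s')"
    using assms(2,3) by (auto simp: strand_image)
  then have "s = s'" using assms(1) by auto
  then show ?thesis using s that by auto
qed

text \<open>A partial drawing, swept from left to right: \<open>E\<close> is drawn completely, whereas a dart \<open>d \<in> W\<close>
  has been drawn from its origin \<open>fst d\<close> up to the point \<open>pos d\<close> of the cross section at \<open>t\<close>.\<close>

definition ends :: "'v set + 'v \<times> 'v \<Rightarrow> 'v set" where
  "ends = case_sum (\<lambda>e. e) (\<lambda>d. {fst d})"

lemma ends_simps [simp]: "ends (Inl e) = e" "ends (Inr d) = {fst d}"
  by (auto simp: ends_def)

text \<open>One index set for finished edges and half-drawn darts lets a single crossing condition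
  serve for both. A dart has only its origin in \<open>ends\<close>; its tip is free.\<close>

definition net :: "'p::topological_space set \<Rightarrow> 'v set \<Rightarrow> ('v set + 'v \<times> 'v) set \<Rightarrow> ('v \<Rightarrow> 'p) \<Rightarrow>
    ('v set + 'v \<times> 'v \<Rightarrow> real \<Rightarrow> 'p) \<Rightarrow> bool" where
  "net S X I p \<Gamma> \<longleftrightarrow> inj_on p X \<and> p ` X \<subseteq> S \<and>
     (\<forall>i\<in>I. ends i \<subseteq> X \<and> arc (\<Gamma> i) \<and> path_image (\<Gamma> i) \<subseteq> S \<and> path_image (\<Gamma> i) \<inter> p ` X = p ` ends i) \<and>
     (\<forall>i\<in>I. \<forall>j\<in>I. i \<noteq> j \<longrightarrow> path_image (\<Gamma> i) \<inter> path_image (\<Gamma> j) = p ` (ends i \<inter> ends j))"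

definition left_of :: "(real \<times> 'b) set \<Rightarrow> real \<Rightarrow> (real \<times> 'b) set" where
  "left_of S t = {q \<in> S. fst q \<le> t}"

definition dr :: "(real \<times> 'b::topological_space) set \<Rightarrow> real \<Rightarrow> 'v set \<Rightarrow> 'v set set \<Rightarrow> ('v \<times> 'v) set \<Rightarrow>
    ('v \<times> 'v \<Rightarrow> 'b) \<Rightarrow> bool" where
  "dr S t X E W pos \<longleftrightarrow> (\<exists>p \<Gamma>. net (left_of S t) X (E <+> W) p \<Gamma> \<and>
     (\<forall>e\<in>E. {pathstart (\<Gamma> (Inl e)), pathfinish (\<Gamma> (Inl e))} = p ` e) \<and>
     (\<forall>d\<in>W. pathstart (\<Gamma> (Inr d)) = p (fst d) \<and> pathfinish (\<Gamma> (Inr d)) = (t, pos d)))"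

text \<open>\<open>P i\<close> is what existed up to \<open>t\<close> and \<open>N i\<close> what is
  added. New points reach back to \<open>t\<close> only inside the old part of the same arc, so
  crossings of an old part with a new one are excluded automatically.\<close>

lemma net_extend:
  assumes "inj_on p X" "p ` X \<subseteq> left_of S t" "t \<le> t'"
    and I: "\<And>i. i \<in> I \<Longrightarrow> ends i \<subseteq> X \<and> arc (\<Gamma> i) \<and> path_image (\<Gamma> i) = P i \<union> N i \<and> P i \<subseteq> left_of S t \<and>
      N i \<subseteq> left_of S t' \<and> (\<forall>q\<in>N i. fst q \<le> t \<longrightarrow> q \<in> P i) \<and> P i \<inter> p ` X = p ` ends i"
    and II: "\<And>i j. i \<in> I \<Longrightarrow> j \<in> I \<Longrightarrow> i \<noteq> j \<Longrightarrow> P i \<inter> P j = p ` (ends i \<inter> ends j) \<and> N i \<inter> N j \<subseteq> P i \<inter> P j"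
  shows "net (left_of S t') X I p \<Gamma>"
proof -
  have LL: "left_of S t \<subseteq> left_of S t'" using assms(3) by (auto simp: left_of_def)
  have L: "fst q \<le> t" if "q \<in> left_of S t" for q using that by (simp add: left_of_def)
  show ?thesis unfolding net_def
  proof (intro conjI ballI impI)
    show "inj_on p X" "p ` X \<subseteq> left_of S t'" using assms LL by auto
    fix i assume i: "i \<in> I"
    note Ii = I[OF i]
    show "ends i \<subseteq> X" "arc (\<Gamma> i)" "path_image (\<Gamma> i) \<subseteq> left_of S t'" using Ii LL by auto
    show "path_image (\<Gamma> i) \<inter> p ` X = p ` ends i"
    proof -
      have "N i \<inter> p ` X \<subseteq> P i"
      proof
        fix q assume q: "q \<in> N i \<inter> p ` X"
        then have "fst q \<le> t" using L assms(2) by (meson IntD2 subsetD)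
        then show "q \<in> P i" using Ii q by simp
      qed
      moreover have "path_image (\<Gamma> i) = P i \<union> N i" "P i \<inter> p ` X = p ` ends i" using Ii by simp_all
      ultimately show ?thesis by blast
    qed
    fix j assume j: "j \<in> I" "i \<noteq> j"
    note Ij = I[OF j(1)] and IIij = II[OF i j(1) j(2)]
    have 1: "N i \<inter> P j \<subseteq> P i"
    proof
      fix q assume q: "q \<in> N i \<inter> P j"
      then have "fst q \<le> t" using L Ij by (meson IntD2 subsetD)
      then show "q \<in> P i" using Ii q by simp
    qed
    have 2: "P i \<inter> N j \<subseteq> P j"
    proof
      fix q assume q: "q \<in> P i \<inter> N j"
      then have "fst q \<le> t" using L Ii by (meson IntD1 subsetD)
      then show "q \<in> P j" using Ij q by simp
    qed
    have 3: "path_image (\<Gamma> i) = P i \<union> N i" "path_image (\<Gamma> j) = P j \<union> N j" using Ii Ij by simp_all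
    note 4 = IIij[THEN conjunct1] IIij[THEN conjunct2]
    show "path_image (\<Gamma> i) \<inter> path_image (\<Gamma> j) = p ` (ends i \<inter> ends j)"
      unfolding 3 4(1)[symmetric] using 1 2 4(2) by blast
  qed
qed

lemma netD:
  assumes "net S X I p \<Gamma>"
  shows "inj_on p X" "p ` X \<subseteq> S"
    "\<And>i. i \<in> I \<Longrightarrow> ends i \<subseteq> X" "\<And>i. i \<in> I \<Longrightarrow> arc (\<Gamma> i)" "\<And>i. i \<in> I \<Longrightarrow> path_image (\<Gamma> i) \<subseteq> S"
    "\<And>i. i \<in> I \<Longrightarrow> path_image (\<Gamma> i) \<inter> p ` X = p ` ends i"
    "\<And>i j. i \<in> I \<Longrightarrow> j \<in> I \<Longrightarrow> i \<noteq> j \<Longrightarrow> path_image (\<Gamma> i) \<inter> path_image (\<Gamma> j) = p ` (ends i \<inter> ends j)"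
  using assms by (simp_all add: net_def)

text \<open>The tip differs from the origin because an arc is injective, and all common points of
  different arcs are vertices.\<close>

lemma free_end:
  assumes n: "net L X I p \<Gamma>" and d: "Inr d \<in> I" "pathstart (\<Gamma> (Inr d)) = p (fst d)" "pathfinish (\<Gamma> (Inr d)) = q"
  shows "q \<in> path_image (\<Gamma> (Inr d))" "q \<notin> p ` X" "\<And>j. j \<in> I \<Longrightarrow> j \<noteq> Inr d \<Longrightarrow> q \<notin> path_image (\<Gamma> j)"
proof -
  have "arc (\<Gamma> (Inr d))" using netD(4)[OF n d(1)] .
  then have ne: "q \<noteq> p (fst d)" using d arc_distinct_ends by metis
  show q: "q \<in> path_image (\<Gamma> (Inr d))" using d by (metis pathfinish_in_path_image)
  show qX: "q \<notin> p ` X" using netD(6)[OF n d(1)] q ne by auto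
  fix j assume "j \<in> I" "j \<noteq> Inr d"
  then have "path_image (\<Gamma> (Inr d)) \<inter> path_image (\<Gamma> j) \<subseteq> p ` X"
    using netD(7)[OF n d(1), of j] netD(3)[OF n d(1)] by auto
  then show "q \<notin> path_image (\<Gamma> j)" using q qX by blast
qed

lemma join_strand:
  fixes g :: "real \<Rightarrow> real \<times> 'b::topological_space"
  assumes "arc g" "path_image g \<subseteq> left_of S t" "pathfinish g = (t, \<beta> 0)" "t < t'" "continuous_on {0..1} \<beta>"
  shows "arc (g +++ strand t t' \<beta>)" "path_image (g +++ strand t t' \<beta>) = path_image g \<union> path_image (strand t t' \<beta>)"
proof -
  have "path_image g \<inter> path_image (strand t t' \<beta>) \<subseteq> {(t, \<beta> 0)}"
    using strand_left[OF assms(4)] assms(2) by (fastforce simp: left_of_def)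
  then show "arc (g +++ strand t t' \<beta>)"
    using assms strand_arc by (intro arc_join) auto
  show "path_image (g +++ strand t t' \<beta>) = path_image g \<union> path_image (strand t t' \<beta>)"
    using assms by (intro path_image_join) auto
qed

text \<open>The dart from \<open>a\<close> arrives: its tip becomes the point of \<open>x\<close>,
  its arc the finished edge, and the darts of \<open>x\<close> start there. They start from one
  common point, which is why disjointness is required only for positive parameters.\<close>

lemma dr_branch:
  fixes \<beta> :: "'v \<times> 'v \<Rightarrow> real \<Rightarrow> 'b::topological_space"
  assumes D: "dr S t X E (insert (a, x) W0) pos" and t: "t < t'" and d0: "(a, x) \<notin> W0" "x \<notin> X"
    and B: "\<And>d. d \<in> B \<Longrightarrow> fst d = x"
    and cont: "\<And>d. d \<in> W0 \<union> B \<Longrightarrow> continuous_on {0..1} (\<beta> d)"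
    and b0: "\<And>d. d \<in> W0 \<Longrightarrow> \<beta> d 0 = pos d" "\<And>d. d \<in> B \<Longrightarrow> \<beta> d 0 = pos (a, x)"
    and b1: "\<And>d. d \<in> W0 \<union> B \<Longrightarrow> \<beta> d 1 = pos' d"
    and S: "\<And>d s. d \<in> W0 \<union> B \<Longrightarrow> s \<in> {0..1} \<Longrightarrow> (t + s * (t' - t), \<beta> d s) \<in> S"
    and disj: "\<And>d e s. d \<in> W0 \<union> B \<Longrightarrow> e \<in> W0 \<union> B \<Longrightarrow> d \<noteq> e \<Longrightarrow> s \<in> {0<..1} \<Longrightarrow> \<beta> d s \<noteq> \<beta> e s"
  shows "dr S t' (insert x X) (insert {a, x} E) (W0 \<union> B) pos'"
proof -
  let ?L = "left_of S t" and ?I = "E <+> insert (a, x) W0" and ?I' = "insert {a, x} E <+> (W0 \<union> B)"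
  obtain p \<Gamma> where n: "net ?L X ?I p \<Gamma>"
    and E: "\<forall>e\<in>E. {pathstart (\<Gamma> (Inl e)), pathfinish (\<Gamma> (Inl e))} = p ` e"
    and W: "\<forall>d\<in>insert (a, x) W0. pathstart (\<Gamma> (Inr d)) = p (fst d) \<and> pathfinish (\<Gamma> (Inr d)) = (t, pos d)"
    using D unfolding dr_def by blast
  note nD = netD[OF n]
  have fe: "(t, pos d) \<in> path_image (\<Gamma> (Inr d))" "(t, pos d) \<notin> p ` X"
    "\<And>j. j \<in> ?I \<Longrightarrow> j \<noteq> Inr d \<Longrightarrow> (t, pos d) \<notin> path_image (\<Gamma> j)" if "d \<in> insert (a, x) W0" for d
  proof -
    have "Inr d \<in> ?I" "pathstart (\<Gamma> (Inr d)) = p (fst d)" "pathfinish (\<Gamma> (Inr d)) = (t, pos d)"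
      using W that by auto
    note f = free_end[OF n this]
    show "(t, pos d) \<in> path_image (\<Gamma> (Inr d))" "(t, pos d) \<notin> p ` X" by (fact f)+
    show "\<And>j. j \<in> ?I \<Longrightarrow> j \<noteq> Inr d \<Longrightarrow> (t, pos d) \<notin> path_image (\<Gamma> j)" by (fact f(3))
  qed
  define q where "q = (t, pos (a, x))"
  note qq = fe[OF insertI1, folded q_def]
  have Xe: "e \<subseteq> X" if "e \<in> E" for e using nD(3)[of "Inl e"] that by auto
  have aX: "a \<in> X" using nD(3)[of "Inr (a, x)"] by auto
  have W0X: "fst d \<in> X" if "d \<in> W0" for d using nD(3)[of "Inr d"] that by auto
  have new: "{a, x} \<notin> E" using Xe d0 by auto
  have BW: "W0 \<inter> B = {}" using B W0X d0 by fastforce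
  define p' where "p' = p(x := q)"
  have p'X: "p' ` A = p ` A" if "A \<subseteq> X" for A using that d0 by (auto simp: p'_def)
  define \<Gamma>' where "\<Gamma>' i = (case i of Inl e \<Rightarrow> if e = {a, x} then \<Gamma> (Inr (a, x)) else \<Gamma> (Inl e)
     | Inr d \<Rightarrow> if d \<in> B then strand t t' (\<beta> d) else \<Gamma> (Inr d) +++ strand t t' (\<beta> d))" for i
  define P where "P i = (case i of Inl e \<Rightarrow> if e = {a, x} then path_image (\<Gamma> (Inr (a, x))) else path_image (\<Gamma> (Inl e))
     | Inr d \<Rightarrow> if d \<in> B then {q} else path_image (\<Gamma> (Inr d)))" for i
  define N where "N i = (case i of Inl e \<Rightarrow> {} | Inr d \<Rightarrow> path_image (strand t t' (\<beta> d)))" for i :: "'v set + 'v \<times> 'v"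
  define old where "old i = (case i of Inl e \<Rightarrow> if e = {a, x} then Inr (a, x) else Inl e | Inr d \<Rightarrow> Inr d)"
    for i :: "'v set + 'v \<times> 'v"
  have qL: "q \<in> ?L" using qq(1) nD(5)[of "Inr (a, x)"] by auto
  have inj: "inj_on p' (insert x X)" using nD(1) qq(2) d0 by (auto simp: p'_def inj_on_def)
  have sub: "p' ` insert x X \<subseteq> ?L" using nD(2) qL p'X[of X] by (auto simp: p'_def)
  have p'x: "p' x = q" by (simp add: p'_def)
  have p'ins: "p' ` insert x X = insert q (p ` X)" using p'X[of X] by (simp add: p'x)
  have isB: "Inr d \<in> ?I' \<Longrightarrow> d \<in> B \<or> (d \<in> W0 \<and> d \<notin> B)" for d using BW by auto
  \<comment> \<open>\<open>oldpart i\<close>: the arc \<open>i\<close> existed before the step, possibly as the dart \<open>(a, x)\<close>\<close>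
  define oldpart where "oldpart i \<longleftrightarrow> (case i of Inl e \<Rightarrow> True | Inr d \<Rightarrow> d \<notin> B)" for i :: "'v set + 'v \<times> 'v"
  have o: "old i \<in> ?I" "P i = path_image (\<Gamma> (old i))" "ends i \<inter> X = ends (old i)" if "i \<in> ?I'" "oldpart i" for i
    using that aX d0 Xe W0X by (auto simp: old_def P_def oldpart_def split: sum.splits)
  have oinj: "old i \<noteq> old j" if "i \<in> ?I'" "oldpart i" "j \<in> ?I'" "oldpart j" "i \<noteq> j" for i j
    using that d0 by (auto simp: old_def oldpart_def split: sum.splits if_splits)
  have nq: "P i = {q}" "ends i = {x}" if "i \<in> ?I'" "\<not> oldpart i" for i
    using that B by (auto simp: P_def oldpart_def split: sum.splits)
  have xin: "x \<in> ends i \<longleftrightarrow> i = Inl {a, x}" if "i \<in> ?I'" "oldpart i" for i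
    using that Xe W0X d0 by (auto simp: oldpart_def split: sum.splits)
  have qin: "q \<in> P i \<longleftrightarrow> i = Inl {a, x}" if "i \<in> ?I'" "oldpart i" for i
  proof
    assume "i = Inl {a, x}" then show "q \<in> P i" using qq(1) by (simp add: P_def)
  next
    assume "q \<in> P i"
    then have "old i = Inr (a, x)" using qq(3)[OF o(1)[OF that]] o(2)[OF that] by auto
    then show "i = Inl {a, x}" using that d0(1) by (auto simp: old_def oldpart_def split: sum.splits if_splits)
  qed
  have st: "(t, \<beta> d 0) \<in> P (Inr d)" if d: "d \<in> W0 \<union> B" for d
  proof (cases "d \<in> B")
    case True
    then show ?thesis using b0(2)[OF True] by (simp add: P_def q_def)
  next
    case False
    then have "d \<in> W0" using d by simp
    then show ?thesis using b0(1) fe(1)[of d] False by (simp add: P_def)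
  qed
  have endsX: "ends i \<subseteq> insert x X" if "i \<in> ?I'" for i
    using that W0X aX B by (auto dest: Xe[THEN subsetD])
  have img: "p' ` ends i = p ` (ends i \<inter> X) \<union> (if x \<in> ends i then {q} else {})" if "i \<in> ?I'" for i
  proof -
    have "ends i = (ends i \<inter> X) \<union> (if x \<in> ends i then {x} else {})"
      using endsX[OF that] by auto
    then have "p' ` ends i = p' ` (ends i \<inter> X) \<union> p' ` (if x \<in> ends i then {x} else {})"
      by (metis image_Un)
    then show ?thesis using p'X[of "ends i \<inter> X"] p'x by simp
  qed
  have "net (left_of S t') (insert x X) ?I' p' \<Gamma>'"
  proof (rule net_extend[OF inj sub less_imp_le[OF t], where P = P and N = N])
    fix i assume i: "i \<in> ?I'"
    have arcs: "arc (\<Gamma>' i) \<and> path_image (\<Gamma>' i) = P i \<union> N i"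
    proof (cases i)
      case (Inl e)
      then show ?thesis using i nD(4) by (auto simp: \<Gamma>'_def P_def N_def)
    next
      case (Inr d)
      show ?thesis
      proof (cases "d \<in> B")
        case True
        then have "q \<in> path_image (strand t t' (\<beta> d))" using b0(2)[OF True]
          by (metis pathstart_in_path_image q_def strand_ends(1))
        then show ?thesis using Inr True strand_arc[OF t cont[of d]] by (auto simp: \<Gamma>'_def P_def N_def)
      next
        case False
        then have d: "d \<in> W0" using i Inr by auto
        have "pathfinish (\<Gamma> (Inr d)) = (t, \<beta> d 0)" using W b0(1)[OF d] d by auto
        from join_strand[OF nD(4)[of "Inr d"] nD(5)[of "Inr d"] this t cont[of d]] d Inr False
        show ?thesis by (auto simp: \<Gamma>'_def P_def N_def)
      qed
    qed
    have PL: "P i \<subseteq> ?L"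
    proof (cases "oldpart i")
      case True
      show ?thesis unfolding o(2)[OF i True] by (rule nD(5)[OF o(1)[OF i True]])
    next
      case False
      then show ?thesis using nq[OF i] qL by simp
    qed
    have NL: "N i \<subseteq> left_of S t'"
    proof (cases i)
      case (Inr d)
      have "path_image (strand t t' (\<beta> d)) \<subseteq> S" using S[of d] i Inr by (auto simp: strand_image)
      then show ?thesis using strand_fst[OF t] Inr by (fastforce simp: N_def left_of_def)
    qed (simp add: N_def)
    have NP: "\<forall>r\<in>N i. fst r \<le> t \<longrightarrow> r \<in> P i"
    proof (intro ballI impI)
      fix r assume r: "r \<in> N i" "fst r \<le> t"
      then obtain d where d: "i = Inr d" "r \<in> path_image (strand t t' (\<beta> d))" by (cases i) (auto simp: N_def)
      then have "r = (t, \<beta> d 0)" using strand_left[OF t] r by blast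
      then show "r \<in> P i" using st[of d] d(1) i by auto
    qed
    have "P i \<inter> p' ` insert x X = p' ` ends i"
    proof (cases "oldpart i")
      case True
      have "P i \<inter> p ` X = p ` (ends i \<inter> X)"
        unfolding o(2)[OF i True] o(3)[OF i True] by (rule nD(6)[OF o(1)[OF i True]])
      moreover have "q \<in> P i \<longleftrightarrow> x \<in> ends i" using qin[OF i True] xin[OF i True] by simp
      moreover have "P i \<inter> insert q (p ` X) = (P i \<inter> p ` X) \<union> (if q \<in> P i then {q} else {})" by auto
      ultimately show ?thesis unfolding p'ins img[OF i] by simp
    next
      case False
      then show ?thesis unfolding p'ins using nq[OF i False] p'x by auto
    qed
    then show "ends i \<subseteq> insert x X \<and> arc (\<Gamma>' i) \<and> path_image (\<Gamma>' i) = P i \<union> N i \<and> P i \<subseteq> ?L \<and>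
      N i \<subseteq> left_of S t' \<and> (\<forall>q\<in>N i. fst q \<le> t \<longrightarrow> q \<in> P i) \<and> P i \<inter> p' ` insert x X = p' ` ends i"
      using endsX[OF i] arcs PL NL NP by blast
    fix j assume j: "j \<in> ?I'" "i \<noteq> j"
    have "P i \<inter> P j = p' ` (ends i \<inter> ends j)"
    proof (cases "oldpart i \<and> oldpart j")
      case True
      then have oi: "oldpart i" and oj: "oldpart j" by auto
      have "P i \<inter> P j = p ` (ends (old i) \<inter> ends (old j))"
        unfolding o(2)[OF i oi] o(2)[OF j(1) oj]
        by (rule nD(7)[OF o(1)[OF i oi] o(1)[OF j(1) oj] oinj[OF i oi j(1) oj j(2)]])
      also have "ends (old i) \<inter> ends (old j) = ends i \<inter> ends j"
        using o(3)[OF i oi] o(3)[OF j(1) oj] xin[OF i oi] xin[OF j(1) oj] endsX[OF i] endsX[OF j(1)] j(2) by blast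
      also have "p ` (ends i \<inter> ends j) = p' ` (ends i \<inter> ends j)"
        using xin[OF i oi] xin[OF j(1) oj] endsX[OF i] j(2) by (intro p'X[symmetric]) blast
      finally show ?thesis .
    next
      case False
      then consider "\<not> oldpart i" "\<not> oldpart j" | "oldpart i" "\<not> oldpart j" | "\<not> oldpart i" "oldpart j" by blast
      then show ?thesis
      proof cases
        case 1
        then show ?thesis using nq i j p'x by auto
      next
        case 2
        then show ?thesis using nq[OF j(1)] qin[OF i] xin[OF i] p'x by auto
      next
        case 3
        then show ?thesis using nq[OF i] qin[OF j(1)] xin[OF j(1)] p'x by auto
      qed
    qed
    moreover have "N i \<inter> N j \<subseteq> P i \<inter> P j"
    proof
      fix r assume r: "r \<in> N i \<inter> N j"
      then obtain d e where de: "i = Inr d" "j = Inr e" "r \<in> path_image (strand t t' (\<beta> d))" "r \<in> path_image (strand t t' (\<beta> e))"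
        by (cases i; cases j) (auto simp: N_def)
      obtain s where s: "s \<in> {0..1}" "r = (t + s * (t' - t), \<beta> d s)" "\<beta> d s = \<beta> e s"
        using strand_meet[OF t de(3,4)] .
      have "d \<in> W0 \<union> B" "e \<in> W0 \<union> B" "d \<noteq> e" using i j de by auto
      then have "\<not> 0 < s" using disj[of d e s] s by auto
      then have "s = 0" using s by simp
      then have "fst r \<le> t" using s by simp
      then show "r \<in> P i \<inter> P j"
        using strand_left[OF t de(3)] strand_left[OF t de(4)] st[of d] st[of e] i j de(1,2) by auto
    qed
    ultimately show "P i \<inter> P j = p' ` (ends i \<inter> ends j) \<and> N i \<inter> N j \<subseteq> P i \<inter> P j" by blast
  qed
  moreover have "\<forall>e\<in>insert {a, x} E. {pathstart (\<Gamma>' (Inl e)), pathfinish (\<Gamma>' (Inl e))} = p' ` e"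
  proof
    fix e assume e: "e \<in> insert {a, x} E"
    show "{pathstart (\<Gamma>' (Inl e)), pathfinish (\<Gamma>' (Inl e))} = p' ` e"
    proof (cases "e = {a, x}")
      case True
      moreover have "p' a = p a" using aX d0(2) by (auto simp: p'_def)
      ultimately show ?thesis using W by (simp add: \<Gamma>'_def p'x q_def)
    next
      case False
      then show ?thesis using E e p'X[OF Xe, of e] by (simp add: \<Gamma>'_def)
    qed
  qed
  moreover have "\<forall>d\<in>W0 \<union> B. pathstart (\<Gamma>' (Inr d)) = p' (fst d) \<and> pathfinish (\<Gamma>' (Inr d)) = (t', pos' d)"
  proof
    fix d assume d: "d \<in> W0 \<union> B"
    show "pathstart (\<Gamma>' (Inr d)) = p' (fst d) \<and> pathfinish (\<Gamma>' (Inr d)) = (t', pos' d)"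
    proof (cases "d \<in> B")
      case True
      then show ?thesis using b0(2) b1 B by (simp add: \<Gamma>'_def p'x q_def)
    next
      case False
      then have dW: "d \<in> W0" using d by simp
      then have "fst d \<noteq> x" using W0X d0(2) by metis
      then show ?thesis using False b1 W dW by (simp add: \<Gamma>'_def p'_def)
    qed
  qed
  ultimately show ?thesis unfolding dr_def by blast
qed

lemma pos_inj:
  assumes "dr S t X E W pos" "d \<in> W" "e \<in> W" "d \<noteq> e" shows "pos d \<noteq> pos e"
proof -
  obtain p \<Gamma> where n: "net (left_of S t) X (E <+> W) p \<Gamma>"
    and W: "\<forall>d\<in>W. pathstart (\<Gamma> (Inr d)) = p (fst d) \<and> pathfinish (\<Gamma> (Inr d)) = (t, pos d)"
    using assms(1) unfolding dr_def by blast
  have "(t, pos d) \<notin> path_image (\<Gamma> (Inr e))"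
    using free_end(3)[OF n, of d "(t, pos d)" "Inr e"] W assms by auto
  moreover have "(t, pos e) \<in> path_image (\<Gamma> (Inr e))"
    using free_end(1)[OF n, of e "(t, pos e)"] W assms by auto
  ultimately show ?thesis by auto
qed

lemma dr_advance:
  fixes \<beta> :: "'v \<times> 'v \<Rightarrow> real \<Rightarrow> 'b::topological_space"
  assumes D: "dr S t X E W pos" and t: "t < t'"
    and cont: "\<And>d. d \<in> W \<Longrightarrow> continuous_on {0..1} (\<beta> d)"
    and b0: "\<And>d. d \<in> W \<Longrightarrow> \<beta> d 0 = pos d" and b1: "\<And>d. d \<in> W \<Longrightarrow> \<beta> d 1 = pos' d"
    and S: "\<And>d s. d \<in> W \<Longrightarrow> s \<in> {0..1} \<Longrightarrow> (t + s * (t' - t), \<beta> d s) \<in> S"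
    and disj: "\<And>d e s. d \<in> W \<Longrightarrow> e \<in> W \<Longrightarrow> d \<noteq> e \<Longrightarrow> s \<in> {0..1} \<Longrightarrow> \<beta> d s \<noteq> \<beta> e s"
  shows "dr S t' X E W pos'"
proof -
  let ?L = "left_of S t" and ?I = "E <+> W"
  obtain p \<Gamma> where n: "net ?L X ?I p \<Gamma>"
    and E: "\<forall>e\<in>E. {pathstart (\<Gamma> (Inl e)), pathfinish (\<Gamma> (Inl e))} = p ` e"
    and W: "\<forall>d\<in>W. pathstart (\<Gamma> (Inr d)) = p (fst d) \<and> pathfinish (\<Gamma> (Inr d)) = (t, pos d)"
    using D unfolding dr_def by blast
  note nD = netD[OF n]
  define \<Gamma>' where "\<Gamma>' i = (case i of Inl e \<Rightarrow> \<Gamma> (Inl e) | Inr d \<Rightarrow> \<Gamma> (Inr d) +++ strand t t' (\<beta> d))" for i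
  define N where "N i = (case i of Inl e \<Rightarrow> {} | Inr d \<Rightarrow> path_image (strand t t' (\<beta> d)))" for i :: "'v set + 'v \<times> 'v"
  have "net (left_of S t') X ?I p \<Gamma>'"
  proof (rule net_extend[OF nD(1,2) less_imp_le[OF t], where P = "\<lambda>i. path_image (\<Gamma> i)" and N = N])
    fix i assume i: "i \<in> ?I"
    have arcs: "arc (\<Gamma>' i) \<and> path_image (\<Gamma>' i) = path_image (\<Gamma> i) \<union> N i"
    proof (cases i)
      case (Inl e)
      then show ?thesis using nD(4)[OF i] by (simp add: \<Gamma>'_def N_def)
    next
      case (Inr d)
      then have d: "d \<in> W" using i by auto
      have "pathfinish (\<Gamma> (Inr d)) = (t, \<beta> d 0)" using W b0[OF d] d by auto
      from join_strand[OF nD(4)[OF i[unfolded Inr]] nD(5)[OF i[unfolded Inr]] this t cont[OF d]] Inr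
      show ?thesis by (simp add: \<Gamma>'_def N_def)
    qed
    have NL: "N i \<subseteq> left_of S t'"
    proof (cases i)
      case (Inr d)
      have "path_image (strand t t' (\<beta> d)) \<subseteq> S" using S[of d] i Inr by (auto simp: strand_image)
      then show ?thesis using strand_fst[OF t] Inr by (fastforce simp: N_def left_of_def)
    qed (simp add: N_def)
    have NP: "\<forall>r\<in>N i. fst r \<le> t \<longrightarrow> r \<in> path_image (\<Gamma> i)"
    proof (intro ballI impI)
      fix r assume r: "r \<in> N i" "fst r \<le> t"
      then obtain d where d: "i = Inr d" "r \<in> path_image (strand t t' (\<beta> d))" by (cases i) (auto simp: N_def)
      then have dW: "d \<in> W" using i by auto
      have "r = (t, \<beta> d 0)" using strand_left[OF t d(2) r(2)] .
      then show "r \<in> path_image (\<Gamma> i)" using b0[OF dW] W dW d(1) by (metis pathfinish_in_path_image)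
    qed
    show "ends i \<subseteq> X \<and> arc (\<Gamma>' i) \<and> path_image (\<Gamma>' i) = path_image (\<Gamma> i) \<union> N i \<and> path_image (\<Gamma> i) \<subseteq> ?L \<and>
      N i \<subseteq> left_of S t' \<and> (\<forall>q\<in>N i. fst q \<le> t \<longrightarrow> q \<in> path_image (\<Gamma> i)) \<and> path_image (\<Gamma> i) \<inter> p ` X = p ` ends i"
      using arcs NL NP nD(3)[OF i] nD(5)[OF i] nD(6)[OF i] by blast
    fix j assume j: "j \<in> ?I" "i \<noteq> j"
    have "N i \<inter> N j = {}"
    proof (rule ccontr)
      assume "N i \<inter> N j \<noteq> {}"
      then obtain r where "r \<in> N i" "r \<in> N j" by blast
      then obtain d e where de: "i = Inr d" "j = Inr e" "r \<in> path_image (strand t t' (\<beta> d))" "r \<in> path_image (strand t t' (\<beta> e))"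
        by (cases i; cases j) (auto simp: N_def)
      obtain s where "s \<in> {0..1}" "\<beta> d s = \<beta> e s" using strand_meet[OF t de(3,4)] by metis
      moreover have "d \<in> W" "e \<in> W" "d \<noteq> e" using i j de by auto
      ultimately show False using disj by blast
    qed
    then show "path_image (\<Gamma> i) \<inter> path_image (\<Gamma> j) = p ` (ends i \<inter> ends j) \<and> N i \<inter> N j \<subseteq> path_image (\<Gamma> i) \<inter> path_image (\<Gamma> j)"
      using nD(7)[OF i j] by simp
  qed
  moreover have "\<forall>e\<in>E. {pathstart (\<Gamma>' (Inl e)), pathfinish (\<Gamma>' (Inl e))} = p ` e"
    using E by (simp add: \<Gamma>'_def)
  moreover have "\<forall>d\<in>W. pathstart (\<Gamma>' (Inr d)) = p (fst d) \<and> pathfinish (\<Gamma>' (Inr d)) = (t', pos' d)"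
    using W b1 by (simp add: \<Gamma>'_def)
  ultimately show ?thesis unfolding dr_def by blast
qed

text \<open>The two darts of one edge are joined by \<open>lam\<close> ahead of the front while all
  other strands continue straight. The finished arc runs out along \<open>d1\<close>, across
  \<open>lam\<close>, and back along \<open>d2\<close>.\<close>

lemma dr_link:
  fixes lam :: "real \<Rightarrow> real \<times> 'b::topological_space"
  assumes D: "dr S t X E (insert d1 (insert d2 W)) pos" and t: "t < t'"
    and ne: "d1 \<noteq> d2" "d1 \<notin> W" "d2 \<notin> W" "fst d1 \<noteq> fst d2" "{fst d1, fst d2} \<notin> E"
    and lam: "arc lam" "pathstart lam = (t, pos d1)" "pathfinish lam = (t, pos d2)"
      "path_image lam \<subseteq> left_of S t'"
      "\<And>q. q \<in> path_image lam \<Longrightarrow> fst q \<le> t \<Longrightarrow> q = (t, pos d1) \<or> q = (t, pos d2)"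
    and S: "\<And>d x. d \<in> W \<Longrightarrow> x \<in> {t..t'} \<Longrightarrow> (x, pos d) \<in> S - path_image lam"
  shows "dr S t' X (insert {fst d1, fst d2} E) W pos"
proof -
  let ?L = "left_of S t" and ?I = "E <+> insert d1 (insert d2 W)" and ?f = "{fst d1, fst d2}"
  let ?I' = "insert ?f E <+> W"
  obtain p \<Gamma> where n: "net ?L X ?I p \<Gamma>"
    and E: "\<forall>e\<in>E. {pathstart (\<Gamma> (Inl e)), pathfinish (\<Gamma> (Inl e))} = p ` e"
    and W: "\<forall>d\<in>insert d1 (insert d2 W). pathstart (\<Gamma> (Inr d)) = p (fst d) \<and> pathfinish (\<Gamma> (Inr d)) = (t, pos d)"
    using D unfolding dr_def by blast
  note nD = netD[OF n]
  have i12: "Inr d1 \<in> ?I" "Inr d2 \<in> ?I" "Inr d1 \<noteq> Inr d2" using ne by auto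
  have st: "pathstart (\<Gamma> (Inr d)) = p (fst d)" "pathfinish (\<Gamma> (Inr d)) = (t, pos d)"
    if "d \<in> insert d1 (insert d2 W)" for d using W that by auto
  note st1 = st[OF insertI1] and st2 = st[OF insertI2[OF insertI1]]
  note f1 = free_end[OF n i12(1) st1] and f2 = free_end[OF n i12(2) st2]
  let ?g = "\<Gamma> (Inr d1) +++ (lam +++ reversepath (\<Gamma> (Inr d2)))"
  let ?\<sigma> = "\<lambda>d. strand t t' (\<lambda>s. pos d)"
  define \<Gamma>' where "\<Gamma>' i = (case i of Inl e \<Rightarrow> if e = ?f then ?g else \<Gamma> (Inl e) | Inr d \<Rightarrow> \<Gamma> (Inr d) +++ ?\<sigma> d)" for i
  define P where "P i = (if i = Inl ?f then path_image (\<Gamma> (Inr d1)) \<union> path_image (\<Gamma> (Inr d2)) else path_image (\<Gamma> i))" for i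
  define N where "N i = (case i of Inl e \<Rightarrow> if e = ?f then path_image lam else {} | Inr d \<Rightarrow> path_image (?\<sigma> d))" for i
  have L: "fst q \<le> t" if "q \<in> ?L" for q using that by (simp add: left_of_def)
  have g: "arc ?g" "path_image ?g = path_image (\<Gamma> (Inr d1)) \<union> path_image (\<Gamma> (Inr d2)) \<union> path_image lam"
    "pathstart ?g = p (fst d1)" "pathfinish ?g = p (fst d2)"
  proof -
    have "path_image lam \<inter> path_image (\<Gamma> (Inr d2)) \<subseteq> {(t, pos d2)}"
    proof
      fix q assume q: "q \<in> path_image lam \<inter> path_image (\<Gamma> (Inr d2))"
      then have "fst q \<le> t" using nD(5)[OF i12(2)] L by blast
      then show "q \<in> {(t, pos d2)}" using lam(5)[of q] q f1(3)[OF i12(2) i12(3)[symmetric]] by auto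
    qed
    then have a2: "arc (lam +++ reversepath (\<Gamma> (Inr d2)))"
      using lam(1-3) st2 arc_reversepath[OF nD(4)[OF i12(2)]] by (intro arc_join) auto
    have im2: "path_image (lam +++ reversepath (\<Gamma> (Inr d2))) = path_image lam \<union> path_image (\<Gamma> (Inr d2))"
      using lam st[of d2] by (subst path_image_join) auto
    have "path_image (\<Gamma> (Inr d1)) \<inter> path_image (\<Gamma> (Inr d2)) = {}"
      using nD(7)[OF i12] ne by simp
    moreover have "path_image (\<Gamma> (Inr d1)) \<inter> path_image lam \<subseteq> {(t, pos d1)}"
    proof
      fix q assume q: "q \<in> path_image (\<Gamma> (Inr d1)) \<inter> path_image lam"
      then have "fst q \<le> t" using nD(5)[OF i12(1)] L by blast
      then show "q \<in> {(t, pos d1)}" using lam(5)[of q] q f2(3)[OF i12(1) i12(3)] by auto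
    qed
    ultimately have "path_image (\<Gamma> (Inr d1)) \<inter> path_image (lam +++ reversepath (\<Gamma> (Inr d2))) \<subseteq> {(t, pos d1)}"
      unfolding im2 by blast
    then show "arc ?g"
      using lam(2) st1 by (intro arc_join[OF nD(4)[OF i12(1)] a2]) auto
    show "path_image ?g = path_image (\<Gamma> (Inr d1)) \<union> path_image (\<Gamma> (Inr d2)) \<union> path_image lam"
      using lam st[of d1] im2 by (subst path_image_join) auto
    show "pathstart ?g = p (fst d1)" "pathfinish ?g = p (fst d2)" using st by auto
  qed
  have ne_f: "i \<noteq> Inl ?f \<Longrightarrow> i \<in> ?I' \<Longrightarrow> i \<in> ?I \<and> i \<noteq> Inr d1 \<and> i \<noteq> Inr d2" for i using ne by auto
  have fI: "Inl ?f \<notin> ?I" using ne by auto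
  have "net (left_of S t') X ?I' p \<Gamma>'"
  proof (rule net_extend[OF nD(1,2) less_imp_le[OF t], where P = P and N = N])
    fix i assume i: "i \<in> ?I'"
    have arcs: "ends i \<subseteq> X \<and> arc (\<Gamma>' i) \<and> path_image (\<Gamma>' i) = P i \<union> N i \<and> P i \<subseteq> ?L \<and> P i \<inter> p ` X = p ` ends i"
    proof (cases "i = Inl ?f")
      case True
      have "ends i = ends (Inr d1) \<union> ends (Inr d2)" using True by auto
      moreover have "P i = path_image (\<Gamma> (Inr d1)) \<union> path_image (\<Gamma> (Inr d2))" using True by (simp add: P_def)
      ultimately have "ends i \<subseteq> X" "P i \<subseteq> ?L" "P i \<inter> p ` X = p ` ends i"
        using nD(3)[OF i12(1)] nD(3)[OF i12(2)] nD(5)[OF i12(1)] nD(5)[OF i12(2)] nD(6)[OF i12(1)] nD(6)[OF i12(2)]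
        by (simp_all add: Int_Un_distrib2)
      then show ?thesis using g True by (simp add: P_def N_def \<Gamma>'_def)
    next
      case False
      then have iI: "i \<in> ?I" using ne_f i by blast
      have "arc (\<Gamma>' i) \<and> path_image (\<Gamma>' i) = P i \<union> N i"
      proof (cases i)
        case (Inl e)
        then show ?thesis using nD(4)[OF iI] False by (simp add: \<Gamma>'_def N_def P_def)
      next
        case (Inr d)
        then have "pathfinish (\<Gamma> (Inr d)) = (t, pos d)" using st i by auto
        from join_strand[OF nD(4)[of "Inr d"] nD(5)[of "Inr d"] this t] iI Inr
        show ?thesis by (simp add: \<Gamma>'_def N_def P_def)
      qed
      then show ?thesis using nD(3)[OF iI] nD(5)[OF iI] nD(6)[OF iI] False by (simp add: P_def)
    qed
    have NL: "N i \<subseteq> left_of S t'"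
    proof (cases i)
      case (Inl e)
      then show ?thesis using lam by (simp add: N_def)
    next
      case (Inr d)
      then have d: "d \<in> W" using i by auto
      have "q \<in> S" if q: "q \<in> path_image (?\<sigma> d)" for q
      proof -
        have "q = (fst q, pos d)" using q by (auto simp: strand_image)
        then show ?thesis using S[OF d, of "fst q"] strand_fst[OF t q] by simp
      qed
      then show ?thesis using strand_fst[OF t] Inr by (fastforce simp: N_def left_of_def)
    qed
    have NP: "\<forall>r\<in>N i. fst r \<le> t \<longrightarrow> r \<in> P i"
    proof (intro ballI impI)
      fix r assume r: "r \<in> N i" "fst r \<le> t"
      show "r \<in> P i"
      proof (cases i)
        case (Inl e)
        then have "e = ?f" "r \<in> path_image lam" using r by (auto simp: N_def split: if_splits)
        then show ?thesis using lam(5)[of r] r f1(1) f2(1) Inl by (auto simp: P_def)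
      next
        case (Inr d)
        then have "r = (t, pos d)" using strand_left[OF t _ r(2)] r(1) by (simp add: N_def)
        moreover have "pathfinish (\<Gamma> (Inr d)) = (t, pos d)" using st i Inr by auto
        ultimately show ?thesis using Inr by (simp add: P_def) (metis pathfinish_in_path_image)
      qed
    qed
    show "ends i \<subseteq> X \<and> arc (\<Gamma>' i) \<and> path_image (\<Gamma>' i) = P i \<union> N i \<and> P i \<subseteq> ?L \<and>
      N i \<subseteq> left_of S t' \<and> (\<forall>q\<in>N i. fst q \<le> t \<longrightarrow> q \<in> P i) \<and> P i \<inter> p ` X = p ` ends i"
      using arcs NL NP by blast
    fix j assume j: "j \<in> ?I'" "i \<noteq> j"
    have f: "P (Inl ?f) \<inter> P k = p ` (ends (Inl ?f) \<inter> ends k)" if k: "k \<in> ?I'" "k \<noteq> Inl ?f" for k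
    proof -
      have kI: "k \<in> ?I" "Inr d1 \<noteq> k" "Inr d2 \<noteq> k" using ne_f k by auto
      have "ends (Inl ?f) \<inter> ends k = (ends (Inr d1) \<inter> ends k) \<union> (ends (Inr d2) \<inter> ends k)" by auto
      then show ?thesis using nD(7)[OF i12(1) kI(1,2)] nD(7)[OF i12(2) kI(1,3)] k
        by (simp only: P_def if_True if_False simp_thms Int_Un_distrib2 image_Un)
    qed
    have "P i \<inter> P j = p ` (ends i \<inter> ends j)"
    proof (cases "i = Inl ?f")
      case True
      then show ?thesis using f[OF j(1)] j(2) by simp
    next
      case False
      show ?thesis
      proof (cases "j = Inl ?f")
        case True
        then show ?thesis using f[OF i False] by (metis Int_commute)
      next
        case False2: False
        then show ?thesis using False nD(7)[of i j] ne_f i j by (simp add: P_def)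
      qed
    qed
    moreover have ln: "path_image lam \<inter> N (Inr d) = {}" if "d \<in> W" for d
    proof (rule ccontr)
      assume "path_image lam \<inter> N (Inr d) \<noteq> {}"
      then obtain q where q: "q \<in> path_image lam" "q \<in> path_image (?\<sigma> d)" by (auto simp: N_def)
      have "q = (fst q, pos d)" using q(2) by (auto simp: strand_image)
      then show False using S[OF that, of "fst q"] strand_fst[OF t q(2)] q(1) by simp
    qed
    have "N i \<inter> N j = {}"
    proof (cases i; cases j)
      fix d e assume ij: "i = Inr d" "j = Inr e"
      show ?thesis
      proof (rule ccontr)
        assume "N i \<inter> N j \<noteq> {}"
        then have "pos d = pos e" using ij by (auto simp: N_def strand_image)
        then show False using pos_inj[OF D, of d e] ij i j by auto
      qed
    qed (use i j ln in \<open>auto simp: N_def split: if_splits\<close>)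
    ultimately show "P i \<inter> P j = p ` (ends i \<inter> ends j) \<and> N i \<inter> N j \<subseteq> P i \<inter> P j" by simp
  qed
  moreover have "\<forall>e\<in>insert ?f E. {pathstart (\<Gamma>' (Inl e)), pathfinish (\<Gamma>' (Inl e))} = p ` e"
    using E ne g(3,4) by (auto simp: \<Gamma>'_def)
  moreover have "\<forall>d\<in>W. pathstart (\<Gamma>' (Inr d)) = p (fst d) \<and> pathfinish (\<Gamma>' (Inr d)) = (t', pos d)"
    using st by (simp add: \<Gamma>'_def)
  ultimately show ?thesis unfolding dr_def by blast
qed

lemma dr_start:
  fixes \<beta> :: "'v \<times> 'v \<Rightarrow> real \<Rightarrow> 'b::topological_space"
  assumes t: "t < t'" and q: "(t, q) \<in> S" and B: "\<And>d. d \<in> B \<Longrightarrow> fst d = x"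
    and cont: "\<And>d. d \<in> B \<Longrightarrow> continuous_on {0..1} (\<beta> d)"
    and b0: "\<And>d. d \<in> B \<Longrightarrow> \<beta> d 0 = q" and b1: "\<And>d. d \<in> B \<Longrightarrow> \<beta> d 1 = pos' d"
    and S: "\<And>d s. d \<in> B \<Longrightarrow> s \<in> {0..1} \<Longrightarrow> (t + s * (t' - t), \<beta> d s) \<in> S"
    and disj: "\<And>d e s. d \<in> B \<Longrightarrow> e \<in> B \<Longrightarrow> d \<noteq> e \<Longrightarrow> s \<in> {0<..1} \<Longrightarrow> \<beta> d s \<noteq> \<beta> e s"
  shows "dr S t' {x} {} B pos'"
proof -
  let ?p = "\<lambda>_ :: 'v. (t, q)" and ?\<Gamma> = "\<lambda>i :: 'v set + 'v \<times> 'v. strand t t' (\<beta> (projr i))"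
  have "net (left_of S t') {x} ({} <+> B) ?p ?\<Gamma>"
  proof (rule net_extend[where P = "\<lambda>_. {(t, q)}" and N = "\<lambda>i. path_image (?\<Gamma> i)" and t = t])
    show "inj_on ?p {x}" "?p ` {x} \<subseteq> left_of S t" "t \<le> t'" using t q by (auto simp: left_of_def)
    fix i :: "'v set + 'v \<times> 'v" assume "i \<in> {} <+> B"
    then obtain d where d: "i = Inr d" "d \<in> B" by auto
    have 1: "(t, q) \<in> path_image (?\<Gamma> i)" using b0 d by (metis pathstart_in_path_image strand_ends(1) sum.sel(2))
    have "path_image (?\<Gamma> i) \<subseteq> S" using S[OF d(2)] d by (auto simp: strand_image)
    then have 2: "path_image (?\<Gamma> i) \<subseteq> left_of S t'"
      using strand_fst(2)[OF t, of _ "\<beta> d"] d by (auto simp: left_of_def)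
    have 3: "r = (t, q)" if "r \<in> path_image (?\<Gamma> i)" "fst r \<le> t" for r
      using strand_left[OF t that] b0 d by simp
    have 4: "ends i = {x}" "arc (?\<Gamma> i)" "(t, q) \<in> left_of S t"
      using B d q strand_arc[OF t cont[OF d(2)]] by (simp_all add: left_of_def)
    show "ends i \<subseteq> {x} \<and> arc (?\<Gamma> i) \<and> path_image (?\<Gamma> i) = {(t, q)} \<union> path_image (?\<Gamma> i) \<and>
        {(t, q)} \<subseteq> left_of S t \<and> path_image (?\<Gamma> i) \<subseteq> left_of S t' \<and>
        (\<forall>r\<in>path_image (?\<Gamma> i). fst r \<le> t \<longrightarrow> r \<in> {(t, q)}) \<and> {(t, q)} \<inter> ?p ` {x} = ?p ` ends i"
      using 1 2 4 by (intro conjI ballI impI) (simp_all add: insert_absorb 3)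
    fix j :: "'v set + 'v \<times> 'v" assume "j \<in> {} <+> B" "i \<noteq> j"
    then obtain e where e: "j = Inr e" "e \<in> B" "d \<noteq> e" using d by auto
    have "r = (t, q)" if r: "r \<in> path_image (?\<Gamma> i)" "r \<in> path_image (?\<Gamma> j)" for r
    proof -
      obtain s where s: "s \<in> {0..1}" "r = (t + s * (t' - t), \<beta> d s)" "\<beta> d s = \<beta> e s"
        using strand_meet[OF t r] d e by auto
      then have "s = 0" using disj[OF d(2) e(2,3), of s] by force
      then show ?thesis using s b0 d by simp
    qed
    then show "{(t, q)} \<inter> {(t, q)} = ?p ` (ends i \<inter> ends j) \<and>
        path_image (?\<Gamma> i) \<inter> path_image (?\<Gamma> j) \<subseteq> {(t, q)} \<inter> {(t, q)}"
      using B d e by auto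
  qed
  then show ?thesis unfolding dr_def
    by (intro exI[of _ ?p] exI[of _ ?\<Gamma>]) (use b0 b1 in auto)
qed

lemma dr_embeds:
  assumes "dr S t V E {} pos" shows "embeds_in (V, E) S"
proof -
  obtain p \<Gamma> where n: "net (left_of S t) V (E <+> {}) p \<Gamma>"
    and E: "\<forall>e\<in>E. {pathstart (\<Gamma> (Inl e)), pathfinish (\<Gamma> (Inl e))} = p ` e"
    using assms unfolding dr_def by blast
  note nD = netD[OF n]
  have L: "left_of S t \<subseteq> S" by (auto simp: left_of_def)
  show ?thesis unfolding embeds_in_def fst_conv snd_conv
  proof (rule exI[of _ p], rule exI[of _ "\<lambda>e. \<Gamma> (Inl e)"], intro conjI ballI impI)
    show "inj_on p V" "p ` V \<subseteq> S" using nD(1,2) L by auto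
    fix e assume e: "e \<in> E"
    then have i: "Inl e \<in> E <+> {}" by (rule InlI)
    show "arc (\<Gamma> (Inl e))" "path_image (\<Gamma> (Inl e)) \<subseteq> S" using nD(4,5)[OF i] L by auto
    show "{pathstart (\<Gamma> (Inl e)), pathfinish (\<Gamma> (Inl e))} = p ` e" using E e by blast
    show "path_image (\<Gamma> (Inl e)) \<inter> p ` V = p ` e" using nD(6)[OF i] by simp
    fix e' assume e': "e' \<in> E" "e \<noteq> e'"
    then show "path_image (\<Gamma> (Inl e)) \<inter> path_image (\<Gamma> (Inl e')) = p ` (e \<inter> e')"
      using nD(7)[OF i InlI[OF e'(1)]] by simp
  qed
qed

section \<open>Charts of the surface\<close>

definition inc :: "('d \<Rightarrow> real) \<Rightarrow> 'd list \<Rightarrow> real \<Rightarrow> real \<Rightarrow> bool" where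
  "inc \<theta> w a b \<longleftrightarrow> sorted_wrt (\<lambda>d e. \<theta> d < \<theta> e) w \<and> (\<forall>d\<in>set w. a < \<theta> d \<and> \<theta> d < b)"

lemma inc_exists: "distinct w \<Longrightarrow> a < b \<Longrightarrow> \<exists>\<theta>. inc \<theta> w a b"
proof (induction w arbitrary: a)
  case (Cons d w)
  let ?m = "(a + b) / 2"
  have m: "a < ?m" "?m < b" using Cons.prems by auto
  then obtain \<theta> where \<theta>: "inc \<theta> w ?m b" using Cons.IH[of ?m] Cons.prems(1) by auto
  define x where "x = (a + ?m) / 2"
  have x: "a < x" "x < ?m" using m by (auto simp: x_def)
  let ?t = "\<theta>(d := x)"
  have t: "?t e = \<theta> e" if "e \<in> set w" for e using Cons.prems(1) that by auto
  have "sorted_wrt (\<lambda>d' e. ?t d' < ?t e) w"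
  proof (rule sorted_wrt_mono_rel[of w "\<lambda>d e. \<theta> d < \<theta> e"])
    show "?t d' < ?t e" if "d' \<in> set w" "e \<in> set w" "\<theta> d' < \<theta> e" for d' e
      using that(3) t[OF that(1)] t[OF that(2)] by simp
    show "sorted_wrt (\<lambda>d e. \<theta> d < \<theta> e) w" using \<theta> by (simp add: inc_def)
  qed
  moreover have "x < ?t e \<and> a < ?t e \<and> ?t e < b" if "e \<in> set w" for e
  proof -
    have "?m < \<theta> e \<and> \<theta> e < b" using \<theta> that by (simp add: inc_def)
    then show ?thesis unfolding t[OF that] using x m by linarith
  qed
  moreover have "x < b" using x m by linarith
  ultimately have "inc ?t (d # w) a b" unfolding inc_def using x(1) by simp
  then show ?case by blast
qed (simp add: inc_def)

lemma inc_cmp: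
  "inc \<theta> w a b \<Longrightarrow> sorted_wrt (\<lambda>d e. \<theta>' d \<le> \<theta>' e) w \<Longrightarrow> d \<in> set w \<Longrightarrow> e \<in> set w \<Longrightarrow> d \<noteq> e \<Longrightarrow>
    (\<theta> d < \<theta> e \<and> \<theta>' d \<le> \<theta>' e) \<or> (\<theta> e < \<theta> d \<and> \<theta>' e \<le> \<theta>' d)"
  by (induction w) (auto simp: inc_def)

lemma inc_distinct: "inc \<theta> w a b \<Longrightarrow> distinct w"
  by (induction w) (auto simp: inc_def)

lemma inc_le: "inc \<theta> w a b \<Longrightarrow> sorted_wrt (\<lambda>d e. \<theta> d \<le> \<theta> e) w"
  unfolding inc_def by (auto intro: sorted_wrt_mono_rel[rotated])

lemma inc_append:
  "inc \<theta> u a b \<Longrightarrow> inc \<theta> v c d \<Longrightarrow> b \<le> c \<Longrightarrow> a \<le> c \<Longrightarrow> b \<le> d \<Longrightarrow> inc \<theta> (u @ v) a d"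
  unfolding inc_def sorted_wrt_append by fastforce

lemma inc_sub: "inc \<theta> w a b \<Longrightarrow> a' \<le> a \<Longrightarrow> b \<le> b' \<Longrightarrow> inc \<theta> w a' b'"
  unfolding inc_def by fastforce

lemma inc_cong: "inc \<theta> w a b \<Longrightarrow> (\<And>d. d \<in> set w \<Longrightarrow> \<theta>' d = \<theta> d) \<Longrightarrow> inc \<theta>' w a b"
  unfolding inc_def by (auto intro: sorted_wrt_mono_rel[rotated])

lemma inc_affine:
  assumes "inc \<theta> w a b" "0 < k" shows "inc (\<lambda>d. k * \<theta> d + l) w (k * a + l) (k * b + l)"
  using assms unfolding inc_def by auto

text \<open>A region of the surface that is a product of an interval of times and an open curve.
  Leaving one point out of a closed cross section turns the cyclic order of the front into a linear
  one. The length 8 is the perimeter of a square of side 2.\<close>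

definition chart :: "(real \<times> 'b::t2_space) set \<Rightarrow> (real \<Rightarrow> 'b) \<Rightarrow> real \<Rightarrow> real \<Rightarrow> bool" where
  "chart S \<phi> a b \<longleftrightarrow> a < b \<and> continuous_on {0<..<8} \<phi> \<and> inj_on \<phi> {0<..<8} \<and>
     (\<forall>x\<in>{a<..<b}. \<forall>\<tau>\<in>{0<..<8}. (x, \<phi> \<tau>) \<in> S)"

lemma convex_comb_in:
  fixes x y :: real
  assumes "lo < x" "x < hi" "lo < y" "y < hi" "s \<in> {0..1}"
  shows "lo < (1 - s) * x + s * y" "(1 - s) * x + s * y < hi"
proof -
  have "(1 - s) * x + s * y = (1 - s) *\<^sub>R x + s *\<^sub>R y" by simp
  moreover have "convex {lo<..<hi}" by (rule convex_real_interval)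
  ultimately have "(1 - s) * x + s * y \<in> {lo<..<hi}"
    using assms convexD[of "{lo<..<hi}" x y "1 - s" s] by auto
  then show "lo < (1 - s) * x + s * y" "(1 - s) * x + s * y < hi" by auto
qed

lemma chart_path:
  assumes "chart S \<phi> a b" "0 < x" "x < 8" "0 < y" "y < 8"
  shows "continuous_on {0..1} (\<lambda>s. \<phi> ((1 - s) * x + s * y))"
proof (rule continuous_on_compose2[of "{0<..<8}" \<phi>])
  show "continuous_on {0<..<8} \<phi>" using assms by (simp add: chart_def)
  show "continuous_on {0..1} (\<lambda>s. (1 - s) * x + s * y)" by (intro continuous_intros)
  show "(\<lambda>s. (1 - s) * x + s * y) ` {0..1} \<subseteq> {0<..<8}"
    using convex_comb_in[OF assms(2-5)] by fastforce
qed

lemma time_in: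
  fixes t :: real
  assumes "a < t" "t < t'" "t' < b" "s \<in> {0..1}" shows "t + s * (t' - t) \<in> {a<..<b}"
  using convex_comb_in[of a t b t' s] assms by (auto simp: algebra_simps)

lemma comb_less:
  fixes x y :: real
  assumes "x \<le> y" "x' < y'" "s \<in> {0<..1}"
  shows "(1 - s) * x + s * x' < (1 - s) * y + s * y'"
proof -
  have "(1 - s) * x \<le> (1 - s) * y" using assms by (intro mult_left_mono) auto
  moreover have "s * x' < s * y'" using assms by (intro mult_strict_left_mono) auto
  ultimately show ?thesis by linarith
qed

lemma comb_less':
  fixes x y :: real
  assumes "x < y" "x' < y'" "s \<in> {0..1}"
  shows "(1 - s) * x + s * x' < (1 - s) * y + s * y'"
proof (cases "s = 0")
  case False
  then show ?thesis using comb_less[of x y x' y' s] assms by auto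
qed (use assms in simp)

lemma chart_neq:
  assumes "chart S \<phi> a b" "0 < x" "x < 8" "0 < y" "y < 8" "x \<noteq> y" shows "\<phi> x \<noteq> \<phi> y"
  using assms by (auto simp: chart_def inj_on_def)

text \<open>Two increasing placements of the same word can be joined by linear interpolation, which
  keeps the strict order at all times.\<close>

lemma chart_advance:
  assumes c: "chart S \<phi> a b" and t: "a < t" "t < t'" "t' < b"
    and D: "dr S t X E (set w) (\<phi> \<circ> \<theta>)" and \<theta>: "inc \<theta> w 0 8" "inc \<theta>' w 0 8"
  shows "dr S t' X E (set w) (\<phi> \<circ> \<theta>')"
proof (rule dr_advance[OF D t(2), where \<beta> = "\<lambda>d s. \<phi> ((1 - s) * \<theta> d + s * \<theta>' d)"])
  fix d assume d: "d \<in> set w"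
  then have r: "0 < \<theta> d" "\<theta> d < 8" "0 < \<theta>' d" "\<theta>' d < 8" using \<theta> by (auto simp: inc_def)
  show "continuous_on {0..1} (\<lambda>s. \<phi> ((1 - s) * \<theta> d + s * \<theta>' d))" by (rule chart_path[OF c r])
  fix s :: real assume s: "s \<in> {0..1}"
  note b = convex_comb_in[OF r s]
  show "(t + s * (t' - t), \<phi> ((1 - s) * \<theta> d + s * \<theta>' d)) \<in> S"
    using c time_in[OF t s] b by (simp add: chart_def)
  fix e assume e: "e \<in> set w" "d \<noteq> e"
  then have r': "0 < \<theta> e" "\<theta> e < 8" "0 < \<theta>' e" "\<theta>' e < 8" using \<theta> by (auto simp: inc_def)
  have "(\<theta> d < \<theta> e \<and> \<theta>' d < \<theta>' e) \<or> (\<theta> e < \<theta> d \<and> \<theta>' e < \<theta>' d)"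
    using inc_cmp[OF \<theta>(1) inc_le[OF \<theta>(2)] d e] inc_cmp[OF \<theta>(2) inc_le[OF \<theta>(1)] d e] by auto
  then have "(1 - s) * \<theta> d + s * \<theta>' d \<noteq> (1 - s) * \<theta> e + s * \<theta>' e"
    using comb_less'[of "\<theta> d" "\<theta> e" "\<theta>' d" "\<theta>' e" s] comb_less'[of "\<theta> e" "\<theta> d" "\<theta>' e" "\<theta>' d" s] s by auto
  then show "\<phi> ((1 - s) * \<theta> d + s * \<theta>' d) \<noteq> \<phi> ((1 - s) * \<theta> e + s * \<theta>' e)"
    using chart_neq[OF c b convex_comb_in[OF r' s]] by blast
qed auto

lemma chart_branch:
  assumes c: "chart S \<phi> a b" and t: "a < t" "t < t'" "t' < b"
    and D: "dr S t X E (set (u @ [(y, x)] @ v)) (\<phi> \<circ> \<theta>)"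
    and \<theta>: "inc \<theta> (u @ [(y, x)] @ v) 0 8" "inc \<theta>' (u @ ds @ v) 0 8"
    and x: "x \<notin> X" "\<And>d. d \<in> set ds \<Longrightarrow> fst d = x"
  shows "dr S t' (insert x X) (insert {y, x} E) (set (u @ ds @ v)) (\<phi> \<circ> \<theta>')"
proof -
  \<comment> \<open>Starting positions: the new darts all begin at the place of the arriving dart,
    so the starting order is only weak.\<close>
  define \<sigma> where "\<sigma> d = (if d \<in> set ds then \<theta> (y, x) else \<theta> d)" for d
  have dist: "distinct (u @ ds @ v)" "distinct (u @ [(y, x)] @ v)" using \<theta> inc_distinct by blast+
  have \<sigma>r: "0 < \<sigma> d" "\<sigma> d < 8" if "d \<in> set (u @ ds @ v)" for d
    using that \<theta>(1) by (auto simp: \<sigma>_def inc_def)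
  have \<sigma>s: "sorted_wrt (\<lambda>d e. \<sigma> d \<le> \<sigma> e) (u @ ds @ v)"
  proof -
    have su: "\<sigma> d = \<theta> d" if "d \<in> set u \<union> set v" for d using that dist by (auto simp: \<sigma>_def)
    have s: "sorted_wrt (\<lambda>d e. \<theta> d \<le> \<theta> e) (u @ [(y, x)] @ v)" using inc_le[OF \<theta>(1)] .
    have "sorted_wrt (\<lambda>d e. \<sigma> d \<le> \<sigma> e) u" "sorted_wrt (\<lambda>d e. \<sigma> d \<le> \<sigma> e) v"
      using s su unfolding sorted_wrt_append by (auto intro: sorted_wrt_mono_rel[rotated])
    moreover have "sorted_wrt (\<lambda>d e. \<sigma> d \<le> \<sigma> e) ds"
      by (rule sorted_wrt_mono_rel[of ds "\<lambda>_ _. True"]) (auto simp: \<sigma>_def intro: sorted_wrt_true)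
    ultimately show ?thesis using s su by (auto simp: sorted_wrt_append \<sigma>_def)
  qed
  have eq: "set (u @ [(y, x)] @ v) = insert (y, x) (set (u @ v))" "set (u @ ds @ v) = set (u @ v) \<union> set ds" by auto
  have nds: "d \<notin> set ds" if "d \<in> set (u @ v)" for d using that dist(1) by auto
  show ?thesis unfolding eq(2)
  proof (rule dr_branch[OF D[unfolded eq(1)] t(2) _ x(1),
        where \<beta> = "\<lambda>d s. \<phi> ((1 - s) * \<sigma> d + s * \<theta>' d)"])
    show "(y, x) \<notin> set (u @ v)" using dist(2) by auto
    show "fst d = x" if "d \<in> set ds" for d using x(2) that .
    show "\<phi> ((1 - 0) * \<sigma> d + 0 * \<theta>' d) = (\<phi> \<circ> \<theta>) d" if "d \<in> set (u @ v)" for d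
      using nds[OF that] by (simp add: \<sigma>_def)
    show "\<phi> ((1 - 0) * \<sigma> d + 0 * \<theta>' d) = (\<phi> \<circ> \<theta>) (y, x)" if "d \<in> set ds" for d
      using that by (simp add: \<sigma>_def)
    fix d assume "d \<in> set (u @ v) \<union> set ds"
    then have d: "d \<in> set (u @ ds @ v)" by auto
    then have r: "0 < \<sigma> d" "\<sigma> d < 8" "0 < \<theta>' d" "\<theta>' d < 8" using \<theta>(2) \<sigma>r by (auto simp: inc_def)
    show "continuous_on {0..1} (\<lambda>s. \<phi> ((1 - s) * \<sigma> d + s * \<theta>' d))" by (rule chart_path[OF c r])
    show "\<phi> ((1 - 1) * \<sigma> d + 1 * \<theta>' d) = (\<phi> \<circ> \<theta>') d" by simp
    fix s :: real
    show "(t + s * (t' - t), \<phi> ((1 - s) * \<sigma> d + s * \<theta>' d)) \<in> S" if s: "s \<in> {0..1}"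
      using c time_in[OF t s] convex_comb_in[OF r s] by (simp add: chart_def)
    fix e assume "e \<in> set (u @ v) \<union> set ds" and de: "d \<noteq> e" and s: "s \<in> {0<..1}"
    then have e: "e \<in> set (u @ ds @ v)" by auto
    then have r': "0 < \<sigma> e" "\<sigma> e < 8" "0 < \<theta>' e" "\<theta>' e < 8" using \<theta>(2) \<sigma>r by (auto simp: inc_def)
    have s': "s \<in> {0..1}" using s by auto
    have "(\<theta>' d < \<theta>' e \<and> \<sigma> d \<le> \<sigma> e) \<or> (\<theta>' e < \<theta>' d \<and> \<sigma> e \<le> \<sigma> d)"
      using inc_cmp[OF \<theta>(2) \<sigma>s d e de] .
    then have "(1 - s) * \<sigma> d + s * \<theta>' d \<noteq> (1 - s) * \<sigma> e + s * \<theta>' e"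
      using comb_less[of "\<sigma> d" "\<sigma> e" "\<theta>' d" "\<theta>' e" s] comb_less[of "\<sigma> e" "\<sigma> d" "\<theta>' e" "\<theta>' d" s] s by auto
    then show "\<phi> ((1 - s) * \<sigma> d + s * \<theta>' d) \<noteq> \<phi> ((1 - s) * \<sigma> e + s * \<theta>' e)"
      using chart_neq[OF c convex_comb_in[OF r s'] convex_comb_in[OF r' s']] by blast
  qed
qed

text \<open>Two strands run from \<open>\<tau>1\<close> and \<open>\<tau>2\<close> to the midpoint
  and meet at time \<open>t'\<close>. Everything stays between \<open>\<tau>1\<close> and
  \<open>\<tau>2\<close>, hence clear of all strands outside this range.\<close>

lemma chart_link_path:
  assumes c: "chart S \<phi> a b" and t: "a < t" "t < t'" "t' < b" and \<tau>: "0 < \<tau>1" "\<tau>1 < \<tau>2" "\<tau>2 < 8"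
  obtains lam where "arc lam" "pathstart lam = (t, \<phi> \<tau>1)" "pathfinish lam = (t, \<phi> \<tau>2)"
    "path_image lam \<subseteq> left_of S t'"
    "\<And>q. q \<in> path_image lam \<Longrightarrow> fst q \<le> t \<Longrightarrow> q = (t, \<phi> \<tau>1) \<or> q = (t, \<phi> \<tau>2)"
    "\<And>q. q \<in> path_image lam \<Longrightarrow> \<exists>\<tau>\<in>{\<tau>1..\<tau>2}. snd q = \<phi> \<tau>"
proof -
  define m where "m = (\<tau>1 + \<tau>2) / 2"
  have m: "\<tau>1 < m" "m < \<tau>2" using \<tau> by (auto simp: m_def)
  let ?b1 = "\<lambda>s. \<phi> ((1 - s) * \<tau>1 + s * m)" and ?b2 = "\<lambda>s. \<phi> ((1 - s) * \<tau>2 + s * m)"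
  let ?s1 = "strand t t' ?b1" and ?s2 = "strand t t' ?b2"
  have in1: "(1 - s) * \<tau>1 + s * m \<in> {\<tau>1..m}" if s: "s \<in> {0..1}" for s
  proof -
    have "s * (m - \<tau>1) \<le> 1 * (m - \<tau>1)" "0 \<le> s * (m - \<tau>1)"
      using s m by (intro mult_right_mono mult_nonneg_nonneg; simp)+
    then show ?thesis by (auto simp: algebra_simps)
  qed
  have in2: "(1 - s) * \<tau>2 + s * m \<in> {m..\<tau>2}" if s: "s \<in> {0..1}" for s
  proof -
    have "s * (\<tau>2 - m) \<le> 1 * (\<tau>2 - m)" "0 \<le> s * (\<tau>2 - m)"
      using s m by (intro mult_right_mono mult_nonneg_nonneg; simp)+
    then show ?thesis by (auto simp: algebra_simps)
  qed
  have a1: "arc ?s1" and a2: "arc ?s2"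
    using \<tau> m by (auto intro!: strand_arc[OF t(2)] chart_path[OF c])
  have im: "fst q \<in> {t..t'} \<and> (\<exists>\<tau>\<in>{\<tau>1..\<tau>2}. snd q = \<phi> \<tau>)" if "q \<in> path_image ?s1 \<union> path_image ?s2" for q
  proof -
    have "fst q \<in> {t..t'}"
      using that strand_fst[OF t(2), of q ?b1] strand_fst[OF t(2), of q ?b2] by auto
    moreover have "\<exists>\<tau>\<in>{\<tau>1..\<tau>2}. snd q = \<phi> \<tau>"
    proof -
      have "\<exists>s\<in>{0..1}. snd r = b s" if "r \<in> path_image (strand t t' b)" for r b
        using that by (auto simp: strand_image)
      from that this[of q ?b1] this[of q ?b2]
      have "(\<exists>s\<in>{0..1}. snd q = ?b1 s) \<or> (\<exists>s\<in>{0..1}. snd q = ?b2 s)" by blast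
      then obtain s where s: "s \<in> {0..1}" "snd q = ?b1 s \<or> snd q = ?b2 s" by blast
      have "(1 - s) * \<tau>1 + s * m \<in> {\<tau>1..\<tau>2}" "(1 - s) * \<tau>2 + s * m \<in> {\<tau>1..\<tau>2}"
        using in1[OF s(1)] in2[OF s(1)] m by auto
      then show ?thesis using s(2) by blast
    qed
    ultimately show ?thesis by blast
  qed
  have cap: "path_image ?s1 \<inter> path_image ?s2 \<subseteq> {(t', \<phi> m)}"
  proof
    fix q assume q: "q \<in> path_image ?s1 \<inter> path_image ?s2"
    then obtain s where s: "s \<in> {0..1}" "q = (t + s * (t' - t), ?b1 s)" "?b1 s = ?b2 s"
      using strand_meet[OF t(2), of q ?b1 ?b2] by blast
    have "(1 - s) * \<tau>1 + s * m = (1 - s) * \<tau>2 + s * m"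
      using chart_neq[OF c _ _ _ _, of "(1 - s) * \<tau>1 + s * m" "(1 - s) * \<tau>2 + s * m"] s in1[OF s(1)] in2[OF s(1)] \<tau> m
      by auto
    then have "s = 1" using \<tau> by simp
    then show "q \<in> {(t', \<phi> m)}" using s by simp
  qed
  let ?lam = "?s1 +++ reversepath ?s2"
  have pi: "path_image ?lam = path_image ?s1 \<union> path_image ?s2"
    by (subst path_image_join) auto
  show ?thesis
  proof (rule that[of ?lam])
    show "arc ?lam" using a1 arc_reversepath[OF a2] cap by (intro arc_join) auto
    show "pathstart ?lam = (t, \<phi> \<tau>1)" "pathfinish ?lam = (t, \<phi> \<tau>2)" by auto
    show "path_image ?lam \<subseteq> left_of S t'"
    proof
      fix q assume "q \<in> path_image ?lam"
      then obtain \<sigma> where q: "fst q \<in> {t..t'}" "\<sigma> \<in> {\<tau>1..\<tau>2}" "snd q = \<phi> \<sigma>" using im pi by blast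
      then have "fst q \<in> {a<..<b}" "\<sigma> \<in> {0<..<8}" using t \<tau> by auto
      then have "(fst q, \<phi> \<sigma>) \<in> S" using c by (simp add: chart_def)
      then have "q \<in> S" using q(3) by (metis prod.collapse)
      then show "q \<in> left_of S t'" using q(1) by (simp add: left_of_def)
    qed
    show "\<exists>\<tau>\<in>{\<tau>1..\<tau>2}. snd q = \<phi> \<tau>" if "q \<in> path_image ?lam" for q using im that pi by blast
    show "q = (t, \<phi> \<tau>1) \<or> q = (t, \<phi> \<tau>2)" if "q \<in> path_image ?lam" "fst q \<le> t" for q
      using that strand_left[OF t(2), of q ?b1] strand_left[OF t(2), of q ?b2] unfolding pi by auto
  qed
qed

lemma chart_link:
  assumes c: "chart S \<phi> a b" and t: "a < t" "t < t'" "t' < b"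
    and D: "dr S t X E (set (u @ [d1, d2] @ v)) (\<phi> \<circ> \<theta>)"
    and \<theta>: "inc \<theta> (u @ [d1, d2] @ v) 0 8"
    and ne: "fst d1 \<noteq> fst d2" "{fst d1, fst d2} \<notin> E"
  shows "dr S t' X (insert {fst d1, fst d2} E) (set (u @ v)) (\<phi> \<circ> \<theta>)"
proof -
  have dist: "distinct (u @ [d1, d2] @ v)" using \<theta> inc_distinct by blast
  have eq: "set (u @ [d1, d2] @ v) = insert d1 (insert d2 (set (u @ v)))" by auto
  have r: "0 < \<theta> d" "\<theta> d < 8" if "d \<in> set (u @ [d1, d2] @ v)" for d using \<theta> that by (auto simp: inc_def)
  have 12: "\<theta> d1 < \<theta> d2" and out: "d \<in> set (u @ v) \<Longrightarrow> \<theta> d \<notin> {\<theta> d1..\<theta> d2}" for d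
    using \<theta> by (auto simp: inc_def sorted_wrt_append)
  obtain lam where lam: "arc lam" "pathstart lam = (t, \<phi> (\<theta> d1))" "pathfinish lam = (t, \<phi> (\<theta> d2))"
    "path_image lam \<subseteq> left_of S t'"
    "\<And>q. q \<in> path_image lam \<Longrightarrow> fst q \<le> t \<Longrightarrow> q = (t, \<phi> (\<theta> d1)) \<or> q = (t, \<phi> (\<theta> d2))"
    "\<And>q. q \<in> path_image lam \<Longrightarrow> \<exists>\<tau>\<in>{\<theta> d1..\<theta> d2}. snd q = \<phi> \<tau>"
    using chart_link_path[OF c t _ 12] r[of d1] r[of d2] by auto
  show ?thesis
  proof (rule dr_link[OF D[unfolded eq] t(2) _ _ _ ne, where lam = lam])
    show "d1 \<noteq> d2" "d1 \<notin> set (u @ v)" "d2 \<notin> set (u @ v)" using dist by auto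
    fix d x assume d: "d \<in> set (u @ v)" and x: "x \<in> {t..t'}"
    then have rd: "0 < \<theta> d" "\<theta> d < 8" using r[of d] by auto
    have "(x, \<phi> (\<theta> d)) \<notin> path_image lam"
    proof
      assume "(x, \<phi> (\<theta> d)) \<in> path_image lam"
      then obtain \<tau> where \<tau>: "\<tau> \<in> {\<theta> d1..\<theta> d2}" "\<phi> (\<theta> d) = \<phi> \<tau>" using lam(6) by fastforce
      then have "0 < \<tau>" "\<tau> < 8" "\<tau> \<noteq> \<theta> d" using r[of d1] r[of d2] out[OF d] by auto
      then show False using chart_neq[OF c rd] \<tau>(2) by metis
    qed
    moreover have "(x, \<phi> (\<theta> d)) \<in> S" using c x t rd by (auto simp: chart_def)
    ultimately show "(x, (\<phi> \<circ> \<theta>) d) \<in> S - path_image lam" by simp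
  qed (use lam in auto)
qed

section \<open>Sweeping a graph through a chart\<close>

definition drawn :: "'v graph \<Rightarrow> 'v set \<Rightarrow> ('v \<times> 'v) list \<Rightarrow> 'v set set" where
  "drawn G X w = {e \<in> edges G. e \<subseteq> X \<and> (\<forall>d\<in>set w. e \<noteq> {fst d, snd d})}"

text \<open>The front carries the current word. An edge with both ends in \<open>X\<close> counts as
  drawn only when neither of its darts is in the word; until then it consists of open
  strands.\<close>

definition swept :: "(real \<times> 'b::t2_space) set \<Rightarrow> (real \<Rightarrow> 'b) \<Rightarrow> real \<Rightarrow> real \<Rightarrow> 'v graph \<Rightarrow> 'v set \<Rightarrow>
    ('v \<times> 'v) list \<Rightarrow> bool" where
  "swept S \<phi> a b G X w \<longleftrightarrow> (\<exists>t \<theta>. a < t \<and> t < b \<and> inc \<theta> w 0 8 \<and>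
     dr S t X (drawn G X w) (set w) (\<phi> \<circ> \<theta>))"

lemma swept_init:
  assumes G: "simple_graph G" "rot_of G \<rho>" and c: "chart S \<phi> a b" and r: "r \<in> verts G"
  shows "swept S \<phi> a b G {r} (\<rho> r)"
proof -
  have dist: "distinct (\<rho> r)" and fst_r: "\<And>d. d \<in> set (\<rho> r) \<Longrightarrow> fst d = r"
    using G(2) r by (auto simp: rot_of_def)
  obtain \<theta> :: "'a \<times> 'a \<Rightarrow> real" where \<theta>: "inc \<theta> (\<rho> r) 0 8" using inc_exists[OF dist, of 0 8] by auto
  have ab: "a < b" using c by (simp add: chart_def)
  define t where "t = (2 * a + b) / 3"
  define t' where "t' = (a + 2 * b) / 3"
  have t: "a < t" "t < t'" "t' < b" using ab by (auto simp: t_def t'_def)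
  have "e \<notin> edges G" if "e \<subseteq> {r}" for e
    using G(1) that by (auto simp: simple_graph_def subset_singleton_iff)
  then have E: "drawn G {r} (\<rho> r) = {}" by (auto simp: drawn_def)
  have "dr S t' {r} {} (set (\<rho> r)) (\<phi> \<circ> \<theta>)"
  proof (rule dr_start[OF t(2), where q = "\<phi> 4" and \<beta> = "\<lambda>d s. \<phi> ((1 - s) * 4 + s * \<theta> d)"])
    show "(t, \<phi> 4) \<in> S" using c t by (simp add: chart_def)
    show "\<And>d. d \<in> set (\<rho> r) \<Longrightarrow> fst d = r" by (rule fst_r)
    fix d assume d: "d \<in> set (\<rho> r)"
    then have rd: "(0 :: real) < 4" "(4 :: real) < 8" "0 < \<theta> d" "\<theta> d < 8" using \<theta> by (auto simp: inc_def)
    show "continuous_on {0..1} (\<lambda>s. \<phi> ((1 - s) * 4 + s * \<theta> d))" by (rule chart_path[OF c rd])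
    show "\<phi> ((1 - 0) * 4 + 0 * \<theta> d) = \<phi> 4" "\<phi> ((1 - 1) * 4 + 1 * \<theta> d) = (\<phi> \<circ> \<theta>) d" by simp_all
    fix s :: real
    show "(t + s * (t' - t), \<phi> ((1 - s) * 4 + s * \<theta> d)) \<in> S" if s: "s \<in> {0..1}"
      using c time_in[OF t s] convex_comb_in[OF rd s] by (simp add: chart_def)
    fix e assume e: "e \<in> set (\<rho> r)" "d \<noteq> e" and s: "s \<in> {0<..1}"
    then have re: "(0 :: real) < 4" "(4 :: real) < 8" "0 < \<theta> e" "\<theta> e < 8" using \<theta> by (auto simp: inc_def)
    have s': "s \<in> {0..1}" using s by auto
    have "\<theta> d < \<theta> e \<or> \<theta> e < \<theta> d" using inc_cmp[OF \<theta> inc_le[OF \<theta>] d e] by auto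
    then have "(1 - s) * 4 + s * \<theta> d \<noteq> (1 - s) * 4 + s * \<theta> e" using s by auto
    then show "\<phi> ((1 - s) * 4 + s * \<theta> d) \<noteq> \<phi> ((1 - s) * 4 + s * \<theta> e)"
      using chart_neq[OF c convex_comb_in[OF rd s'] convex_comb_in[OF re s']] by blast
  qed
  then show ?thesis unfolding swept_def E using t \<theta> by (intro exI[of _ t'] exI[of _ \<theta>]) auto
qed

text \<open>A step of \<open>grows\<close> is what the front does at a vertex: the strand
  \<open>d\<close> reaches \<open>b'\<close> and is replaced by the other darts of \<open>b'\<close>
  in rotation order. Contraction and drawing thus proceed together.\<close>

lemma swept_grows:
  assumes G: "simple_graph G" "rot_of G \<rho>" and c: "chart S \<phi> a b"
  shows "grows prod.swap \<rho> W w \<Longrightarrow> W \<subseteq> verts G \<Longrightarrow> swept S \<phi> a b G W w"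
proof (induction rule: grows.induct)
  case (grows_init r)
  then show ?case using swept_init[OF G c] by simp
next
  case (grows_step W u d v b' xs ys)
  note rot = rot_of_rotation[OF G]
  let ?w = "u @ [d] @ v" and ?w' = "u @ ys @ xs @ v"
  have W: "W \<subseteq> verts G" "b' \<in> verts G" using grows_step.prems by auto
  note pr = grows_props[OF rot(1) grows_step(1) W(1)]
  have "grows prod.swap \<rho> (insert b' W) ?w'" using grows_step(1-3) by (rule grows.grows_step)
  note pr' = grows_props[OF rot(1) this grows_step.prems]
  have \<rho>: "distinct (\<rho> b')" "set (\<rho> b') = {d \<in> adj G. fst d = b'}" using G(2) W by (auto simp: rot_of_def)
  obtain y x where d: "d = (y, x)" by (cases d)
  have "prod.swap d \<in> set (\<rho> b')" using grows_step(3) by simp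
  then have x: "x = b'" "(y, x) \<in> adj G" using \<rho>(2) d adjD(4)[OF G(1)] by auto
  have dW: "darts \<rho> W = {d \<in> adj G. fst d \<in> W}" using G(2) W by (auto simp: darts_def rot_of_def)
  have y: "y \<in> W" "y \<noteq> x" using pr d dW adjD(3)[OF G(1) x(2)] by auto
  have wW: "fst d' \<in> W" "d' \<in> adj G" if "d' \<in> set ?w" for d' using pr that dW by auto
  have xy: "fst d' = x" "d' \<in> adj G" if "d' \<in> set (xs @ ys)" for d' using \<rho>(2) grows_step(3) that x by auto
  \<comment> \<open>Exactly one edge becomes drawn: an edge from \<open>x\<close> into
    \<open>W\<close> other than \<open>{y, x}\<close> still has a dart in the word.\<close>
  have E: "drawn G (insert x W) ?w' = insert {y, x} (drawn G W ?w)"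
  proof (intro set_eqI iffI)
    fix e assume e: "e \<in> drawn G (insert x W) ?w'"
    then have eG: "e \<in> edges G" "e \<subseteq> insert x W" and no: "\<And>d'. d' \<in> set ?w' \<Longrightarrow> e \<noteq> {fst d', snd d'}"
      by (auto simp: drawn_def)
    show "e \<in> insert {y, x} (drawn G W ?w)"
    proof (cases "x \<in> e")
      case True
      then obtain z where z: "e = {x, z}" "z \<noteq> x" using simple_edge[OF G(1) eG(1)] by (metis doubleton_eq_iff insertE singletonD)
      then have "(x, z) \<in> set (\<rho> b')" using \<rho>(2) eG x by (auto simp: adj_def)
      moreover have "(x, z) \<notin> set xs \<union> set ys" using no[of "(x, z)"] z by auto
      ultimately have "(x, z) = prod.swap d" using grows_step(3) by auto
      then show ?thesis using z d by auto
    next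
      case False
      then have "e \<subseteq> W" using eG by auto
      moreover have "e \<noteq> {fst d', snd d'}" if "d' \<in> set ?w" for d'
      proof (cases "d' = d")
        case True
        then show ?thesis using False d by auto
      next
        case False
        then show ?thesis using no[of d'] that by auto
      qed
      ultimately show ?thesis using eG by (auto simp: drawn_def)
    qed
  next
    fix e assume "e \<in> insert {y, x} (drawn G W ?w)"
    then show "e \<in> drawn G (insert x W) ?w'"
    proof
      assume e: "e = {y, x}"
      have "{y, x} \<noteq> {fst d', snd d'}" if d': "d' \<in> set ?w'" for d'
      proof
        assume "{y, x} = {fst d', snd d'}"
        then have "d' = (y, x) \<or> d' = (x, y)" by (cases d') (auto simp: doubleton_eq_iff)
        then show False
        proof
          assume "d' = (y, x)"
          then have "d' \<notin> set (xs @ ys)" using xy(1) y by force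
          then show False using d' pr d \<open>d' = (y, x)\<close> by auto
        next
          assume *: "d' = (x, y)"
          then have "d' \<in> set (xs @ ys)" using d' wW(1)[of d'] grows_step(2) x(1) by auto
          then show False using \<rho>(1) grows_step(3) d * by auto
        qed
      qed
      then show ?thesis using e x y by (auto simp: drawn_def adj_def)
    next
      assume e: "e \<in> drawn G W ?w"
      then have "x \<notin> e" using grows_step(2) x by (auto simp: drawn_def)
      then have "e \<noteq> {fst d', snd d'}" if "d' \<in> set (xs @ ys)" for d' using xy(1)[OF that] by auto
      then show ?thesis using e by (auto simp: drawn_def)
    qed
  qed
  obtain t \<theta> where t: "a < t" "t < b" and \<theta>: "inc \<theta> ?w 0 8" and D: "dr S t W (drawn G W ?w) (set ?w) (\<phi> \<circ> \<theta>)"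
    using grows_step.IH[OF W(1)] by (auto simp: swept_def)
  have "distinct ?w'" using pr' by blast
  then obtain \<theta>' where \<theta>': "inc \<theta>' (u @ (ys @ xs) @ v) 0 8" using inc_exists[of "u @ (ys @ xs) @ v" 0 8] by auto
  define t' where "t' = (t + b) / 2"
  have t': "t < t'" "t' < b" using t by (auto simp: t'_def)
  have "dr S t' (insert x W) (insert {y, x} (drawn G W ?w)) (set (u @ (ys @ xs) @ v)) (\<phi> \<circ> \<theta>')"
  proof (rule chart_branch[OF c t(1) t' _ _ \<theta>'])
    show "dr S t W (drawn G W ?w) (set (u @ [(y, x)] @ v)) (\<phi> \<circ> \<theta>)" using D d by simp
    show "inc \<theta> (u @ [(y, x)] @ v) 0 8" using \<theta> d by simp
    show "x \<notin> W" using grows_step(2) x by simp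
    show "fst d' = x" if "d' \<in> set (ys @ xs)" for d' using xy(1)[of d'] that by auto
  qed
  then have "dr S t' (insert x W) (drawn G (insert x W) ?w') (set ?w') (\<phi> \<circ> \<theta>')" unfolding E by simp
  then show ?case using t t' \<theta>' x unfolding swept_def by (intro exI[of _ t'] exI[of _ \<theta>']) simp
qed

lemma drawn_remove:
  assumes G: "simple_graph G" and w: "set w = insert x (insert (prod.swap x) (set w'))" "set w \<subseteq> adj G"
    and n: "x \<notin> set w'" "prod.swap x \<notin> set w'"
  shows "drawn G (verts G) w' = insert {fst x, fst (prod.swap x)} (drawn G (verts G) w)"
    "{fst x, fst (prod.swap x)} \<notin> drawn G (verts G) w" "fst x \<noteq> fst (prod.swap x)"
proof -
  obtain a b where x: "x = (a, b)" by (cases x)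
  have ab: "(a, b) \<in> adj G" using w x by auto
  have sub: "e \<subseteq> verts G" if "e \<in> edges G" for e using G that by (auto simp: simple_graph_def)
  have no: "{a, b} \<noteq> {fst d, snd d}" if "d \<in> set w'" for d
  proof
    assume "{a, b} = {fst d, snd d}"
    then have "d = x \<or> d = prod.swap x" using x by (cases d) (auto simp: doubleton_eq_iff)
    then show False using that n by auto
  qed
  show "fst x \<noteq> fst (prod.swap x)" using adjD(3)[OF G ab] x by simp
  show "{fst x, fst (prod.swap x)} \<notin> drawn G (verts G) w" using w x by (auto simp: drawn_def)
  have "{a, b} \<in> edges G" using ab by (simp add: adj_def)
  moreover have "a \<in> verts G" "b \<in> verts G" using adjD(1,2)[OF G ab] by auto
  ultimately show "drawn G (verts G) w' = insert {fst x, fst (prod.swap x)} (drawn G (verts G) w)"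
    using no w(1) x sub by (auto simp: drawn_def insert_commute)
qed

lemma swept_cancel:
  assumes G: "simple_graph G" and c: "chart S \<phi> a b"
    and w: "distinct (u @ [x, prod.swap x] @ v)" "set (u @ [x, prod.swap x] @ v) \<subseteq> adj G"
    and s: "swept S \<phi> a b G (verts G) (u @ [x, prod.swap x] @ v)"
  shows "swept S \<phi> a b G (verts G) (u @ v)"
proof -
  let ?w = "u @ [x, prod.swap x] @ v"
  obtain t \<theta> where t: "a < t" "t < b" and \<theta>: "inc \<theta> ?w 0 8"
    and D: "dr S t (verts G) (drawn G (verts G) ?w) (set ?w) (\<phi> \<circ> \<theta>)"
    using s by (auto simp: swept_def)
  have set: "set ?w = insert x (insert (prod.swap x) (set (u @ v)))" by auto
  have n: "x \<notin> set (u @ v)" "prod.swap x \<notin> set (u @ v)" using w(1) by auto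
  note r = drawn_remove[OF G set w(2) n]
  define t' where "t' = (t + b) / 2"
  have t': "t < t'" "t' < b" using t by (auto simp: t'_def)
  have "dr S t' (verts G) (drawn G (verts G) (u @ v)) (set (u @ v)) (\<phi> \<circ> \<theta>)"
    unfolding r(1) by (rule chart_link[OF c t(1) t' D \<theta> r(3) r(2)])
  moreover have "inc \<theta> (u @ v) 0 8" using \<theta> by (auto simp: inc_def sorted_wrt_append)
  ultimately show ?thesis unfolding swept_def using t t' by (intro exI[of _ t'] exI[of _ \<theta>]) auto
qed

lemma swept_embeds:
  assumes G: "simple_graph G" and s: "swept S \<phi> a b G (verts G) []"
  shows "embeds_in G S"
proof -
  have "drawn G (verts G) [] = edges G" using G by (auto simp: drawn_def simple_graph_def)
  then have "\<exists>t pos. dr S t (verts G) (edges G) {} pos" using s by (auto simp: swept_def)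
  then show ?thesis using dr_embeds by fastforce
qed

lemma chart_plane: "chart (UNIV :: (real \<times> real) set) (\<lambda>x. x) 0 1"
  by (auto simp: chart_def continuous_on_id)

lemma red_planar:
  assumes G: "simple_graph G"
  shows "red prod.swap s w \<Longrightarrow> s = 0 \<Longrightarrow> distinct w \<Longrightarrow> set w \<subseteq> adj G \<Longrightarrow>
    swept UNIV (\<lambda>x :: real. x) 0 1 G (verts G) w \<Longrightarrow> planar G"
proof (induction rule: red.induct)
  case (red_nil g)
  then show ?case using swept_embeds[OF G] by (simp add: planar_def)
next
  case (red_cancel g u v x)
  then show ?case using swept_cancel[OF G chart_plane red_cancel.prems(2-4)] by auto
qed simp

text \<open>Without handles only cancellations occur, and a strip of the plane is chart enough for
  them.\<close>

lemma word_planar: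
  assumes G: "simple_graph G" and w: "rot_of G \<rho>" "grows prod.swap \<rho> (verts G) w" "red prod.swap 0 w"
  shows "planar G"
proof -
  note pr = grows_props[OF rot_of_rotation(1)[OF G w(1)] w(2) subset_refl]
  then show ?thesis
    using red_planar[OF G w(3)] swept_grows[OF G w(1) chart_plane w(2)] rot_of_rotation(2)[OF G w(1)] by auto
qed

section \<open>Cross sections of the bored block\<close>

lemma surfaceI:
  assumes B: "(x, y, z) \<in> bored_block g"
    and z: "z = 0 \<or> z = 1 \<or> y = 0 \<or> y = 3 \<or>
      (\<exists>i<g. x \<in> {2 * real i + 1<..<2 * real i + 2} \<and> (y = 1 \<or> y = 2))"
  shows "(x, y, z) \<in> orientable_surface g"
proof -
  have "(x, y, z) \<notin> interior (bored_block g)"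
  proof
    assume "(x, y, z) \<in> interior (bored_block g)"
    then obtain e where e: "0 < e" "ball (x, y, z) e \<subseteq> bored_block g" by (auto simp: mem_interior)
    \<comment> \<open>Capped at \<open>1/2\<close> so that stepping off a tunnel wall at
      \<open>y = 1\<close> or \<open>y = 2\<close> lands inside the tunnel and not beyond its far
      wall.\<close>
    define d where "d = min (e / 2) (1 / 2)"
    have d: "0 < d" "d < e" "d < 1" using e by (auto simp: d_def)
    have zin: "(x, y, z') \<in> bored_block g" if "\<bar>z - z'\<bar> < e" for z'
      using that e(2) by (auto simp: dist_Pair_Pair dist_real_def)
    have yin: "(x, y', z) \<in> bored_block g" if "\<bar>y - y'\<bar> < e" for y'
      using that e(2) by (auto simp: dist_Pair_Pair dist_real_def)
    from z consider "z = 0" | "z = 1" | "y = 0" | "y = 3"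
      | i where "i < g" "x \<in> {2 * real i + 1<..<2 * real i + 2}" "y = 1 \<or> y = 2" by blast
    then show False
    proof cases
      case 1
      then show False using zin[of "- d"] d by (auto simp: bored_block_def)
    next
      case 2
      then show False using zin[of "1 + d"] d by (auto simp: bored_block_def)
    next
      case 3
      then show False using yin[of "- d"] d by (auto simp: bored_block_def)
    next
      case 4
      then show False using yin[of "3 + d"] d by (auto simp: bored_block_def)
    next
      case 5
      then have "(x, 1 + d, z) \<in> bored_block g \<or> (x, 2 - d, z) \<in> bored_block g"
        using yin[of "1 + d"] yin[of "2 - d"] d by auto
      then show False using 5 d by (auto simp: bored_block_def)
    qed
  qed
  then show ?thesis
    using B closure_subset[of "bored_block g"] by (auto simp: orientable_surface_def frontier_def)
qed

definition cu :: "real \<Rightarrow> real" where "cu \<tau> = max (- 1) (min 1 (2 - \<bar>\<tau> - 4\<bar>))"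
text \<open>The term in the absolute value takes the point up the left side, along the top and down
  the right side; \<open>\<tau> - 8\<close> takes over in the last unit and brings it back to the
  middle of the left side.\<close>

definition cv :: "real \<Rightarrow> real" where "cv \<tau> = max (- 1) (min 1 (max (2 - \<bar>\<tau> - 2\<bar>) (\<tau> - 8)))"

text \<open>For \<open>\<tau>\<close> between 0 and 8 the point \<open>(cu \<tau>, cv \<tau>)\<close> runs once around the square of side 2, starting
  in the middle of its left side. The boundary of \<open>[l, l + W] \<times> [0, 1]\<close> is traversed by \<open>rim l W\<close>
  from the middle of its left side, and by \<open>mir l W\<close> from the middle of its right side.\<close>

definition rim :: "real \<Rightarrow> real \<Rightarrow> real \<Rightarrow> real \<times> real" where
  "rim l W \<tau> = (l + W * (1 + cu \<tau>) / 2, (1 + cv \<tau>) / 2)"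
definition mir :: "real \<Rightarrow> real \<Rightarrow> real \<Rightarrow> real \<times> real" where
  "mir l W \<tau> = (l + W * (1 - cu \<tau>) / 2, (1 - cv \<tau>) / 2)"

lemma cu_cv_bounds: "- 1 \<le> cu \<tau>" "cu \<tau> \<le> 1" "- 1 \<le> cv \<tau>" "cv \<tau> \<le> 1"
  by (auto simp: cu_def cv_def)

lemma cu_cv_boundary: "cu \<tau> = 1 \<or> cu \<tau> = - 1 \<or> cv \<tau> = 1 \<or> cv \<tau> = - 1"
  unfolding cu_def cv_def max_def min_def abs_if by (smt (verit))

lemma cu_cv_top: "1 \<le> \<tau> \<Longrightarrow> \<tau> \<le> 3 \<Longrightarrow> cu \<tau> = \<tau> - 2 \<and> cv \<tau> = 1"
  unfolding cu_def cv_def max_def min_def abs_if by (smt (verit))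

lemma cu_cv_bottom: "5 \<le> \<tau> \<Longrightarrow> \<tau> \<le> 7 \<Longrightarrow> cu \<tau> = 6 - \<tau> \<and> cv \<tau> = - 1"
  unfolding cu_def cv_def max_def min_def abs_if by (smt (verit))

lemma cu_cv_inj:
  assumes "0 < \<tau>" "\<tau> < 8" "0 < \<sigma>" "\<sigma> < 8" "cu \<tau> = cu \<sigma>" "cv \<tau> = cv \<sigma>" shows "\<tau> = \<sigma>"
  using assms unfolding cu_def cv_def max_def min_def abs_if by (smt (verit))

lemma cu_cv_continuous: "continuous_on A cu" "continuous_on A cv"
  unfolding cu_def cv_def by (intro continuous_intros)+

lemma rim_chart:
  assumes "a < b" "W > 0" "\<And>x y z. a < x \<Longrightarrow> x < b \<Longrightarrow> l \<le> y \<Longrightarrow> y \<le> l + W \<Longrightarrow> 0 \<le> z \<Longrightarrow> z \<le> 1 \<Longrightarrow>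
    y = l \<or> y = l + W \<or> z = 0 \<or> z = 1 \<Longrightarrow> (x, y, z) \<in> S"
  shows "chart S (rim l W) a b" "chart S (mir l W) a b"
proof -
  have y: "l \<le> l + W * k / 2" "l + W * k / 2 \<le> l + W" if "0 \<le> k" "k \<le> 2" for k
    using that assms(2) mult_left_mono[of k 2 W] by auto
  have mem: "(x, l + W * p / 2, q / 2) \<in> S"
    if "a < x" "x < b" "0 \<le> p" "p \<le> 2" "0 \<le> q" "q \<le> 2" "p = 0 \<or> p = 2 \<or> q = 0 \<or> q = 2" for x p q
    using that y[of p] by (intro assms(3)) auto
  have b: "0 \<le> 1 + cu \<tau>" "1 + cu \<tau> \<le> 2" "0 \<le> 1 + cv \<tau>" "1 + cv \<tau> \<le> 2"
    "0 \<le> 1 - cu \<tau>" "1 - cu \<tau> \<le> 2" "0 \<le> 1 - cv \<tau>" "1 - cv \<tau> \<le> 2" for \<tau>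
    using cu_cv_bounds[of \<tau>] by auto
  have "continuous_on {0<..<8} (rim l W)" "continuous_on {0<..<8} (mir l W)"
    unfolding rim_def mir_def by (intro continuous_intros cu_cv_continuous; simp)+
  moreover have "inj_on (rim l W) {0<..<8}" "inj_on (mir l W) {0<..<8}"
    using assms(2) cu_cv_inj by (auto simp: inj_on_def rim_def mir_def)
  moreover have "(x, rim l W \<tau>) \<in> S" "(x, mir l W \<tau>) \<in> S" if "a < x" "x < b" for x \<tau>
  proof -
    have "1 + cu \<tau> = 0 \<or> 1 + cu \<tau> = 2 \<or> 1 + cv \<tau> = 0 \<or> 1 + cv \<tau> = 2"
      "1 - cu \<tau> = 0 \<or> 1 - cu \<tau> = 2 \<or> 1 - cv \<tau> = 0 \<or> 1 - cv \<tau> = 2"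
      using cu_cv_boundary[of \<tau>] by auto
    then show "(x, rim l W \<tau>) \<in> S" "(x, mir l W \<tau>) \<in> S"
      unfolding rim_def mir_def using that b[of \<tau>] by (auto intro!: mem)
  qed
  ultimately show "chart S (rim l W) a b" "chart S (mir l W) a b"
    using assms(1) by (auto simp: chart_def)
qed

lemma no_tunnel:
  assumes "i < g" "x \<in> {2 * real i + 1<..<2 * real i + 2}" "2 * real j < x" "x < 2 * real j + 1" shows False
proof -
  have "real i < real j" "real j < real i + 1" using assms by auto
  then have "Suc i \<le> j" by simp
  then have "real (Suc i) \<le> real j" by (simp only: of_nat_le_iff)
  then show False using \<open>real j < real i + 1\<close> by simp
qed

lemma tube_chart:
  assumes "j \<le> g" shows "chart (orientable_surface g) (rim 0 3) (2 * real j) (2 * real j + 1)"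
proof (rule rim_chart(1))
  fix x y z :: real
  assume x: "2 * real j < x" "x < 2 * real j + 1" and y: "0 \<le> y" "y \<le> 0 + 3" and z: "0 \<le> z" "z \<le> 1"
    and b: "y = 0 \<or> y = 0 + 3 \<or> z = 0 \<or> z = 1"
  have "real j \<le> real g" using assms by simp
  then have "x \<le> 2 * real g + 1" using x by linarith
  then have "(x, y, z) \<in> bored_block g"
    using x y z no_tunnel[OF _ _ x] by (auto simp: bored_block_def)
  then show "(x, y, z) \<in> orientable_surface g" using b by (intro surfaceI) auto
qed auto

text \<open>Beside a tunnel each of the two arms is a tube of its own. \<open>rim\<close> serves for
  \<open>l = 0\<close> and \<open>mir\<close> for \<open>l = 2\<close>, so that the omitted point
  lies on the outer wall in both cases.\<close>

lemma arm_chart: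
  assumes "j < g" and W: "l = 0 \<or> l = 2"
  shows "chart (orientable_surface g) (rim l 1) (2 * real j + 1) (2 * real j + 2)"
    "chart (orientable_surface g) (mir l 1) (2 * real j + 1) (2 * real j + 2)"
proof -
  have *: "(x, y, z) \<in> orientable_surface g" if x: "2 * real j + 1 < x" "x < 2 * real j + 2"
    and y: "l \<le> y" "y \<le> l + 1" and z: "0 \<le> z" "z \<le> 1" and b: "y = l \<or> y = l + 1 \<or> z = 0 \<or> z = 1" for x y z
  proof (rule surfaceI)
    have "real j + 1 \<le> real g" using assms(1) by linarith
    then have "x \<le> 2 * real g + 1" using x by linarith
    moreover have "0 \<le> x" using x by linarith
    ultimately show "(x, y, z) \<in> bored_block g" using W y z by (auto simp: bored_block_def)
    show "z = 0 \<or> z = 1 \<or> y = 0 \<or> y = 3 \<or>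
      (\<exists>i<g. x \<in> {2 * real i + 1<..<2 * real i + 2} \<and> (y = 1 \<or> y = 2))"
      using b W x assms(1) by auto
  qed
  show "chart (orientable_surface g) (rim l 1) (2 * real j + 1) (2 * real j + 2)"
    "chart (orientable_surface g) (mir l 1) (2 * real j + 1) (2 * real j + 2)"
    by (rule rim_chart; use * in auto)+
qed

text \<open>Where a tunnel begins or ends no chart reaches across. Lines on the top or bottom face
  that pass beside the tunnels do, and the strands are moved onto such lines before each
  transition.\<close>

lemma safe_surface:
  assumes "0 \<le> x" "x \<le> 2 * real g + 1" "z = 0 \<or> z = 1" "0 \<le> y" "y \<le> 3" "y < 1 \<or> 2 < y"
  shows "(x, y, z) \<in> orientable_surface g"
  using assms by (intro surfaceI) (auto simp: bored_block_def)

lemma dr_cong: "dr S t X E W pos \<Longrightarrow> (\<And>d. d \<in> W \<Longrightarrow> pos' d = pos d) \<Longrightarrow> dr S t X E W pos'"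
  unfolding dr_def by simp

lemma dr_straight:
  assumes D: "dr S t X E W pos" and t: "t < t'" and S: "\<And>d x. d \<in> W \<Longrightarrow> x \<in> {t..t'} \<Longrightarrow> (x, pos d) \<in> S"
  shows "dr S t' X E W pos"
proof (rule dr_advance[OF D t, where \<beta> = "\<lambda>d s. pos d"])
  fix d s assume "d \<in> W" and s: "s \<in> {0..1 :: real}"
  moreover have "s * (t' - t) \<le> 1 * (t' - t)" "0 \<le> s * (t' - t)"
    using s t by (intro mult_right_mono mult_nonneg_nonneg; simp)+
  then have "t + s * (t' - t) \<in> {t..t'}" by simp
  ultimately show "(t + s * (t' - t), pos d) \<in> S" using S by blast
next
  fix d e assume "d \<in> W" "e \<in> W" "d \<noteq> e"
  then show "pos d \<noteq> pos e" using pos_inj[OF D] by blast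
qed auto

lemma inc_four:
  assumes d: "distinct (A @ B @ C @ D)" and "a1 < b1" "a2 < b2" "a3 < b3" "a4 < b4"
  shows "\<exists>\<theta>. inc \<theta> A a1 b1 \<and> inc \<theta> B a2 b2 \<and> inc \<theta> C a3 b3 \<and> inc \<theta> D a4 (b4 :: real)"
proof -
  obtain f1 where f1: "inc f1 A a1 b1" using inc_exists[of A a1 b1] d assms(2) by auto
  obtain f2 where f2: "inc f2 B a2 b2" using inc_exists[of B a2 b2] d assms(3) by auto
  obtain f3 where f3: "inc f3 C a3 b3" using inc_exists[of C a3 b3] d assms(4) by auto
  obtain f4 where f4: "inc f4 D a4 b4" using inc_exists[of D a4 b4] d assms(5) by auto
  let ?f = "\<lambda>d. if d \<in> set A then f1 d else if d \<in> set B then f2 d else if d \<in> set C then f3 d else f4 d"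
  have "inc ?f A a1 b1" by (rule inc_cong[OF f1]) auto
  moreover have "inc ?f B a2 b2" by (rule inc_cong[OF f2]) (use d in auto)
  moreover have "inc ?f C a3 b3" by (rule inc_cong[OF f3]) (use d in auto)
  moreover have "inc ?f D a4 b4" by (rule inc_cong[OF f4]) (use d in auto)
  ultimately show ?thesis by blast
qed

section \<open>Handles\<close>

lemma rim_top: "1 \<le> \<tau> \<Longrightarrow> \<tau> \<le> 3 \<Longrightarrow> rim l W \<tau> = (l + W * (\<tau> - 1) / 2, 1)"
  using cu_cv_top[of \<tau>] by (simp add: rim_def)
lemma rim_bottom: "5 \<le> \<tau> \<Longrightarrow> \<tau> \<le> 7 \<Longrightarrow> rim l W \<tau> = (l + W * (7 - \<tau>) / 2, 0)"
  using cu_cv_bottom[of \<tau>] by (simp add: rim_def)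
lemma mir_bottom: "1 \<le> \<tau> \<Longrightarrow> \<tau> \<le> 3 \<Longrightarrow> mir l W \<tau> = (l + W * (3 - \<tau>) / 2, 0)"
  using cu_cv_top[of \<tau>] by (simp add: mir_def)
lemma mir_top: "5 \<le> \<tau> \<Longrightarrow> \<tau> \<le> 7 \<Longrightarrow> mir l W \<tau> = (l + W * (\<tau> - 5) / 2, 1)"
  using cu_cv_bottom[of \<tau>] by (simp add: mir_def)

lemma rim_fst: "0 \<le> W \<Longrightarrow> fst (rim l W \<tau>) \<le> l + W"
  using cu_cv_bounds[of \<tau>] mult_left_mono[of "1 + cu \<tau>" 2 W] by (simp add: rim_def)
lemma mir_fst: "0 \<le> W \<Longrightarrow> l \<le> fst (mir l W \<tau>)"
  using cu_cv_bounds[of \<tau>] by (simp add: mir_def)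

lemma inc_in: "inc \<theta> w a b \<Longrightarrow> d \<in> set w \<Longrightarrow> a < \<theta> d \<and> \<theta> d < b"
  by (simp add: inc_def)

text \<open>Beside the \<open>j\<close>-th tunnel the cross section consists of two circles. The strands of \<open>U1\<close> and \<open>U2\<close>
  travel along the first, those of \<open>d1\<close>, \<open>Y1\<close>, \<open>Y2\<close>, \<open>d2\<close> along the second. On the second circle \<open>d2\<close> and \<open>d1\<close>
  are neighbours, so they can be linked there, and the circle can then be turned before the two
  circles merge again.\<close>

lemma handle_dr:
  fixes g j :: nat
  defines "S \<equiv> orientable_surface g"
  assumes j: "j < g" and t: "2 * real j < t" "t < 2 * real j + 1"
    and D: "dr S t X E (set (U1 @ [d1] @ Y1 @ Y2 @ [d2] @ U2)) (rim 0 3 \<circ> \<theta>)"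
    and \<theta>: "inc \<theta> (U1 @ [d1] @ Y1 @ Y2 @ [d2] @ U2) 0 8"
    and ne: "fst d1 \<noteq> fst d2" "{fst d1, fst d2} \<notin> E"
    and U: "U1 @ U2 = V1 @ V2"
  shows "\<exists>t' \<theta>'. 2 * real (Suc j) < t' \<and> t' < 2 * real (Suc j) + 1 \<and> inc \<theta>' (V1 @ Y2 @ Y1 @ V2) 0 8 \<and>
    dr S t' X (insert {fst d1, fst d2} E) (set (V1 @ Y2 @ Y1 @ V2)) (rim 0 3 \<circ> \<theta>')"
proof -
  let ?w = "U1 @ [d1] @ Y1 @ Y2 @ [d2] @ U2"
  let ?T = "[d1] @ Y1" and ?B = "Y2 @ [d2]" and ?J = "2 * real j"
  have dist: "distinct ?w" using \<theta> inc_distinct by blast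
  have jg: "real j + 1 \<le> real g" using j by linarith
  have setV: "set V1 \<union> set V2 = set U1 \<union> set U2" using arg_cong[OF U, of set] by simp
  have distV: "distinct (V1 @ V2)" using dist unfolding U[symmetric] by auto
  have "distinct (U1 @ ?T @ ?B @ U2)" using dist by simp
  \<comment> \<open>On the top face \<open>rim 0 3\<close> has \<open>y = 3 (\<tau> - 1) / 2\<close>
    and on the bottom face \<open>y = 3 (7 - \<tau>) / 2\<close>; the four intervals are the parts
    with \<open>y < 1\<close> or \<open>y > 2\<close>. On the far arm \<open>d1\<close>,
    \<open>Y1\<close> lie on the top and \<open>Y2\<close>, \<open>d2\<close> on the bottom.\<close>
  then obtain f where f: "inc f U1 1 (5/3)" "inc f ?T (7/3) 3" "inc f ?B 5 (17/3)" "inc f U2 (19/3) 7"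
    using inc_four[of U1 ?T ?B U2 1 "5/3" "7/3" 3 5 "17/3" "19/3" 7] by auto
  have f8: "inc f (U1 @ ?T @ ?B @ U2) 0 8"
  proof -
    have "inc f (U1 @ ?T) 1 3" by (rule inc_append[OF f(1,2)]) auto
    then have "inc f ((U1 @ ?T) @ ?B) 1 (17/3)" by (rule inc_append[OF _ f(3)]) auto
    then have "inc f (((U1 @ ?T) @ ?B) @ U2) 1 7" by (rule inc_append[OF _ f(4)]) auto
    from inc_sub[OF this, of 0 8] show ?thesis by simp
  qed
  define t1 where "t1 = (t + (?J + 1)) / 2"
  have t1: "t < t1" "t1 < ?J + 1" using t by (auto simp: t1_def)
  define pos1 where "pos1 = rim 0 3 \<circ> f"
  have "dr S t1 X E (set ?w) pos1"
    using chart_advance[OF tube_chart[of j g] t(1) t1 _ \<theta>, of X E f] D f8 j unfolding S_def pos1_def by simp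
  have p1: "d \<in> set U1 \<Longrightarrow> pos1 d = (3 * (f d - 1) / 2, 1) \<and> 1 < f d \<and> f d < 5/3"
    "d \<in> set ?T \<Longrightarrow> pos1 d = (3 * (f d - 1) / 2, 1) \<and> 7/3 < f d \<and> f d < 3"
    "d \<in> set ?B \<Longrightarrow> pos1 d = (3 * (7 - f d) / 2, 0) \<and> 5 < f d \<and> f d < 17/3"
    "d \<in> set U2 \<Longrightarrow> pos1 d = (3 * (7 - f d) / 2, 0) \<and> 19/3 < f d \<and> f d < 7" for d
    using inc_in[OF f(1), of d] inc_in[OF f(2), of d] inc_in[OF f(3), of d] inc_in[OF f(4), of d]
    by (auto simp: pos1_def rim_top rim_bottom)
  have safe1: "(x, pos1 d) \<in> S" if d: "d \<in> set ?w" and x: "?J < x" "x < ?J + 2" for d x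
  proof -
    have "d \<in> set U1 \<or> d \<in> set ?T \<or> d \<in> set ?B \<or> d \<in> set U2" using d by auto
    then have "\<exists>y z. pos1 d = (y, z) \<and> (z = 0 \<or> z = 1) \<and> 0 \<le> y \<and> y \<le> 3 \<and> (y < 1 \<or> 2 < y)"
      using p1[of d] by fastforce
    then show ?thesis using x jg unfolding S_def by (auto intro!: safe_surface)
  qed
  define t2 where "t2 = ?J + 5/4"
  have "dr S t2 X E (set ?w) pos1"
  proof (rule dr_straight[OF \<open>dr S t1 X E (set ?w) pos1\<close>])
    show "t1 < t2" using t1 by (simp add: t2_def)
    show "(x, pos1 d) \<in> S" if "d \<in> set ?w" "x \<in> {t1..t2}" for d x
      using safe1[OF that(1), of x] that(2) t t1 by (auto simp: t2_def)
  qed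
  note C1 = arm_chart(1)[OF j, of 0, folded S_def, simplified] and C2 = arm_chart(2)[OF j, of 2, folded S_def, simplified]
  \<comment> \<open>The same points in the parameter of \<open>mir 2 1\<close>, solved from the
    formulas for \<open>y\<close>. This parameter starts at the outer wall, so the second circle is
    read as \<open>Y2 d2 d1 Y1\<close>.\<close>
  define q where "q d = (if d \<in> set ?T then 3 * f d - 2 else 3 * f d - 14)" for d
  have nT: "d \<notin> set ?T" if "d \<in> set ?B" for d using that dist by auto
  have q1: "inc q ?T 5 7"
  proof -
    have "inc (\<lambda>d. 3 * f d + (- 2)) ?T (3 * (7/3) + (- 2)) (3 * 3 + (- 2))" by (rule inc_affine[OF f(2)]) simp
    then have "inc (\<lambda>d. 3 * f d + (- 2)) ?T 5 7" by simp
    then show ?thesis by (rule inc_cong) (simp add: q_def)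
  qed
  have q2: "inc q ?B 1 3"
  proof -
    have "inc (\<lambda>d. 3 * f d + (- 14)) ?B (3 * 5 + (- 14)) (3 * (17/3) + (- 14))" by (rule inc_affine[OF f(3)]) simp
    then have "inc (\<lambda>d. 3 * f d + (- 14)) ?B 1 3" by simp
    then show ?thesis by (rule inc_cong) (use nT in \<open>auto simp: q_def\<close>)
  qed
  have q8: "inc q (?B @ ?T) 0 8"
    using inc_sub[OF inc_append[OF q2 q1]] by simp
  have pq: "pos1 d = mir 2 1 (q d)" if "d \<in> set (?B @ ?T)" for d
  proof (cases "d \<in> set ?T")
    case True
    then show ?thesis using p1(2)[OF True] mir_top[of "q d" 2 1] by (simp add: q_def field_simps)
  next
    case False
    then have dB: "d \<in> set ?B" using that by auto
    then show ?thesis using p1(3)[OF dB] mir_bottom[of "q d" 2 1] False by (simp add: q_def field_simps)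
  qed
  have ql: "q d2 < q d1" and out: "d \<in> set (Y2 @ Y1) \<Longrightarrow> q d \<notin> {q d2..q d1}" for d
    using q8 by (auto simp: inc_def sorted_wrt_append)
  have qr: "0 < q d" "q d < 8" if "d \<in> set (?B @ ?T)" for d using inc_in[OF q8 that] by auto
  define t3 where "t3 = ?J + 3/2"
  have t23: "?J + 1 < t2" "t2 < t3" "t3 < ?J + 2" by (auto simp: t2_def t3_def)
  obtain lam where lam: "arc lam" "pathstart lam = (t2, mir 2 1 (q d2))" "pathfinish lam = (t2, mir 2 1 (q d1))"
    "path_image lam \<subseteq> left_of S t3"
    "\<And>r. r \<in> path_image lam \<Longrightarrow> fst r \<le> t2 \<Longrightarrow> r = (t2, mir 2 1 (q d2)) \<or> r = (t2, mir 2 1 (q d1))"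
    "\<And>r. r \<in> path_image lam \<Longrightarrow> \<exists>\<tau>\<in>{q d2..q d1}. snd r = mir 2 1 \<tau>"
    using chart_link_path[OF C2 t23 _ ql] qr[of d2] qr[of d1] by auto
  let ?W = "set (Y2 @ Y1 @ U1 @ U2)" and ?E = "insert {fst d1, fst d2} E"
  have "dr S t3 X (insert {fst d2, fst d1} E) ?W pos1"
  proof (rule dr_link[where lam = lam and t = t2])
    show "dr S t2 X E (insert d2 (insert d1 ?W)) pos1"
    proof -
      have "insert d2 (insert d1 ?W) = set ?w" by auto
      then show ?thesis using \<open>dr S t2 X E (set ?w) pos1\<close> by simp
    qed
    show "t2 < t3" "arc lam" "path_image lam \<subseteq> left_of S t3" using t23 lam by auto
    show "d2 \<noteq> d1" "d2 \<notin> ?W" "d1 \<notin> ?W" using dist by auto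
    show "fst d2 \<noteq> fst d1" "{fst d2, fst d1} \<notin> E" using ne by (auto simp: insert_commute)
    show "pathstart lam = (t2, pos1 d2)" "pathfinish lam = (t2, pos1 d1)" using lam pq by auto
    show "r = (t2, pos1 d2) \<or> r = (t2, pos1 d1)" if "r \<in> path_image lam" "fst r \<le> t2" for r
      using lam(5)[OF that] pq by auto
    fix d x assume d: "d \<in> ?W" and x: "x \<in> {t2..t3}"
    have "(x, pos1 d) \<in> S" using safe1[of d x] d x t23 by auto
    moreover have "(x, pos1 d) \<notin> path_image lam"
    proof
      assume "(x, pos1 d) \<in> path_image lam"
      then obtain \<tau> where \<tau>: "\<tau> \<in> {q d2..q d1}" "pos1 d = mir 2 1 \<tau>" using lam(6) by fastforce
      show False
      proof (cases "d \<in> set (Y2 @ Y1)")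
        case True
        then have "pos1 d = mir 2 1 (q d)" "0 < q d" "q d < 8" using pq[of d] qr[of d] by auto
        moreover have "0 < \<tau>" "\<tau> < 8" "q d \<noteq> \<tau>" using \<tau>(1) out[OF True] qr[of d2] qr[of d1] by auto
        ultimately show False using chart_neq[OF C2] \<tau>(2) by metis
      next
        case False
        then have "d \<in> set U1 \<or> d \<in> set U2" using d by auto
        then have "fst (pos1 d) < 1" using p1(1)[of d] p1(4)[of d] by auto
        then show False using mir_fst[of 1 2 \<tau>] \<tau>(2) by simp
      qed
    qed
    ultimately show "(x, pos1 d) \<in> S - path_image lam" by simp
  qed
  then have D3: "dr S t3 X ?E ?W pos1" by (simp add: insert_commute)
  define h where "h d = (if d \<in> set U1 then 3 * f d - 2 else 3 * f d - 14)" for d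
  have nU: "d \<notin> set U1" if "d \<in> set U2" for d using that dist by auto
  have h8: "inc h (V1 @ V2) 0 8"
  proof -
    have "inc (\<lambda>d. 3 * f d + (- 2)) U1 (3 * 1 + (- 2)) (3 * (5/3) + (- 2))" by (rule inc_affine[OF f(1)]) simp
    then have "inc (\<lambda>d. 3 * f d + (- 2)) U1 1 3" by simp
    then have h1: "inc h U1 1 3" by (rule inc_cong) (simp add: h_def)
    have "inc (\<lambda>d. 3 * f d + (- 14)) U2 (3 * (19/3) + (- 14)) (3 * 7 + (- 14))" by (rule inc_affine[OF f(4)]) simp
    then have "inc (\<lambda>d. 3 * f d + (- 14)) U2 5 7" by simp
    then have h2: "inc h U2 5 7" by (rule inc_cong) (use nU in \<open>auto simp: h_def\<close>)
    show ?thesis using inc_sub[OF inc_append[OF h1 h2], of 0 8] unfolding U by simp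
  qed
  have ph: "pos1 d = rim 0 1 (h d)" if "d \<in> set (V1 @ V2)" for d
  proof (cases "d \<in> set U1")
    case True
    then show ?thesis using p1(1)[OF True] rim_top[of "h d" 0 1] by (simp add: h_def field_simps)
  next
    case False
    then have dU: "d \<in> set U2" using that setV by auto
    then show ?thesis using p1(4)[OF dU] rim_bottom[of "h d" 0 1] False by (simp add: h_def field_simps)
  qed
  have "distinct (V1 @ (Y2 @ Y1) @ V2)" using dist distV setV by auto
  \<comment> \<open>Places taken before the circles merge: \<open>V1\<close> above and
    \<open>V2\<close> below on the first circle, the whole second word on the top. Since
    \<open>U1 @ U2 = V1 @ V2\<close>, letters may pass between the top and the bottom of the first
    circle.\<close>
  then obtain k where k: "inc k V1 1 3" "inc k (Y2 @ Y1) 5 7" "inc k V2 5 7"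
    using inc_four[of V1 "Y2 @ Y1" V2 "[]" 1 3 5 7 5 7 0 1] by auto
  have k8: "inc k (V1 @ V2) 0 8" "inc k (Y2 @ Y1) 0 8"
    using inc_sub[OF inc_append[OF k(1,3)], of 0 8] inc_sub[OF k(2), of 0 8] by auto
  have qY: "inc q (Y2 @ Y1) 0 8" using q8 by (auto simp: inc_def sorted_wrt_append)
  have sets: "?W = set (V1 @ V2) \<union> set (Y2 @ Y1)" "set (V1 @ V2) \<inter> set (Y2 @ Y1) = {}"
    using setV dist by auto
  define pos4 where "pos4 d = (if d \<in> set (Y2 @ Y1) then mir 2 1 (k d) else rim 0 1 (k d))" for d
  define \<beta> where "\<beta> d s = (if d \<in> set (Y2 @ Y1) then mir 2 1 ((1 - s) * q d + s * k d)
    else rim 0 1 ((1 - s) * h d + s * k d))" for d s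
  have bT: "\<beta> d = (\<lambda>s. mir 2 1 ((1 - s) * q d + s * k d))" if "d \<in> set (Y2 @ Y1)" for d
    using that by (intro ext) (simp add: \<beta>_def)
  have bF: "\<beta> d = (\<lambda>s. rim 0 1 ((1 - s) * h d + s * k d))" if "d \<notin> set (Y2 @ Y1)" for d
    using that by (intro ext) (auto simp: \<beta>_def)
  define t4 where "t4 = ?J + 7/4"
  have t34: "?J + 1 < t3" "t3 < t4" "t4 < ?J + 2" by (auto simp: t3_def t4_def)
  have D4: "dr S t4 X ?E ?W pos4"
  proof (rule dr_advance[OF D3 t34(2), where \<beta> = \<beta>])
    fix d assume d: "d \<in> ?W"
    have r: "d \<in> set (Y2 @ Y1) \<Longrightarrow> 0 < q d \<and> q d < 8 \<and> 0 < k d \<and> k d < 8"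
      "d \<notin> set (Y2 @ Y1) \<Longrightarrow> 0 < h d \<and> h d < 8 \<and> 0 < k d \<and> k d < 8"
      using inc_in[OF qY, of d] inc_in[OF k8(2), of d] inc_in[OF h8, of d] inc_in[OF k8(1), of d] d sets by blast+
    show "continuous_on {0..1} (\<beta> d)"
    proof (cases "d \<in> set (Y2 @ Y1)")
      case True
      show ?thesis unfolding bT[OF True] by (rule chart_path[OF C2]) (use r(1)[OF True] in simp_all)
    next
      case False
      show ?thesis unfolding bF[OF False] by (rule chart_path[OF C1]) (use r(2)[OF False] in simp_all)
    qed
    show "\<beta> d 0 = pos1 d"
    proof (cases "d \<in> set (Y2 @ Y1)")
      case True
      then have "d \<in> set (?B @ ?T)" by auto
      then show ?thesis unfolding bT[OF True] using pq by simp
    next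
      case False
      then have "d \<in> set (V1 @ V2)" using d sets by blast
      then show ?thesis unfolding bF[OF False] using ph by simp
    qed
    show "\<beta> d 1 = pos4 d" by (simp add: \<beta>_def pos4_def)
    fix s :: real assume s: "s \<in> {0..1}"
    have cc: "d \<in> set (Y2 @ Y1) \<Longrightarrow> 0 < (1 - s) * q d + s * k d \<and> (1 - s) * q d + s * k d < 8"
      "d \<notin> set (Y2 @ Y1) \<Longrightarrow> 0 < (1 - s) * h d + s * k d \<and> (1 - s) * h d + s * k d < 8"
      using r convex_comb_in[of 0 "q d" 8 "k d" s] convex_comb_in[of 0 "h d" 8 "k d" s] s by blast+
    show "(t3 + s * (t4 - t3), \<beta> d s) \<in> S"
    proof (cases "d \<in> set (Y2 @ Y1)")
      case True
      show ?thesis unfolding bT[OF True] using C2 time_in[OF t34 s] cc(1)[OF True] by (simp add: chart_def)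
    next
      case False
      show ?thesis unfolding bF[OF False] using C1 time_in[OF t34 s] cc(2)[OF False] by (simp add: chart_def)
    qed
    fix e assume e: "e \<in> ?W" "d \<noteq> e"
    have r': "e \<in> set (Y2 @ Y1) \<Longrightarrow> 0 < q e \<and> q e < 8 \<and> 0 < k e \<and> k e < 8"
      "e \<notin> set (Y2 @ Y1) \<Longrightarrow> 0 < h e \<and> h e < 8 \<and> 0 < k e \<and> k e < 8"
      using inc_in[OF qY, of e] inc_in[OF k8(2), of e] inc_in[OF h8, of e] inc_in[OF k8(1), of e] e sets by blast+
    have cc': "e \<in> set (Y2 @ Y1) \<Longrightarrow> 0 < (1 - s) * q e + s * k e \<and> (1 - s) * q e + s * k e < 8"
      "e \<notin> set (Y2 @ Y1) \<Longrightarrow> 0 < (1 - s) * h e + s * k e \<and> (1 - s) * h e + s * k e < 8"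
      using r' convex_comb_in[of 0 "q e" 8 "k e" s] convex_comb_in[of 0 "h e" 8 "k e" s] s by blast+
    consider "d \<in> set (Y2 @ Y1)" "e \<in> set (Y2 @ Y1)" | "d \<notin> set (Y2 @ Y1)" "e \<notin> set (Y2 @ Y1)"
      | "(d \<in> set (Y2 @ Y1)) \<noteq> (e \<in> set (Y2 @ Y1))" by blast
    then show "\<beta> d s \<noteq> \<beta> e s"
    proof cases
      case 1
      have "(q d < q e \<and> k d < k e) \<or> (q e < q d \<and> k e < k d)"
        using inc_cmp[OF qY inc_le[OF k8(2)] 1 e(2)] inc_cmp[OF k8(2) inc_le[OF qY] 1 e(2)] by auto
      then have "(1 - s) * q d + s * k d \<noteq> (1 - s) * q e + s * k e"
        using comb_less'[of "q d" "q e" "k d" "k e" s] comb_less'[of "q e" "q d" "k e" "k d" s] s by auto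
      then show ?thesis using chart_neq[OF C2, of "(1 - s) * q d + s * k d" "(1 - s) * q e + s * k e"]
        cc(1)[OF 1(1)] cc'(1)[OF 1(2)] unfolding bT[OF 1(1)] bT[OF 1(2)] by blast
    next
      case 2
      then have V: "d \<in> set (V1 @ V2)" "e \<in> set (V1 @ V2)" using d e sets by blast+
      have "(h d < h e \<and> k d < k e) \<or> (h e < h d \<and> k e < k d)"
        using inc_cmp[OF h8 inc_le[OF k8(1)] V e(2)] inc_cmp[OF k8(1) inc_le[OF h8] V e(2)] by auto
      then have "(1 - s) * h d + s * k d \<noteq> (1 - s) * h e + s * k e"
        using comb_less'[of "h d" "h e" "k d" "k e" s] comb_less'[of "h e" "h d" "k e" "k d" s] s by auto
      then show ?thesis using chart_neq[OF C1, of "(1 - s) * h d + s * k d" "(1 - s) * h e + s * k e"]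
        cc(2)[OF 2(1)] cc'(2)[OF 2(2)] unfolding bF[OF 2(1)] bF[OF 2(2)] by blast
    next
      case 3
      have "fst (rim 0 1 a) < fst (mir 2 1 b)" for a b
        using rim_fst[of 1 0 a] mir_fst[of 1 2 b] by simp
      then have "rim 0 1 a \<noteq> mir 2 1 b" for a b by (metis less_irrefl)
      then show ?thesis using 3 bT[of d] bT[of e] bF[of d] bF[of e] by metis
    qed
  qed
  have p4: "d \<in> set V1 \<Longrightarrow> pos4 d = ((k d - 1) / 2, 1) \<and> 1 < k d \<and> k d < 3"
    "d \<in> set (Y2 @ Y1) \<Longrightarrow> pos4 d = (2 + (k d - 5) / 2, 1) \<and> 5 < k d \<and> k d < 7"
    "d \<in> set V2 \<Longrightarrow> pos4 d = ((7 - k d) / 2, 0) \<and> 5 < k d \<and> k d < 7" for d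
  proof -
    show "d \<in> set V1 \<Longrightarrow> pos4 d = ((k d - 1) / 2, 1) \<and> 1 < k d \<and> k d < 3"
      using inc_in[OF k(1), of d] rim_top[of "k d" 0 1] sets(2) by (auto simp: pos4_def)
    show "d \<in> set (Y2 @ Y1) \<Longrightarrow> pos4 d = (2 + (k d - 5) / 2, 1) \<and> 5 < k d \<and> k d < 7"
      using inc_in[OF k(2), of d] mir_top[of "k d" 2 1] by (auto simp: pos4_def)
    show "d \<in> set V2 \<Longrightarrow> pos4 d = ((7 - k d) / 2, 0) \<and> 5 < k d \<and> k d < 7"
      using inc_in[OF k(3), of d] rim_bottom[of "k d" 0 1] sets(2) by (auto simp: pos4_def)
  qed
  define t5 where "t5 = ?J + 5/2"
  have D5: "dr S t5 X ?E ?W pos4"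
  proof (rule dr_straight[OF D4])
    show "t4 < t5" by (simp add: t4_def t5_def)
    fix d x assume d: "d \<in> ?W" and x: "x \<in> {t4..t5}"
    have "d \<in> set V1 \<or> d \<in> set (Y2 @ Y1) \<or> d \<in> set V2" using d sets by auto
    then have "\<exists>y z. pos4 d = (y, z) \<and> (z = 0 \<or> z = 1) \<and> 0 \<le> y \<and> y \<le> 3 \<and> (y < 1 \<or> 2 < y)"
      using p4[of d] by fastforce
    moreover have "0 \<le> x" "x \<le> 2 * real g + 1" using x jg by (auto simp: t4_def t5_def)
    ultimately show "(x, pos4 d) \<in> S" unfolding S_def by (auto intro!: safe_surface)
  qed
  \<comment> \<open>Back to the parameter of \<open>rim 0 3\<close>, for which the top runs through
    both arms: \<open>V1\<close>, then \<open>Y2 @ Y1\<close>, and \<open>V2\<close> on the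
    bottom.\<close>
  define m where "m d = (if d \<in> set V2 then (k d + 14) / 3 else (k d + 2) / 3)" for d
  have nV: "d \<notin> set V2" if "d \<in> set (V1 @ Y2 @ Y1)" for d
    using that distV sets(2) by auto
  have m8: "inc m (V1 @ (Y2 @ Y1) @ V2) 0 8"
  proof -
    have "inc (\<lambda>d. 1/3 * k d + 2/3) V1 (1/3 * 1 + 2/3) (1/3 * 3 + 2/3)" by (rule inc_affine[OF k(1)]) simp
    then have "inc (\<lambda>d. 1/3 * k d + 2/3) V1 1 (5/3)" by simp
    then have m1: "inc m V1 1 (5/3)" by (rule inc_cong) (use nV in \<open>auto simp: m_def field_simps\<close>)
    have "inc (\<lambda>d. 1/3 * k d + 2/3) (Y2 @ Y1) (1/3 * 5 + 2/3) (1/3 * 7 + 2/3)" by (rule inc_affine[OF k(2)]) simp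
    then have "inc (\<lambda>d. 1/3 * k d + 2/3) (Y2 @ Y1) (7/3) 3" by simp
    then have m2: "inc m (Y2 @ Y1) (7/3) 3" by (rule inc_cong) (use nV in \<open>auto simp: m_def field_simps\<close>)
    have "inc (\<lambda>d. 1/3 * k d + 14/3) V2 (1/3 * 5 + 14/3) (1/3 * 7 + 14/3)" by (rule inc_affine[OF k(3)]) simp
    then have "inc (\<lambda>d. 1/3 * k d + 14/3) V2 (19/3) 7" by simp
    then have m3: "inc m V2 (19/3) 7" by (rule inc_cong) (auto simp: m_def field_simps)
    have "inc m ((Y2 @ Y1) @ V2) (7/3) 7" using inc_append[OF m2 m3] by simp
    from inc_append[OF m1 this] have "inc m (V1 @ (Y2 @ Y1) @ V2) 1 7" by simp
    then show ?thesis by (rule inc_sub) auto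
  qed
  have "dr S t5 X ?E (set (V1 @ (Y2 @ Y1) @ V2)) (rim 0 3 \<circ> m)"
  proof (rule dr_cong[of _ _ _ _ _ pos4])
    have "?W = set (V1 @ (Y2 @ Y1) @ V2)" using sets by auto
    then show "dr S t5 X ?E (set (V1 @ (Y2 @ Y1) @ V2)) pos4" using D5 by simp
    fix d assume "d \<in> set (V1 @ (Y2 @ Y1) @ V2)"
    then consider "d \<in> set V1" | "d \<in> set (Y2 @ Y1)" | "d \<in> set V2" by auto
    then show "(rim 0 3 \<circ> m) d = pos4 d"
    proof cases
      case 1
      then show ?thesis using p4(1)[OF 1] nV[of d] rim_top[of "m d" 0 3] by (simp add: m_def field_simps)
    next
      case 2
      then have "d \<notin> set V2" using nV[of d] by simp
      then show ?thesis using p4(2)[OF 2] rim_top[of "m d" 0 3] by (simp add: m_def field_simps)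
    next
      case 3
      then show ?thesis using p4(3)[OF 3] rim_bottom[of "m d" 0 3] by (simp add: m_def field_simps)
    qed
  qed
  then show ?thesis using m8 by (intro exI[of _ t5] exI[of _ m]) (auto simp: t5_def)
qed

text \<open>\<open>j\<close> tunnels have been passed. A handle step uses the next one to link
  \<open>x\<close>; afterwards \<open>y\<close> and its partner are neighbours and are cancelled in
  the following tube.\<close>

lemma red_surface:
  fixes g :: nat
  defines "S \<equiv> orientable_surface g"
  assumes G: "simple_graph G"
  shows "red prod.swap s w \<Longrightarrow> j + s \<le> g \<Longrightarrow> distinct w \<Longrightarrow> set w \<subseteq> adj G \<Longrightarrow>
    swept S (rim 0 3) (2 * real j) (2 * real j + 1) G (verts G) w \<Longrightarrow> embeds_in G S"
proof (induction arbitrary: j rule: red.induct)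
  case (red_nil s)
  then show ?case using swept_embeds[OF G] by simp
next
  case (red_cancel s u v x)
  have "j \<le> g" using red_cancel.prems by simp
  note c = tube_chart[OF this, folded S_def]
  show ?case using swept_cancel[OF G c red_cancel.prems(2-4)] red_cancel by auto
next
  case (red_handle s A D C B E x y)
  let ?w = "A @ [x] @ B @ [y] @ C @ [prod.swap x] @ D @ [prod.swap y] @ E"
  \<comment> \<open>The brackets show the roles in \<open>handle_dr\<close>: \<open>V1\<close>,
    \<open>Y2\<close>, \<open>Y1\<close>, \<open>V2\<close>.\<close>
  let ?w1 = "(A @ D) @ C @ (B @ [y]) @ ([prod.swap y] @ E)"
  have j: "j < g" "Suc j \<le> g" "Suc j + s \<le> g" using red_handle.prems by auto
  obtain t \<theta> where t: "2 * real j < t" "t < 2 * real j + 1" and \<theta>: "inc \<theta> ?w 0 8"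
    and Dr: "dr S t (verts G) (drawn G (verts G) ?w) (set ?w) (rim 0 3 \<circ> \<theta>)"
    using red_handle.prems(4) by (auto simp: swept_def)
  have set: "set ?w = insert x (insert (prod.swap x) (set ?w1))" by auto
  have n: "x \<notin> set ?w1" "prod.swap x \<notin> set ?w1" using red_handle.prems(2) by auto
  note r = drawn_remove[OF G set red_handle.prems(3) n]
  have w: "?w = A @ [x] @ (B @ [y]) @ C @ [prod.swap x] @ (D @ [prod.swap y] @ E)" by simp
  have "A @ D @ [prod.swap y] @ E = (A @ D) @ ([prod.swap y] @ E)" by simp
  from handle_dr[OF j(1) t Dr[unfolded S_def w] \<theta>[unfolded w] r(3) r(2)[unfolded w] this]
  have "swept S (rim 0 3) (2 * real (Suc j)) (2 * real (Suc j) + 1) G (verts G) ?w1"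
    unfolding swept_def r(1) S_def w by blast
  moreover have "?w1 = (A @ D @ C @ B) @ [y, prod.swap y] @ E" by simp
  ultimately have s1: "swept S (rim 0 3) (2 * real (Suc j)) (2 * real (Suc j) + 1) G (verts G) ((A @ D @ C @ B) @ [y, prod.swap y] @ E)"
    by (simp only:)
  have d1: "distinct ((A @ D @ C @ B) @ [y, prod.swap y] @ E)" using red_handle.prems(2) by auto
  have a1: "set ((A @ D @ C @ B) @ [y, prod.swap y] @ E) \<subseteq> adj G" using red_handle.prems(3) by auto
  have "swept S (rim 0 3) (2 * real (Suc j)) (2 * real (Suc j) + 1) G (verts G) ((A @ D @ C @ B) @ E)"
    using swept_cancel[OF G tube_chart[OF j(2), folded S_def] d1 a1 s1] .
  then show ?case using red_handle.IH[OF j(3)] d1 a1 by simp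
qed

theorem word_surface:
  assumes G: "simple_graph G" and w: "rot_of G \<rho>" "grows prod.swap \<rho> (verts G) w" "red prod.swap g w"
  shows "genus_at_most g G"
proof -
  note pr = grows_props[OF rot_of_rotation(1)[OF G w(1)] w(2) subset_refl]
  have c: "chart (orientable_surface g) (rim 0 3) (2 * real 0) (2 * real 0 + 1)" by (rule tube_chart) simp
  have "swept (orientable_surface g) (rim 0 3) (2 * real 0) (2 * real 0 + 1) G (verts G) w"
    by (rule swept_grows[OF G w(1) c w(2) subset_refl])
  then show ?thesis
    unfolding genus_at_most_def using red_surface[OF G w(3), of 0 g] pr rot_of_rotation(2)[OF G w(1)] by auto
qed

section \<open>Minors of cellular maps\<close>

text \<open>Connectedness in terms of cuts, the form in which \<open>grows_exists\<close> consumes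
  it and in which \<open>linked_nerve\<close> obtains it from topological connectedness.\<close>

definition linked :: "('u \<Rightarrow> 'u \<Rightarrow> bool) \<Rightarrow> 'u set \<Rightarrow> bool" where
  "linked A W \<longleftrightarrow> (\<forall>Z. Z \<subset> W \<longrightarrow> Z \<noteq> {} \<longrightarrow> (\<exists>x\<in>Z. \<exists>y\<in>W - Z. A x y))"

lemma linkedD: "linked A W \<Longrightarrow> Z \<subset> W \<Longrightarrow> Z \<noteq> {} \<Longrightarrow> \<exists>x\<in>Z. \<exists>y\<in>W - Z. A x y"
  by (simp add: linked_def)

lemma linked_Union:
  assumes L: "\<And>i. i \<in> I \<Longrightarrow> linked A (W i)" and z: "\<And>i. i \<in> I \<Longrightarrow> z \<in> W i"
  shows "linked A (\<Union>i\<in>I. W i)"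
  unfolding linked_def
proof (intro allI impI)
  fix Z assume Z: "Z \<subset> (\<Union>i\<in>I. W i)" "Z \<noteq> {}"
  have "\<exists>i\<in>I. Z \<inter> W i \<noteq> {} \<and> Z \<inter> W i \<subset> W i"
  proof (cases "z \<in> Z")
    case True
    obtain y i where "i \<in> I" "y \<in> W i" "y \<notin> Z" using Z(1) by blast
    then show ?thesis using True z by blast
  next
    case False
    obtain y i where "i \<in> I" "y \<in> W i" "y \<in> Z" using Z by blast
    then show ?thesis using False z by blast
  qed
  then obtain i where i: "i \<in> I" "Z \<inter> W i \<subset> W i" "Z \<inter> W i \<noteq> {}" by blast
  from linkedD[OF L[OF i(1)] i(2,3)] i(1) show "\<exists>x\<in>Z. \<exists>y\<in>(\<Union>i\<in>I. W i) - Z. A x y" by blast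
qed

lemma linked_Un:
  assumes "linked A W" "linked A W'" "z \<in> W" "z \<in> W'" shows "linked A (W \<union> W')"
  using linked_Union[of "{True, False}" A "\<lambda>b. if b then W else W'" z] assms
  by (auto simp: Un_commute)

lemma linked_pair:
  assumes "A x y" "A y x" shows "linked A {x, y}"
  unfolding linked_def
proof (intro allI impI)
  fix Z assume "Z \<subset> {x, y}" "Z \<noteq> {}"
  then have "(Z = {x} \<and> x \<noteq> y) \<or> (Z = {y} \<and> x \<noteq> y)" by blast
  then show "\<exists>u\<in>Z. \<exists>v\<in>{x, y} - Z. A u v" using assms by auto
qed

lemma linked_insert:
  assumes "linked A W" "x \<in> W" "A x y" "A y x" shows "linked A (insert y W)"
  using linked_Un[OF assms(1) linked_pair[of A x y, OF assms(3,4)] assms(2)] assms(2) by (simp add: insert_absorb)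

text \<open>\<open>C\<close> will be the strip of cells along an edge, \<open>B\<close> and
  \<open>B'\<close> the branch sets of its ends. Take \<open>R\<close> as large as possible: the
  step out of \<open>B \<union> R\<close> that stays in \<open>C\<close> must lead into
  \<open>B'\<close>, since otherwise \<open>R\<close> could grow.\<close>

lemma linked_connect:
  assumes sym: "\<And>x y. x \<in> V \<Longrightarrow> y \<in> V \<Longrightarrow> A x y \<Longrightarrow> A y x" and fin: "finite C" and V: "B \<subseteq> V" "C \<subseteq> V"
    and B: "linked A B" and C: "linked A C" "B \<inter> C \<noteq> {}" "C \<inter> B' \<noteq> {}" "B \<inter> B' = {}"
  shows "\<exists>R\<subseteq>C - B'. linked A (B \<union> R) \<and> (\<exists>x\<in>B \<union> R. \<exists>y\<in>B'. A x y)"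
proof -
  let ?P = "\<lambda>R. R \<subseteq> C - B' \<and> linked A (B \<union> R)"
  have "\<exists>R. ?P R \<and> (\<forall>R'. ?P R' \<longrightarrow> card R' \<le> card R)"
    by (rule ex_has_greatest_nat[of ?P "{}" card "Suc (card C)"])
       (use B fin card_mono[of C] in \<open>auto simp: less_Suc_eq_le\<close>)
  then obtain R where R: "?P R" and max: "\<And>R'. ?P R' \<Longrightarrow> card R' \<le> card R" by blast
  have "(B \<union> R) \<inter> C \<subset> C" "(B \<union> R) \<inter> C \<noteq> {}" using C R by blast+
  from linkedD[OF C(1) this] obtain x y where xy: "x \<in> B \<union> R" "y \<in> C" "y \<notin> B \<union> R" "A x y" by blast
  have "y \<in> B'"
  proof (rule ccontr)
    assume "y \<notin> B'"
    moreover have "A y x" using sym xy R V by blast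
    ultimately have "?P (insert y R)" using R xy linked_insert[of A "B \<union> R" x y] by auto
    from max[OF this] have "card (insert y R) \<le> card R" .
    moreover have "finite R" using R fin finite_subset by blast
    ultimately show False using xy(3) by simp
  qed
  then show ?thesis using R xy by blast
qed

text \<open>If the cells meeting \<open>K\<close> split into two unlinked families, the unions of
  both are closed, cover \<open>K\<close> and share a point of it; but the cells at that point are
  linked across the split.\<close>

lemma linked_nerve:
  fixes cell :: "'u \<Rightarrow> 'p::topological_space set"
  assumes fin: "finite V" and cl: "\<And>u. u \<in> V \<Longrightarrow> closed (cell u)" and K: "connected K" "K \<subseteq> \<Union> (cell ` V)"
    and loc: "\<And>q. q \<in> K \<Longrightarrow> linked A {u \<in> V. q \<in> cell u}"
  shows "linked A {u \<in> V. cell u \<inter> K \<noteq> {}}"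
  unfolding linked_def
proof (intro allI impI, rule ccontr)
  let ?N = "{u \<in> V. cell u \<inter> K \<noteq> {}}"
  fix Z assume Z: "Z \<subset> ?N" "Z \<noteq> {}" and no: "\<not> (\<exists>x\<in>Z. \<exists>y\<in>?N - Z. A x y)"
  let ?K1 = "\<Union> (cell ` Z)" and ?K2 = "\<Union> (cell ` (?N - Z))"
  have "closed ?K1" "closed ?K2" using Z fin cl by (auto intro!: closed_UN intro: finite_subset)
  moreover have "K \<subseteq> ?K1 \<union> ?K2" using K(2) by blast
  moreover have "?K1 \<inter> K \<noteq> {}" "?K2 \<inter> K \<noteq> {}" using Z by blast+
  ultimately obtain q where q: "q \<in> K" "q \<in> ?K1" "q \<in> ?K2"
    using connected_closedD[OF K(1), of ?K1 ?K2] by blast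
  let ?V = "{u \<in> V. q \<in> cell u}"
  have "?V \<inter> Z \<subset> ?V" "?V \<inter> Z \<noteq> {}" using q Z by blast+
  from linkedD[OF loc[OF q(1)] this] obtain x y where "x \<in> Z" "y \<in> ?V" "y \<notin> Z" "A x y" by blast
  moreover have "y \<in> ?N" using \<open>y \<in> ?V\<close> q(1) by blast
  ultimately show False using no by blast
qed

section \<open>Contraction of linked sets in a cellular map\<close>

definition dart_adj :: "('d \<Rightarrow> 'd) \<Rightarrow> ('u \<Rightarrow> 'd list) \<Rightarrow> 'u \<Rightarrow> 'u \<Rightarrow> bool" where
  "dart_adj a \<rho> x y \<longleftrightarrow> (\<exists>d\<in>set (\<rho> x). a d \<in> set (\<rho> y))"

text \<open>Every vertex and dart of the map must be accounted for in the Euler count of the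
  quotient, so the vertices left over are absorbed one at a time.\<close>

lemma partition_extend:
  fixes U :: "'v \<Rightarrow> 'u set"
  assumes sym: "\<And>x y. x \<in> V \<Longrightarrow> y \<in> V \<Longrightarrow> A x y \<Longrightarrow> A y x" and fin: "finite V" and V: "linked A V" and X: "X \<noteq> {}"
  shows "(\<And>v. v \<in> X \<Longrightarrow> U v \<subseteq> V \<and> U v \<noteq> {} \<and> linked A (U v)) \<Longrightarrow>
    (\<And>v w. v \<in> X \<Longrightarrow> w \<in> X \<Longrightarrow> v \<noteq> w \<Longrightarrow> U v \<inter> U w = {}) \<Longrightarrow>
    \<exists>U'. (\<forall>v\<in>X. U v \<subseteq> U' v \<and> U' v \<subseteq> V \<and> U' v \<noteq> {} \<and> linked A (U' v)) \<and>
      (\<forall>v\<in>X. \<forall>w\<in>X. v \<noteq> w \<longrightarrow> U' v \<inter> U' w = {}) \<and> (\<Union>v\<in>X. U' v) = V"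
proof (induction "card (V - (\<Union>v\<in>X. U v))" arbitrary: U rule: less_induct)
  case less
  let ?Z = "\<Union>v\<in>X. U v"
  show ?case
  proof (cases "?Z = V")
    case True
    then show ?thesis using less.prems by (intro exI[of _ U]) auto
  next
    case False
    moreover have "?Z \<subseteq> V" using less.prems(1) by blast
    ultimately have sub: "?Z \<subset> V" by blast
    have ne: "?Z \<noteq> {}"
    proof -
      obtain v0 where "v0 \<in> X" using X by blast
      then show ?thesis using less.prems(1)[of v0] by blast
    qed
    from linkedD[OF V sub ne] obtain x y v where xy: "v \<in> X" "x \<in> U v" "y \<in> V" "y \<notin> ?Z" "A x y" by blast
    let ?U = "U(v := insert y (U v))"
    have x: "x \<in> V" using less.prems(1) xy by blast
    have Z': "(\<Union>w\<in>X. ?U w) = insert y ?Z" using xy(1) by auto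
    have "card (V - insert y ?Z) < card (V - ?Z)"
      using fin xy by (intro psubset_card_mono) auto
    then have lt: "card (V - (\<Union>w\<in>X. ?U w)) < card (V - ?Z)" unfolding Z' .
    have p1: "?U w \<subseteq> V \<and> ?U w \<noteq> {} \<and> linked A (?U w)" if "w \<in> X" for w
      using less.prems(1)[OF that] xy linked_insert[of A "U v" x y] sym[OF x xy(3) xy(5)] by auto
    have p2: "?U w \<inter> ?U w' = {}" if "w \<in> X" "w' \<in> X" "w \<noteq> w'" for w w'
      using less.prems(2)[OF that] xy(4) that by auto
    obtain U' where U': "\<forall>w\<in>X. ?U w \<subseteq> U' w \<and> U' w \<subseteq> V \<and> U' w \<noteq> {} \<and> linked A (U' w)"
      "\<forall>v\<in>X. \<forall>w\<in>X. v \<noteq> w \<longrightarrow> U' v \<inter> U' w = {}" "(\<Union>v\<in>X. U' v) = V"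
      using less.hyps[OF lt p1 p2] by blast
    have "U w \<subseteq> ?U w" for w by auto
    then show ?thesis using U' by (intro exI[of _ U']) blast
  qed
qed

lemma walk_map:
  assumes "\<And>x. x \<in> set xs \<Longrightarrow> r (\<pi> x) = x \<and> r (b (\<pi> x)) = a x"
  shows "walk a c p xs q \<Longrightarrow> walk b (c \<circ> r) p (map \<pi> xs) q"
  using assms by (induction xs arbitrary: p) auto

text \<open>The branch sets are enlarged to a partition and contracted, which preserves the Euler
  count; then one edge is kept for each adjacent pair. The quotient is connected and contains
  \<open>G\<close> as a spanning subgraph, so the bound passes to \<open>G\<close>. The hypothesis
  is doubled because darts are counted instead of edges.\<close>

lemma minor_gen:
  fixes \<rho> :: "'u \<Rightarrow> 'd list" and c :: "'d \<Rightarrow> nat" and G :: "'v graph"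
  assumes rot: "rotation a \<rho> V" and w: "\<And>u. u \<in> V \<Longrightarrow> walk a c (p u) (\<rho> u) (p u)"
    and euler: "int (card (darts \<rho> V)) + 4 \<le> 2 * int (card V) + 2 * int (card (c ` darts \<rho> V \<union> p ` V)) + 2 * t"
    and conn: "linked (dart_adj a \<rho>) V"
    and G: "simple_graph G" "verts G \<noteq> {}"
    and U: "\<And>v. v \<in> verts G \<Longrightarrow> U v \<subseteq> V \<and> U v \<noteq> {} \<and> linked (dart_adj a \<rho>) (U v)"
    and disj: "\<And>v w. v \<in> verts G \<Longrightarrow> w \<in> verts G \<Longrightarrow> v \<noteq> w \<Longrightarrow> U v \<inter> U w = {}"
    and edge: "\<And>v w. {v, w} \<in> edges G \<Longrightarrow> \<exists>x y. (x \<in> U v \<and> y \<in> U w \<or> x \<in> U w \<and> y \<in> U v) \<and> dart_adj a \<rho> x y"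
  shows "\<exists>t'\<le>t. gen G t'"
proof -
  let ?A = "dart_adj a \<rho>" and ?X = "verts G"
  have inv: "inv_on a (darts \<rho> V)" and fin: "finite V" using rot by (auto simp: rotation_def)
  have finX: "finite ?X" using G(1) by (simp add: simple_graph_def)
  have inD: "d \<in> darts \<rho> V" if "d \<in> set (\<rho> x)" "x \<in> V" for d x using that by (auto simp: darts_def)
  have sym: "?A y x" if "x \<in> V" "y \<in> V" "?A x y" for x y
    using that inv_onD(2)[OF inv] inD unfolding dart_adj_def by metis
  have "\<exists>U'. (\<forall>v\<in>?X. U v \<subseteq> U' v \<and> U' v \<subseteq> V \<and> U' v \<noteq> {} \<and> linked ?A (U' v)) \<and>
      (\<forall>v\<in>?X. \<forall>w\<in>?X. v \<noteq> w \<longrightarrow> U' v \<inter> U' w = {}) \<and> (\<Union>v\<in>?X. U' v) = V"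
    by (rule partition_extend[of V ?A ?X U, OF sym fin conn G(2) U disj])
  then obtain U' where U': "\<forall>v\<in>?X. U v \<subseteq> U' v \<and> U' v \<subseteq> V \<and> U' v \<noteq> {} \<and> linked ?A (U' v)"
    "\<forall>v\<in>?X. \<forall>w\<in>?X. v \<noteq> w \<longrightarrow> U' v \<inter> U' w = {}" "(\<Union>v\<in>?X. U' v) = V"
    by (elim exE conjE) (rule that)
  have U'V: "U' v \<subseteq> V" if "v \<in> ?X" for v using U'(1) that by blast
  have dU: "darts \<rho> (U' v) \<inter> darts \<rho> (U' w) = {}" if "v \<in> ?X" "w \<in> ?X" "v \<noteq> w" for v w
  proof -
    have "U' v \<inter> U' w = {}" using U'(2) that by blast
    then have "x \<notin> darts \<rho> (U' v)" if "x \<in> darts \<rho> (U' w)" for x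
      using rotation_disjoint[OF rot U'V[OF \<open>v \<in> ?X\<close>]] that U'V[OF \<open>w \<in> ?X\<close>] unfolding darts_def by blast
    then show ?thesis by blast
  qed
  have "\<exists>r. grows a \<rho> (U' v) r" if v: "v \<in> ?X" for v
  proof (rule grows_exists[OF rot U'V[OF v]])
    show "U' v \<noteq> {}" using U'(1) v by blast
    fix W assume W: "W \<subset> U' v" "W \<noteq> {}"
    have "linked ?A (U' v)" using U'(1) v by blast
    from linkedD[OF this W] obtain x y where "x \<in> W" "y \<in> U' v - W" "?A x y" by blast
    then show "\<exists>d\<in>darts \<rho> W. a d \<in> darts \<rho> (U' v - W)"
      unfolding dart_adj_def darts_def by blast
  qed
  then obtain r where r: "\<And>v. v \<in> ?X \<Longrightarrow> grows a \<rho> (U' v) (r v)" by metis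
  note pr = grows_props[OF rot r U'V]
  have "\<exists>q. walk a c q (r v) q \<and> c ` darts \<rho> (U' v) \<union> p ` U' v \<subseteq> insert q (c ` set (r v) \<union> (\<lambda>x. c (a x)) ` set (r v))"
    if "v \<in> ?X" for v by (rule grows_walk[OF rot w r[OF that] U'V[OF that]])
  then obtain q where q: "\<And>v. v \<in> ?X \<Longrightarrow> walk a c (q v) (r v) (q v)"
    "\<And>v. v \<in> ?X \<Longrightarrow> c ` darts \<rho> (U' v) \<union> p ` U' v \<subseteq> insert (q v) (c ` set (r v) \<union> (\<lambda>x. c (a x)) ` set (r v))"
    by metis
  let ?D = "darts r ?X" and ?T = "\<lambda>v. darts \<rho> (U' v) - set (r v)"
  have DV: "darts \<rho> V = (\<Union>v\<in>?X. darts \<rho> (U' v))" unfolding U'(3)[symmetric] by (auto simp: darts_def)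
  have rD: "set (r v) \<subseteq> darts \<rho> (U' v)" if "v \<in> ?X" for v using pr[OF that that] by blast
  have Dsplit: "darts \<rho> V = ?D \<union> (\<Union>v\<in>?X. ?T v)" "?D \<inter> (\<Union>v\<in>?X. ?T v) = {}"
  proof -
    show "darts \<rho> V = ?D \<union> (\<Union>v\<in>?X. ?T v)" unfolding DV using rD by (auto simp: darts_def[of r])
    show "?D \<inter> (\<Union>v\<in>?X. ?T v) = {}"
    proof (rule ccontr)
      assume "\<not> ?thesis"
      then obtain d v w where d: "v \<in> ?X" "w \<in> ?X" "d \<in> set (r v)" "d \<in> ?T w" by (auto simp: darts_def[of r])
      then have "v = w" using dU[of v w] rD[of v] by blast
      then show False using d by simp
    qed
  qed
  have invT: "inv_on a (\<Union>v\<in>?X. ?T v)"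
    using pr unfolding inv_on_def by blast
  have Deq: "?D = darts \<rho> V - (\<Union>v\<in>?X. ?T v)" using Dsplit by blast
  have invD: "inv_on a ?D" unfolding Deq by (rule inv_on_diff[OF inv invT]) (use Dsplit in blast)
  have finD: "finite (darts \<rho> V)" by (rule finite_darts[OF fin])
  \<comment> \<open>Two darts for each of the \<open>card (U' v) - 1\<close> contracted edges of a
    branch set.\<close>
  have cardT: "card (\<Union>v\<in>?X. ?T v) + 2 * card ?X = 2 * card V"
  proof -
    have "card (\<Union>v\<in>?X. ?T v) = (\<Sum>v\<in>?X. card (?T v))"
      using finX dU finD DV by (intro card_UN_disjoint) (auto intro: finite_subset)
    moreover have "card V = (\<Sum>v\<in>?X. card (U' v))"
      unfolding U'(3)[symmetric] using finX U' fin by (intro card_UN_disjoint) (auto intro: finite_subset)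
    moreover have "(\<Sum>v\<in>?X. card (?T v) + 2) = (\<Sum>v\<in>?X. 2 * card (U' v))"
      by (rule sum.cong) (use pr in auto)
    then have "(\<Sum>v\<in>?X. card (?T v)) + 2 * card ?X = 2 * (\<Sum>v\<in>?X. card (U' v))"
      unfolding sum.distrib sum_distrib_left by simp
    ultimately show ?thesis by simp
  qed
  have cardD: "card (darts \<rho> V) + 2 * card ?X = card ?D + 2 * card V"
  proof -
    have "card (darts \<rho> V) = card ?D + card (\<Union>v\<in>?X. ?T v)"
      unfolding Dsplit(1) using finD Dsplit by (intro card_Un_disjoint) (auto intro: finite_subset)
    then show ?thesis using cardT by simp
  qed
  have rotr: "rotation a r ?X"
    unfolding rotation_def
  proof (intro conjI ballI impI)
    show "finite ?X" "inv_on a ?D" by (fact finX, fact invD)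
    show "distinct (r v)" if "v \<in> ?X" for v using pr[OF that that] by blast
    show "set (r u) \<inter> set (r v) = {}" if "u \<in> ?X" "v \<in> ?X" "u \<noteq> v" for u v
      using dU[OF that] rD[OF that(1)] rD[OF that(2)] by blast
  qed
  let ?C = "c ` darts \<rho> V \<union> p ` V" and ?C1 = "c ` ?D \<union> q ` ?X"
  have colours: "?C \<subseteq> ?C1"
  proof -
    have "c ` darts \<rho> (U' v) \<union> p ` U' v \<subseteq> ?C1" if v: "v \<in> ?X" for v
    proof -
      have "set (r v) \<subseteq> ?D" using v by (auto simp: darts_def)
      moreover have "(\<lambda>x. c (a x)) ` set (r v) \<subseteq> (\<lambda>x. c (a x)) ` ?D" using calculation by blast
      ultimately have "insert (q v) (c ` set (r v) \<union> (\<lambda>x. c (a x)) ` set (r v)) \<subseteq> ?C1"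
        using v unfolding inv_on_image[OF invD] by blast
      then show ?thesis using q(2)[OF v] by blast
    qed
    then have "(\<Union>v\<in>?X. c ` darts \<rho> (U' v) \<union> p ` U' v) \<subseteq> ?C1" by (rule UN_least)
    moreover have "?C = (\<Union>v\<in>?X. c ` darts \<rho> (U' v) \<union> p ` U' v)" unfolding DV using U'(3) by blast
    ultimately show ?thesis by (simp only:)
  qed
  then have K1: "card ?C \<le> card ?C1" using finX finite_darts[OF finX, of r] by (intro card_mono) auto
  define E where "E = {{v, u} | v u. v \<in> ?X \<and> u \<in> ?X \<and> v \<noteq> u \<and> (\<exists>d\<in>set (r v). a d \<in> set (r u))}"
  let ?H = "(?X, E)"
  have sH: "simple_graph ?H" using finX by (auto simp: E_def simple_graph_def)
  \<comment> \<open>A dart between different branch sets is never contracted, because contracted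
    darts are closed under reversal within one branch set.\<close>
  have cross: "d \<in> set (r v)" if "v \<in> ?X" "u \<in> ?X" "v \<noteq> u" "d \<in> darts \<rho> (U' v)" "a d \<in> darts \<rho> (U' u)" for d v u
  proof (rule ccontr)
    assume "d \<notin> set (r v)"
    then have "a d \<in> ?T v" using that pr[of v] inv_onD(1)[of a "?T v" d] by blast
    then show False using dU[OF that(1-3)] that(5) by blast
  qed
  have EI: "{v, u} \<in> E" if vu: "v \<in> ?X" "u \<in> ?X" "v \<noteq> u" and xy: "x \<in> U' v" "y \<in> U' u" "?A x y" for v u x y
  proof -
    obtain d where d: "d \<in> set (\<rho> x)" "a d \<in> set (\<rho> y)" using xy(3) by (auto simp: dart_adj_def)
    then have dd: "d \<in> darts \<rho> (U' v)" "a d \<in> darts \<rho> (U' u)" using xy by (auto simp: darts_def)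
    have "a (a d) = d" using inv_onD(2)[OF inv] dd(1) U'V[OF vu(1)] by (auto simp: darts_def)
    then have "d \<in> set (r v)" "a d \<in> set (r u)"
      using cross[OF vu dd] cross[OF vu(2,1) vu(3)[symmetric] dd(2)] dd(1) by auto
    then show ?thesis using vu unfolding E_def by blast
  qed
  have cH: "connected_graph ?H"
  proof -
    obtain v0 where v0: "v0 \<in> ?X" using G(2) by blast
    let ?R = "(adj ?H)\<^sup>* `` {v0}"
    have "?R \<subseteq> ?X" using adj_rtrancl_verts[OF sH] v0 by auto
    moreover have "?X \<subseteq> ?R"
    proof (rule ccontr)
      assume "\<not> ?X \<subseteq> ?R"
      then obtain v1 where v1: "v1 \<in> ?X" "v1 \<notin> ?R" by blast
      let ?Z = "\<Union>v\<in>?R. U' v"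
      have "?Z \<subseteq> V" using U'V \<open>?R \<subseteq> ?X\<close> by blast
      moreover have "U' v1 \<inter> ?Z = {}"
      proof -
        have "U' v1 \<inter> U' v = {}" if v: "v \<in> ?R" for v
        proof -
          have "v \<in> ?X" "v1 \<noteq> v" using v v1(2) \<open>?R \<subseteq> ?X\<close> by blast+
          then show ?thesis using U'(2) v1(1) by blast
        qed
        then show ?thesis by blast
      qed
      moreover obtain z where "z \<in> U' v1" "z \<in> V" using U'(1) v1(1) by blast
      ultimately have "?Z \<subset> V" by blast
      have "U' v0 \<noteq> {}" "v0 \<in> ?R" using U'(1) v0 by blast+
      then have "?Z \<noteq> {}" by blast
      from linkedD[OF conn \<open>?Z \<subset> V\<close> this] obtain x y where xy: "x \<in> ?Z" "y \<in> V" "y \<notin> ?Z" "?A x y" by blast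
      obtain v where v: "v \<in> ?R" "x \<in> U' v" using xy(1) by blast
      have "y \<in> (\<Union>v\<in>?X. U' v)" using xy(2) U'(3) by simp
      then obtain u where u: "u \<in> ?X" "y \<in> U' u" by blast
      have "u \<notin> ?R" using xy(3) u(2) by blast
      moreover have "v \<in> ?X" "v \<noteq> u" using v(1) \<open>?R \<subseteq> ?X\<close> \<open>u \<notin> ?R\<close> by blast+
      ultimately have "{v, u} \<in> E" using EI[of v u x y] v u xy(4) by blast
      then have "(v, u) \<in> adj ?H" by (simp add: adj_def)
      then have "u \<in> ?R" using v(1) by (auto intro: rtrancl.rtrancl_into_rtrancl)
      then show False using \<open>u \<notin> ?R\<close> by simp
    qed
    ultimately show ?thesis using v0 by (intro connected_fromI[of v0]) auto
  qed
  have EG: "edges G \<subseteq> E"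
  proof
    fix e assume e: "e \<in> edges G"
    obtain v u where vu: "e = {v, u}" "v \<noteq> u" "v \<in> ?X" "u \<in> ?X" using simple_edge[OF G(1) e] .
    then obtain x y where "x \<in> U v \<and> y \<in> U u \<or> x \<in> U u \<and> y \<in> U v" "?A x y" using edge e by blast
    then have "x \<in> U' v \<and> y \<in> U' u \<or> x \<in> U' u \<and> y \<in> U' v" using U'(1) vu by blast
    then show "e \<in> E" using EI[of v u x y] EI[of u v x y] \<open>?A x y\<close> vu by (auto simp: insert_commute)
  qed
  define own where "own d = (THE v. v \<in> ?X \<and> d \<in> set (r v))" for d
  have own: "own d = v" if "v \<in> ?X" "d \<in> set (r v)" for d v
    unfolding own_def
  proof (rule the_equality)
    show "u = v" if "u \<in> ?X \<and> d \<in> set (r u)" for u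
      using dU[of u v] rD[of u] rD[of v] that \<open>v \<in> ?X\<close> \<open>d \<in> set (r v)\<close> by blast
  qed (use that in simp)
  have "\<exists>d. d \<in> ?D \<and> {own d, own (a d)} = e" if e: "e \<in> E" for e
  proof -
    obtain v u d where "e = {v, u}" "v \<in> ?X" "u \<in> ?X" "d \<in> set (r v)" "a d \<in> set (r u)"
      using e unfolding E_def by blast
    then have "d \<in> ?D" "{own d, own (a d)} = e" using own by (auto simp: darts_def)
    then show ?thesis by blast
  qed
  then obtain \<delta> where \<delta>: "\<And>e. e \<in> E \<Longrightarrow> \<delta> e \<in> ?D \<and> {own (\<delta> e), own (a (\<delta> e))} = e" by metis
  define \<pi> where "\<pi> d = (own d, own (a d))" for d
  \<comment> \<open>One dart is fixed for each pair of adjacent branch sets; the two orders of the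
    pair receive it and its reverse, so \<open>rep\<close> commutes with reversal.\<close>
  define rep where "rep x = (if own (\<delta> {fst x, snd x}) = fst x then \<delta> {fst x, snd x} else a (\<delta> {fst x, snd x}))" for x
  have rep: "rep x \<in> ?D \<and> \<pi> (rep x) = x \<and> rep (prod.swap x) = a (rep x)" if "x \<in> adj ?H" for x
  proof -
    obtain v u where x: "x = (v, u)" by (cases x)
    have vu: "v \<noteq> u" "{v, u} \<in> E" using adjD(3,5)[OF sH] that x by auto
    let ?d = "\<delta> {v, u}"
    have d: "?d \<in> ?D" "{own ?d, own (a ?d)} = {v, u}" using \<delta>[OF vu(2)] by auto
    have ad: "a ?d \<in> ?D" "a (a ?d) = ?d" using inv_onD[OF invD d(1)] by auto
    have "own ?d = v \<and> own (a ?d) = u \<or> own ?d = u \<and> own (a ?d) = v" using d(2) by (auto simp: doubleton_eq_iff)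
    then show ?thesis using x d ad vu by (auto simp: rep_def \<pi>_def insert_commute)
  qed
  let ?Y = "rep ` adj ?H"
  have adjsw: "prod.swap x \<in> adj ?H" "prod.swap x \<noteq> x" if "x \<in> adj ?H" for x
    using adjD(3,4)[OF sH, of "fst x" "snd x"] that by (auto simp: prod.swap_def prod_eq_iff)
  have invY: "inv_on a ?Y"
  proof -
    have "a (rep x) \<in> ?Y" if "x \<in> adj ?H" for x using rep[OF that] adjsw[OF that] by (metis image_eqI)
    then show ?thesis using rep inv_onD(2,3)[OF invD] unfolding inv_on_def by blast
  qed
  have YD: "?Y \<subseteq> ?D" using rep by blast
  have injY: "inj_on rep (adj ?H)" using rep by (metis inj_onI)
  obtain \<rho>' and c' :: "'d \<Rightarrow> nat" and p' where r': "rotation a \<rho>' ?X" "\<forall>v\<in>?X. walk a c' (p' v) (\<rho>' v) (p' v)"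
    "\<forall>v\<in>?X. set (\<rho>' v) = set (r v) \<inter> ?Y"
    "2 * card ?C1 + card ?Y \<le> 2 * card (c' ` ?Y \<union> p' ` ?X) + card ?D"
    using delete_darts[OF rotr q(1) YD invY] by blast
  have \<pi>rep: "rep (\<pi> d) = d" "\<pi> d \<in> adj ?H" if "d \<in> ?Y" for d using that rep by auto
  have rot': "rot_of ?H (\<lambda>v. map \<pi> (\<rho>' v))"
    unfolding rot_of_def
  proof (intro ballI conjI)
    fix v assume "v \<in> verts ?H"
    then have v: "v \<in> ?X" by simp
    have "inj_on \<pi> (set (\<rho>' v))"
    proof (rule inj_onI)
      fix d e assume "d \<in> set (\<rho>' v)" "e \<in> set (\<rho>' v)" "\<pi> d = \<pi> e"
      then show "d = e" using r'(3) v \<pi>rep(1) by (metis IntD2)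
    qed
    then show "distinct (map \<pi> (\<rho>' v))" using r'(1) v by (simp add: distinct_map rotation_def)
    show "set (map \<pi> (\<rho>' v)) = {d \<in> adj ?H. fst d = v}"
    proof (intro set_eqI iffI)
      fix x assume "x \<in> set (map \<pi> (\<rho>' v))"
      then obtain d where d: "x = \<pi> d" "d \<in> set (r v)" "d \<in> ?Y" using r'(3) v by auto
      then show "x \<in> {d \<in> adj ?H. fst d = v}" using \<pi>rep(2)[OF d(3)] own[OF v d(2)] by (simp add: \<pi>_def)
    next
      fix x assume x: "x \<in> {d \<in> adj ?H. fst d = v}"
      then have rx: "rep x \<in> ?D" "\<pi> (rep x) = x" using rep by auto
      then obtain u where u: "u \<in> ?X" "rep x \<in> set (r u)" by (auto simp: darts_def)
      then have "u = fst x" using own[OF u] rx(2) by (metis \<pi>_def fst_conv)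
      then have "rep x \<in> set (\<rho>' v)" using r'(3) v u x by auto
      then show "x \<in> set (map \<pi> (\<rho>' v))" using rx(2) by (metis image_eqI list.set_map)
    qed
  qed
  have walk': "walk prod.swap (c' \<circ> rep) (p' v) (map \<pi> (\<rho>' v)) (p' v)" if v: "v \<in> ?X" for v
  proof (rule walk_map)
    show "walk a c' (p' v) (\<rho>' v) (p' v)" using r'(2) v by blast
    fix d assume "d \<in> set (\<rho>' v)"
    then have d: "d \<in> ?Y" using r'(3) v by blast
    from rep[OF \<pi>rep(2)[OF d]] \<pi>rep(1)[OF d] show "rep (\<pi> d) = d \<and> rep (prod.swap (\<pi> d)) = a d" by simp
  qed
  have im: "(c' \<circ> rep) ` adj ?H \<union> p' ` ?X = c' ` ?Y \<union> p' ` ?X" by (simp add: image_comp)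
  have "card ?Y = 2 * card E" using card_image[OF injY] card_adj[OF sH] by simp
  then have "int (card E) + 2 \<le> int (card ?X) + int (card (c' ` ?Y \<union> p' ` ?X)) + t"
    using r'(4) K1 euler cardD by linarith
  then have "cert ?H t"
    unfolding cert_def using rot' walk' im
    by (intro exI[of _ "\<lambda>v. map \<pi> (\<rho>' v)"] exI[of _ "c' \<circ> rep"] exI[of _ p']) simp
  then have "gen ?H t" using sH cH by (rule gen_conn[rotated 2])
  from gen_subgraph[OF this, of "edges G"] EG show ?thesis by simp
qed

text \<open>Each arc is cut at one and two thirds. \<open>K v\<close> is the point of
  \<open>v\<close> with the adjacent thirds and \<open>M e\<close> the middle third, so that pieces
  meet only where an edge is incident with a vertex. Compactness will give positive distances in all
  other cases.\<close>

lemma embedding_pieces: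
  fixes S :: "'b::t2_space set" and G :: "'v graph"
  assumes G: "simple_graph G" and emb: "embeds_in G S"
  shows "\<exists>K M. (\<forall>v\<in>verts G. compact (K v) \<and> connected (K v) \<and> K v \<noteq> {} \<and> K v \<subseteq> S) \<and>
    (\<forall>e\<in>edges G. compact (M e) \<and> connected (M e) \<and> M e \<subseteq> S) \<and>
    (\<forall>v\<in>verts G. \<forall>w\<in>verts G. v \<noteq> w \<longrightarrow> K v \<inter> K w = {}) \<and>
    (\<forall>e\<in>edges G. \<forall>w\<in>verts G. w \<notin> e \<longrightarrow> K w \<inter> M e = {}) \<and>
    (\<forall>e\<in>edges G. \<forall>e'\<in>edges G. e \<noteq> e' \<longrightarrow> M e \<inter> M e' = {}) \<and>
    (\<forall>e\<in>edges G. \<forall>v\<in>e. K v \<inter> M e \<noteq> {})"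
proof -
  obtain p :: "'v \<Rightarrow> 'b" and \<gamma> where inj: "inj_on p (verts G)" and pS: "p ` verts G \<subseteq> S"
    and edge: "\<forall>e\<in>edges G. arc (\<gamma> e) \<and> path_image (\<gamma> e) \<subseteq> S \<and>
        {pathstart (\<gamma> e), pathfinish (\<gamma> e)} = p ` e \<and> path_image (\<gamma> e) \<inter> p ` verts G = p ` e"
    and cross: "\<forall>e\<in>edges G. \<forall>e'\<in>edges G. e \<noteq> e' \<longrightarrow> path_image (\<gamma> e) \<inter> path_image (\<gamma> e') = p ` (e \<inter> e')"
    using emb unfolding embeds_in_def by (elim exE conjE) (rule that)
  have sub: "e \<subseteq> verts G" if "e \<in> edges G" for e using G that by (simp add: simple_graph_def)
  \<comment> \<open>The parameter, 0 or 1, at which the arc of \<open>e\<close> passes through its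
    end \<open>v\<close>; for a vertex outside \<open>e\<close> the value is meaningless.\<close>
  define \<tau> where "\<tau> e v = (if \<gamma> e 0 = p v then 0 else 1 :: real)" for e v
  have \<tau>: "\<tau> e v = 0 \<or> \<tau> e v = 1" for e v by (simp add: \<tau>_def)
  have injg: "s = t" if "e \<in> edges G" "s \<in> {0..1}" "t \<in> {0..1}" "\<gamma> e s = \<gamma> e t" for e s t
    using edge that by (auto simp: arc_def inj_on_def)
  have \<tau>e: "\<gamma> e (\<tau> e v) = p v" if "e \<in> edges G" "v \<in> e" for e v
  proof -
    have "p v \<in> {\<gamma> e 0, \<gamma> e 1}" using edge that by (auto simp: pathstart_def pathfinish_def)
    then show ?thesis by (auto simp: \<tau>_def)
  qed
  have at: "x \<in> e \<and> t = \<tau> e x" if "e \<in> edges G" "x \<in> verts G" "t \<in> {0..1}" "\<gamma> e t = p x" for e x t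
  proof -
    have "p x \<in> path_image (\<gamma> e) \<inter> p ` verts G" using that by (auto simp: path_image_def intro: rev_image_eqI)
    then have "p x \<in> p ` e" using edge that(1) by blast
    then have x: "x \<in> e" using inj sub[OF that(1)] that(2) by (auto simp: inj_on_def)
    have "\<tau> e x \<in> {0..1}" using \<tau>[of e x] by auto
    then show ?thesis using x injg[OF that(1,3)] \<tau>e[OF that(1) x] that(4) by auto
  qed
  have meet: "\<exists>x. x \<in> e \<and> x \<in> e' \<and> x \<in> verts G \<and> t = \<tau> e x \<and> s = \<tau> e' x"
    if e: "e \<in> edges G" "e' \<in> edges G" "e \<noteq> e'" and t: "t \<in> {0..1}" "s \<in> {0..1}" "\<gamma> e t = \<gamma> e' s" for e e' t s
  proof -
    have "\<gamma> e t \<in> path_image (\<gamma> e) \<inter> path_image (\<gamma> e')" using t unfolding path_image_def by (metis IntI image_eqI)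
    then obtain x where x: "x \<in> e \<inter> e'" "\<gamma> e t = p x" using cross e by blast
    then have "x \<in> verts G" using sub e by blast
    moreover have "x \<in> e \<and> t = \<tau> e x" "x \<in> e' \<and> s = \<tau> e' x"
      using at[OF e(1) calculation t(1)] at[OF e(2) calculation t(2)] x(2) t(3) by simp_all
    ultimately show ?thesis by blast
  qed
  have \<tau>ne: "\<tau> e u \<noteq> \<tau> e v" if "e \<in> edges G" "u \<in> e" "v \<in> e" "u \<noteq> v" for e u v
    using \<tau>e[OF that(1,2)] \<tau>e[OF that(1,3)] inj sub[OF that(1)] that by (metis inj_onD subsetD)
  \<comment> \<open>The third of the parameter interval next to that end.\<close>
  define T where "T e v = {0..1} \<inter> cball (\<tau> e v) (1/3)" for e v
  have Tends: "T e u \<inter> T e v = {}" if "e \<in> edges G" "u \<in> e" "v \<in> e" "u \<noteq> v" for e u v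
    using \<tau>ne[OF that] \<tau>[of e u] \<tau>[of e v] by (auto simp: T_def dist_real_def)
  have T\<tau>: "t = \<tau> e x \<Longrightarrow> t \<in> T e v \<Longrightarrow> \<tau> e x = \<tau> e v" for t e x v
    using \<tau>[of e x] \<tau>[of e v] by (auto simp: T_def dist_real_def)
  have T01: "t \<in> T e v \<Longrightarrow> t \<in> {0..1}" for t e v by (simp add: T_def)
  define K where "K v = insert (p v) (\<Union>e\<in>{e \<in> edges G. v \<in> e}. \<gamma> e ` T e v)" for v
  define M where "M e = \<gamma> e ` {1/3..2/3}" for e
  have contg: "continuous_on {0..1} (\<gamma> e)" if "e \<in> edges G" for e
    using edge that by (auto simp: arc_def path_def)
  have img: "\<gamma> e ` X \<subseteq> S" if "e \<in> edges G" "X \<subseteq> {0..1}" for e X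
  proof -
    have "\<gamma> e ` {0..1} \<subseteq> S" using edge that(1) unfolding path_image_def by simp
    then show ?thesis using that(2) by (meson image_mono order_trans)
  qed
  have c1: "compact (\<gamma> e ` T e v) \<and> connected (\<gamma> e ` T e v)" if "e \<in> edges G" for e v
  proof -
    have "continuous_on (T e v) (\<gamma> e)" using contg[OF that] by (rule continuous_on_subset) (simp add: T_def)
    moreover have "compact (T e v)" "convex (T e v)" unfolding T_def by (auto intro: convex_Int)
    ultimately show ?thesis using compact_continuous_image connected_continuous_image convex_connected by blast
  qed
  have pT: "p v \<in> \<gamma> e ` T e v" if "e \<in> edges G" "v \<in> e" for e v
    using \<tau>e[OF that] \<tau>[of e v] by (intro image_eqI[of _ _ "\<tau> e v"]) (auto simp: T_def)
  have k1: "compact (K v) \<and> connected (K v) \<and> K v \<noteq> {} \<and> K v \<subseteq> S" if "v \<in> verts G" for v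
  proof (intro conjI)
    have "K v = {p v} \<union> (\<Union>e\<in>{e \<in> edges G. v \<in> e}. \<gamma> e ` T e v)" by (simp add: K_def)
    moreover have "finite {e \<in> edges G. v \<in> e}" using simple_finite_edges[OF G] by simp
    ultimately show "compact (K v)" using c1 by (auto intro!: compact_UN compact_insert)
    have "K v = \<Union> (insert {p v} ((\<lambda>e. \<gamma> e ` T e v) ` {e \<in> edges G. v \<in> e}))" by (simp add: K_def)
    also have "connected \<dots>"
      by (rule connected_Union) (use c1 pT in auto)
    finally show "connected (K v)" .
    show "K v \<noteq> {}" by (simp add: K_def)
    have "\<gamma> e ` T e v \<subseteq> S" if "e \<in> edges G" for e by (rule img[OF that]) (simp add: T_def)
    then show "K v \<subseteq> S" using pS that unfolding K_def by blast
  qed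
  have m1: "compact (M e) \<and> connected (M e) \<and> M e \<subseteq> S" if "e \<in> edges G" for e
  proof -
    have "continuous_on {1/3..2/3} (\<gamma> e)" using contg[OF that] by (rule continuous_on_subset) auto
    then show ?thesis unfolding M_def using img[OF that, of "{1/3..2/3}"]
      by (auto intro: compact_continuous_image connected_continuous_image)
  qed
  have Kcase: "q = p v \<or> (\<exists>e t. e \<in> edges G \<and> v \<in> e \<and> t \<in> T e v \<and> q = \<gamma> e t)" if "q \<in> K v" for q v
    using that by (auto simp: K_def)
  have Knv: "x = v" if "p x \<in> K v" "x \<in> verts G" "v \<in> verts G" for x v
    using Kcase[OF that(1)]
  proof (elim disjE exE conjE)
    show "p x = p v \<Longrightarrow> x = v" using inj that by (auto simp: inj_on_def)
    fix e t assume e: "e \<in> edges G" "v \<in> e" "t \<in> T e v" "p x = \<gamma> e t"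
    then have "x \<in> e \<and> t = \<tau> e x" using at[OF e(1) that(2) T01[OF e(3)]] by simp
    then show "x = v" using T\<tau>[of t e x v] e \<tau>ne[of e x v] by auto
  qed
  have KK: "K v \<inter> K w = {}" if vw: "v \<in> verts G" "w \<in> verts G" "v \<noteq> w" for v w
  proof (rule ccontr)
    assume "K v \<inter> K w \<noteq> {}"
    then obtain q where q: "q \<in> K v" "q \<in> K w" by blast
    have "q \<noteq> p v" "q \<noteq> p w" using Knv[of v w] Knv[of w v] q vw by auto
    then have "\<exists>e t. e \<in> edges G \<and> v \<in> e \<and> t \<in> T e v \<and> q = \<gamma> e t"
      "\<exists>e t. e \<in> edges G \<and> w \<in> e \<and> t \<in> T e w \<and> q = \<gamma> e t"
      using Kcase[OF q(1)] Kcase[OF q(2)] by simp_all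
    then obtain e t e' s where e: "e \<in> edges G" "v \<in> e" "t \<in> T e v" "q = \<gamma> e t"
      "e' \<in> edges G" "w \<in> e'" "s \<in> T e' w" "q = \<gamma> e' s"
      by (elim exE conjE) (rule that)
    show False
    proof (cases "e = e'")
      case True
      have "\<gamma> e s = \<gamma> e t" using e(4,8) True by simp
      from injg[OF e(1) T01[OF e(7)] T01[OF e(3)] this] have "t \<in> T e w" using e(7) True by simp
      then show ?thesis using Tends[OF e(1,2) _ vw(3)] e(3,6) True by blast
    next
      case False
      have "\<gamma> e t = \<gamma> e' s" using e(4,8) by simp
      from meet[OF e(1,5) False T01[OF e(3)] T01[OF e(7)] this]
      obtain x where x: "x \<in> verts G" "t = \<tau> e x" "x \<in> e" by blast
      then have "q = p x" using e(4) \<tau>e[OF e(1) x(3)] by simp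
      then have "x = v" "x = w" using Knv[OF _ x(1) vw(1)] Knv[OF _ x(1) vw(2)] q by simp_all
      then show ?thesis using vw(3) by simp
    qed
  qed
  have mid: "\<not> (t = \<tau> e x \<and> t \<in> {1/3..2/3})" for t e x using \<tau>[of e x] by auto
  have Mno: "p x \<notin> M e" if "e \<in> edges G" "x \<in> verts G" for x e
  proof
    assume "p x \<in> M e"
    then obtain t where t: "t \<in> {1/3..2/3}" "\<gamma> e t = p x" by (auto simp: M_def)
    then show False using at[OF that, of t] mid[of t e x] by auto
  qed

  have EM: "\<gamma> e t \<notin> M e'" if "e \<in> edges G" "e' \<in> edges G" "e \<noteq> e'" "t \<in> {0..1}" for e e' t
  proof
    assume "\<gamma> e t \<in> M e'"
    then obtain s where s: "s \<in> {1/3..2/3}" "\<gamma> e t = \<gamma> e' s" by (auto simp: M_def)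
    then have "s \<in> {0..1}" by auto
    from meet[OF that(1-4) this s(2)] obtain x where "s = \<tau> e' x" by blast
    then show False using mid[of s e' x] s by auto
  qed
  have KM: "K w \<inter> M e = {}" if "e \<in> edges G" "w \<in> verts G" "w \<notin> e" for e w
  proof -
    have "q \<notin> M e" if "q \<in> K w" for q
      using Kcase[OF that]
    proof (elim disjE exE conjE)
      show "q = p w \<Longrightarrow> q \<notin> M e" using Mno \<open>e \<in> edges G\<close> \<open>w \<in> verts G\<close> by blast
      fix e' t assume "e' \<in> edges G" "w \<in> e'" "t \<in> T e' w" "q = \<gamma> e' t"
      then show "q \<notin> M e" using EM[of e' e t] T01[of t e' w] \<open>e \<in> edges G\<close> \<open>w \<notin> e\<close> by auto
    qed
    then show ?thesis by blast
  qed
  have MM: "M e \<inter> M e' = {}" if "e \<in> edges G" "e' \<in> edges G" "e \<noteq> e'" for e e'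
  proof -
    have "q \<notin> M e'" if "q \<in> M e" for q
    proof -
      obtain t where "t \<in> {1/3..2/3}" "q = \<gamma> e t" using \<open>q \<in> M e\<close> by (auto simp: M_def)
      then show ?thesis using EM[OF \<open>e \<in> edges G\<close> \<open>e' \<in> edges G\<close> \<open>e \<noteq> e'\<close>, of t] by auto
    qed
    then show ?thesis by blast
  qed
  have KMe: "K v \<inter> M e \<noteq> {}" if "e \<in> edges G" "v \<in> e" for e v
  proof -
    define t where "t = (if \<tau> e v = 0 then 1/3 else 2/3 :: real)"
    have "t \<in> T e v" "t \<in> {1/3..2/3}" using \<tau>[of e v] by (auto simp: t_def T_def dist_real_def)
    then have "\<gamma> e t \<in> K v" "\<gamma> e t \<in> M e" using that by (auto simp: K_def M_def)
    then show ?thesis by blast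
  qed
  show ?thesis
    by (rule exI[of _ K], rule exI[of _ M]) (intro conjI ballI impI k1[THEN conjunct1] k1[THEN conjunct2, THEN conjunct1]
      k1[THEN conjunct2, THEN conjunct2, THEN conjunct1] k1[THEN conjunct2, THEN conjunct2, THEN conjunct2]
      m1[THEN conjunct1] m1[THEN conjunct2, THEN conjunct1] m1[THEN conjunct2, THEN conjunct2] KK KM MM KMe)
qed

text \<open>The cells are so small that none meets two pieces that have to be kept apart. Those
  meeting \<open>K v\<close> start the branch set of \<open>v\<close>; those along
  \<open>M e\<close> are added to one end of \<open>e\<close>, as far as the branch set of the other
  end. Different edges use different cells, so the branch sets stay disjoint.\<close>

lemma branch_gen:
  fixes \<rho> :: "'u \<Rightarrow> 'd list" and c :: "'d \<Rightarrow> nat" and G :: "'v graph" and cell :: "'u \<Rightarrow> 'p::topological_space set"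
  assumes rot: "rotation a \<rho> V" and w: "\<And>u. u \<in> V \<Longrightarrow> walk a c (p u) (\<rho> u) (p u)"
    and euler: "int (card (darts \<rho> V)) + 4 \<le> 2 * int (card V) + 2 * int (card (c ` darts \<rho> V \<union> p ` V)) + 2 * t"
    and conn: "linked (dart_adj a \<rho>) V"
    and cl: "\<And>u. u \<in> V \<Longrightarrow> closed (cell u)" and cov: "S \<subseteq> \<Union> (cell ` V)"
    and loc: "\<And>q. q \<in> S \<Longrightarrow> linked (dart_adj a \<rho>) {u \<in> V. q \<in> cell u}"
    and G: "simple_graph G" "verts G \<noteq> {}"
    and K: "\<And>v. v \<in> verts G \<Longrightarrow> connected (K v) \<and> K v \<noteq> {} \<and> K v \<subseteq> S"
    and M: "\<And>e. e \<in> edges G \<Longrightarrow> connected (M e) \<and> M e \<subseteq> S"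
    and KK: "\<And>v w u. v \<in> verts G \<Longrightarrow> w \<in> verts G \<Longrightarrow> v \<noteq> w \<Longrightarrow> u \<in> V \<Longrightarrow> cell u \<inter> K v = {} \<or> cell u \<inter> K w = {}"
    and KM: "\<And>e w u. e \<in> edges G \<Longrightarrow> w \<in> verts G \<Longrightarrow> w \<notin> e \<Longrightarrow> u \<in> V \<Longrightarrow> cell u \<inter> K w = {} \<or> cell u \<inter> M e = {}"
    and MM: "\<And>e e' u. e \<in> edges G \<Longrightarrow> e' \<in> edges G \<Longrightarrow> e \<noteq> e' \<Longrightarrow> u \<in> V \<Longrightarrow> cell u \<inter> M e = {} \<or> cell u \<inter> M e' = {}"
    and KMe: "\<And>e v. e \<in> edges G \<Longrightarrow> v \<in> e \<Longrightarrow> K v \<inter> M e \<noteq> {}"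
  shows "\<exists>t'\<le>t. gen G t'"
proof -
  let ?A = "dart_adj a \<rho>"
  have inv: "inv_on a (darts \<rho> V)" and fin: "finite V" using rot by (auto simp: rotation_def)
  have inD: "d \<in> darts \<rho> V" if "d \<in> set (\<rho> x)" "x \<in> V" for d x using that by (auto simp: darts_def)
  have sym: "?A y x" if "x \<in> V" "y \<in> V" "?A x y" for x y
    using that inv_onD(2)[OF inv] inD unfolding dart_adj_def by metis
  define B where "B v = {u \<in> V. cell u \<inter> K v \<noteq> {}}" for v
  define C where "C e = {u \<in> V. cell u \<inter> M e \<noteq> {}}" for e
  have nerve: "linked ?A {u \<in> V. cell u \<inter> L \<noteq> {}}" if "connected L" "L \<subseteq> S" for L
    by (rule linked_nerve[OF fin cl that(1)]) (use cov loc that in blast)+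
  have B: "linked ?A (B v)" "B v \<noteq> {}" "B v \<subseteq> V" if "v \<in> verts G" for v
  proof -
    show "linked ?A (B v)" unfolding B_def using K[OF that] by (intro nerve) auto
    have "\<exists>q. q \<in> K v \<and> q \<in> S" using K[OF that] by blast
    then obtain q where "q \<in> K v" "q \<in> S" by blast
    moreover from this obtain u where "u \<in> V" "q \<in> cell u" using cov by blast
    ultimately show "B v \<noteq> {}" by (auto simp: B_def)
    show "B v \<subseteq> V" by (auto simp: B_def)
  qed
  have C: "linked ?A (C e)" "C e \<subseteq> V" if "e \<in> edges G" for e
  proof -
    show "linked ?A (C e)" unfolding C_def using M[OF that] by (intro nerve) auto
    show "C e \<subseteq> V" by (auto simp: C_def)
  qed
  have BB: "B v \<inter> B w = {}" if "v \<in> verts G" "w \<in> verts G" "v \<noteq> w" for v w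
    using KK[OF that] by (auto simp: B_def)
  have BC: "B w \<inter> C e = {}" if "e \<in> edges G" "w \<in> verts G" "w \<notin> e" for e w
    using KM[OF that] by (auto simp: B_def C_def)
  have CC: "C e \<inter> C e' = {}" if "e \<in> edges G" "e' \<in> edges G" "e \<noteq> e'" for e e'
    using MM[OF that] by (auto simp: C_def)
  have BCe: "B v \<inter> C e \<noteq> {}" if "e \<in> edges G" "v \<in> e" for e v
  proof -
    from KMe[OF that] obtain q where q: "q \<in> K v" "q \<in> M e" by blast
    then have "q \<in> S" using M[OF that(1)] by blast
    then obtain u where "u \<in> V" "q \<in> cell u" using cov by blast
    then show ?thesis using q by (auto simp: B_def C_def)
  qed
  have "\<exists>v w R. e = {v, w} \<and> v \<noteq> w \<and> v \<in> verts G \<and> w \<in> verts G \<and> R \<subseteq> C e - B w \<and>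
      linked ?A (B v \<union> R) \<and> (\<exists>x\<in>B v \<union> R. \<exists>y\<in>B w. ?A x y)" if e: "e \<in> edges G" for e
  proof -
    obtain v w where vw: "e = {v, w}" "v \<noteq> w" "v \<in> verts G" "w \<in> verts G" using simple_edge[OF G(1) e] .
    have "finite (C e)" using C(2)[OF e] fin finite_subset by blast
    from linked_connect[of V ?A "C e" "B v" "B w", OF sym this B(3)[OF vw(3)] C(2)[OF e] B(1)[OF vw(3)] C(1)[OF e]]
      BCe[OF e, of v] BCe[OF e, of w] BB[OF vw(3,4,2)] vw(1)
    have "\<exists>R\<subseteq>C e - B w. linked ?A (B v \<union> R) \<and> (\<exists>x\<in>B v \<union> R. \<exists>y\<in>B w. ?A x y)" by (simp add: Int_commute)
    then show ?thesis using vw by blast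
  qed
  then obtain ow ot R where R: "\<And>e. e \<in> edges G \<Longrightarrow> e = {ow e, ot e} \<and> ow e \<noteq> ot e \<and> ow e \<in> verts G \<and> ot e \<in> verts G \<and>
      R e \<subseteq> C e - B (ot e) \<and> linked ?A (B (ow e) \<union> R e) \<and> (\<exists>x\<in>B (ow e) \<union> R e. \<exists>y\<in>B (ot e). ?A x y)"
    by metis
  define U where "U v = B v \<union> (\<Union>e\<in>{e \<in> edges G. ow e = v}. R e)" for v
  have BU: "B v \<subseteq> U v" for v by (auto simp: U_def)
  have RU: "B (ow e) \<union> R e \<subseteq> U (ow e)" if "e \<in> edges G" for e using that by (auto simp: U_def)
  have BR: "B w \<inter> R e = {}" if "e \<in> edges G" "w \<in> verts G" "w \<noteq> ow e" for e w
  proof (cases "w \<in> e")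
    case True
    then have "w = ot e" using R[OF that(1)] that(3) by auto
    then show ?thesis using R[OF that(1)] by blast
  next
    case False
    then show ?thesis using BC[OF that(1,2)] R[OF that(1)] by blast
  qed
  show ?thesis
  proof (rule minor_gen[OF rot w euler conn G])
    fix v assume v: "v \<in> verts G"
    obtain z where z: "z \<in> B v" using B(2)[OF v] by blast
    have "U v = (\<Union>W\<in>insert (B v) ((\<lambda>e. B v \<union> R e) ` {e \<in> edges G. ow e = v}). W)" by (auto simp: U_def)
    also have "linked ?A \<dots>"
      by (rule linked_Union[of _ _ _ z]) (use B(1)[OF v] R z in auto)
    finally have "linked ?A (U v)" .
    moreover have "R e \<subseteq> V" if "e \<in> edges G" for e using R[OF that] C(2)[OF that] by blast
    then have "U v \<subseteq> V" using B(3)[OF v] by (auto simp: U_def)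
    ultimately show "U v \<subseteq> V \<and> U v \<noteq> {} \<and> linked ?A (U v)" using z BU by blast
  next
    fix v w assume vw: "v \<in> verts G" "w \<in> verts G" "v \<noteq> w"
    show "U v \<inter> U w = {}"
    proof (rule ccontr)
      assume "U v \<inter> U w \<noteq> {}"
      then obtain x where "x \<in> U v" "x \<in> U w" by blast
      then consider "x \<in> B v" "x \<in> B w" | e where "x \<in> B v" "e \<in> edges G" "ow e = w" "x \<in> R e"
        | e where "x \<in> B w" "e \<in> edges G" "ow e = v" "x \<in> R e"
        | e e' where "e \<in> edges G" "ow e = v" "x \<in> R e" "e' \<in> edges G" "ow e' = w" "x \<in> R e'"
        unfolding U_def by blast
      then show False
      proof cases
        case 1
        then show ?thesis using BB[OF vw] by blast
      next
        case 2
        then show ?thesis using BR[OF 2(2) vw(1)] vw(3) by auto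
      next
        case 3
        then show ?thesis using BR[OF 3(2) vw(2)] vw(3) by auto
      next
        case 4
        then have "e \<noteq> e'" using vw(3) by auto
        then show ?thesis using CC[OF 4(1,4)] R[OF 4(1)] R[OF 4(4)] 4(3,6) by blast
      qed
    qed
  next
    fix v w assume e: "{v, w} \<in> edges G"
    from R[OF e] obtain x y where xy: "x \<in> B (ow {v, w}) \<union> R {v, w}" "y \<in> B (ot {v, w})" "?A x y" by blast
    have "x \<in> U (ow {v, w})" "y \<in> U (ot {v, w})" using RU[OF e] BU xy by blast+
    moreover have "{v, w} = {ow {v, w}, ot {v, w}}" using R[OF e] by blast
    then have "(v = ow {v, w} \<and> w = ot {v, w}) \<or> (v = ot {v, w} \<and> w = ow {v, w})" by (meson doubleton_eq_iff)
    ultimately show "\<exists>x y. (x \<in> U v \<and> y \<in> U w \<or> x \<in> U w \<and> y \<in> U v) \<and> ?A x y" using xy(3) by metis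
  qed
qed

section \<open>A lattice on the surface\<close>

text \<open>Adjacency is assumed in both directions because either \<open>Z\<close> or its
  complement omits \<open>z\<close>; a least element of that one steps into the other.\<close>

lemma linked_descent:
  fixes \<mu> :: "'u \<Rightarrow> nat"
  assumes z: "z \<in> W" and step: "\<And>x. x \<in> W \<Longrightarrow> x \<noteq> z \<Longrightarrow> \<exists>y\<in>W. A x y \<and> A y x \<and> \<mu> y < \<mu> x"
  shows "linked A W"
  unfolding linked_def
proof (intro allI impI)
  have least: "\<exists>x\<in>X. \<exists>y\<in>W - X. A x y \<and> A y x" if X: "X \<subseteq> W" "X \<noteq> {}" "z \<notin> X" for X
  proof -
    obtain x where x: "x \<in> X" "\<And>y. y \<in> X \<Longrightarrow> \<mu> x \<le> \<mu> y" using X(2) ex_has_least_nat[of "\<lambda>x. x \<in> X" _ \<mu>] by blast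
    then have "x \<in> W" "x \<noteq> z" using X by auto
    from step[OF this] obtain y where "y \<in> W" "A x y" "A y x" "\<mu> y < \<mu> x" by blast
    then show ?thesis using x by force
  qed
  fix Z assume Z: "Z \<subset> W" "Z \<noteq> {}"
  show "\<exists>x\<in>Z. \<exists>y\<in>W - Z. A x y"
  proof (cases "z \<in> Z")
    case True
    have "W - (W - Z) = Z" "W - Z \<noteq> {}" using Z by auto
    then show ?thesis using least[of "W - Z"] True by auto
  next
    case False
    then show ?thesis using least[of Z] Z by auto
  qed
qed

lemma linked_diameter2:
  assumes "\<And>x y. x \<in> W \<Longrightarrow> y \<in> W \<Longrightarrow> \<exists>m\<in>W. (x = m \<or> A x m) \<and> (m = y \<or> A m y)"
  shows "linked A W"
  unfolding linked_def
proof (intro allI impI)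
  fix Z assume Z: "Z \<subset> W" "Z \<noteq> {}"
  then obtain x y where xy: "x \<in> Z" "x \<in> W" "y \<in> W" "y \<notin> Z" by blast
  from assms[OF xy(2,3)] obtain m where "m \<in> W" "x = m \<or> A x m" "m = y \<or> A m y" by blast
  then show "\<exists>x\<in>Z. \<exists>y\<in>W - Z. A x y" using xy by (cases "m \<in> Z") auto
qed

section \<open>Pixels, with directions numbered counterclockwise from the right\<close>

definition nb :: "int \<times> int \<Rightarrow> nat \<Rightarrow> int \<times> int" where
  "nb u d = (if d = 0 then (fst u + 1, snd u) else if d = 1 then (fst u, snd u + 1)
    else if d = 2 then (fst u - 1, snd u) else (fst u, snd u - 1))"

text \<open>A unit square with pixels as corners is named after its lower left corner; \<open>sqr u d\<close> lies to
  the right of the ray leaving \<open>u\<close> in direction \<open>d\<close>.\<close>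

definition sqr :: "int \<times> int \<Rightarrow> nat \<Rightarrow> int \<times> int" where
  "sqr u d = (if d = 0 then (fst u, snd u - 1) else if d = 1 then u
    else if d = 2 then (fst u - 1, snd u) else (fst u - 1, snd u - 1))"

definition opp :: "nat \<Rightarrow> nat" where
  "opp d = (if d = 0 then 2 else if d = 1 then 3 else if d = 2 then 0 else 1)"

definition corners :: "int \<times> int \<Rightarrow> (int \<times> int) set" where
  "corners x = {x, (fst x + 1, snd x), (fst x, snd x + 1), (fst x + 1, snd x + 1)}"

lemma dir_cases: "(d::nat) < 4 \<Longrightarrow> d = 0 \<or> d = 1 \<or> d = 2 \<or> d = 3" by auto

lemma nb_opp: "d < 4 \<Longrightarrow> nb (nb u d) (opp d) = u" "d < 4 \<Longrightarrow> opp d < 4" "d < 4 \<Longrightarrow> opp (opp d) = d"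
  by (auto simp: nb_def opp_def dest!: dir_cases)

text \<open>\<open>a\<close> and \<open>b\<close> are the side lengths of a rectangle,
  \<open>n\<close> that of each square hole, \<open>(p k, q)\<close> its lower left corner. The
  strict inequalities leave a free column or row between holes and along the border.\<close>

locale holed_grid =
  fixes g :: nat and n a b q :: int and p :: "nat \<Rightarrow> int"
  assumes n1: "1 \<le> n" and a1: "1 \<le> a" and p1: "\<And>k. k < g \<Longrightarrow> 1 \<le> p k" and pa: "\<And>k. k < g \<Longrightarrow> p k + n < a"
    and q1: "1 \<le> q" and qb: "q + n < b" and sep: "\<And>k l. k < l \<Longrightarrow> l < g \<Longrightarrow> p k + n < p l"
begin

definition hole :: "nat \<Rightarrow> (int \<times> int) set" where
  "hole k = {p k..<p k + n} \<times> {q..<q + n}"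

definition pix :: "(int \<times> int) set" where
  "pix = {0..<a} \<times> {0..<b} - (\<Union>k<g. hole k)"

definition V :: "((int \<times> int) \<times> bool) set" where "V = pix \<times> UNIV"

text \<open>A dart that would leave the region crosses to the same pixel on the other sheet. Gluing
  two copies of a disc with \<open>g\<close> holes along all \<open>g + 1\<close> boundary curves
  gives the surface of genus \<open>g\<close>.\<close>

definition \<alpha> :: "(int \<times> int) \<times> bool \<times> nat \<Rightarrow> (int \<times> int) \<times> bool \<times> nat" where
  "\<alpha> x = (case x of (u, s, d) \<Rightarrow> if nb u d \<in> pix then (nb u d, s, opp d) else (u, \<not> s, d))"

text \<open>Counterclockwise order on one sheet and clockwise order on the other make the glued
  surface consistently oriented.\<close>

definition \<rho> :: "(int \<times> int) \<times> bool \<Rightarrow> ((int \<times> int) \<times> bool \<times> nat) list" where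
  "\<rho> x = map (\<lambda>d. (fst x, snd x, d)) (if snd x then [0, 1, 2, 3] else [0, 3, 2, 1])"

definition full :: "int \<times> int \<Rightarrow> bool" where "full x \<longleftrightarrow> corners x \<subseteq> pix"

text \<open>The faces come from unit squares between pixels. A square with all four corners present
  gives a face on each sheet; an incomplete one straddles the boundary and has one colour for both
  sheets.\<close>

definition tag :: "bool \<Rightarrow> int \<times> int \<Rightarrow> (int \<times> int) \<times> nat" where
  "tag s x = (x, if full x then (if s then 1 else 2) else 0)"

text \<open>On the reversed sheet the square on the left of the ray replaces the one on the right,
  whence the shift by one.\<close>

definition col :: "(int \<times> int) \<times> bool \<times> nat \<Rightarrow> (int \<times> int) \<times> nat" where
  "col x = (case x of (u, s, d) \<Rightarrow> tag s (sqr u (if s then d else (d + 1) mod 4)))"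

text \<open>Both squares beside a missing neighbour are incomplete, so a change of sheet does not
  change the colour.\<close>

lemma col_jump:
  assumes "nb u d \<notin> pix" "d < 4" shows "tag True (sqr u d) = tag False (sqr u d)"
    "tag True (sqr u ((d + 1) mod 4)) = tag False (sqr u ((d + 1) mod 4))"
proof -
  have "nb u d \<in> corners (sqr u d)" "nb u d \<in> corners (sqr u ((d + 1) mod 4))"
    using dir_cases[OF assms(2)] by (auto simp: nb_def sqr_def corners_def prod_eq_iff)
  then have "\<not> full (sqr u d)" "\<not> full (sqr u ((d + 1) mod 4))" using assms(1) by (auto simp: full_def)
  then show "tag True (sqr u d) = tag False (sqr u d)"
    "tag True (sqr u ((d + 1) mod 4)) = tag False (sqr u ((d + 1) mod 4))" by (auto simp: tag_def)
qed

lemma col_next: "d < 4 \<Longrightarrow> col (\<alpha> (u, True, d)) = col (u, True, (d + 1) mod 4)"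
  "d < 4 \<Longrightarrow> col (\<alpha> (u, False, (d + 1) mod 4)) = col (u, False, d)"
proof -
  assume d: "d < 4"
  show "col (\<alpha> (u, True, d)) = col (u, True, (d + 1) mod 4)"
  proof (cases "nb u d \<in> pix")
    case True
    moreover have "sqr (nb u d) (opp d) = sqr u ((d + 1) mod 4)"
      using dir_cases[OF d] by (auto simp: nb_def sqr_def opp_def prod_eq_iff)
    ultimately show ?thesis by (simp add: \<alpha>_def col_def)
  next
    case False
    then show ?thesis using col_jump(2)[OF False d] by (simp add: \<alpha>_def col_def)
  qed
  let ?d = "(d + 1) mod 4"
  have d': "?d < 4" by simp
  show "col (\<alpha> (u, False, ?d)) = col (u, False, d)"
  proof (cases "nb u ?d \<in> pix")
    case True
    moreover have "sqr (nb u ?d) ((opp ?d + 1) mod 4) = sqr u ?d"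
      using dir_cases[OF d] by (auto simp: nb_def sqr_def opp_def prod_eq_iff)
    ultimately show ?thesis by (simp add: \<alpha>_def col_def)
  next
    case False
    then show ?thesis using col_jump(1)[OF False d'] by (simp add: \<alpha>_def col_def)
  qed
qed

lemma walk_\<rho>: "walk \<alpha> (to_nat \<circ> col) (to_nat (col (fst x, snd x, 0))) (\<rho> x) (to_nat (col (fst x, snd x, 0)))"
proof -
  have m: "(0 + 1) mod 4 = (1::nat)" "(1 + 1) mod 4 = (2::nat)" "(2 + 1) mod 4 = (3::nat)" "(3 + 1) mod 4 = (0::nat)"
    by simp_all
  note c = col_next[of 0 "fst x", unfolded m] col_next[of 1 "fst x", unfolded m]
    col_next[of 2 "fst x", unfolded m] col_next[of 3 "fst x", unfolded m]
  have l: "0 < (4::nat)" "1 < (4::nat)" "2 < (4::nat)" "3 < (4::nat)" by simp_all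
  show ?thesis
    by (cases "snd x") (simp_all only: \<rho>_def if_True if_False list.map walk.simps comp_apply c l simp_thms)
qed

lemma finite_pix: "finite pix" by (simp add: pix_def)

lemma set_\<rho>: "set (\<rho> x) = (\<lambda>d. (fst x, snd x, d)) ` {..<4}"
proof -
  have "{..<4} = {0, 1, 2, 3 :: nat}" by auto
  then show ?thesis by (auto simp: \<rho>_def)
qed

lemma darts_V: "darts \<rho> V = {(u, s, d). u \<in> pix \<and> d < 4}"
  by (force simp: darts_def V_def set_\<rho>)

lemma rotation_\<rho>: "rotation \<alpha> \<rho> V"
  unfolding rotation_def
proof (intro conjI ballI impI)
  show "finite V" by (simp add: V_def finite_pix)
  show "inv_on \<alpha> (darts \<rho> V)" unfolding darts_V inv_on_def
    by (auto simp: \<alpha>_def nb_opp) (auto simp: nb_def split: if_splits)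
  show "distinct (\<rho> x)" for x by (simp add: \<rho>_def)
  show "set (\<rho> x) \<inter> set (\<rho> y) = {}" if "x \<noteq> y" for x y using that by (auto simp: set_\<rho> prod_eq_iff)
qed

lemma card_darts_V: "card (darts \<rho> V) = 8 * card pix" "card V = 2 * card pix"
proof -
  have "darts \<rho> V = pix \<times> UNIV \<times> {..<4}" unfolding darts_V by auto
  then show "card (darts \<rho> V) = 8 * card pix" by (simp add: card_cartesian_product)
  show "card V = 2 * card pix" by (simp add: V_def card_cartesian_product)
qed

lemma dart_adjI:
  assumes "u \<in> pix" "d < 4"
  shows "nb u d \<in> pix \<Longrightarrow> dart_adj \<alpha> \<rho> (u, s) (nb u d, s)" "nb u d \<notin> pix \<Longrightarrow> dart_adj \<alpha> \<rho> (u, s) (u, \<not> s)"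
proof -
  show "nb u d \<in> pix \<Longrightarrow> dart_adj \<alpha> \<rho> (u, s) (nb u d, s)"
    unfolding dart_adj_def using assms nb_opp(2)[OF assms(2)] by (intro bexI[of _ "(u, s, d)"]) (auto simp: set_\<rho> \<alpha>_def)
  show "nb u d \<notin> pix \<Longrightarrow> dart_adj \<alpha> \<rho> (u, s) (u, \<not> s)"
    unfolding dart_adj_def using assms by (intro bexI[of _ "(u, s, d)"]) (auto simp: set_\<rho> \<alpha>_def)
qed

lemma dart_adj_both:
  assumes "u \<in> pix" "d < 4"
  shows "nb u d \<in> pix \<Longrightarrow> dart_adj \<alpha> \<rho> (nb u d, s) (u, s)"
  using dart_adjI(1)[of "nb u d" "opp d" s] nb_opp[OF assms(2)] assms by simp

text \<open>Holes are separated by a free column, so two columns at distance at most 1 touch the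
  same hole. A column may be the one just to the right of its hole, but only if the other column is
  not further right.\<close>

lemma hole_unique:
  assumes "k < g" "l < g" "p k \<le> i" "i \<le> p k + n" "p l \<le> i'" "i' \<le> p l + n" "\<bar>i - i'\<bar> \<le> 1"
    "i < p k + n \<or> i' \<le> i" "i' < p l + n \<or> i \<le> i'"
  shows "k = l"
  using sep[of k l] sep[of l k] assms by (cases k l rule: linorder_cases) auto

text \<open>From any pixel one descends towards the corner, to the left if possible and otherwise
  downwards: to the right of a hole there is a free column, and so there is in column 0. The last
  step, at the corner itself, changes the sheet.\<close>

lemma linked_V: "linked (dart_adj \<alpha> \<rho>) V"
proof (rule linked_descent[where z = "((0, 0), True)" and \<mu> = "\<lambda>(u, s). nat (fst u) + nat (snd u) + (if s then 0 else 1)"])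
  have no: "(0, j) \<notin> hole k" "(i, 0) \<notin> hole k" if "k < g" for i j k using p1[OF that] q1 by (auto simp: hole_def)
  show "((0, 0), True) \<in> V" using a1 q1 qb n1 no by (auto simp: V_def pix_def)
  fix x assume x: "x \<in> V" "x \<noteq> ((0, 0), True)"
  obtain i j s where xe: "x = ((i, j), s)" by (metis prod.exhaust)
  have u: "(i, j) \<in> pix" using x(1) xe by (simp add: V_def)
  then have ij: "0 \<le> i" "0 \<le> j" "i < a" "j < b" by (auto simp: pix_def)
  note A = dart_adjI[OF u, of _ s] dart_adj_both[OF u, of _ s]
  consider "(i - 1, j) \<in> pix" | "(i, j - 1) \<in> pix" "(i - 1, j) \<notin> pix" | "i = 0" "j = 0"
  proof -
    have "(i, j - 1) \<in> pix" if W: "(i - 1, j) \<notin> pix" and n0: "\<not> (i = 0 \<and> j = 0)"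
    proof (cases "i = 0")
      case True
      then show ?thesis using n0 ij no by (auto simp: pix_def)
    next
      case False
      then obtain k where k: "k < g" "(i - 1, j) \<in> hole k" using W ij by (auto simp: pix_def)
      have "(i, j) \<notin> hole k" using u k(1) by (auto simp: pix_def)
      then have i: "i = p k + n" using k(2) by (auto simp: hole_def)
      have "(i, j - 1) \<notin> hole l" if "l < g" for l
        using hole_unique[OF k(1) that, of i i] sep[of k l] sep[of l k] i n1 that k(1)
        by (cases k l rule: linorder_cases) (auto simp: hole_def)
      moreover have "1 \<le> j" using k(2) q1 by (auto simp: hole_def)
      ultimately show ?thesis using ij by (auto simp: pix_def)
    qed
    then show thesis using that by blast
  qed
  then show "\<exists>y\<in>V. dart_adj \<alpha> \<rho> x y \<and> dart_adj \<alpha> \<rho> y x \<and>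
      (case y of (u, s) \<Rightarrow> nat (fst u) + nat (snd u) + (if s then 0 else 1)) <
      (case x of (u, s) \<Rightarrow> nat (fst u) + nat (snd u) + (if s then 0 else 1))"
  proof cases
    case 1
    then show ?thesis unfolding xe using A(1)[of 2] A(3)[of 2]
      by (intro bexI[of _ "((i - 1, j), s)"]) (auto simp: nb_def V_def pix_def)
  next
    case 2
    then show ?thesis unfolding xe using A(1)[of 3] A(3)[of 3]
      by (intro bexI[of _ "((i, j - 1), s)"]) (auto simp: nb_def V_def pix_def)
  next
    case 3
    have "s = False" using x(2) xe 3 by auto
    moreover have "nb (i, j) 2 \<notin> pix" using 3 by (auto simp: nb_def pix_def)
    ultimately show ?thesis unfolding xe using dart_adjI(2)[OF u, of 2 s] dart_adjI(2)[OF u, of 2 "\<not> s"] u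
      by (intro bexI[of _ "((i, j), True)"]) (auto simp: V_def)
  qed
qed

text \<open>If both other corners of the patch were missing, they would lie in one hole, and a hole
  is a rectangle that would then contain the given pixels as well.\<close>

lemma no_diagonal:
  assumes "(i, j) \<in> pix" "(i', j') \<in> pix" "\<bar>i - i'\<bar> \<le> 1" "\<bar>j - j'\<bar> \<le> 1"
  shows "(i', j) \<in> pix \<or> (i, j') \<in> pix"
proof (rule ccontr)
  assume "\<not> ?thesis"
  then obtain k l where kl: "k < g" "l < g" "(i', j) \<in> hole k" "(i, j') \<in> hole l" using assms(1,2) by (auto simp: pix_def)
  have "k = l" by (rule hole_unique[of k l i' i]) (use kl assms(3) in \<open>auto simp: hole_def\<close>)
  then have "(i, j) \<in> hole k" using kl by (auto simp: hole_def)
  then show False using assms(1) kl(1) by (auto simp: pix_def)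
qed

text \<open>Two pixels of a 2 by 2 patch are equal, adjacent, or joined through a third one by
  \<open>no_diagonal\<close>.\<close>

lemma linked_patch:
  assumes I: "\<And>i i'. i \<in> I \<Longrightarrow> i' \<in> I \<Longrightarrow> \<bar>i - i'\<bar> \<le> 1" and J: "\<And>j j'. j \<in> J \<Longrightarrow> j' \<in> J \<Longrightarrow> \<bar>j - j'\<bar> \<le> 1"
  shows "linked (dart_adj \<alpha> \<rho>) ((pix \<inter> I \<times> J) \<times> {s})"
proof (rule linked_diameter2)
  let ?W = "(pix \<inter> I \<times> J) \<times> {s}"
  have hor: "dart_adj \<alpha> \<rho> ((i, j), s) ((i', j), s)" if "(i, j) \<in> pix" "(i', j) \<in> pix" "i \<noteq> i'" "\<bar>i - i'\<bar> \<le> 1" for i i' j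
  proof -
    have "i' = i + 1 \<or> i' = i - 1" using that(3,4) by linarith
    then show ?thesis using dart_adjI(1)[OF that(1), of 0 s] dart_adjI(1)[OF that(1), of 2 s] that(2) by (auto simp: nb_def)
  qed
  have ver: "dart_adj \<alpha> \<rho> ((i, j), s) ((i, j'), s)" if "(i, j) \<in> pix" "(i, j') \<in> pix" "j \<noteq> j'" "\<bar>j - j'\<bar> \<le> 1" for i j j'
  proof -
    have "j' = j + 1 \<or> j' = j - 1" using that(3,4) by linarith
    then show ?thesis using dart_adjI(1)[OF that(1), of 1 s] dart_adjI(1)[OF that(1), of 3 s] that(2) by (auto simp: nb_def)
  qed
  fix x y assume xy: "x \<in> ?W" "y \<in> ?W"
  obtain i j i' j' where e: "x = ((i, j), s)" "y = ((i', j'), s)" using xy by auto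
  have m: "(i, j) \<in> pix" "(i', j') \<in> pix" "i \<in> I" "i' \<in> I" "j \<in> J" "j' \<in> J" using xy e by auto
  note d = I[OF m(3,4)] J[OF m(5,6)]
  from no_diagonal[OF m(1,2) d] show "\<exists>m\<in>?W. (x = m \<or> dart_adj \<alpha> \<rho> x m) \<and> (m = y \<or> dart_adj \<alpha> \<rho> m y)"
  proof
    assume c: "(i', j) \<in> pix"
    show ?thesis unfolding e using c m hor[OF m(1) c _ d(1)] ver[OF c m(2) _ d(2)]
      by (intro bexI[of _ "((i', j), s)"]) auto
  next
    assume c: "(i, j') \<in> pix"
    show ?thesis unfolding e using c m ver[OF m(1) c _ d(2)] hor[OF c m(2) _ d(1)]
      by (intro bexI[of _ "((i, j'), s)"]) auto
  qed
qed

text \<open>A pixel with a missing neighbour is adjacent to its copy on the other sheet, which ties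
  the two patches together.\<close>

lemma linked_patch_both:
  assumes "\<And>i i'. i \<in> I \<Longrightarrow> i' \<in> I \<Longrightarrow> \<bar>i - i'\<bar> \<le> 1" "\<And>j j'. j \<in> J \<Longrightarrow> j' \<in> J \<Longrightarrow> \<bar>j - j'\<bar> \<le> 1"
    and u: "u \<in> pix \<inter> I \<times> J" "d < 4" "nb u d \<notin> pix"
  shows "linked (dart_adj \<alpha> \<rho>) ((pix \<inter> I \<times> J) \<times> UNIV)"
proof -
  let ?A = "dart_adj \<alpha> \<rho>" and ?W = "\<lambda>s. (pix \<inter> I \<times> J) \<times> {s}"
  have L: "linked ?A (?W s)" for s by (rule linked_patch) (use assms in auto)
  have "linked ?A (insert (u, False) (?W True))"
    by (rule linked_insert[OF L, of "(u, True)"]) (use u dart_adjI(2)[of u d True] dart_adjI(2)[of u d False] in auto)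
  from linked_Un[OF this L[of False], of "(u, False)"] u(1)
  have "linked ?A (insert (u, False) (?W True) \<union> ?W False)" by simp
  moreover have "insert (u, False) (?W True) \<union> ?W False = (pix \<inter> I \<times> J) \<times> UNIV" using u(1) by auto
  ultimately show ?thesis by simp
qed

lemma card_pix: "int (card pix) \<le> a * b - int g * n\<^sup>2"
proof -
  have hk: "hole k \<subseteq> {0..<a} \<times> {0..<b}" if "k < g" for k using p1[OF that] pa[OF that] q1 qb by (auto simp: hole_def)
  have disj: "hole k \<inter> hole l = {}" if "k < g" "l < g" "k \<noteq> l" for k l
    using sep[of k l] sep[of l k] that n1 by (cases k l rule: linorder_cases) (auto simp: hole_def)
  have "card (\<Union>k<g. hole k) = (\<Sum>k<g. card (hole k))"
    by (rule card_UN_disjoint) (use disj in \<open>auto simp: hole_def\<close>)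
  also have "\<dots> = g * nat n * nat n" by (simp add: hole_def card_cartesian_product)
  finally have c: "card (\<Union>k<g. hole k) = g * nat n * nat n" .
  have "card pix = card ({0..<a} \<times> {0..<b}) - card (\<Union>k<g. hole k)"
    unfolding pix_def using hk by (intro card_Diff_subset) (auto simp: hole_def)
  moreover have "card (\<Union>k<g. hole k) \<le> card ({0..<a} \<times> {0..<b})" using hk by (intro card_mono) auto
  ultimately have "int (card pix) = int (card ({0..<a} \<times> {0..<b})) - int (card (\<Union>k<g. hole k))" by simp
  moreover have "int (card ({0..<a} \<times> {0..<b})) = a * b" using a1 q1 qb n1 by (simp add: card_cartesian_product)
  moreover have "int (card (\<Union>k<g. hole k)) = int g * n\<^sup>2" using c n1 by (simp add: power2_eq_square)
  ultimately show ?thesis by simp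
qed

lemma card_diff_UN_ge:
  assumes "finite R" "\<And>k. k < g \<Longrightarrow> finite (B k) \<and> int (card (B k)) \<le> m" "0 \<le> m" "R - (\<Union>k<g. B k) \<subseteq> T" "finite T"
  shows "int (card R) - int g * m \<le> int (card T)"
proof -
  let ?U = "\<Union>k<g. B k"
  have "card R \<le> card (R - ?U) + card ?U"
    using card_mono[of "(R - ?U) \<union> ?U" R] card_Un_le[of "R - ?U" ?U] assms(1,2) by auto
  moreover have "card ?U \<le> (\<Sum>k<g. card (B k))" by (rule card_UN_le) simp
  moreover have "int (\<Sum>k<g. card (B k)) \<le> int g * m"
    using sum_mono[of "{..<g}" "\<lambda>k. int (card (B k))" "\<lambda>k. m"] assms(2) by simp
  moreover have "card (R - ?U) \<le> card T" using assms by (intro card_mono)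
  ultimately show ?thesis by linarith
qed

text \<open>With \<open>T\<close> squares that touch a pixel and \<open>F\<close> complete ones
  there are at least \<open>T + F\<close> colours. A hole contains \<open>(n - 1)^2\<close> squares
  and touches \<open>(n + 1)^2\<close>, and these add up to \<open>2 n^2 + 2\<close>: twice the
  removed pixels and 2 more for each hole. The Euler characteristic therefore comes out as at least
  \<open>2 - 2 g\<close>, whatever the scale.\<close>

lemma euler:
  "int (card (darts \<rho> V)) + 4 \<le> 2 * int (card V) +
    2 * int (card ((to_nat \<circ> col) ` darts \<rho> V \<union> (\<lambda>x. to_nat (col (fst x, snd x, 0))) ` V)) + 2 * (2 * int g)"
proof -
  let ?T = "{x. corners x \<inter> pix \<noteq> {}}" and ?F = "{x. full x}"
  have bd: "?T \<subseteq> {-1..<a} \<times> {-1..<b}" by (auto simp: corners_def pix_def)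
  then have finT: "finite ?T" by (rule finite_subset) simp
  have FT: "?F \<subseteq> ?T" by (auto simp: full_def corners_def)
  then have finF: "finite ?F" using finT finite_subset by blast
  let ?C = "col ` darts \<rho> V"
  have sub: "(\<lambda>x. (x, 0)) ` (?T - ?F) \<union> (\<lambda>x. (x, 1)) ` ?F \<union> (\<lambda>x. (x, 2)) ` ?F \<subseteq> ?C"
  proof -
    have "tag s x \<in> ?C" if "x \<in> ?T" for s x
    proof -
      have "corners x \<inter> pix \<noteq> {}" using that by simp
      then obtain u where u: "u \<in> corners x" "u \<in> pix" by blast
      have "x = sqr u 1 \<or> x = sqr u 2 \<or> x = sqr u 0 \<or> x = sqr u 3" using u(1) by (auto simp: corners_def sqr_def)
      then obtain d where d: "d \<in> {0, 1, 2, 3 :: nat}" "x = sqr u d" by blast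
      then have d: "d < 4" "x = sqr u d" by auto
      have "tag s x = col (u, s, if s then d else (d + 3) mod 4)"
      proof -
        \<comment> \<open>Undoes the shift that \<open>col\<close> makes on the reversed
          sheet.\<close>
        have "((d + 3) mod 4 + 1) mod 4 = d" using d(1) by presburger
        then show ?thesis using d(2) by (cases s) (simp_all only: col_def prod.case if_True if_False)
      qed
      moreover have "(u, s, if s then d else (d + 3) mod 4) \<in> darts \<rho> V" using u d by (auto simp: darts_V)
      ultimately show ?thesis by blast
    qed
    note t = this
    have "(x, 0) \<in> ?C" if "x \<in> ?T - ?F" for x using t[of x True] that by (simp add: tag_def)
    moreover have "(x, 1) \<in> ?C" "(x, 2) \<in> ?C" if "x \<in> ?F" for x
      using t[of x True] t[of x False] that FT by (auto simp: tag_def)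
    ultimately show ?thesis by blast
  qed
  have c1: "card ?T + card ?F \<le> card ?C"
  proof -
    let ?i = "\<lambda>k x. (x :: int \<times> int, k :: nat)"
    have "card (?i 0 ` (?T - ?F) \<union> ?i 1 ` ?F \<union> ?i 2 ` ?F) = card (?i 0 ` (?T - ?F)) + card (?i 1 ` ?F) + card (?i 2 ` ?F)"
      using finT finF by (subst card_Un_disjoint; (subst card_Un_disjoint)?) auto
    also have "\<dots> = card (?T - ?F) + card ?F + card ?F" by (simp add: card_image inj_on_def)
    also have "\<dots> = card ?T + card ?F" using card_Diff_subset[OF finF FT] card_mono[OF finT FT] by simp
    finally show ?thesis using card_mono[OF _ sub] finite_darts[of V \<rho>] by (simp add: V_def finite_pix)
  qed
  have c2: "card ?C \<le> card ((to_nat \<circ> col) ` darts \<rho> V \<union> (\<lambda>x. to_nat (col (fst x, snd x, 0))) ` V)" (is "_ \<le> card (?D \<union> ?E)")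
  proof -
    have "?D = to_nat ` ?C" by (simp add: image_comp)
    then have "card ?D = card ?C" by (simp add: card_image)
    moreover have "card ?D \<le> card (?D \<union> ?E)"
      by (rule card_mono) (auto simp: V_def finite_pix finite_darts)
    ultimately show ?thesis by simp
  qed
  have T: "(a + 1) * (b + 1) - int g * (n - 1)\<^sup>2 \<le> int (card ?T)"
  proof -
    let ?B = "\<lambda>k. {p k..<p k + n - 1} \<times> {q..<q + n - 1}"
    have "x \<in> ?T" if x: "x \<in> {-1..<a} \<times> {-1..<b} - (\<Union>k<g. ?B k)" for x
    proof (rule ccontr)
      assume no: "x \<notin> ?T"
      obtain i j where e: "x = (i, j)" by (cases x)
      have ij: "-1 \<le> i" "i < a" "-1 \<le> j" "j < b" using x e by auto
      have c: "(i', j') \<notin> pix" if "i' \<in> {i, i + 1}" "j' \<in> {j, j + 1}" for i' j' using no that by (auto simp: e corners_def)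
      have h: "\<exists>k<g. (i', j') \<in> hole k" if "i' \<in> {i, i + 1}" "j' \<in> {j, j + 1}" "0 \<le> i'" "i' < a" "0 \<le> j'" "j' < b" for i' j'
        using c[OF that(1,2)] that by (auto simp: pix_def)
      have hb: "1 \<le> i' \<and> i' + 1 < a \<and> 1 \<le> j' \<and> j' + 1 < b" if "(i', j') \<in> hole k" "k < g" for i' j' k
        using that p1[of k] pa[of k] q1 qb by (auto simp: hole_def)
      have b1: "1 \<le> b" using q1 qb n1 by linarith
      let ?i = "max i 0" and ?j = "max j 0"
      have "?i \<in> {i, i + 1}" "?j \<in> {j, j + 1}" using ij by auto
      then obtain k where "k < g" "(?i, ?j) \<in> hole k" using h[of ?i ?j] ij a1 b1 by auto
      from hb[OF this(2,1)] this have r: "1 \<le> i" "1 \<le> j" "i + 1 < a" "j + 1 < b" "k < g" "(i, j) \<in> hole k" by (auto simp: max_def split: if_splits)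
      obtain l where l: "l < g" "(i + 1, j + 1) \<in> hole l" using h[of "i + 1" "j + 1"] r by auto
      have "k = l" by (rule hole_unique[of k l i "i + 1"]) (use l r in \<open>auto simp: hole_def\<close>)
      then have "x \<in> ?B k" using l r(6) e by (auto simp: hole_def)
      then have "x \<in> (\<Union>k<g. ?B k)" using r(5) by (intro UN_I) auto
      then show False using x by simp
    qed
    then have "{-1..<a} \<times> {-1..<b} - (\<Union>k<g. ?B k) \<subseteq> ?T" by (intro subsetI)
    from card_diff_UN_ge[of "{-1..<a} \<times> {-1..<b}" ?B "(n - 1)\<^sup>2", OF _ _ _ this finT]
    have "int (card ({-1..<a} \<times> {-1..<b})) - int g * (n - 1)\<^sup>2 \<le> int (card ?T)"
      using n1 by (simp add: card_cartesian_product power2_eq_square)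
    moreover have "int (card ({-1..<a} \<times> {-1..<b})) = (a + 1) * (b + 1)"
      using a1 q1 qb n1 by (simp add: card_cartesian_product)
    ultimately show ?thesis by simp
  qed
  have F: "(a - 1) * (b - 1) - int g * (n + 1)\<^sup>2 \<le> int (card ?F)"
  proof -
    let ?B = "\<lambda>k. {p k - 1..<p k + n} \<times> {q - 1..<q + n}"
    have "x \<in> ?F" if x: "x \<in> {0..<a - 1} \<times> {0..<b - 1} - (\<Union>k<g. ?B k)" for x
    proof -
      have "u \<notin> hole k" if "u \<in> corners x" "k < g" for u k
      proof
        assume "u \<in> hole k"
        then have "x \<in> ?B k" using that(1) by (cases x) (auto simp: hole_def corners_def)
        then have "x \<in> (\<Union>k<g. ?B k)" using that(2) by (intro UN_I) auto
        then show False using x by simp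
      qed
      note nh = this
      have c: "corners x \<subseteq> {0..<a} \<times> {0..<b}" using x by (auto simp: corners_def)
      have "u \<in> pix" if "u \<in> corners x" for u
        unfolding pix_def using nh[OF that] c that by (intro DiffI subsetD[OF c]) auto
      then show ?thesis by (simp add: full_def subset_iff)
    qed
    then have "{0..<a - 1} \<times> {0..<b - 1} - (\<Union>k<g. ?B k) \<subseteq> ?F" by (intro subsetI)
    from card_diff_UN_ge[of "{0..<a - 1} \<times> {0..<b - 1}" ?B "(n + 1)\<^sup>2", OF _ _ _ this finF]
    have "int (card ({0..<a - 1} \<times> {0..<b - 1})) - int g * (n + 1)\<^sup>2 \<le> int (card ?F)"
      using n1 by (simp add: card_cartesian_product power2_eq_square)
    moreover have "int (card ({0..<a - 1} \<times> {0..<b - 1})) = (a - 1) * (b - 1)"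
      using a1 q1 qb n1 by (simp add: card_cartesian_product)
    ultimately show ?thesis by simp
  qed
  have "2 * int (card pix) + 2 - 2 * int g \<le> 2 * (a * b - int g * n\<^sup>2) + 2 - 2 * int g"
    using card_pix by simp
  also have "\<dots> = (a + 1) * (b + 1) - int g * (n - 1)\<^sup>2 + ((a - 1) * (b - 1) - int g * (n + 1)\<^sup>2)"
    by (simp add: power2_eq_square algebra_simps)
  also have "\<dots> \<le> int (card ?T) + int (card ?F)" by (rule add_mono[OF T F])
  also have "\<dots> \<le> int (card ((to_nat \<circ> col) ` darts \<rho> V \<union> (\<lambda>x. to_nat (col (fst x, snd x, 0))) ` V))"
    using c1 c2 by linarith
  finally show ?thesis unfolding card_darts_V by simp
qed

end

context holed_grid
begin

section \<open>Covering the points of the holed rectangle by pixels\<close>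

lemma pix_left: "k < g \<Longrightarrow> 0 \<le> j \<Longrightarrow> j < b \<Longrightarrow> (p k - 1, j) \<in> pix"
proof -
  assume k: "k < g" and j: "0 \<le> j" "j < b"
  have "(p k - 1, j) \<notin> hole l" if l: "l < g" for l
    using sep[of k l] sep[of l k] k l n1 by (cases k l rule: linorder_cases) (auto simp: hole_def)
  then show ?thesis using k j p1[OF k] pa[OF k] n1 by (auto simp: pix_def)
qed

lemma pix_right: "k < g \<Longrightarrow> 0 \<le> j \<Longrightarrow> j < b \<Longrightarrow> (p k + n, j) \<in> pix"
proof -
  assume k: "k < g" and j: "0 \<le> j" "j < b"
  have "(p k + n, j) \<notin> hole l" if l: "l < g" for l
    using sep[of k l] sep[of l k] k l n1 by (cases k l rule: linorder_cases) (auto simp: hole_def)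
  then show ?thesis using k j p1[OF k] pa[OF k] n1 by (auto simp: pix_def)
qed

lemma pix_low: "0 \<le> i \<Longrightarrow> i < a \<Longrightarrow> 0 \<le> j \<Longrightarrow> j < q \<Longrightarrow> (i, j) \<in> pix"
  using qb n1 by (auto simp: pix_def hole_def)

lemma pix_high: "0 \<le> i \<Longrightarrow> i < a \<Longrightarrow> q + n \<le> j \<Longrightarrow> j < b \<Longrightarrow> (i, j) \<in> pix"
  using q1 n1 by (auto simp: pix_def hole_def)

lemma pix_first: "0 \<le> j \<Longrightarrow> j < b \<Longrightarrow> (0, j) \<in> pix"
  using p1 a1 by (force simp: pix_def hole_def)

lemma pix_last: "0 \<le> j \<Longrightarrow> j < b \<Longrightarrow> (a - 1, j) \<in> pix"
  using pa a1 by (force simp: pix_def hole_def)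

text \<open>Here the pixel \<open>(i, j)\<close> is a closed unit square with lower left corner
  \<open>(i, j)\<close>, so a point lies in up to four of them.\<close>

definition around :: "real \<times> real \<Rightarrow> (int \<times> int) set" where
  "around y = {i. of_int i \<le> fst y \<and> fst y \<le> of_int i + 1} \<times> {j. of_int j \<le> snd y \<and> snd y \<le> of_int j + 1}"

lemma clip: 
  fixes l r :: int and y :: real
  assumes "l \<le> y" "y \<le> r" "l < r" shows "\<exists>i. l \<le> i \<and> i < r \<and> i \<le> y \<and> y \<le> i + 1"
proof (cases "y = r")
  case True
  then show ?thesis using assms by (intro exI[of _ "r - 1"]) auto
next
  case False
  then show ?thesis using assms by (intro exI[of _ "\<lfloor>y\<rfloor>"]) (auto simp: le_floor_iff floor_less_iff)
qed

text \<open>A point of a removed pixel that is not inside an open hole lies on the edge of the hole,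
  and the pixel across that edge is present.\<close>

lemma pix_cover:
  fixes y :: "real \<times> real"
  assumes "0 \<le> fst y" "fst y \<le> a" "0 \<le> snd y" "snd y \<le> b"
    and out: "\<And>k. k < g \<Longrightarrow> \<not> (p k < fst y \<and> fst y < p k + n \<and> q < snd y \<and> snd y < q + n)"
  shows "pix \<inter> around y \<noteq> {}"
proof -
  have b1: "0 < b" using q1 qb n1 by linarith
  obtain i where i: "0 \<le> i" "i < a" "i \<le> fst y" "fst y \<le> i + 1" using clip[of 0 "fst y" a] assms a1 by auto
  obtain j where j: "0 \<le> j" "j < b" "j \<le> snd y" "snd y \<le> j + 1" using clip[of 0 "snd y" b] assms b1 by auto
  show ?thesis
  proof (cases "(i, j) \<in> pix")
    case True
    then show ?thesis using i j by (auto simp: around_def)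
  next
    case False
    then obtain k where k: "k < g" "(i, j) \<in> hole k" using i j by (auto simp: pix_def)
    then have h: "p k \<le> i" "i + 1 \<le> p k + n" "q \<le> j" "j + 1 \<le> q + n" by (auto simp: hole_def)
    then have h': "real_of_int (p k) \<le> fst y" "fst y \<le> p k + n" "real_of_int q \<le> snd y" "snd y \<le> q + n"
      using i j by linarith+
    consider "fst y = p k" | "fst y = p k + n" | "snd y = q" | "snd y = q + n" using out[OF k(1)] h' by linarith
    then show ?thesis
    proof cases
      case 1
      then show ?thesis using pix_left[OF k(1) j(1,2)] j by (auto simp: around_def)
    next
      case 2
      then show ?thesis using pix_right[OF k(1) j(1,2)] j by (auto simp: around_def)
    next
      case 3
      then show ?thesis using pix_low[OF i(1,2), of "q - 1"] q1 i by (auto simp: around_def)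
    next
      case 4
      then show ?thesis using pix_high[OF i(1,2), of "q + n"] qb i by (auto simp: around_def)
    qed
  qed
qed

text \<open>On a boundary curve some pixel at the point lacks a neighbour, and there the two sheets
  are joined.\<close>

lemma pix_boundary:
  fixes y :: "real \<times> real"
  assumes y: "0 \<le> fst y" "fst y \<le> a" "0 \<le> snd y" "snd y \<le> b"
    and bd: "fst y = 0 \<or> fst y = a \<or> snd y = 0 \<or> snd y = b \<or>
      (\<exists>k<g. p k \<le> fst y \<and> fst y \<le> p k + n \<and> q \<le> snd y \<and> snd y \<le> q + n \<and>
        (fst y = p k \<or> fst y = p k + n \<or> snd y = q \<or> snd y = q + n))"
  shows "\<exists>u\<in>pix \<inter> around y. \<exists>d<4. nb u d \<notin> pix"
proof -
  have b1: "0 < b" using q1 qb n1 by linarith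
  obtain i where i: "0 \<le> i" "i < a" "i \<le> fst y" "fst y \<le> i + 1" using clip[of 0 "fst y" a] y a1 by auto
  obtain j where j: "0 \<le> j" "j < b" "j \<le> snd y" "snd y \<le> j + 1" using clip[of 0 "snd y" b] y b1 by auto
  have I: "(i', j') \<in> pix \<Longrightarrow> of_int i' \<le> fst y \<Longrightarrow> fst y \<le> of_int i' + 1 \<Longrightarrow> of_int j' \<le> snd y \<Longrightarrow> snd y \<le> of_int j' + 1 \<Longrightarrow>
      d < 4 \<Longrightarrow> nb (i', j') d \<notin> pix \<Longrightarrow> ?thesis" for i' j' d
    by (intro bexI[of _ "(i', j')"]) (auto simp: around_def)
  from bd show ?thesis
  proof (elim disjE exE conjE)
    assume "fst y = 0"
    then show ?thesis using pix_first[OF j(1,2)] j by (intro I[of 0 j 2]) (auto simp: nb_def pix_def)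
  next
    assume "fst y = a"
    then show ?thesis using pix_last[OF j(1,2)] j by (intro I[of "a - 1" j 0]) (auto simp: nb_def pix_def)
  next
    assume "snd y = 0"
    then show ?thesis using pix_low[OF i(1,2), of 0] q1 i by (intro I[of i 0 3]) (auto simp: nb_def pix_def)
  next
    assume "snd y = b"
    then show ?thesis using pix_high[OF i(1,2), of "b - 1"] qb i by (intro I[of i "b - 1" 1]) (auto simp: nb_def pix_def)
  next
    fix k assume k: "k < g" and r: "p k \<le> fst y" "fst y \<le> p k + n" "q \<le> snd y" "snd y \<le> q + n"
    obtain i where i: "p k \<le> i" "i < p k + n" "i \<le> fst y" "fst y \<le> i + 1" using clip[of "p k" "fst y" "p k + n"] r n1 by auto
    obtain j where j: "q \<le> j" "j < q + n" "j \<le> snd y" "snd y \<le> j + 1" using clip[of q "snd y" "q + n"] r n1 by auto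
    have ij: "(i', j') \<notin> pix" if "p k \<le> i'" "i' < p k + n" "q \<le> j'" "j' < q + n" for i' j'
      using that k by (auto simp: pix_def hole_def)
    have ia: "0 \<le> i" "i < a" and jb: "0 \<le> j" "j < b" using i j p1[OF k] pa[OF k] q1 qb by auto
    show ?thesis if "fst y = p k"
      using that pix_left[OF k jb] j by (intro I[of "p k - 1" j 0]) (auto simp: nb_def ij n1)
    show ?thesis if "fst y = p k + n"
      using that pix_right[OF k jb] j ij[of "p k + n - 1" j] n1 by (intro I[of "p k + n" j 2]) (auto simp: nb_def)
    show ?thesis if "snd y = q"
      using that pix_low[OF ia, of "q - 1"] q1 i ij[of i q] n1 by (intro I[of i "q - 1" 1]) (auto simp: nb_def)
    show ?thesis if "snd y = q + n"
      using that pix_high[OF ia, of "q + n"] qb i ij[of i "q + n - 1"] n1 by (intro I[of i "q + n" 3]) (auto simp: nb_def)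
  qed
qed

text \<open>\<open>T\<close> will be the set of halves of the surface that contain a given point:
  one in general, both at mid-height, where the point is on a boundary curve.\<close>

lemma linked_around:
  assumes "T = {s} \<or> (\<exists>u\<in>pix \<inter> around y. \<exists>d<4. nb u d \<notin> pix)" "T \<noteq> {}"
  shows "linked (dart_adj \<alpha> \<rho>) ((pix \<inter> around y) \<times> T)"
proof -
  have I: "\<bar>i - i'\<bar> \<le> 1" if "i \<in> {i. of_int i \<le> t \<and> t \<le> of_int i + 1}" "i' \<in> {i. of_int i \<le> t \<and> t \<le> of_int i + 1}"
    for i i' :: int and t :: real
  proof -
    have "real_of_int i \<le> real_of_int (i' + 1)" "real_of_int i' \<le> real_of_int (i + 1)" using that by auto
    then show ?thesis by linarith
  qed
  have "T = {True} \<or> T = {False} \<or> T = UNIV" using assms(2) subset_UNIV[of T] unfolding UNIV_bool by blast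
  then show ?thesis
  proof (elim disjE)
    assume T: "T = UNIV"
    then have "T \<noteq> {s}" by auto
    then obtain u d where "u \<in> pix \<inter> around y" "d < 4" "nb u d \<notin> pix" using assms(1) by blast
    then show ?thesis unfolding T around_def by (intro linked_patch_both[OF I I]) auto
  qed (auto simp: around_def intro!: linked_patch[OF I I])
qed

end

section \<open>Flattening each half of the surface onto the holed rectangle\<close>

definition stretch :: "real \<Rightarrow> real \<Rightarrow> real" where "stretch \<tau> x = x - \<tau> * cos (pi * x)"

text \<open>The cosine term changes at most \<open>\<pi> \<tau>\<close> times as fast as
  \<open>x\<close>, and \<open>\<pi> < 4\<close> with \<open>\<tau> \<le> 1/8\<close> makes this
  factor at most \<open>1/2\<close>.\<close>

lemma stretch_mono:
  assumes "0 \<le> \<tau>" "\<tau> \<le> 1/8" "x < y" shows "stretch \<tau> x < stretch \<tau> y"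
proof -
  have "cos (pi * y) - cos (pi * x) = 2 * sin ((pi * y + pi * x) / 2) * sin ((pi * x - pi * y) / 2)"
    by (rule cos_diff_cos)
  then have "\<bar>cos (pi * y) - cos (pi * x)\<bar> = 2 * \<bar>sin ((pi * y + pi * x) / 2)\<bar> * \<bar>sin ((pi * x - pi * y) / 2)\<bar>"
    by (simp add: abs_mult)
  also have "\<dots> \<le> 2 * 1 * \<bar>(pi * x - pi * y) / 2\<bar>"
    by (intro mult_mono abs_sin_x_le_abs_x) auto
  also have "\<dots> = pi * (y - x)" using assms(3) by (simp add: right_diff_distrib[symmetric] abs_mult)
  also have "\<dots> \<le> 4 * (y - x)" using pi_less_4 assms(3) by (intro mult_right_mono) auto
  finally have "\<bar>cos (pi * y) - cos (pi * x)\<bar> \<le> 4 * (y - x)" .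
  then have "\<tau> * \<bar>cos (pi * y) - cos (pi * x)\<bar> \<le> 1/8 * (4 * (y - x))" using assms by (intro mult_mono) auto
  moreover have "\<tau> * (cos (pi * y) - cos (pi * x)) \<le> \<tau> * \<bar>cos (pi * y) - cos (pi * x)\<bar>" using assms(1) by (intro mult_left_mono) auto
  ultimately show ?thesis using assms(3) by (simp add: stretch_def algebra_simps)
qed

lemma stretch_less: "0 \<le> \<tau> \<Longrightarrow> \<tau> \<le> 1/8 \<Longrightarrow> stretch \<tau> x < stretch \<tau> y \<longleftrightarrow> x < y"
  using stretch_mono[of \<tau> x y] stretch_mono[of \<tau> y x] by (metis linorder_less_linear order_less_asym)

lemma stretch_le: "0 \<le> \<tau> \<Longrightarrow> \<tau> \<le> 1/8 \<Longrightarrow> stretch \<tau> x \<le> stretch \<tau> y \<longleftrightarrow> x \<le> y"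
  using stretch_less[of \<tau> y x] by (simp add: not_less[symmetric])

text \<open>The walls stand at integers: solid intervals start at even numbers and end at odd ones.
  The cosine shifts the former left and the latter right by \<open>\<tau>\<close>, so deeper points
  of a wall are laid out further beyond the edge of the face.\<close>

lemma stretch_odd: "stretch \<tau> (2 * real k + 1) = 2 * real k + 1 + \<tau>"
  using cos_npi2[of "2 * k + 1"] by (simp add: stretch_def add.commute)

lemma stretch_even: "stretch \<tau> (2 * real k) = 2 * real k - \<tau>"
  using cos_npi2[of "2 * k"] by (simp add: stretch_def)

text \<open>A quarter of the distance to the nearer of the top and bottom faces, hence at most
  \<open>1/8\<close>, reached at mid-height; scaled by 8, the collar is then one unit wide.\<close>

definition depth :: "real \<times> real \<times> real \<Rightarrow> real" where
  "depth w = min (snd (snd w)) (1 - snd (snd w)) / 4"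

text \<open>On each half of the surface this map is the vertical projection, modified so that the walls are
  laid out in a collar around the boundary of the face.\<close>

definition flatten :: "real \<times> real \<times> real \<Rightarrow> real \<times> real" where
  "flatten w = (8 * stretch (depth w) (fst w) + 1, 8 * stretch (depth w) (fst (snd w)) + 1)"

lemma continuous_flatten: "continuous_on X flatten"
  unfolding flatten_def stretch_def depth_def by (intro continuous_intros) auto

definition sheet :: "bool \<Rightarrow> (real \<times> real \<times> real) set" where
  "sheet s = {w. if s then 1/2 \<le> snd (snd w) else snd (snd w) \<le> 1/2}"

lemma closed_sheet: "closed (sheet s)"
  unfolding sheet_def by (cases s) (auto intro!: closed_Collect_le continuous_intros)

lemma closed_bored_block: "closed (bored_block g)"
  unfolding bored_block_def
  by (intro closed_Diff open_UN ballI closed_Times closed_atLeastAtMost open_Times open_greaterThanLessThan open_UNIV)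

lemma surface_point:
  assumes "(x, y, z) \<in> orientable_surface g"
  shows "0 \<le> x" "x \<le> 2 * real g + 1" "0 \<le> y" "y \<le> 3" "0 \<le> z" "z \<le> 1"
    "k < g \<Longrightarrow> \<not> (2 * real k + 1 < x \<and> x < 2 * real k + 2 \<and> 1 < y \<and> y < 2)"
    "z = 0 \<or> z = 1 \<or> x = 0 \<or> x = 2 * real g + 1 \<or> y = 0 \<or> y = 3 \<or>
      (\<exists>k<g. 2 * real k + 1 \<le> x \<and> x \<le> 2 * real k + 2 \<and> 1 \<le> y \<and> y \<le> 2)"
proof -
  have "(x, y, z) \<in> bored_block g"
    using assms closed_bored_block[of g] by (simp add: orientable_surface_def frontier_def)
  then have b: "x \<in> {0..2 * real g + 1}" "y \<in> {0..3}" "z \<in> {0..1}"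
      "\<forall>k<g. \<not> (2 * real k + 1 < x \<and> x < 2 * real k + 2 \<and> 1 < y \<and> y < 2)"
    by (auto simp: bored_block_def)
  show "0 \<le> x" "x \<le> 2 * real g + 1" "0 \<le> y" "y \<le> 3" "0 \<le> z" "z \<le> 1" using b by auto
  show "k < g \<Longrightarrow> \<not> (2 * real k + 1 < x \<and> x < 2 * real k + 2 \<and> 1 < y \<and> y < 2)" using b(4) by blast
  show "z = 0 \<or> z = 1 \<or> x = 0 \<or> x = 2 * real g + 1 \<or> y = 0 \<or> y = 3 \<or>
      (\<exists>k<g. 2 * real k + 1 \<le> x \<and> x \<le> 2 * real k + 2 \<and> 1 \<le> y \<and> y \<le> 2)"
  proof (rule ccontr)
    \<comment> \<open>Open because the closed tunnels are removed; a point with none of the listed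
      properties would lie in it and be interior.\<close>
    let ?U = "{0<..<2 * real g + 1} \<times> {0<..<3 :: real} \<times> {0<..<1 :: real} -
      (\<Union>i<g. {2 * real i + 1..2 * real i + 2} \<times> {1..2} \<times> UNIV)"
    assume "\<not> ?thesis"
    then have m: "(x, y, z) \<in> ?U" using b(1-3) by auto
    have o: "open ?U"
      by (intro open_Diff closed_UN ballI open_Times closed_Times closed_atLeastAtMost open_greaterThanLessThan closed_UNIV finite_lessThan)
    have "?U \<subseteq> bored_block g" by (force simp: bored_block_def)
    from interiorI[OF o m this] have "(x, y, z) \<in> interior (bored_block g)" .
    then show False using assms by (simp add: orientable_surface_def frontier_def)
  qed
qed

lemma depth_bounds: "w \<in> orientable_surface g \<Longrightarrow> 0 \<le> depth w \<and> depth w \<le> 1/8"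
  using surface_point(5,6)[of "fst w" "fst (snd w)" "snd (snd w)" g] by (auto simp: depth_def min_def)

lemma stretch_bounds:
  assumes "0 \<le> \<tau>" "\<tau> \<le> 1/8"
  shows "0 \<le> x \<Longrightarrow> - \<tau> \<le> stretch \<tau> x" "x \<le> 2 * real k + 1 \<Longrightarrow> stretch \<tau> x \<le> 2 * real k + 1 + \<tau>"
    "stretch \<tau> x < 2 * real k + 2 - \<tau> \<longleftrightarrow> x < 2 * real k + 2" "2 * real k + 1 + \<tau> < stretch \<tau> x \<longleftrightarrow> 2 * real k + 1 < x"
    "stretch \<tau> x \<le> 2 * real k + 2 - \<tau> \<longleftrightarrow> x \<le> 2 * real k + 2" "2 * real k + 1 + \<tau> \<le> stretch \<tau> x \<longleftrightarrow> 2 * real k + 1 \<le> x"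
  using stretch_le[OF assms, of 0 x] stretch_le[OF assms, of x "2 * real k + 1"] stretch_less[OF assms, of x "2 * real (k + 1)"]
    stretch_less[OF assms, of "2 * real k + 1" x] stretch_le[OF assms, of x "2 * real (k + 1)"] stretch_le[OF assms, of "2 * real k + 1" x]
    stretch_odd[of \<tau> k] stretch_even[of \<tau> "k + 1"] stretch_even[of \<tau> 0]
  by (auto simp: algebra_simps)

text \<open>If the depths differ, the deeper point lies on a wall, and its image lies further beyond
  the edge of the face than a point of the smaller depth can reach. Equal depths leave one injective
  stretching, and within one half the depth determines the height.\<close>

lemma flatten_inj:
  assumes "v \<in> orientable_surface g" "w \<in> orientable_surface g" "v \<in> sheet s" "w \<in> sheet s" "flatten v = flatten w"
  shows "v = w"
proof -
  have key: "\<not> depth v < depth w"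
    if v: "v \<in> orientable_surface g" and w: "w \<in> orientable_surface g" and eq: "flatten v = flatten w" for v w
  proof
    assume less: "depth v < depth w"
    obtain x y z where vv: "v = (x, y, z)" by (metis prod.exhaust)
    obtain x' y' z' where ww: "w = (x', y', z')" by (metis prod.exhaust)
    note pv = surface_point[OF v[unfolded vv]] and pw = surface_point[OF w[unfolded ww]]
    let ?t = "depth v" and ?t' = "depth w"
    have t: "0 \<le> ?t" "?t \<le> 1/8" "0 \<le> ?t'" "?t' \<le> 1/8" using depth_bounds v w by blast+
    note B = stretch_bounds[OF t(1,2)] and B' = stretch_bounds[OF t(3,4)]
    have e: "stretch ?t x = stretch ?t' x'" "stretch ?t y = stretch ?t' y'"
      using eq by (auto simp: flatten_def vv ww)
    have "z' \<noteq> 0" "z' \<noteq> 1" using less t by (auto simp: depth_def ww)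
    then consider "x' = 0" | "x' = 2 * real g + 1" | "y' = 0" | "y' = 3"
      | k where "k < g" "2 * real k + 1 \<le> x'" "x' \<le> 2 * real k + 2" "1 \<le> y'" "y' \<le> 2"
      using pw(8) by blast
    then show False
    proof cases
      case 1
      then show ?thesis using B(1)[OF pv(1)] e(1) less stretch_even[of ?t' 0] by simp
    next
      case 2
      then show ?thesis using B(2)[OF pv(2)] e(1) less stretch_odd[of ?t' g] by simp
    next
      case 3
      then show ?thesis using B(1)[OF pv(3)] e(2) less stretch_even[of ?t' 0] by simp
    next
      case 4
      then show ?thesis using B(2)[of y 1] pv(4) e(2) less stretch_odd[of ?t' 1] by simp
    next
      case 5
      have "2 * real k + 1 + ?t' \<le> stretch ?t x" "stretch ?t x \<le> 2 * real k + 2 - ?t'"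
        using B'(5)[of x' k] B'(6)[of k x'] 5 e by auto
      then have "2 * real k + 1 < x" "x < 2 * real k + 2" using B(3)[of x k] B(4)[of k x] less by linarith+
      moreover have "1 + ?t' \<le> stretch ?t y" "stretch ?t y \<le> 2 - ?t'"
        using B'(5)[of y' 0] B'(6)[of 0 y'] 5 e by auto
      then have "1 < y" "y < 2" using B(3)[of y 0] B(4)[of 0 y] less by simp_all
      ultimately show ?thesis using pv(7)[OF 5(1)] by blast
    qed
  qed
  have d: "depth v = depth w" using key[OF assms(1,2)] key[OF assms(2,1)] assms(5) by fastforce
  have t: "0 \<le> depth w" "depth w \<le> 1/8" using depth_bounds assms(2) by blast+
  have inj: "a = b" if "stretch (depth w) a = stretch (depth w) b" for a b
    using stretch_le[OF t, of a b] stretch_le[OF t, of b a] that by simp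
  have "fst v = fst w" "fst (snd v) = fst (snd w)" using assms(5) d inj by (auto simp: flatten_def)
  moreover have "snd (snd v) = snd (snd w)"
    using d assms(3,4) by (cases s) (auto simp: depth_def sheet_def min_def split: if_splits)
  ultimately show ?thesis by (simp add: prod_eq_iff)
qed

text \<open>The collar widens \<open>[0, 2 g + 1]\<close> and \<open>[0, 3]\<close> by at most
  \<open>1/8\<close> at both ends; under \<open>8 s + 1\<close> this becomes
  \<open>16 g + 10\<close> and 26. The tunnel from \<open>2 k + 1\<close> to \<open>2 k + 2\<close>,
  narrowed by \<open>1/8\<close> at both ends, becomes the interval from \<open>16 k + 10\<close> to
  \<open>16 k + 16\<close>; its range from 1 to 2 in \<open>y\<close> becomes that from 10 to
  16.\<close>

lemma flatten_range:
  assumes "w \<in> orientable_surface g"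
  shows "0 \<le> fst (flatten w)" "fst (flatten w) \<le> 16 * real g + 10" "0 \<le> snd (flatten w)" "snd (flatten w) \<le> 26"
    "k < g \<Longrightarrow> \<not> (16 * real k + 10 < fst (flatten w) \<and> fst (flatten w) < 16 * real k + 16 \<and>
      10 < snd (flatten w) \<and> snd (flatten w) < 16)"
proof -
  obtain x y z where w: "w = (x, y, z)" by (metis prod.exhaust)
  note p = surface_point[OF assms[unfolded w]]
  let ?t = "depth w"
  have t: "0 \<le> ?t" "?t \<le> 1/8" using depth_bounds assms by blast+
  note B = stretch_bounds[OF t]
  have f: "fst (flatten w) = 8 * stretch ?t x + 1" "snd (flatten w) = 8 * stretch ?t y + 1" by (simp_all add: flatten_def w)
  show "0 \<le> fst (flatten w)" "fst (flatten w) \<le> 16 * real g + 10" "0 \<le> snd (flatten w)" "snd (flatten w) \<le> 26"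
    using B(1)[OF p(1)] B(2)[OF p(2)] B(1)[OF p(3)] B(2)[of y 1] p(4) t f by auto
  show "\<not> (16 * real k + 10 < fst (flatten w) \<and> fst (flatten w) < 16 * real k + 16 \<and>
      10 < snd (flatten w) \<and> snd (flatten w) < 16)" if "k < g"
  proof
    assume h: "16 * real k + 10 < fst (flatten w) \<and> fst (flatten w) < 16 * real k + 16 \<and> 10 < snd (flatten w) \<and> snd (flatten w) < 16"
    have "2 * real k + 1 < x" using B(4)[of k x] h f(1) t by linarith
    moreover have "x < 2 * real k + 2" using B(3)[of x k] h f(1) t by linarith
    moreover have "1 < y" using B(4)[of 0 y] h f(2) t by simp
    moreover have "y < 2" using B(3)[of y 0] h f(2) t by simp
    ultimately show False using p(7)[OF that] by blast
  qed
qed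

text \<open>At mid-height the depth is \<open>1/8\<close>, so the walls reach the rim of the
  rectangle or of a hole. This is where the two halves of the surface meet, as the sheets do under
  \<open>\<alpha>\<close>.\<close>

lemma flatten_boundary:
  assumes "w \<in> orientable_surface g" "w \<in> sheet True" "w \<in> sheet False"
  shows "fst (flatten w) = 0 \<or> fst (flatten w) = 16 * real g + 10 \<or> snd (flatten w) = 0 \<or> snd (flatten w) = 26 \<or>
      (\<exists>k<g. 16 * real k + 10 \<le> fst (flatten w) \<and> fst (flatten w) \<le> 16 * real k + 16 \<and> 10 \<le> snd (flatten w) \<and> snd (flatten w) \<le> 16 \<and>
        (fst (flatten w) = 16 * real k + 10 \<or> fst (flatten w) = 16 * real k + 16 \<or> snd (flatten w) = 10 \<or> snd (flatten w) = 16))"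
proof -
  obtain x y z where w: "w = (x, y, z)" by (metis prod.exhaust)
  note p = surface_point[OF assms(1)[unfolded w]]
  let ?t = "depth w"
  have z: "z = 1/2" using assms(2,3) by (simp add: sheet_def w)
  then have t: "?t = 1/8" by (simp add: depth_def w)
  have t': "0 \<le> ?t" "?t \<le> 1/8" by (simp_all add: t)
  note B = stretch_bounds[OF t']
  have f: "fst (flatten w) = 8 * stretch ?t x + 1" "snd (flatten w) = 8 * stretch ?t y + 1" by (simp_all add: flatten_def w)
  consider "x = 0" | "x = 2 * real g + 1" | "y = 0" | "y = 3"
    | k where "k < g" "2 * real k + 1 \<le> x" "x \<le> 2 * real k + 2" "1 \<le> y" "y \<le> 2"
    using p(8) z by fastforce
  then show ?thesis
  proof cases
    case 1
    then show ?thesis using f(1) stretch_even[of ?t 0] t by simp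
  next
    case 2
    then show ?thesis using f(1) stretch_odd[of ?t g] t by simp
  next
    case 3
    then show ?thesis using f(2) stretch_even[of ?t 0] t by simp
  next
    case 4
    then show ?thesis using f(2) stretch_odd[of ?t 1] t by simp
  next
    case 5
    have r: "16 * real k + 10 \<le> fst (flatten w)" "fst (flatten w) \<le> 16 * real k + 16" 
      using B(6)[of k x] B(5)[of x k] 5 f t by linarith+
    have r': "10 \<le> snd (flatten w)" "snd (flatten w) \<le> 16"
      using B(6)[of 0 y] B(5)[of y 0] 5 f t by simp_all
    have "fst (flatten w) = 16 * real k + 10 \<or> fst (flatten w) = 16 * real k + 16 \<or> snd (flatten w) = 10 \<or> snd (flatten w) = 16"
      using flatten_range(5)[OF assms(1) 5(1)] r r' by linarith
    then show ?thesis using r r' 5(1) by blast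
  qed
qed

section \<open>Resolution of disjoint compact pieces by a fine lattice\<close>

definition resolves :: "nat \<Rightarrow> (real \<times> real \<times> real) set \<Rightarrow> (real \<times> real \<times> real) set \<Rightarrow> bool" where
  "resolves N K L \<longleftrightarrow> (\<forall>s. \<forall>v\<in>K \<inter> sheet s. \<forall>w\<in>L \<inter> sheet s.
    \<not> (\<bar>real N * fst (flatten v) - real N * fst (flatten w)\<bar> \<le> 1 \<and> \<bar>real N * snd (flatten v) - real N * snd (flatten w)\<bar> \<le> 1))"

lemma sheets_separate:
  assumes K: "compact K" "K \<subseteq> orientable_surface g" and L: "compact L" "L \<subseteq> orientable_surface g" and "K \<inter> L = {}"
  shows "\<exists>\<delta>>0. \<forall>v\<in>K \<inter> sheet s. \<forall>w\<in>L \<inter> sheet s. \<delta> \<le> dist (flatten v) (flatten w)"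
proof -
  have c: "compact (flatten ` (K \<inter> sheet s))" "closed (flatten ` (L \<inter> sheet s))"
    using compact_continuous_image[OF continuous_flatten compact_Int_closed[OF K(1) closed_sheet]]
      compact_continuous_image[OF continuous_flatten compact_Int_closed[OF L(1) closed_sheet]] compact_imp_closed by blast+
  have "flatten ` (K \<inter> sheet s) \<inter> flatten ` (L \<inter> sheet s) = {}"
  proof (rule ccontr)
    assume "\<not> ?thesis"
    then obtain v w where vw: "v \<in> K" "v \<in> sheet s" "w \<in> L" "w \<in> sheet s" "flatten v = flatten w" by blast
    have "v = w" by (rule flatten_inj[of v g w s]) (use vw K(2) L(2) in blast)+
    then show False using vw assms(5) by blast
  qed
  from separate_compact_closed[OF c this] show ?thesis by simp
qed

text \<open>Images at distance at least \<open>\<delta>\<close> are told apart once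
  \<open>N \<delta>\<close> exceeds 2, the most that two coordinate differences of size at most 1
  can add up to.\<close>

lemma eventually_resolves:
  assumes K: "compact K" "K \<subseteq> orientable_surface g" and L: "compact L" "L \<subseteq> orientable_surface g" and "K \<inter> L = {}"
  shows "\<forall>\<^sub>F N in sequentially. resolves N K L"
proof -
  obtain \<delta> where \<delta>: "\<And>s. \<delta> s > 0" "\<And>s v w. v \<in> K \<inter> sheet s \<Longrightarrow> w \<in> L \<inter> sheet s \<Longrightarrow> \<delta> s \<le> dist (flatten v) (flatten w)"
    using sheets_separate[OF assms] by metis
  let ?d = "min (\<delta> True) (\<delta> False)"
  have d: "?d > 0" using \<delta>(1) by simp
  have res: "\<not> (\<bar>real N * fst (flatten v) - real N * fst (flatten w)\<bar> \<le> 1 \<and> \<bar>real N * snd (flatten v) - real N * snd (flatten w)\<bar> \<le> 1)"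
    if N: "2 / ?d < real N" and v: "v \<in> K \<inter> sheet s" and w: "w \<in> L \<inter> sheet s" for N s v w
  proof
    assume c: "\<bar>real N * fst (flatten v) - real N * fst (flatten w)\<bar> \<le> 1 \<and> \<bar>real N * snd (flatten v) - real N * snd (flatten w)\<bar> \<le> 1"
    have N0: "real N > 0" using N d by (meson divide_pos_pos less_trans zero_less_numeral)
    have "\<delta> s \<le> dist (flatten v) (flatten w)" by (rule \<delta>(2)[OF v w])
    also have "\<dots> \<le> dist (fst (flatten v)) (fst (flatten w)) + dist (snd (flatten v)) (snd (flatten w))"
      unfolding dist_prod_def by (rule sqrt_sum_squares_le_sum) auto
    finally have "real N * \<delta> s \<le> real N * \<bar>fst (flatten v) - fst (flatten w)\<bar> + real N * \<bar>snd (flatten v) - snd (flatten w)\<bar>"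
      using N0 by (simp add: dist_real_def distrib_left[symmetric])
    also have "\<dots> = \<bar>real N * fst (flatten v) - real N * fst (flatten w)\<bar> + \<bar>real N * snd (flatten v) - real N * snd (flatten w)\<bar>"
      by (simp add: abs_mult right_diff_distrib[symmetric])
    also have "\<dots> \<le> 2" using c by simp
    finally have "real N * \<delta> s \<le> 2" .
    moreover have "?d \<le> \<delta> s" by (cases s) auto
    then have "real N * ?d \<le> real N * \<delta> s" using N0 by (intro mult_left_mono) auto
    moreover have "2 < real N * ?d" using N d by (simp add: divide_less_eq)
    ultimately show False by linarith
  qed
  have "\<forall>\<^sub>F N in sequentially. 2 / ?d < real N"
    using filterlim_real_sequentially unfolding filterlim_at_top_dense by blast
  then show ?thesis
  proof (rule eventually_mono)
    fix N assume "2 / ?d < real N"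
    from res[OF this] show "resolves N K L" unfolding resolves_def by blast
  qed
qed

text \<open>Only the scale \<open>N\<close> of the lattice depends on the drawing. It has to resolve
  finitely many pairs of disjoint pieces, each of which is resolved by all large
  \<open>N\<close>.\<close>

theorem genus_gen:
  fixes G :: "'v graph"
  assumes G: "simple_graph G" "verts G \<noteq> {}" and gen: "genus_at_most g G"
  shows "\<exists>t\<le>2 * int g. gen G t"
proof -
  let ?S = "orientable_surface g"
  obtain K M where K: "\<forall>v\<in>verts G. compact (K v) \<and> connected (K v) \<and> K v \<noteq> {} \<and> K v \<subseteq> ?S"
    and M: "\<forall>e\<in>edges G. compact (M e) \<and> connected (M e) \<and> M e \<subseteq> ?S"
    and KK: "\<forall>v\<in>verts G. \<forall>w\<in>verts G. v \<noteq> w \<longrightarrow> K v \<inter> K w = {}"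
    and KM: "\<forall>e\<in>edges G. \<forall>w\<in>verts G. w \<notin> e \<longrightarrow> K w \<inter> M e = {}"
    and MM: "\<forall>e\<in>edges G. \<forall>e'\<in>edges G. e \<noteq> e' \<longrightarrow> M e \<inter> M e' = {}"
    and KMe: "\<forall>e\<in>edges G. \<forall>v\<in>e. K v \<inter> M e \<noteq> {}"
    using embedding_pieces[OF G(1) gen[unfolded genus_at_most_def]] by (elim exE conjE) (rule that)
  have fin: "finite (verts G)" "finite (edges G)" using G(1) simple_finite_edges[OF G(1)] by (simp_all add: simple_graph_def)
  have guard: "\<forall>\<^sub>F N in sequentially. P \<longrightarrow> Q N" if "P \<Longrightarrow> \<forall>\<^sub>F N in sequentially. Q N" for P and Q :: "nat \<Rightarrow> bool"
    using that by (cases P) auto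
  have K': "compact (K v)" "K v \<subseteq> ?S" if "v \<in> verts G" for v using K that by blast+
  have M': "compact (M e)" "M e \<subseteq> ?S" if "e \<in> edges G" for e using M that by blast+
  have "\<forall>\<^sub>F N in sequentially. \<forall>v\<in>verts G. \<forall>w\<in>verts G. v \<noteq> w \<longrightarrow> resolves N (K v) (K w)"
  proof (intro eventually_ball_finite fin ballI guard)
    fix v w assume a: "v \<in> verts G" "w \<in> verts G" "v \<noteq> w"
    have "K v \<inter> K w = {}" using KK a by blast
    then show "\<forall>\<^sub>F N in sequentially. resolves N (K v) (K w)"
      by (rule eventually_resolves[OF K'[OF a(1)] K'[OF a(2)]])
  qed
  moreover have "\<forall>\<^sub>F N in sequentially. \<forall>e\<in>edges G. \<forall>w\<in>verts G. w \<notin> e \<longrightarrow> resolves N (K w) (M e)"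
  proof (intro eventually_ball_finite fin ballI guard)
    fix e w assume a: "e \<in> edges G" "w \<in> verts G" "w \<notin> e"
    have "K w \<inter> M e = {}" using KM a by blast
    then show "\<forall>\<^sub>F N in sequentially. resolves N (K w) (M e)"
      by (rule eventually_resolves[OF K'[OF a(2)] M'[OF a(1)]])
  qed
  moreover have "\<forall>\<^sub>F N in sequentially. \<forall>e\<in>edges G. \<forall>e'\<in>edges G. e \<noteq> e' \<longrightarrow> resolves N (M e) (M e')"
  proof (intro eventually_ball_finite fin ballI guard)
    fix e e' assume a: "e \<in> edges G" "e' \<in> edges G" "e \<noteq> e'"
    have "M e \<inter> M e' = {}" using MM a by blast
    then show "\<forall>\<^sub>F N in sequentially. resolves N (M e) (M e')"
      by (rule eventually_resolves[OF M'[OF a(1)] M'[OF a(2)]])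
  qed
  moreover have "\<forall>\<^sub>F N in sequentially. 0 < N" by (rule eventually_gt_at_top)
  ultimately have "\<forall>\<^sub>F N in sequentially. (\<forall>v\<in>verts G. \<forall>w\<in>verts G. v \<noteq> w \<longrightarrow> resolves N (K v) (K w)) \<and>
      (\<forall>e\<in>edges G. \<forall>w\<in>verts G. w \<notin> e \<longrightarrow> resolves N (K w) (M e)) \<and>
      (\<forall>e\<in>edges G. \<forall>e'\<in>edges G. e \<noteq> e' \<longrightarrow> resolves N (M e) (M e')) \<and> 0 < N"
    by (intro eventually_conj)
  from eventually_happens'[OF sequentially_bot this] obtain N where fKK: "\<forall>v\<in>verts G. \<forall>w\<in>verts G. v \<noteq> w \<longrightarrow> resolves N (K v) (K w)"
    and fKM: "\<forall>e\<in>edges G. \<forall>w\<in>verts G. w \<notin> e \<longrightarrow> resolves N (K w) (M e)"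
    and fMM: "\<forall>e\<in>edges G. \<forall>e'\<in>edges G. e \<noteq> e' \<longrightarrow> resolves N (M e) (M e')" and N: "0 < N"
    by (elim exE conjE) (rule that)
  \<comment> \<open>The numbers of \<open>flatten_range\<close> times \<open>N\<close>: holes of
    side 6 starting at \<open>16 k + 10\<close> and at height 10, in a rectangle of
    \<open>16 g + 10\<close> by 26.\<close>
  interpret grid: holed_grid g "6 * int N" "(16 * int g + 10) * int N" "26 * int N" "10 * int N" "\<lambda>k. (16 * int k + 10) * int N"
  proof
    show "1 \<le> 6 * int N" "1 \<le> 10 * int N" "10 * int N + 6 * int N < 26 * int N" using N by auto
    have pos: "1 \<le> (16 * int k + 10) * int N" for k using N by (metis add_nonneg_pos int_one_le_iff_zero_less mult_nonneg_nonneg mult_pos_pos of_nat_0_le_iff of_nat_0_less_iff zero_le_numeral zero_less_numeral)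
    show "1 \<le> (16 * int g + 10) * int N" "1 \<le> (16 * int k + 10) * int N" for k by (rule pos)+
    have less: "(16 * int k + 10) * int N + 6 * int N < (16 * int l + 10) * int N" if "k < l" for k l
    proof -
      have "(16 * int k + 16) * int N < (16 * int l + 10) * int N" using that N by (intro mult_strict_right_mono) auto
      then show ?thesis by (simp add: algebra_simps)
    qed
    show "(16 * int k + 10) * int N + 6 * int N < (16 * int g + 10) * int N" if "k < g" for k by (rule less[OF that])
    show "(16 * int k + 10) * int N + 6 * int N < (16 * int l + 10) * int N" if "k < l" "l < g" for k l by (rule less[OF that(1)])
  qed
  define y where "y w = (real N * fst (flatten w), real N * snd (flatten w))" for w
  \<comment> \<open>The part of one half of the surface that lies over a closed pixel. Mid-height
    points belong to both halves.\<close>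
  define cell where "cell u = {w \<in> ?S. w \<in> sheet (snd u) \<and> fst u \<in> grid.around (y w)}" for u
  have Np: "0 < real N" using N by simp
  have cf: "continuous_on UNIV (\<lambda>w. fst (flatten w))" "continuous_on UNIV (\<lambda>w. snd (flatten w))"
    by (intro continuous_on_fst continuous_on_snd continuous_flatten)+
  have cl: "closed (cell u)" for u
  proof -
    have "cell u = ?S \<inter> sheet (snd u) \<inter> {w. real_of_int (fst (fst u)) \<le> real N * fst (flatten w)} \<inter>
      {w. real N * fst (flatten w) \<le> real_of_int (fst (fst u)) + 1} \<inter> {w. real_of_int (snd (fst u)) \<le> real N * snd (flatten w)} \<inter>
      {w. real N * snd (flatten w) \<le> real_of_int (snd (fst u)) + 1}"
      by (auto simp: cell_def y_def grid.around_def mem_Times_iff)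
    also have "closed \<dots>"
      by (intro closed_Int closed_sheet closed_Collect_le continuous_on_mult continuous_on_add continuous_on_const cf)
         (simp add: orientable_surface_def)
    finally show ?thesis .
  qed
  have bds: "0 \<le> fst (y w)" "fst (y w) \<le> real_of_int ((16 * int g + 10) * int N)" "0 \<le> snd (y w)" "snd (y w) \<le> real_of_int (26 * int N)"
    if "w \<in> ?S" for w
    using flatten_range(1-4)[OF that] Np by (auto simp: y_def mult.commute[of "real N"] intro!: mult_right_mono)
  have le: "(real_of_int ((16 * int k + 10) * int N) \<le> fst (y w)) = (16 * real k + 10 \<le> fst (flatten w))"
    "(fst (y w) \<le> real_of_int ((16 * int k + 10) * int N + 6 * int N)) = (fst (flatten w) \<le> 16 * real k + 16)"
    "(real_of_int (10 * int N) \<le> snd (y w)) = (10 \<le> snd (flatten w))"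
    "(snd (y w) \<le> real_of_int (10 * int N + 6 * int N)) = (snd (flatten w) \<le> 16)" for k w
  proof -
    have e: "real_of_int ((16 * int k + 10) * int N) = real N * (16 * real k + 10)"
      "real_of_int ((16 * int k + 10) * int N + 6 * int N) = real N * (16 * real k + 16)"
      "real_of_int (10 * int N) = real N * 10" "real_of_int (10 * int N + 6 * int N) = real N * 16" by (simp_all add: algebra_simps)
    show "(real_of_int ((16 * int k + 10) * int N) \<le> fst (y w)) = (16 * real k + 10 \<le> fst (flatten w))"
      "(fst (y w) \<le> real_of_int ((16 * int k + 10) * int N + 6 * int N)) = (fst (flatten w) \<le> 16 * real k + 16)"
      "(real_of_int (10 * int N) \<le> snd (y w)) = (10 \<le> snd (flatten w))"
      "(snd (y w) \<le> real_of_int (10 * int N + 6 * int N)) = (snd (flatten w) \<le> 16)"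
      unfolding e y_def fst_conv snd_conv by (rule mult_le_cancel_left_pos[OF Np])+
  qed
  have cover: "grid.pix \<inter> grid.around (y w) \<noteq> {}" if w: "w \<in> ?S" for w
  proof (rule grid.pix_cover[OF bds[OF w]])
    fix k assume k: "k < g"
    have "\<not> (16 * real k + 10 < fst (flatten w) \<and> fst (flatten w) < 16 * real k + 16 \<and> 10 < snd (flatten w) \<and> snd (flatten w) < 16)"
      by (rule flatten_range(5)[OF w k])
    moreover have "16 * real k + 10 < fst (flatten w)" if "real_of_int ((16 * int k + 10) * int N) < fst (y w)"
    proof -
      have "real N * (16 * real k + 10) < real N * fst (flatten w)" using that by (simp add: y_def algebra_simps)
      then show ?thesis using Np by simp
    qed
    moreover have "fst (flatten w) < 16 * real k + 16" if "fst (y w) < real_of_int ((16 * int k + 10) * int N + 6 * int N)"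
    proof -
      have "real N * fst (flatten w) < real N * (16 * real k + 16)" using that by (simp add: y_def algebra_simps)
      then show ?thesis using Np by simp
    qed
    moreover have "10 < snd (flatten w)" if "real_of_int (10 * int N) < snd (y w)"
    proof -
      have "real N * 10 < real N * snd (flatten w)" using that by (simp add: y_def algebra_simps)
      then show ?thesis using Np by simp
    qed
    moreover have "snd (flatten w) < 16" if "snd (y w) < real_of_int (10 * int N + 6 * int N)"
    proof -
      have "real N * snd (flatten w) < real N * 16" using that by (simp add: y_def algebra_simps)
      then show ?thesis using Np by simp
    qed
    ultimately show "\<not> (real_of_int ((16 * int k + 10) * int N) < fst (y w) \<and>
        fst (y w) < real_of_int ((16 * int k + 10) * int N + 6 * int N) \<and>
        real_of_int (10 * int N) < snd (y w) \<and> snd (y w) < real_of_int (10 * int N + 6 * int N))" by blast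
  qed
  have sh: "\<exists>s. w \<in> sheet s" for w by (cases "1/2 \<le> snd (snd w)") (auto simp: sheet_def intro: exI[of _ True] exI[of _ False])
  have cov: "?S \<subseteq> \<Union> (cell ` grid.V)"
  proof
    fix w assume w: "w \<in> ?S"
    obtain s where "w \<in> sheet s" using sh by blast
    moreover obtain u where "u \<in> grid.pix" "u \<in> grid.around (y w)" using cover[OF w] by blast
    ultimately have "(u, s) \<in> grid.V" "w \<in> cell (u, s)" using w by (auto simp: grid.V_def cell_def)
    then show "w \<in> \<Union> (cell ` grid.V)" by blast
  qed
  have loc: "linked (dart_adj grid.\<alpha> grid.\<rho>) {u \<in> grid.V. w \<in> cell u}" if w: "w \<in> ?S" for w
  proof -
    let ?T = "{s. w \<in> sheet s}"
    have eq: "{u \<in> grid.V. w \<in> cell u} = (grid.pix \<inter> grid.around (y w)) \<times> ?T"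
      using w by (auto simp: grid.V_def cell_def)
    have "\<exists>s. ?T = {s} \<or> (\<exists>u\<in>grid.pix \<inter> grid.around (y w). \<exists>d<4. nb u d \<notin> grid.pix)"
    proof (cases "w \<in> sheet True \<and> w \<in> sheet False")
      case True
      have "fst (y w) = 0 \<or> fst (y w) = real_of_int ((16 * int g + 10) * int N) \<or> snd (y w) = 0 \<or> snd (y w) = real_of_int (26 * int N) \<or>
        (\<exists>k<g. real_of_int ((16 * int k + 10) * int N) \<le> fst (y w) \<and> fst (y w) \<le> real_of_int ((16 * int k + 10) * int N + 6 * int N) \<and>
          real_of_int (10 * int N) \<le> snd (y w) \<and> snd (y w) \<le> real_of_int (10 * int N + 6 * int N) \<and>
          (fst (y w) = real_of_int ((16 * int k + 10) * int N) \<or> fst (y w) = real_of_int ((16 * int k + 10) * int N + 6 * int N) \<or>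
           snd (y w) = real_of_int (10 * int N) \<or> snd (y w) = real_of_int (10 * int N + 6 * int N)))"
        using flatten_boundary[OF w conjunct1[OF True] conjunct2[OF True]]
      proof (elim disjE exE conjE)
        fix k assume k: "k < g" "16 * real k + 10 \<le> fst (flatten w)" "fst (flatten w) \<le> 16 * real k + 16"
          "10 \<le> snd (flatten w)" "snd (flatten w) \<le> 16"
        show ?thesis if "fst (flatten w) = 16 * real k + 10"
        proof -
          have "fst (y w) = real_of_int ((16 * int k + 10) * int N)" using that by (simp add: y_def)
          then show ?thesis using k unfolding le by blast
        qed
        show ?thesis if "fst (flatten w) = 16 * real k + 16"
        proof -
          have "fst (y w) = real_of_int ((16 * int k + 10) * int N + 6 * int N)" using that by (simp add: y_def algebra_simps)
          then show ?thesis using k unfolding le by blast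
        qed
        show ?thesis if "snd (flatten w) = 10"
        proof -
          have "snd (y w) = real_of_int (10 * int N)" using that by (simp add: y_def)
          then show ?thesis using k unfolding le by blast
        qed
        show ?thesis if "snd (flatten w) = 16"
        proof -
          have "snd (y w) = real_of_int (10 * int N + 6 * int N)" using that by (simp add: y_def)
          then show ?thesis using k unfolding le by blast
        qed
      qed (auto simp: y_def)
      then show ?thesis using grid.pix_boundary[OF bds[OF w]] by blast
    next
      case False
      have "?T = {True} \<or> ?T = {False}" using sh[of w] False by (auto; metis (full_types))
      then show ?thesis by blast
    qed
    then obtain s where "?T = {s} \<or> (\<exists>u\<in>grid.pix \<inter> grid.around (y w). \<exists>d<4. nb u d \<notin> grid.pix)" ..
    moreover have "?T \<noteq> {}" using sh[of w] by blast
    ultimately show ?thesis unfolding eq by (rule grid.linked_around)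
  qed
  have sep: "cell u \<inter> X = {} \<or> cell u \<inter> Y = {}" if f: "resolves N X Y" for u X Y
  proof (rule ccontr)
    assume "\<not> ?thesis"
    then obtain v w where vw: "v \<in> cell u" "v \<in> X" "w \<in> cell u" "w \<in> Y" by blast
    have "\<bar>real N * fst (flatten v) - real N * fst (flatten w)\<bar> \<le> 1 \<and> \<bar>real N * snd (flatten v) - real N * snd (flatten w)\<bar> \<le> 1"
      using vw(1,3) by (auto simp: cell_def y_def grid.around_def mem_Times_iff)
    moreover have "v \<in> X \<inter> sheet (snd u)" "w \<in> Y \<inter> sheet (snd u)" using vw by (auto simp: cell_def)
    ultimately show False using f unfolding resolves_def by blast
  qed
  show ?thesis
  proof (rule branch_gen[where cell = cell and K = K and M = M and S = ?S,
        OF grid.rotation_\<rho> grid.walk_\<rho> grid.euler grid.linked_V cl cov loc G])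
    show "connected (K v) \<and> K v \<noteq> {} \<and> K v \<subseteq> ?S" if "v \<in> verts G" for v using K that by blast
    show "connected (M e) \<and> M e \<subseteq> ?S" if "e \<in> edges G" for e using M that by blast
    show "cell u \<inter> K v = {} \<or> cell u \<inter> K w = {}" if "v \<in> verts G" "w \<in> verts G" "v \<noteq> w" for v w u using fKK that by (intro sep) blast
    show "cell u \<inter> K w = {} \<or> cell u \<inter> M e = {}" if "e \<in> edges G" "w \<in> verts G" "w \<notin> e" for e w u using fKM that by (intro sep) blast
    show "cell u \<inter> M e = {} \<or> cell u \<inter> M e' = {}" if "e \<in> edges G" "e' \<in> edges G" "e \<noteq> e'" for e e' u using fMM that by (intro sep) blast
    show "K v \<inter> M e \<noteq> {}" if "e \<in> edges G" "v \<in> e" for e v using KMe that by blast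
  qed
qed

section \<open>Consequences for embedded graphs\<close>

lemma embeds_subgraph:
  assumes "embeds_in G S" "X \<subseteq> verts G" "F \<subseteq> edges G" "\<And>e. e \<in> F \<Longrightarrow> e \<subseteq> X"
  shows "embeds_in (X, F) S"
proof -
  obtain p \<gamma> where inj: "inj_on p (verts G)" and pS: "p ` verts G \<subseteq> S"
    and edge: "\<forall>e\<in>edges G. arc (\<gamma> e) \<and> path_image (\<gamma> e) \<subseteq> S \<and>
        {pathstart (\<gamma> e), pathfinish (\<gamma> e)} = p ` e \<and> path_image (\<gamma> e) \<inter> p ` verts G = p ` e"
    and cross: "\<forall>e\<in>edges G. \<forall>e'\<in>edges G. e \<noteq> e' \<longrightarrow> path_image (\<gamma> e) \<inter> path_image (\<gamma> e') = p ` (e \<inter> e')"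
    using assms(1) unfolding embeds_in_def by (elim exE conjE) (rule that)
  have "path_image (\<gamma> e) \<inter> p ` X = p ` e" if "e \<in> F" for e
  proof -
    have "p ` e \<subseteq> p ` X" "p ` X \<subseteq> p ` verts G" using assms(2) assms(4)[OF that] by (simp_all add: image_mono)
    moreover have "path_image (\<gamma> e) \<inter> p ` verts G = p ` e" using edge assms(3) that by (meson subsetD)
    ultimately show ?thesis by blast
  qed
  moreover have "p ` X \<subseteq> S" using pS assms(2) by (meson image_mono order_trans)
  moreover have "inj_on p X" using inj assms(2) inj_on_subset by blast
  moreover have FG: "e \<in> edges G" if "e \<in> F" for e using that assms(3) by blast
  ultimately show ?thesis unfolding embeds_in_def fst_conv snd_conv
  proof (intro exI[of _ p] exI[of _ \<gamma>] conjI ballI impI)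
    fix e assume "e \<in> F"
    from bspec[OF edge FG[OF this]] show "arc (\<gamma> e)" "path_image (\<gamma> e) \<subseteq> S"
      "{pathstart (\<gamma> e), pathfinish (\<gamma> e)} = p ` e" by simp_all
  qed (use cross FG in simp_all)
qed

lemma planar_iso:
  assumes iso: "graph_iso C H" and C: "simple_graph C" and pl: "planar C"
  shows "planar H"
proof -
  obtain f where f: "bij_betw f (verts C) (verts H)" and fe: "(\<lambda>e. f ` e) ` edges C = edges H"
    using iso unfolding graph_iso_def by blast
  obtain p :: "_ \<Rightarrow> real \<times> real" and \<gamma> where inj: "inj_on p (verts C)"
    and edge: "\<forall>e\<in>edges C. arc (\<gamma> e) \<and> path_image (\<gamma> e) \<subseteq> UNIV \<and>
        {pathstart (\<gamma> e), pathfinish (\<gamma> e)} = p ` e \<and> path_image (\<gamma> e) \<inter> p ` verts C = p ` e"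
    and cross: "\<forall>e\<in>edges C. \<forall>e'\<in>edges C. e \<noteq> e' \<longrightarrow> path_image (\<gamma> e) \<inter> path_image (\<gamma> e') = p ` (e \<inter> e')"
    using pl unfolding planar_def embeds_in_def by (elim exE conjE) (rule that)
  define h where "h = inv_into (verts C) f"
  have finj: "inj_on f (verts C)" and fim: "f ` verts C = verts H" using f by (auto simp: bij_betw_def)
  have sub: "e \<subseteq> verts C" if "e \<in> edges C" for e using C that by (simp add: simple_graph_def)
  have hf: "h ` f ` X = X" if "X \<subseteq> verts C" for X
    using inv_into_image_cancel[OF finj that] by (simp add: h_def)
  have hV: "h ` verts H = verts C" using hf[of "verts C"] fim by simp
  have hb: "bij_betw h (verts H) (verts C)" unfolding h_def by (rule bij_betw_inv_into[OF f])
  have ph: "(p \<circ> h) ` f ` X = p ` X" if "X \<subseteq> verts C" for X unfolding image_comp[symmetric] hf[OF that] ..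
  have pV: "(p \<circ> h) ` verts H = p ` verts C" using ph[of "verts C"] fim by simp
  have "embeds_in H (UNIV :: (real \<times> real) set)"
    unfolding embeds_in_def
  proof (rule exI[of _ "p \<circ> h"], rule exI[of _ "\<gamma> \<circ> image h"], intro conjI ballI impI)
    show "inj_on (p \<circ> h) (verts H)" using hb inj by (intro comp_inj_on) (auto simp: bij_betw_def)
    fix e' assume "e' \<in> edges H"
    then have "e' \<in> (\<lambda>e. f ` e) ` edges C" using fe by simp
    then obtain e where e: "e' = f ` e" "e \<in> edges C" by (rule imageE)
    have g: "(\<gamma> \<circ> image h) e' = \<gamma> e" using hf[OF sub[OF e(2)]] e(1) by simp
    have pe: "(p \<circ> h) ` e' = p ` e" unfolding e(1) by (rule ph[OF sub[OF e(2)]])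
    show "arc ((\<gamma> \<circ> image h) e')"
      "{pathstart ((\<gamma> \<circ> image h) e'), pathfinish ((\<gamma> \<circ> image h) e')} = (p \<circ> h) ` e'"
      "path_image ((\<gamma> \<circ> image h) e') \<inter> (p \<circ> h) ` verts H = (p \<circ> h) ` e'"
      unfolding g pe pV using edge e(2) by simp_all
    fix e2' assume "e2' \<in> edges H" and ne: "e' \<noteq> e2'"
    then have "e2' \<in> (\<lambda>e. f ` e) ` edges C" using fe by simp
    then obtain e2 where e2: "e2' = f ` e2" "e2 \<in> edges C" by (rule imageE)
    have g2: "(\<gamma> \<circ> image h) e2' = \<gamma> e2" using hf[OF sub[OF e2(2)]] e2(1) by simp
    have "e' \<inter> e2' = f ` (e \<inter> e2)" unfolding e(1) e2(1)
      using inj_on_image_Int[OF finj sub[OF e(2)] sub[OF e2(2)]] by simp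
    moreover have "e \<inter> e2 \<subseteq> verts C" using sub[OF e(2)] by blast
    ultimately have "(p \<circ> h) ` (e' \<inter> e2') = p ` (e \<inter> e2)" using ph by simp
    moreover have "e \<noteq> e2" using ne e(1) e2(1) by blast
    ultimately show "path_image ((\<gamma> \<circ> image h) e') \<inter> path_image ((\<gamma> \<circ> image h) e2') = (p \<circ> h) ` (e' \<inter> e2')"
      unfolding g g2 using cross e(2) e2(2) by simp
  qed auto
  then show ?thesis by (simp add: planar_def)
qed

lemma connected_mono: "connected_graph (V, F) \<Longrightarrow> F \<subseteq> E \<Longrightarrow> connected_graph (V, E)"
  unfolding connected_graph_def using adj_mono[of F E V V] by auto

lemma spanning_edges:
  assumes G: "simple_graph (V, E)" "connected_graph (V, E)"
  shows "\<exists>F\<subseteq>E. connected_graph (V, F) \<and> card F < card V"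
proof -
  have fin: "finite V" "finite E" using G(1) simple_finite_edges[OF G(1)] by (auto simp: simple_graph_def)
  have tree: "\<exists>W F. W \<subseteq> V \<and> F \<subseteq> E \<and> connected_graph (W, F) \<and> card F < card W \<and> card W = Suc k" if "Suc k \<le> card V" for k
    using that
  proof (induction k)
    case 0
    obtain v where "v \<in> V" using G(2) by (auto simp: connected_graph_def)
    then show ?case by (intro exI[of _ "{v}"] exI[of _ "{}"]) (auto simp: connected_graph_def)
  next
    case (Suc k)
    then obtain W F where W: "W \<subseteq> V" "F \<subseteq> E" "connected_graph (W, F)" "card F < card W" "card W = Suc k" by auto
    have "W \<noteq> V" using W(5) Suc.prems by auto
    then have "W \<subset> V" using W(1) by blast
    moreover have "W \<noteq> {}" using W(5) by auto
    ultimately obtain d where d: "d \<in> adj (V, E)" "fst d \<in> W" "snd d \<in> - W" using connected_cut[OF G(2), of W] by auto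
    obtain u v where uv: "d = (u, v)" by (cases d)
    then have e: "{u, v} \<in> E" "u \<in> W" "v \<notin> W" using d by (auto simp: adj_def)
    then have "v \<in> V" using G(1) by (auto simp: simple_graph_def)
    have "connected_graph ({v}, {})" by (simp add: connected_graph_def)
    from connected_join[OF W(3) this e(2), of v] have "connected_graph (insert v W, insert {u, v} F)" by (simp add: Un_commute)
    moreover have "finite W" "finite F" using W fin finite_subset by blast+
    then have "card (insert {u, v} F) < card (insert v W)" "card (insert v W) = Suc (Suc k)"
      using W(4,5) e(3) card_insert_le_m1[of "card W" F "{u, v}"] by (auto simp: card_insert_if)
    ultimately show ?case using W(1,2) e(1) \<open>v \<in> V\<close>
      by (intro exI[of _ "insert v W"] exI[of _ "insert {u, v} F"]) auto
  qed
  have "card V \<noteq> 0" using G(2) fin by (auto simp: connected_graph_def)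
  then obtain k where "card V = Suc k" using not0_implies_Suc by blast
  with tree[of k] obtain W F where WF: "W \<subseteq> V" "F \<subseteq> E" "connected_graph (W, F)" "card F < card W" "card W = card V" by auto
  have "W = V" using card_subset_eq[OF fin(1) WF(1,5)] .
  then show ?thesis using WF by blast
qed

text \<open>A connected non-planar graph has more edges than vertices, so two edges lie outside a
  spanning tree. One pays for a move; the other shows that a cycle is left.\<close>

lemma two_removable_edges:
  assumes G: "simple_graph (V, E)" "connected_graph (V, E)" "\<not> planar (V, E)"
  shows "\<exists>e\<in>E. \<exists>f\<in>E. e \<noteq> f \<and> connected_graph (V, E - {e}) \<and> connected_graph (V, E - {e} - {f})"
proof -
  have "\<not> card E \<le> card V"
  proof
    assume "card E \<le> card V"
    then obtain \<rho> w where "rot_of (V, E) \<rho>" "grows prod.swap \<rho> (verts (V, E)) w" "red prod.swap 0 w"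
      using sparse_word[OF G(1,2)] by auto
    then show False using word_planar[OF G(1)] G(3) by blast
  qed
  moreover obtain F where F: "F \<subseteq> E" "connected_graph (V, F)" "card F < card V" using spanning_edges[OF G(1,2)] by blast
  moreover have fin: "finite E" using simple_finite_edges[OF G(1)] by simp
  ultimately have "2 \<le> card (E - F)" using card_Diff_subset[of F E] finite_subset[OF F(1) fin] by linarith
  then obtain B where B: "B \<subseteq> E - F" "card B = 2" by (rule obtain_subset_with_card_n)
  then obtain e f where ef: "B = {e, f}" "e \<noteq> f" by (meson card_2_iff)
  have "connected_graph (V, E - {e})" "connected_graph (V, E - {e} - {f})"
    by (rule connected_mono[OF F(2)]; use B(1) ef F(1) in blast)+
  then show ?thesis using ef B(1) by blast
qed

text \<open>In the given drawing \<open>u\<close> and \<open>v\<close> may border no common face, so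
  it is abandoned. The component of \<open>u\<close> is split off the certificate, the rest is
  connected without raising the total, the new edge joins the two, and the result is drawn afresh;
  it contains the desired graph.\<close>

lemma genus_add_edge:
  assumes G: "simple_graph G" "genus_at_most g G" and u: "u \<in> verts G" and v: "v \<in> verts G" "(u, v) \<notin> (adj G)\<^sup>*"
  shows "genus_at_most g (verts G, insert {u, v} (edges G))"
proof -
  have "verts G \<noteq> {}" using u by blast
  from genus_gen[OF G(1) this G(2)] obtain t where t: "t \<le> 2 * int g" "gen G t" by blast
  define U where "U = (adj G)\<^sup>* `` {u}"
  have U: "U \<subseteq> verts G" unfolding U_def using adj_rtrancl_verts[OF G(1) _ u] by blast
  have uU: "u \<in> U" "v \<notin> U" using v(2) by (auto simp: U_def)
  have cU: "connected_graph (U, {e \<in> edges G. e \<subseteq> U})" by (rule component_connected[OF G(1) u U_def])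
  have eU: "e \<subseteq> U \<or> e \<inter> U = {}" if "e \<in> edges G" for e by (rule component_edges[OF G(1) U_def that])
  from gen_split[OF t(2) U cU eU] uU(2) v(1) obtain a b where ab: "a + b = t" "cert (U, {e \<in> edges G. e \<subseteq> U}) a"
    "gen (verts G - U, {e \<in> edges G. e \<inter> U = {}}) b" by blast
  from gen_connect[OF ab(3)] obtain E where E: "{e \<in> edges G. e \<inter> U = {}} \<subseteq> E" "simple_graph (verts G - U, E)"
    "connected_graph (verts G - U, E)" "cert (verts G - U, E) b" by auto
  let ?A = "{e \<in> edges G. e \<subseteq> U}"
  let ?G = "(U \<union> (verts G - U), insert {u, v} (?A \<union> E))"
  have sA: "simple_graph (U, ?A)" using G(1) U finite_subset by (auto simp: simple_graph_def)
  have V: "U \<union> (verts G - U) = verts G" using U by blast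
  have vU: "v \<in> verts G - U" using v(1) uU(2) by blast
  have dj: "U \<inter> (verts G - U) = {}" by blast
  have s: "simple_graph ?G" by (rule simple_join[OF sA E(2) dj uU(1) vU])
  have c: "connected_graph ?G" by (rule connected_join[OF cU E(3) uU(1) vU])
  have ce: "cert ?G t" using cert_join[OF sA E(2) dj uU(1) vU ab(2) E(4)] ab(1) by simp
  obtain \<rho> w where "rot_of ?G \<rho>" "grows prod.swap \<rho> (verts ?G) w" "red prod.swap g w"
    using cert_word[OF s c ce t(1)] by blast
  from word_surface[OF s this] have emb: "embeds_in ?G (orientable_surface g)" by (simp add: genus_at_most_def)
  have sub: "edges G \<subseteq> ?A \<union> E"
  proof
    fix e assume e: "e \<in> edges G"
    then show "e \<in> ?A \<union> E" using eU[OF e] E(1) by blast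
  qed
  show ?thesis unfolding genus_at_most_def
  proof (rule embeds_subgraph[OF emb])
    show "verts G \<subseteq> verts ?G" using V by simp
    show "insert {u, v} (edges G) \<subseteq> edges ?G" unfolding snd_conv by (rule insert_mono[OF sub])
    show "e \<subseteq> verts G" if "e \<in> insert {u, v} (edges G)" for e using that G(1) u v(1) by (auto simp: simple_graph_def)
  qed
qed

text \<open>A certificate of value at most 0 gives a word reducible without handles, hence a plane
  drawing. So each non-planar component takes at least 1 from the total.\<close>

lemma gen_pieces:
  fixes F :: "'v set \<Rightarrow> 'v set set"
  assumes "finite \<U>" "\<And>U. U \<in> \<U> \<Longrightarrow> simple_graph (U, F U) \<and> connected_graph (U, F U) \<and> \<not> planar (U, F U)"
    "\<And>U W. U \<in> \<U> \<Longrightarrow> W \<in> \<U> \<Longrightarrow> U \<noteq> W \<Longrightarrow> U \<inter> W = {}" "gen (\<Union>\<U>, \<Union> (F ` \<U>)) t"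
  shows "int (card \<U>) \<le> t"
  using assms
proof (induction "card \<U>" arbitrary: \<U> t rule: less_induct)
  case less
  have "\<Union>\<U> \<noteq> {}" using gen_simple[OF less.prems(4)] by simp
  then obtain U where U: "U \<in> \<U>" by blast
  note p = less.prems(2)[OF U]
  let ?R = "\<U> - {U}"
  have Fsub: "e \<subseteq> W \<and> e \<noteq> {}" if "W \<in> \<U>" "e \<in> F W" for e W
    using less.prems(2)[OF that(1)] that(2) by (auto simp: simple_graph_def)
  have dj: "U \<inter> W = {}" if "W \<in> ?R" for W using less.prems(3)[OF U] that by blast
  have out: "e \<inter> U = {}" if "W \<in> ?R" "e \<in> F W" for e W
  proof -
    have "e \<subseteq> W" using Fsub[of W e] that by blast
    then show ?thesis using dj[OF that(1)] by blast
  qed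
  have split: "\<Union> (F ` \<U>) = F U \<union> \<Union> (F ` ?R)" using U by blast
  have FU: "{e \<in> \<Union> (F ` \<U>). e \<subseteq> U} = F U"
  proof -
    have "\<not> e \<subseteq> U" if "W \<in> ?R" "e \<in> F W" for e W
    proof -
      have "e \<noteq> {}" using Fsub[of W e] that by blast
      then show ?thesis using out[OF that] by blast
    qed
    moreover have "e \<subseteq> U" if "e \<in> F U" for e using Fsub[OF U that] by blast
    ultimately show ?thesis unfolding split by blast
  qed
  have FR: "{e \<in> \<Union> (F ` \<U>). e \<inter> U = {}} = \<Union> (F ` ?R)"
  proof -
    have "e \<inter> U \<noteq> {}" if "e \<in> F U" for e using Fsub[OF U that] by blast
    then show ?thesis unfolding split using out by blast
  qed
  have VR: "\<Union>\<U> - U = \<Union>?R"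
  proof -
    have "\<Union>\<U> = U \<union> \<Union>?R" using U by blast
    moreover have "U \<inter> \<Union>?R = {}" using dj by blast
    ultimately show ?thesis by blast
  qed
  have pos: "1 \<le> s" if "cert (U, F U) s" for s
  proof (rule ccontr)
    assume "\<not> 1 \<le> s"
    then have le: "s \<le> 2 * int 0" by simp
    from p have "simple_graph (U, F U)" "connected_graph (U, F U)" by blast+
    from cert_word[OF this that le] obtain \<rho> w
      where "rot_of (U, F U) \<rho>" "grows prod.swap \<rho> (verts (U, F U)) w" "red prod.swap 0 w" by blast
    then show False using word_planar[of "(U, F U)" \<rho> w] p by blast
  qed
  have sub: "U \<subseteq> verts (\<Union>\<U>, \<Union> (F ` \<U>))" using U by auto
  have cU: "connected_graph (U, {e \<in> edges (\<Union>\<U>, \<Union> (F ` \<U>)). e \<subseteq> U})" unfolding snd_conv FU using p by blast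
  have eU: "e \<subseteq> U \<or> e \<inter> U = {}" if "e \<in> edges (\<Union>\<U>, \<Union> (F ` \<U>))" for e
  proof -
    have "e \<in> F U \<or> e \<in> \<Union> (F ` ?R)" using that split by auto
    then show ?thesis using FU FR by blast
  qed
  have "(U = \<Union>\<U> \<and> cert (\<Union>\<U>, \<Union> (F ` \<U>)) t) \<or>
      (U \<noteq> \<Union>\<U> \<and> (\<exists>a b. a + b = t \<and> cert (U, F U) a \<and> gen (\<Union>?R, \<Union> (F ` ?R)) b))"
    using gen_split[OF less.prems(4) sub cU eU] unfolding fst_conv snd_conv FU FR VR by simp
  then show ?case
  proof (elim disjE conjE exE)
    assume UU: "U = \<Union>\<U>" and "cert (\<Union>\<U>, \<Union> (F ` \<U>)) t"
    have "W = U" if "W \<in> \<U>" for W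
    proof (rule ccontr)
      assume "W \<noteq> U"
      then have "U \<inter> W = {}" "W \<subseteq> U" using dj that UU by auto
      moreover have "W \<noteq> {}" using less.prems(2)[OF that] by (auto simp: connected_graph_def)
      ultimately show False by blast
    qed
    then have "\<U> = {U}" using U by blast
    moreover from this have "cert (U, F U) t" using \<open>cert (\<Union>\<U>, \<Union> (F ` \<U>)) t\<close> by simp
    ultimately show ?thesis using pos by simp
  next
    fix a b assume ab: "a + b = t" "cert (U, F U) a" and g: "gen (\<Union>?R, \<Union> (F ` ?R)) b"
    have "1 \<le> a" by (rule pos[OF ab(2)])
    have lt: "card ?R < card \<U>" by (rule psubset_card_mono) (use U less.prems(1) in auto)
    have "int (card ?R) \<le> b"
    proof (rule less.hyps[OF lt _ _ _ g])
      show "finite ?R" using less.prems(1) by simp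
      show "simple_graph (W, F W) \<and> connected_graph (W, F W) \<and> \<not> planar (W, F W)" if "W \<in> ?R" for W
        using less.prems(2) that by blast
      show "W \<inter> W' = {}" if "W \<in> ?R" "W' \<in> ?R" "W \<noteq> W'" for W W' using less.prems(3) that by blast
    qed
    moreover have "card \<U> = Suc (card ?R)" using U less.prems(1) card_Suc_Diff1[of \<U> U] by simp
    ultimately show ?thesis using ab(1) \<open>1 \<le> a\<close> by simp
  qed
qed

text \<open>The sets are not components of the given graph, but they are components of the subgraph
  that keeps only the edges inside them, and this embeds as well.\<close>

lemma nonplanar_pieces:
  assumes G: "simple_graph (V, E)" "genus_at_most g (V, E)" and fin: "finite \<U>"
    and U: "\<And>U. U \<in> \<U> \<Longrightarrow> U \<subseteq> V \<and> connected_graph (U, {e \<in> E. e \<subseteq> U}) \<and> \<not> planar (U, {e \<in> E. e \<subseteq> U})"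
    and dj: "\<And>U W. U \<in> \<U> \<Longrightarrow> W \<in> \<U> \<Longrightarrow> U \<noteq> W \<Longrightarrow> U \<inter> W = {}"
  shows "card \<U> \<le> 2 * g"
proof (cases "\<U> = {}")
  case False
  let ?F = "\<lambda>U. {e \<in> E. e \<subseteq> U}"
  let ?G = "(\<Union>\<U>, \<Union> (?F ` \<U>))"
  have sub: "\<Union>\<U> \<subseteq> V" using U by blast
  have finV: "finite V" using G(1) by (simp add: simple_graph_def)
  have sF: "simple_graph (U, ?F U)" if "U \<in> \<U>" for U
    using G(1) U[OF that] finite_subset[OF _ finV, of U] by (auto simp: simple_graph_def)
  have sG: "simple_graph ?G" using G(1) finite_subset[OF sub finV] by (auto simp: simple_graph_def)
  have "embeds_in ?G (orientable_surface g)"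
    using G(2) unfolding genus_at_most_def by (rule embeds_subgraph) (use sub in auto)
  moreover have "\<Union>\<U> \<noteq> {}" using False U by (auto simp: connected_graph_def)
  ultimately obtain t where t: "t \<le> 2 * int g" "gen ?G t" using genus_gen[OF sG] by (auto simp: genus_at_most_def)
  have "int (card \<U>) \<le> t" by (rule gen_pieces[OF fin _ dj t(2)]) (use U sF in blast)+
  then show ?thesis using t(1) by linarith
qed simp

section \<open>Double counting\<close>

definition induced :: "'v set set \<Rightarrow> 'v set \<Rightarrow> 'v set set" where "induced E U = {e \<in> E. e \<subseteq> U}"

definition leaving :: "'v set set \<Rightarrow> 'v set \<Rightarrow> 'v set set" where
  "leaving E U = {e \<in> E. e \<inter> U \<noteq> {} \<and> \<not> e \<subseteq> U}"

text \<open>The shape of a copy once it has been tied to the rest by one edge.\<close>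

definition pendant :: "nat \<Rightarrow> 'v set set \<Rightarrow> 'v set \<Rightarrow> bool" where
  "pendant h E U \<longleftrightarrow> card U = h \<and> connected_graph (U, induced E U) \<and> card (leaving E U) \<le> 1"

lemma connected_step:
  assumes U: "connected_graph (U, induced E U)" and x: "x \<in> U" "x \<in> C" and n: "\<not> U \<subseteq> C"
  obtains a b where "{a, b} \<in> E" "a \<in> U" "a \<in> C" "b \<in> U" "b \<notin> C"
proof -
  have "U \<inter> C \<subset> verts (U, induced E U)" "U \<inter> C \<noteq> {}" using x n by auto
  from connected_cut[OF U this] obtain d where d: "d \<in> adj (U, induced E U)" "fst d \<in> U \<inter> C" "snd d \<in> - (U \<inter> C)" by blast
  obtain a b where ab: "d = (a, b)" by (cases d)
  then have "{a, b} \<in> E" "{a, b} \<subseteq> U" using d(1) by (auto simp: adj_def induced_def)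
  then show ?thesis using that[of a b] d(2,3) ab by simp
qed

text \<open>Having equal size, neither set contains the other, so by connectedness each has an edge
  leaving the intersection into its own remainder. That edge is the only one leaving the other set,
  and none is left for the union.\<close>

lemma pendant_union_closed:
  assumes fin: "finite E" and h: "1 \<le> h" and U: "pendant h E U" and U': "pendant h E U'"
    and ne: "U \<noteq> U'" and x: "x \<in> U" "x \<in> U'"
  shows "leaving E (U \<union> U') = {}"
proof -
  have c: "connected_graph (U, induced E U)" "connected_graph (U', induced E U')" using U U' by (auto simp: pendant_def)
  have finU: "finite U" "finite U'" using U U' h by (auto simp: pendant_def intro: card_ge_0_finite)
  have same: "card U = card U'" using U U' by (simp add: pendant_def)
  have n: "\<not> U \<subseteq> U'" "\<not> U' \<subseteq> U"
    using card_subset_eq[OF finU(2), of U] card_subset_eq[OF finU(1), of U'] same ne by auto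
  obtain a b where ab: "{a, b} \<in> E" "a \<in> U" "a \<in> U'" "b \<in> U" "b \<notin> U'" using connected_step[OF c(1) x n(1)] .
  obtain p q where pq: "{p, q} \<in> E" "p \<in> U'" "p \<in> U" "q \<in> U'" "q \<notin> U" using connected_step[OF c(2) x(2,1) n(2)] .
  have m: "{a, b} \<in> leaving E U'" "{p, q} \<in> leaving E U" using ab pq by (auto simp: leaving_def)
  have one: "e = e'" if "pendant h E X" "e \<in> leaving E X" "e' \<in> leaving E X" for e e' X
  proof -
    have "finite (leaving E X)" using fin by (simp add: leaving_def)
    then show ?thesis using that card_le_Suc0_iff_eq[of "leaving E X"] by (simp add: pendant_def)
  qed
  have "False" if "e \<in> leaving E (U \<union> U')" for e
  proof -
    have e: "e \<in> E" "\<not> e \<subseteq> U \<union> U'" "e \<inter> U \<noteq> {} \<or> e \<inter> U' \<noteq> {}" using that by (auto simp: leaving_def)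
    then have "e \<in> leaving E U \<or> e \<in> leaving E U'" by (auto simp: leaving_def)
    then have "e = {p, q} \<or> e = {a, b}" using one[OF U _ m(2)] one[OF U' _ m(1)] by blast
    then show False using e(2) ab pq by auto
  qed
  then show ?thesis by blast
qed

text \<open>If two such sets contain \<open>x\<close>, their union is closed under edges, so every
  connected set through \<open>x\<close> lies in it; it has at most \<open>2 h\<close> vertices and
  hence at most \<open>4 ^ h\<close> subsets.\<close>

lemma pendant_count:
  assumes fin: "finite E" and h: "1 \<le> h"
  shows "finite {U. pendant h E U \<and> x \<in> U} \<and> card {U. pendant h E U \<and> x \<in> U} \<le> 4 ^ h"
proof (cases "\<exists>U U'. pendant h E U \<and> x \<in> U \<and> pendant h E U' \<and> x \<in> U' \<and> U \<noteq> U'")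
  case True
  then obtain U U' where U: "pendant h E U" "x \<in> U" "pendant h E U'" "x \<in> U'" "U \<noteq> U'" by blast
  let ?C = "U \<union> U'"
  have cl: "leaving E ?C = {}" by (rule pendant_union_closed[OF fin h U(1,3,5,2,4)])
  have sub: "{U. pendant h E U \<and> x \<in> U} \<subseteq> Pow ?C"
  proof
    fix W assume "W \<in> {U. pendant h E U \<and> x \<in> U}"
    then have W: "connected_graph (W, induced E W)" "x \<in> W" by (auto simp: pendant_def)
    show "W \<in> Pow ?C"
    proof (rule ccontr)
      assume "W \<notin> Pow ?C"
      then have n: "\<not> W \<subseteq> ?C" by simp
      have xC: "x \<in> ?C" using U(2) by simp
      obtain a b where "{a, b} \<in> E" "a \<in> ?C" "b \<notin> ?C" using connected_step[OF W xC n] by metis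
      then have "{a, b} \<in> leaving E ?C" by (auto simp: leaving_def)
      then show False using cl by simp
    qed
  qed
  have fC: "finite ?C" using U h by (auto simp: pendant_def intro: card_ge_0_finite)
  have "card ?C \<le> 2 * h" using card_Un_le[of U U'] U by (simp add: pendant_def)
  then have "(2::nat) ^ card ?C \<le> 2 ^ (2 * h)" by (rule power_increasing) simp
  moreover have "card {U. pendant h E U \<and> x \<in> U} \<le> card (Pow ?C)" using sub fC by (intro card_mono) auto
  moreover have "(2::nat) ^ (2 * h) = 4 ^ h" by (simp add: power_mult)
  ultimately show ?thesis using finite_subset[OF sub] fC by (simp add: card_Pow)
next
  case False
  have "{U. pendant h E U \<and> x \<in> U} = {} \<or> (\<exists>U. {U. pendant h E U \<and> x \<in> U} = {U})" using False by blast
  then show ?thesis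
  proof (elim disjE exE)
    fix U assume eq: "{U. pendant h E U \<and> x \<in> U} = {U}"
    show ?thesis unfolding eq by simp
  qed (simp only:, simp)
qed

text \<open>\<open>J x\<close> is the information lost by \<open>\<Phi>\<close>: together with
  \<open>\<Phi> x\<close> it determines \<open>x\<close>, and \<open>B y\<close> contains its
  possible values.\<close>

lemma fibre_count:
  assumes Y: "finite Y" "\<And>x. x \<in> X \<Longrightarrow> \<Phi> x \<in> Y"
    and fib: "\<And>y. y \<in> Y \<Longrightarrow> finite (B y) \<and> card (B y) \<le> k \<and> inj_on J {x \<in> X. \<Phi> x = y} \<and> J ` {x \<in> X. \<Phi> x = y} \<subseteq> B y"
  shows "card X \<le> k * card Y"
proof -
  have c: "card {x \<in> X. \<Phi> x = y} \<le> k" if "y \<in> Y" for y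
    using fib[OF that] card_inj_on_le[of J "{x \<in> X. \<Phi> x = y}" "B y"] by linarith
  have eq: "(\<Union>y\<in>Y. {x \<in> X. \<Phi> x = y}) = X" using Y(2) by blast
  have "card X \<le> (\<Sum>y\<in>Y. card {x \<in> X. \<Phi> x = y})"
    using card_UN_le[OF Y(1), of "\<lambda>y. {x \<in> X. \<Phi> x = y}"] unfolding eq .
  also have "\<dots> \<le> (\<Sum>y\<in>Y. k)" by (rule sum_mono) (rule c)
  finally show ?thesis by (simp add: mult.commute)
qed

lemma card_Sigma_ge:
  assumes "finite A" "\<And>a. a \<in> A \<Longrightarrow> finite (B a) \<and> d \<le> card (B a)"
  shows "card A * d \<le> card (Sigma A B)"
proof -
  have "card (Sigma A B) = (\<Sum>a\<in>A. card (B a))" using assms by (intro card_SigmaI) auto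
  moreover have "(\<Sum>a\<in>A. d) \<le> (\<Sum>a\<in>A. card (B a))" by (rule sum_mono) (use assms in auto)
  ultimately show ?thesis by simp
qed

lemma card_Sigma_le:
  assumes "finite A" "\<And>a. a \<in> A \<Longrightarrow> finite (B a) \<and> card (B a) \<le> d"
  shows "card (Sigma A B) \<le> card A * d"
proof -
  have "card (Sigma A B) = (\<Sum>a\<in>A. card (B a))" using assms by (intro card_SigmaI) auto
  moreover have "(\<Sum>a\<in>A. card (B a)) \<le> (\<Sum>a\<in>A. d)" by (rule sum_mono) (use assms in auto)
  ultimately show ?thesis by simp
qed

section \<open>Edge moves on the family of graphs with \<open>m\<close> edges\<close>

locale genus_family =
  fixes V :: "'v set" and g m h :: nat
  assumes finV: "finite V" and h1: "1 \<le> h"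
begin

definition Gs :: "'v set set set" where
  "Gs = {E. simple_graph (V, E) \<and> card E = m \<and> genus_at_most g (V, E)}"

definition weak :: "'v set set \<Rightarrow> 'v set set" where "weak E = {U. U \<subseteq> V \<and> pendant h E U}"

text \<open>Staying connected without \<open>f\<close> means that \<open>f\<close> lies on a
  cycle.\<close>

definition ears :: "'v set set \<Rightarrow> 'v set set" where
  "ears E = {U \<in> weak E. \<exists>f\<in>induced E U. connected_graph (U, induced E U - {f})}"

definition heavy :: "'v set set \<Rightarrow> 'v set set" where "heavy E = {U \<in> weak E. \<not> planar (U, induced E U)}"

definition isolated :: "'v set set \<Rightarrow> 'v set \<Rightarrow> bool" where
  "isolated E U \<longleftrightarrow> U \<subseteq> V \<and> card U = h \<and> leaving E U = {} \<and> connected_graph (U, induced E U) \<and> \<not> planar (U, induced E U)"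

lemma finite_Gs: "finite Gs"
proof (rule finite_subset)
  show "Gs \<subseteq> Pow (Pow V)" by (auto simp: Gs_def simple_graph_def)
qed (simp add: finV)

lemma finite_edges: "E \<in> Gs \<Longrightarrow> finite E"
  using simple_finite_edges[of "(V, E)"] by (simp add: Gs_def)

lemma finite_weak: "finite (weak E)"
  by (rule finite_subset[of _ "Pow V"]) (auto simp: weak_def finV)

lemma weak_meet:
  assumes "finite E" "finite X"
  shows "card {U \<in> weak E. U \<inter> X \<noteq> {}} \<le> card X * 4 ^ h"
proof -
  note pc = pendant_count[OF assms(1) h1]
  have "{U \<in> weak E. U \<inter> X \<noteq> {}} \<subseteq> (\<Union>x\<in>X. {U. pendant h E U \<and> x \<in> U})" by (auto simp: weak_def)
  then have "card {U \<in> weak E. U \<inter> X \<noteq> {}} \<le> card (\<Union>x\<in>X. {U. pendant h E U \<and> x \<in> U})"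
    using assms(2) pc by (intro card_mono) auto
  also have "\<dots> \<le> (\<Sum>x\<in>X. card {U. pendant h E U \<and> x \<in> U})" by (rule card_UN_le[OF assms(2)])
  also have "\<dots> \<le> (\<Sum>x\<in>X. 4 ^ h)" by (rule sum_mono) (use pc in blast)
  finally show ?thesis by simp
qed

lemma weak_nonempty: "U \<in> weak E \<Longrightarrow> U \<noteq> {}"
  using h1 by (auto simp: weak_def pendant_def)

lemma weak_card:
  assumes "finite E" shows "card (weak E) \<le> card V * 4 ^ h"
proof -
  have "weak E = {U \<in> weak E. U \<inter> V \<noteq> {}}" using weak_nonempty by (auto simp: weak_def)
  then show ?thesis using weak_meet[OF assms finV] by simp
qed

text \<open>A largest disjoint subfamily has at most \<open>2 g\<close> members and so covers at
  most \<open>2 g h\<close> vertices. By maximality every heavy set contains one of these vertices,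
  and each vertex lies in at most \<open>4 ^ h\<close> weak sets.\<close>

lemma heavy_card:
  assumes E: "E \<in> Gs" shows "card (heavy E) \<le> 2 * g * h * 4 ^ h"
proof -
  define packing where "packing D \<longleftrightarrow> D \<subseteq> heavy E \<and> (\<forall>U\<in>D. \<forall>W\<in>D. U \<noteq> W \<longrightarrow> U \<inter> W = {})" for D
  have fin: "finite (heavy E)" using finite_weak by (simp add: heavy_def)
  have "\<exists>D. packing D \<and> (\<forall>D'. packing D' \<longrightarrow> card D' \<le> card D)"
    by (rule ex_has_greatest_nat[of packing "{}" card "Suc (card (heavy E))"])
       (use fin card_mono[of "heavy E"] in \<open>auto simp: less_Suc_eq_le packing_def\<close>)
  then obtain D where D': "packing D" and max: "\<And>D'. packing D' \<Longrightarrow> card D' \<le> card D" by blast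
  from D' have D: "D \<subseteq> heavy E" "\<And>U W. U \<in> D \<Longrightarrow> W \<in> D \<Longrightarrow> U \<noteq> W \<Longrightarrow> U \<inter> W = {}"
    unfolding packing_def by blast+
  have finD: "finite D" using finite_subset[OF D(1) fin] .
  have G: "simple_graph (V, E)" "genus_at_most g (V, E)" using E by (auto simp: Gs_def)
  have cD: "card D \<le> 2 * g"
  proof (rule nonplanar_pieces[OF G finD])
    fix U assume "U \<in> D"
    then have "U \<in> heavy E" using D(1) by blast
    then show "U \<subseteq> V \<and> connected_graph (U, {e \<in> E. e \<subseteq> U}) \<and> \<not> planar (U, {e \<in> E. e \<subseteq> U})"
      by (simp add: heavy_def weak_def pendant_def induced_def)
  qed (rule D(2))
  have cX: "card (\<Union>D) \<le> 2 * g * h"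
  proof -
    have "card (\<Union>D) \<le> (\<Sum>U\<in>D. card U)" using card_Union_le_sum_card[of D] by simp
    also have "\<dots> = (\<Sum>U\<in>D. h)"
      by (rule sum.cong) (use D(1) in \<open>auto simp: heavy_def weak_def pendant_def\<close>)
    also have "\<dots> \<le> 2 * g * h" using cD by simp
    finally show ?thesis .
  qed
  have finX: "finite (\<Union>D)"
  proof -
    have "\<Union>D \<subseteq> V" using D(1) by (auto simp: heavy_def weak_def)
    then show ?thesis by (rule finite_subset[OF _ finV])
  qed
  have "heavy E \<subseteq> {U \<in> weak E. U \<inter> \<Union>D \<noteq> {}}"
  proof
    fix U assume U: "U \<in> heavy E"
    have w: "U \<in> weak E" using U by (simp add: heavy_def)
    have "U \<inter> \<Union>D \<noteq> {}"
    proof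
      assume no: "U \<inter> \<Union>D = {}"
      have noW: "U \<inter> W = {}" if "W \<in> D" for W using no Union_upper[OF that] by (metis Int_mono bot.extremum_uniqueI order_refl)
      have "U \<notin> D" using noW[of U] weak_nonempty[OF w] by auto
      moreover have "packing (insert U D)"
        unfolding packing_def
      proof (intro conjI ballI impI)
        show "insert U D \<subseteq> heavy E" using U D(1) by blast
        fix W W' assume "W \<in> insert U D" "W' \<in> insert U D" "W \<noteq> W'"
        then consider "W \<in> D" "W' \<in> D" | "W = U" "W' \<in> D" | "W' = U" "W \<in> D" by blast
        then show "W \<inter> W' = {}"
        proof cases
          case 1
          then show ?thesis using D(2) \<open>W \<noteq> W'\<close> by blast
        next
          case 2
          then show ?thesis using noW by simp
        next
          case 3
          then show ?thesis using noW[of W] by (simp add: Int_commute)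
        qed
      qed
      from max[OF this] have "card (insert U D) \<le> card D" .
      ultimately show False using finD by simp
    qed
    then show "U \<in> {U \<in> weak E. U \<inter> \<Union>D \<noteq> {}}" using w by simp
  qed
  then have "card (heavy E) \<le> card {U \<in> weak E. U \<inter> \<Union>D \<noteq> {}}" using finite_weak by (intro card_mono) auto
  also have "\<dots> \<le> card (\<Union>D) * 4 ^ h" by (rule weak_meet[OF finite_edges[OF E] finX])
  also have "\<dots> \<le> 2 * g * h * 4 ^ h" using cX by simp
  finally show ?thesis .
qed

lemma closed_reach:
  assumes cl: "leaving E U = {}" and F: "F \<subseteq> E" and z: "z \<in> U" and r: "(z, v) \<in> (adj (V, F))\<^sup>*"
  shows "v \<in> U"
  using r
proof (induction rule: rtrancl_induct)
  case (step x y)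
  then have "{x, y} \<in> E" using F by (auto simp: adj_def)
  then have "{x, y} \<subseteq> U" using cl step.IH by (auto simp: leaving_def)
  then show ?case by simp
qed (rule z)

text \<open>\<open>f\<close> may be any edge. No edge leaves \<open>U\<close>, so \<open>z\<close>
  and \<open>v\<close> lie in different components also after the deletion, and the new edge keeps
  the genus bound.\<close>

lemma move_edge:
  assumes E: "E \<in> Gs" and U: "U \<subseteq> V" "leaving E U = {}" and z: "z \<in> U" and v: "v \<in> V" "v \<notin> U" and f: "f \<in> E"
  shows "insert {z, v} (E - {f}) \<in> Gs"
proof -
  let ?F = "E - {f}"
  have G: "simple_graph (V, E)" "card E = m" "embeds_in (V, E) (orientable_surface g)"
    using E by (auto simp: Gs_def genus_at_most_def)
  have sF: "simple_graph (V, ?F)" using G(1) by (auto simp: simple_graph_def)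
  have "embeds_in (V, ?F) (orientable_surface g)"
    by (rule embeds_subgraph[OF G(3)]) (use G(1) in \<open>auto simp: simple_graph_def\<close>)
  then have gF: "genus_at_most g (V, ?F)" by (simp add: genus_at_most_def)
  have zV: "z \<in> V" using z U(1) by blast
  have "(z, v) \<notin> (adj (V, ?F))\<^sup>*" using closed_reach[OF U(2) _ z, of ?F v] v(2) by blast
  from genus_add_edge[OF sF gF _ _ this] zV v(1) have "genus_at_most g (V, insert {z, v} ?F)" by simp
  moreover have "simple_graph (V, insert {z, v} ?F)" using sF zV v z by (auto simp: simple_graph_def card_2_iff)
  moreover have "{z, v} \<notin> E" using U(2) z v(2) by (auto simp: leaving_def)
  then have "card (insert {z, v} ?F) = m" using card_Suc_Diff1[OF finite_edges[OF E] f] finite_edges[OF E] G(2) by simp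
  ultimately show ?thesis by (simp add: Gs_def)
qed

lemma edge_ne: "E \<in> Gs \<Longrightarrow> e \<in> E \<Longrightarrow> e \<noteq> {}"
  by (auto simp: Gs_def simple_graph_def)

lemma move_leaving:
  assumes U: "leaving E U = {}" and z: "z \<in> U" and v: "v \<notin> U"
  shows "leaving (insert {z, v} (E - {f})) U = {{z, v}}"
  using assms by (auto simp: leaving_def)

lemma move_inner:
  assumes "z \<in> U" "v \<notin> U" shows "induced (insert {z, v} (E - {f})) U = induced E U - {f}"
  using assms by (auto simp: induced_def)

text \<open>It is enough to remember the inner edges of the set \<open>W\<close> that lost
  \<open>f\<close>, besides the new edge: adding them back restores \<open>f\<close>.\<close>

lemma move_undo:
  assumes U: "leaving E U = {}" and z: "z \<in> U" and v: "v \<notin> U" and f: "f \<in> induced E W"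
  shows "E = (insert {z, v} (E - {f}) - {{z, v}}) \<union> induced E W"
proof -
  have "{z, v} \<notin> E" using U z v by (auto simp: leaving_def)
  then show ?thesis using f by (auto simp: induced_def)
qed

text \<open>\<open>A1\<close> holds the graphs all of whose first moves end with at most
  \<open>K\<close> ears: at least \<open>card V - h\<close> moves each, labelled by an ear and its
  inner edges. For a graph in \<open>A2\<close> one attachment with more than \<open>K\<close> ears
  supplies the ears that second moves break open: about \<open>K * card V\<close> moves, labelled by
  boundedly many places for the copy and, up to a constant factor, \<open>card V\<close> places for
  the broken ear. The factor \<open>c\<close> bounds the sets of inner edges.\<close>

theorem isolated_bound:
  assumes n: "2 * h \<le> card V"
  defines "A \<equiv> {E \<in> Gs. \<exists>U. isolated E U}" and "c \<equiv> 2 ^ 2 ^ h"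
  shows "\<exists>A1 A2. A = A1 \<union> A2 \<and> card A1 * (card V - h) \<le> K * c * card Gs \<and>
    card A2 * ((Suc K - h * 4 ^ h) * (card V - 2 * h)) \<le> (2 * g * h * 4 ^ h) * (card V * 4 ^ h * c) * card Gs"
proof -
  have "\<exists>U e f z. isolated E U \<and> z \<in> U \<and> e \<in> induced E U \<and> f \<in> induced E U \<and> e \<noteq> f \<and>
      connected_graph (U, induced E U - {e}) \<and> connected_graph (U, induced E U - {e} - {f})" if "E \<in> A" for E
  proof -
    have "\<exists>U. isolated E U" using that by (simp add: A_def)
    then obtain U where U: "isolated E U" ..
    then have c: "connected_graph (U, induced E U)" "\<not> planar (U, induced E U)" "U \<subseteq> V" by (auto simp: isolated_def)
    have "simple_graph (V, E)" using that by (auto simp: A_def Gs_def)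
    then have s: "simple_graph (U, induced E U)" using c(3) finite_subset by (auto simp: simple_graph_def induced_def)
    obtain z where "z \<in> U" using c(1) by (auto simp: connected_graph_def)
    moreover obtain e f where "e \<in> induced E U" "f \<in> induced E U" "e \<noteq> f" "connected_graph (U, induced E U - {e})"
      "connected_graph (U, induced E U - {e} - {f})" using two_removable_edges[OF s c(1,2)] by blast
    ultimately show ?thesis using U by blast
  qed
  then obtain u e f z where ch: "\<And>E. E \<in> A \<Longrightarrow> isolated E (u E) \<and> z E \<in> u E \<and> e E \<in> induced E (u E) \<and> f E \<in> induced E (u E) \<and>
      e E \<noteq> f E \<and> connected_graph (u E, induced E (u E) - {e E}) \<and> connected_graph (u E, induced E (u E) - {e E} - {f E})"
    by metis
  have AG: "E \<in> Gs" if "E \<in> A" for E using that by (simp add: A_def)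
  have finA: "finite A" using finite_Gs by (simp add: A_def)
  have uV: "u E \<subseteq> V" "card (u E) = h" "leaving E (u E) = {}" "connected_graph (u E, induced E (u E))" "\<not> planar (u E, induced E (u E))"
    "z E \<in> u E" if "E \<in> A" for E
    using ch[OF that] by (auto simp: isolated_def)
  have finu: "finite (u E)" if "E \<in> A" for E by (rule finite_subset[OF uV(1)[OF that] finV])
  \<comment> \<open>First move: the copy gives up \<open>e E\<close> and is tied to
    \<open>v\<close>; the edge \<open>f E\<close> shows that a cycle is left in it.\<close>
  define \<Phi> where "\<Phi> E v = insert {z E, v} (E - {e E})" for E v
  have \<Phi>G: "\<Phi> E v \<in> Gs" if "E \<in> A" "v \<in> V - u E" for E v
    unfolding \<Phi>_def using that(2) ch[OF that(1)]
    by (intro move_edge[OF AG[OF that(1)] uV(1,3,6)[OF that(1)]]) (auto simp: induced_def)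
  have \<Phi>l: "leaving (\<Phi> E v) (u E) = {{z E, v}}" if "E \<in> A" "v \<in> V - u E" for E v
    unfolding \<Phi>_def using that(2) by (intro move_leaving[OF uV(3,6)[OF that(1)]]) auto
  have \<Phi>i: "induced (\<Phi> E v) (u E) = induced E (u E) - {e E}" if "E \<in> A" "v \<in> V - u E" for E v
    unfolding \<Phi>_def using that(2) by (intro move_inner[OF uV(6)[OF that(1)]]) auto
  have \<Phi>e: "u E \<in> ears (\<Phi> E v)" if E: "E \<in> A" "v \<in> V - u E" for E v
  proof -
    have "pendant h (\<Phi> E v) (u E)" unfolding pendant_def \<Phi>l[OF E] \<Phi>i[OF E] using uV[OF E(1)] ch[OF E(1)] by simp
    then have "u E \<in> weak (\<Phi> E v)" using uV(1)[OF E(1)] by (simp add: weak_def)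
    moreover have "f E \<in> induced (\<Phi> E v) (u E)" "connected_graph (u E, induced (\<Phi> E v) (u E) - {f E})"
      unfolding \<Phi>i[OF E] using ch[OF E(1)] by auto
    ultimately show ?thesis unfolding ears_def by blast
  qed
  have \<Phi>u: "E = (\<Phi> E v - {{z E, v}}) \<union> induced E (u E)" if E: "E \<in> A" "v \<in> V - u E" for E v
    unfolding \<Phi>_def using that(2) ch[OF E(1)] by (intro move_undo[OF uV(3,6)[OF E(1)]]) auto
  have innerP: "induced E U \<in> Pow (Pow U)" for E :: "'v set set" and U by (auto simp: induced_def)
  have cardP: "finite (Pow (Pow U)) \<and> card (Pow (Pow U)) \<le> c" if "card U = h" for U :: "'v set"
  proof -
    have "finite U" using that h1 by (intro card_ge_0_finite) auto
    then show ?thesis using that by (simp add: card_Pow c_def)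
  qed
  define A1 where "A1 = {E \<in> A. \<forall>v\<in>V - u E. card (ears (\<Phi> E v)) \<le> K}"
  define A2 where "A2 = A - A1"
  have A12: "A = A1 \<union> A2" by (auto simp: A1_def A2_def)
  have b1: "card A1 * (card V - h) \<le> K * c * card Gs"
  proof -
    let ?X = "Sigma A1 (\<lambda>E. V - u E)"
    have A1A: "E \<in> A" if "E \<in> A1" for E using that by (simp add: A1_def)
    have "card A1 * (card V - h) \<le> card ?X"
    proof (rule card_Sigma_ge)
      show "finite A1" using finA by (simp add: A1_def)
      fix E assume "E \<in> A1"
      note E = A1A[OF this]
      show "finite (V - u E) \<and> card V - h \<le> card (V - u E)"
        using finV card_Diff_subset[OF finu[OF E] uV(1)[OF E]] uV(2)[OF E] by simp
    qed
    also have "card ?X \<le> K * c * card Gs"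
    proof (rule fibre_count[where \<Phi> = "\<lambda>(E, v). \<Phi> E v" and J = "\<lambda>(E, v). (u E, induced E (u E))"
          and B = "\<lambda>E1. if card (ears E1) \<le> K then Sigma (ears E1) (\<lambda>U. Pow (Pow U)) else {}"])
      show "finite Gs" by (rule finite_Gs)
      show "(case x of (E, v) \<Rightarrow> \<Phi> E v) \<in> Gs" if "x \<in> ?X" for x
        using that \<Phi>G A1A by auto
      fix E1 assume E1: "E1 \<in> Gs"
      let ?S = "{x \<in> ?X. (case x of (E, v) \<Rightarrow> \<Phi> E v) = E1}"
      let ?B = "if card (ears E1) \<le> K then Sigma (ears E1) (\<lambda>U. Pow (Pow U)) else {}"
      have fe: "finite (ears E1)" using finite_weak by (simp add: ears_def)
      have ce: "card U = h" if "U \<in> ears E1" for U using that by (simp add: ears_def weak_def pendant_def)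
      have cS: "card (Sigma (ears E1) (\<lambda>U. Pow (Pow U))) \<le> card (ears E1) * c"
        by (rule card_Sigma_le[OF fe]) (use cardP ce in blast)
      have finB: "finite ?B" using fe cardP ce by auto
      have cB: "card ?B \<le> K * c" using cS by (auto intro: order_trans mult_le_mono1)
      have inj: "inj_on (\<lambda>(E, v). (u E, induced E (u E))) ?S"
      proof (rule inj_onI)
        fix x x' assume x: "x \<in> ?S" "x' \<in> ?S" "(case x of (E, v) \<Rightarrow> (u E, induced E (u E))) = (case x' of (E, v) \<Rightarrow> (u E, induced E (u E)))"
        obtain E v E' v' where xx: "x = (E, v)" "x' = (E', v')" by (cases x, cases x') simp
        have E: "E \<in> A" "v \<in> V - u E" and E': "E' \<in> A" "v' \<in> V - u E'" and a: "\<Phi> E' v' = \<Phi> E v"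
          "u E = u E'" "induced E (u E) = induced E' (u E')" using x A1A unfolding xx by auto
        \<comment> \<open>The tie is the only edge leaving the copy, so it can be read off the moved
          graph.\<close>
        have l: "{{z E, v}} = {{z E', v'}}" using \<Phi>l[OF E] \<Phi>l[OF E'] a(1,2) by simp
        have "E = (\<Phi> E v - {{z E, v}}) \<union> induced E (u E)" by (rule \<Phi>u[OF E])
        also have "\<dots> = (\<Phi> E' v' - {{z E', v'}}) \<union> induced E' (u E')" unfolding l a(1,3) ..
        also have "\<dots> = E'" by (rule \<Phi>u[OF E', symmetric])
        finally have "E = E'" .
        then show "x = x'" using l unfolding xx by (auto simp: doubleton_eq_iff)
      qed
      have im: "(\<lambda>(E, v). (u E, induced E (u E))) ` ?S \<subseteq> ?B"
      proof
        fix y assume "y \<in> (\<lambda>(E, v). (u E, induced E (u E))) ` ?S"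
        then obtain E v where E: "E \<in> A1" "v \<in> V - u E" "\<Phi> E v = E1" "y = (u E, induced E (u E))" by auto
        have "card (ears E1) \<le> K" using E unfolding A1_def by blast
        moreover have "u E \<in> ears E1" using \<Phi>e[OF A1A[OF E(1)] E(2)] E(3) by simp
        ultimately show "y \<in> ?B" using E(4) innerP by simp
      qed
      show "finite ?B \<and> card ?B \<le> K * c \<and> inj_on (\<lambda>(E, v). (u E, induced E (u E))) ?S \<and>
          (\<lambda>(E, v). (u E, induced E (u E))) ` ?S \<subseteq> ?B" using finB cB inj im by blast
    qed
    finally show ?thesis .
  qed
  have "\<exists>v. v \<in> V - u E \<and> K < card (ears (\<Phi> E v))" if "E \<in> A2" for E
    using that by (auto simp: A2_def A1_def not_le)
  \<comment> \<open>This attachment only exhibits many ears; the second move starts again from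
    \<open>E\<close>.\<close>
  then obtain v0 where v0: "\<And>E. E \<in> A2 \<Longrightarrow> v0 E \<in> V - u E" "\<And>E. E \<in> A2 \<Longrightarrow> K < card (ears (\<Phi> E (v0 E)))"
    by metis
  have A2A: "E \<in> A" if "E \<in> A2" for E using that by (simp add: A2_def)
  define k where "k E U = (SOME k. k \<in> induced E U \<and> connected_graph (U, induced E U - {k}))" for E :: "'v set set" and U
  have k: "k E U \<in> induced E U \<and> connected_graph (U, induced E U - {k E U})" if "U \<in> ears E" for E U
    unfolding k_def by (rule someI_ex) (use that in \<open>auto simp: ears_def\<close>)
  \<comment> \<open>Ears that avoid the copy have the same inner edges in \<open>E\<close>, since
    \<open>E\<close> and the moved graph differ only in edges meeting the copy. At most
    \<open>h * 4 ^ h\<close> ears are lost by this restriction.\<close>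
  define T where "T E = {U \<in> ears (\<Phi> E (v0 E)). U \<inter> u E = {}}" for E
  define \<kappa> where "\<kappa> E U = k (\<Phi> E (v0 E)) U" for E U
  \<comment> \<open>Second move: the intact copy is tied to \<open>v\<close>, and the edge is taken
    from a cycle of the ear \<open>U\<close>. Choosing \<open>v\<close> outside \<open>U\<close>
    keeps the tie from leaving \<open>U\<close>, so \<open>U\<close> is still weak and can be found
    again.\<close>
  define \<Psi> where "\<Psi> E U v = insert {z E, v} (E - {\<kappa> E U})" for E U v
  have T: "U \<subseteq> V" "card U = h" "U \<inter> u E = {}" "\<kappa> E U \<in> induced E U" "connected_graph (U, induced E U - {\<kappa> E U})"
    "card (leaving E U) \<le> 1" if E: "E \<in> A2" "U \<in> T E" for E U
  proof -
    let ?E1 = "\<Phi> E (v0 E)"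
    have U: "U \<in> ears ?E1" "U \<inter> u E = {}" using E(2) by (auto simp: T_def)
    have w: "U \<subseteq> V" "pendant h ?E1 U" using U(1) by (auto simp: ears_def weak_def)
    show "U \<subseteq> V" "U \<inter> u E = {}" "card U = h" using w U(2) by (auto simp: pendant_def)
    have eE: "e E \<in> E" "e E \<subseteq> u E" "e E \<noteq> {}" using ch[OF A2A[OF E(1)]] edge_ne[OF AG[OF A2A[OF E(1)]]] by (auto simp: induced_def)
    have eU: "e E \<inter> U = {}" using eE(2) U(2) by blast
    then have "\<not> e E \<subseteq> U" using eE(3) by blast
    moreover have "z E \<notin> U" using uV(6)[OF A2A[OF E(1)]] U(2) by blast
    ultimately have i: "induced ?E1 U = induced E U" unfolding \<Phi>_def induced_def by auto
    show "\<kappa> E U \<in> induced E U" "connected_graph (U, induced E U - {\<kappa> E U})"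
      using k[OF U(1)] unfolding \<kappa>_def i by auto
    have "leaving E U \<subseteq> leaving ?E1 U" unfolding \<Phi>_def leaving_def using eU by auto
    moreover have "finite (leaving ?E1 U)" using finite_edges[OF \<Phi>G[OF A2A[OF E(1)] v0(1)[OF E(1)]]] by (simp add: leaving_def)
    ultimately have "card (leaving E U) \<le> card (leaving ?E1 U)" by (intro card_mono)
    then show "card (leaving E U) \<le> 1" using w(2) by (simp add: pendant_def)
  qed
  have \<Psi>G: "\<Psi> E U v \<in> Gs" if E: "E \<in> A2" "U \<in> T E" "v \<in> V - u E - U" for E U v
    unfolding \<Psi>_def using E(3) T(4)[OF E(1,2)]
    by (intro move_edge[OF AG[OF A2A[OF E(1)]] uV(1,3,6)[OF A2A[OF E(1)]]]) (auto simp: induced_def)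
  have \<Psi>l: "leaving (\<Psi> E U v) (u E) = {{z E, v}}" if E: "E \<in> A2" "U \<in> T E" "v \<in> V - u E - U" for E U v
    unfolding \<Psi>_def using E(3) by (intro move_leaving[OF uV(3,6)[OF A2A[OF E(1)]]]) auto
  have \<Psi>h: "u E \<in> heavy (\<Psi> E U v)" if E: "E \<in> A2" "U \<in> T E" "v \<in> V - u E - U" for E U v
  proof -
    have "\<kappa> E U \<in> E" "\<kappa> E U \<subseteq> U" using T(4)[OF E(1,2)] by (auto simp: induced_def)
    then have "\<not> \<kappa> E U \<subseteq> u E" using T(3)[OF E(1,2)] edge_ne[OF AG[OF A2A[OF E(1)]], of "\<kappa> E U"] by blast
    then have "induced E (u E) - {\<kappa> E U} = induced E (u E)" by (auto simp: induced_def)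
    moreover have "induced (\<Psi> E U v) (u E) = induced E (u E) - {\<kappa> E U}"
      unfolding \<Psi>_def using E(3) by (intro move_inner[OF uV(6)[OF A2A[OF E(1)]]]) auto
    ultimately have i: "induced (\<Psi> E U v) (u E) = induced E (u E)" by simp
    show ?thesis unfolding heavy_def weak_def pendant_def mem_Collect_eq i \<Psi>l[OF E] using uV[OF A2A[OF E(1)]] by simp
  qed
  have \<Psi>w: "U \<in> weak (\<Psi> E U v)" if E: "E \<in> A2" "U \<in> T E" "v \<in> V - u E - U" for E U v
  proof -
    have z: "z E \<notin> U" using uV(6)[OF A2A[OF E(1)]] T(3)[OF E(1,2)] by blast
    have "induced (\<Psi> E U v) U = induced E U - {\<kappa> E U}" using z by (auto simp: \<Psi>_def induced_def)
    moreover have "leaving (\<Psi> E U v) U \<subseteq> leaving E U" using z E(3) by (auto simp: \<Psi>_def leaving_def)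
    then have "card (leaving (\<Psi> E U v) U) \<le> card (leaving E U)"
      using finite_edges[OF AG[OF A2A[OF E(1)]]] by (intro card_mono) (auto simp: leaving_def)
    ultimately show ?thesis using T[OF E(1,2)] by (simp add: weak_def pendant_def)
  qed
  have \<Psi>u: "E = (\<Psi> E U v - {{z E, v}}) \<union> induced E U" if E: "E \<in> A2" "U \<in> T E" "v \<in> V - u E - U" for E U v
    unfolding \<Psi>_def using E(3) T(4)[OF E(1,2)] by (intro move_undo[OF uV(3,6)[OF A2A[OF E(1)]]]) auto
  have cT: "Suc K - h * 4 ^ h \<le> card (T E)" if E: "E \<in> A2" for E
  proof -
    let ?E1 = "\<Phi> E (v0 E)"
    let ?M = "{U \<in> weak ?E1. U \<inter> u E \<noteq> {}}"
    have fe: "finite ?E1" using finite_edges[OF \<Phi>G[OF A2A[OF E] v0(1)[OF E]]] .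
    have "ears ?E1 \<subseteq> T E \<union> ?M" by (auto simp: T_def ears_def)
    then have "card (ears ?E1) \<le> card (T E \<union> ?M)" using finite_weak by (intro card_mono) (auto simp: T_def ears_def)
    also have "\<dots> \<le> card (T E) + card ?M" by (rule card_Un_le)
    also have "card ?M \<le> h * 4 ^ h" using weak_meet[OF fe finu[OF A2A[OF E]]] uV(2)[OF A2A[OF E]] by simp
    finally show ?thesis using v0(2)[OF E] by simp
  qed
  have b2: "card A2 * ((Suc K - h * 4 ^ h) * (card V - 2 * h)) \<le> (2 * g * h * 4 ^ h) * (card V * 4 ^ h * c) * card Gs"
  proof -
    let ?X = "Sigma A2 (\<lambda>E. Sigma (T E) (\<lambda>U. V - u E - U))"
    have finT: "finite (T E)" for E using finite_weak by (simp add: T_def ears_def)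
    have "card A2 * ((Suc K - h * 4 ^ h) * (card V - 2 * h)) \<le> card ?X"
    proof (rule card_Sigma_ge)
      show "finite A2" using finA by (simp add: A2_def)
      fix E assume E: "E \<in> A2"
      have cd: "card V - 2 * h \<le> card (V - u E - U)" if "U \<in> T E" for U
      proof -
        have "card (V - u E - U) = card (V - u E) - card U"
          using T(1,3)[OF E that] finite_subset[OF T(1)[OF E that] finV] by (intro card_Diff_subset) auto
        moreover have "card (V - u E) = card V - h"
          using card_Diff_subset[OF finu[OF A2A[OF E]] uV(1)[OF A2A[OF E]]] uV(2)[OF A2A[OF E]] by simp
        ultimately show ?thesis using T(2)[OF E that] by simp
      qed
      have "card (T E) * (card V - 2 * h) \<le> card (Sigma (T E) (\<lambda>U. V - u E - U))"
        by (rule card_Sigma_ge[OF finT]) (use cd finV in auto)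
      moreover have "(Suc K - h * 4 ^ h) * (card V - 2 * h) \<le> card (T E) * (card V - 2 * h)"
        by (rule mult_le_mono1[OF cT[OF E]])
      ultimately have "(Suc K - h * 4 ^ h) * (card V - 2 * h) \<le> card (Sigma (T E) (\<lambda>U. V - u E - U))"
        by (rule order_trans[rotated])
      moreover have "finite (Sigma (T E) (\<lambda>U. V - u E - U))" using finT finV by auto
      ultimately show "finite (Sigma (T E) (\<lambda>U. V - u E - U)) \<and>
          (Suc K - h * 4 ^ h) * (card V - 2 * h) \<le> card (Sigma (T E) (\<lambda>U. V - u E - U))" by blast
    qed
    also have "card ?X \<le> (2 * g * h * 4 ^ h) * (card V * 4 ^ h * c) * card Gs"
    proof (rule fibre_count[where \<Phi> = "\<lambda>(E, U, v). \<Psi> E U v" and J = "\<lambda>(E, U, v). (u E, U, induced E U)"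
          and B = "\<lambda>E3. heavy E3 \<times> Sigma (weak E3) (\<lambda>U. Pow (Pow U))"])
      show "finite Gs" by (rule finite_Gs)
      show "(case x of (E, U, v) \<Rightarrow> \<Psi> E U v) \<in> Gs" if "x \<in> ?X" for x
        using that \<Psi>G by auto
      fix E3 assume E3: "E3 \<in> Gs"
      let ?S = "{x \<in> ?X. (case x of (E, U, v) \<Rightarrow> \<Psi> E U v) = E3}"
      let ?B2 = "Sigma (weak E3) (\<lambda>U. Pow (Pow U))"
      have cw: "card U = h" if "U \<in> weak E3" for U using that by (simp add: weak_def pendant_def)
      have fB2: "finite ?B2" using finite_weak cardP cw by auto
      have "card ?B2 \<le> card (weak E3) * c"
        by (rule card_Sigma_le[OF finite_weak]) (use cardP cw in blast)
      also have "\<dots> \<le> card V * 4 ^ h * c" by (rule mult_le_mono1[OF weak_card[OF finite_edges[OF E3]]])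
      finally have cB2: "card ?B2 \<le> card V * 4 ^ h * c" .
      have fh: "finite (heavy E3)" using finite_weak by (simp add: heavy_def)
      have finB: "finite (heavy E3 \<times> ?B2)" using fh fB2 by simp
      have cB: "card (heavy E3 \<times> ?B2) \<le> (2 * g * h * 4 ^ h) * (card V * 4 ^ h * c)"
        unfolding card_cartesian_product by (rule mult_le_mono[OF heavy_card[OF E3] cB2])
      have inj: "inj_on (\<lambda>(E, U, v). (u E, U, induced E U)) ?S"
      proof (rule inj_onI)
        fix x x' assume x: "x \<in> ?S" "x' \<in> ?S"
          "(case x of (E, U, v) \<Rightarrow> (u E, U, induced E U)) = (case x' of (E, U, v) \<Rightarrow> (u E, U, induced E U))"
        obtain E U v E' U' v' where xx: "x = (E, U, v)" "x' = (E', U', v')" by (cases x, cases x') simp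
        have E: "E \<in> A2" "U \<in> T E" "v \<in> V - u E - U" and E': "E' \<in> A2" "U' \<in> T E'" "v' \<in> V - u E' - U'"
          and a: "\<Psi> E' U' v' = \<Psi> E U v" "u E = u E'" "induced E U = induced E' U'" "U = U'" using x unfolding xx by auto
        have l: "{{z E, v}} = {{z E', v'}}" using \<Psi>l[OF E] \<Psi>l[OF E'] a(1,2) by simp
        have "E = (\<Psi> E U v - {{z E, v}}) \<union> induced E U" by (rule \<Psi>u[OF E])
        also have "\<dots> = (\<Psi> E' U' v' - {{z E', v'}}) \<union> induced E' U'" unfolding l a(1,3) ..
        also have "\<dots> = E'" by (rule \<Psi>u[OF E', symmetric])
        finally have "E = E'" .
        then show "x = x'" using l a(4) unfolding xx by (auto simp: doubleton_eq_iff)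
      qed
      have im: "(\<lambda>(E, U, v). (u E, U, induced E U)) ` ?S \<subseteq> heavy E3 \<times> ?B2"
      proof
        fix y assume "y \<in> (\<lambda>(E, U, v). (u E, U, induced E U)) ` ?S"
        then obtain E U v where E: "E \<in> A2" "U \<in> T E" "v \<in> V - u E - U" and y: "\<Psi> E U v = E3" "y = (u E, U, induced E U)" by auto
        have "u E \<in> heavy E3" using \<Psi>h[OF E] y(1) by simp
        moreover have "U \<in> weak E3" using \<Psi>w[OF E] y(1) by simp
        ultimately show "y \<in> heavy E3 \<times> ?B2" using y(2) innerP by simp
      qed
      show "finite (heavy E3 \<times> ?B2) \<and> card (heavy E3 \<times> ?B2) \<le> (2 * g * h * 4 ^ h) * (card V * 4 ^ h * c) \<and>
          inj_on (\<lambda>(E, U, v). (u E, U, induced E U)) ?S \<and> (\<lambda>(E, U, v). (u E, U, induced E U)) ` ?S \<subseteq> heavy E3 \<times> ?B2"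
        using finB cB inj im by blast
    qed
    finally show ?thesis .
  qed
  show ?thesis using A12 b1 b2 by blast
qed

end

section \<open>From components to the probability\<close>

lemma component_isolated:
  fixes G :: "'v graph" and H :: "'a graph"
  assumes G: "simple_graph G" and H: "\<not> planar H" and c: "has_component_iso G H"
  shows "\<exists>U\<subseteq>verts G. card U = card (verts H) \<and> leaving (edges G) U = {} \<and>
    connected_graph (U, induced (edges G) U) \<and> \<not> planar (U, induced (edges G) U)"
proof -
  obtain C where C: "C \<in> graph_components G" "graph_iso C H" using c unfolding has_component_iso_def by blast
  then obtain v where v: "v \<in> verts G" "C = ((adj G)\<^sup>* `` {v}, {e \<in> edges G. e \<subseteq> (adj G)\<^sup>* `` {v}})"
    unfolding graph_components_def Let_def by blast
  define U where "U = (adj G)\<^sup>* `` {v}"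
  have CU: "C = (U, induced (edges G) U)" using v(2) by (simp add: U_def induced_def)
  have UV: "U \<subseteq> verts G" unfolding U_def using adj_rtrancl_verts[OF G _ v(1)] by blast
  have "connected_graph C" unfolding CU induced_def by (rule component_connected[OF G v(1) U_def])
  moreover have "leaving (edges G) U = {}" using component_edges[OF G U_def] by (auto simp: leaving_def)
  moreover have sC: "simple_graph C"
    unfolding CU using G finite_subset[OF UV] by (auto simp: simple_graph_def induced_def)
  have "\<not> planar C" using planar_iso[OF C(2) sC] H by blast
  moreover obtain f where "bij_betw f (verts C) (verts H)" using C(2) by (auto simp: graph_iso_def)
  then have "card U = card (verts H)" unfolding CU by (simp add: bij_betw_same_card)
  ultimately show ?thesis using UV unfolding CU by blast
qed

lemma component_probability_bound:
  fixes H :: "'a graph" and g n m :: nat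
  assumes H: "simple_graph H" "connected_graph H" "\<not> planar H"
  defines "h \<equiv> card (verts H)" and "S \<equiv> genus_graphs g n m"
  assumes n: "4 * h \<le> n"
  shows "measure (random_genus_graph g n m) {G \<in> space (random_genus_graph g n m). has_component_iso G H}
    \<le> 2 * 2 ^ 2 ^ h * (sqrt n + h * 4 ^ h) / n + 2 * ((2 * g * h * 4 ^ h) * (4 ^ h * 2 ^ 2 ^ h)) / sqrt n"
proof -
  have "h \<noteq> 0" using H(1,2) by (simp add: h_def connected_graph_def simple_graph_def)
  then have h1: "1 \<le> h" by simp
  define W where "W = {1..n}"
  have cW: "card W = n" and fW: "finite W" by (simp_all add: W_def)
  interpret genus_family W g m h by unfold_locales (fact fW, fact h1)
  define A where "A = {E \<in> Gs. \<exists>U. isolated E U}"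
  \<comment> \<open>The summand \<open>h * 4 ^ h\<close> makes up for the ears that meet the copy,
    so that at least \<open>sqrt n\<close> others remain; with \<open>sqrt n\<close> both ratios are
    of order \<open>1 / sqrt n\<close>.\<close>
  define K where "K = nat \<lfloor>sqrt n\<rfloor> + h * 4 ^ h"
  define c :: nat where "c = 2 ^ 2 ^ h"
  define D where "D = (2 * g * h * 4 ^ h) * (4 ^ h * c)"
  have "2 * h \<le> card W" using n cW by simp
  from isolated_bound[OF this, of K] obtain A1 A2 where A12: "A = A1 \<union> A2"
    and b1: "card A1 * (n - h) \<le> K * c * card Gs"
    and b2: "card A2 * ((Suc K - h * 4 ^ h) * (n - 2 * h)) \<le> (2 * g * h * 4 ^ h) * (n * 4 ^ h * c) * card Gs"
    unfolding A_def c_def cW by auto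
  have SG: "S = (\<lambda>E. (W, E)) ` Gs"
  proof (intro set_eqI iffI)
    fix G assume "G \<in> S"
    then have G: "simple_graph G" "verts G = W" "card (edges G) = m" "genus_at_most g G"
      by (simp_all add: S_def genus_graphs_def W_def)
    have GW: "G = (W, edges G)" using G(2) by (simp add: prod_eq_iff)
    have "edges G \<in> Gs" unfolding Gs_def using G GW by simp
    then show "G \<in> (\<lambda>E. (W, E)) ` Gs" using GW by blast
  next
    fix G assume "G \<in> (\<lambda>E. (W, E)) ` Gs"
    then show "G \<in> S" unfolding S_def genus_graphs_def W_def[symmetric] by (auto simp: Gs_def)
  qed
  have finS: "finite S" unfolding SG using finite_Gs by simp
  have cS: "card S = card Gs" unfolding SG by (rule card_image) (auto simp: inj_on_def)
  let ?B = "{G \<in> S. has_component_iso G H}"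
  have "?B \<subseteq> (\<lambda>E. (W, E)) ` A"
  proof
    fix G assume G: "G \<in> ?B"
    then have s: "simple_graph G" "has_component_iso G H" "verts G = W" by (auto simp: S_def genus_graphs_def W_def)
    from G obtain E where E: "E \<in> Gs" "G = (W, E)" using SG by auto
    from component_isolated[OF s(1) H(3) s(2)] have "\<exists>U. isolated E U"
      unfolding isolated_def E(2) fst_conv snd_conv h_def[symmetric] by blast
    then show "G \<in> (\<lambda>E. (W, E)) ` A" using E by (auto simp: A_def)
  qed
  moreover have finA: "finite A" using finite_Gs by (simp add: A_def)
  ultimately have "card ?B \<le> card ((\<lambda>E. (W, E)) ` A)" by (intro card_mono) auto
  also have "\<dots> \<le> card A" by (rule card_image_le[OF finA])
  also have "\<dots> \<le> card A1 + card A2" unfolding A12 by (rule card_Un_le)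
  finally have cB: "card ?B \<le> card A1 + card A2" .
  have sp: "space (random_genus_graph g n m) = S" by (simp add: random_genus_graph_def space_uniform_count_measure S_def)
  have ms: "measure (random_genus_graph g n m) ?B = card ?B / card S"
    unfolding random_genus_graph_def S_def[symmetric] by (rule measure_uniform_count_measure[OF finS]) auto
  have npos: "0 < real n" using n h1 by simp
  show ?thesis
  \<comment> \<open>For an empty family the measure is a quotient by 0 and hence 0.\<close>
  proof (cases "card S = 0")
    case True
    then show ?thesis unfolding sp ms by simp
  next
    case False
    let ?s = "real (card Gs)" and ?r = "sqrt (real n)"
    have s: "0 < ?s" using False cS by simp
    have r: "0 < ?r" using npos by simp
    \<comment> \<open>The bound \<open>4 * h \<le> n\<close> is chosen for this.\<close>
    have nh: "real n / 2 \<le> real (n - h)" "real n / 2 \<le> real (n - 2 * h)" using n by (simp_all add: of_nat_diff)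
    have fl: "real (nat \<lfloor>?r\<rfloor>) \<le> ?r" "?r \<le> real (Suc (nat \<lfloor>?r\<rfloor>))" using r by linarith+
    have K1: "real K \<le> ?r + h * 4 ^ h" using fl(1) by (simp add: K_def)
    have K2: "?r \<le> real (Suc K - h * 4 ^ h)" using fl(2) by (simp add: K_def)
    have "real (card A1) * (real n / 2) \<le> real (card A1) * real (n - h)" using nh by (intro mult_left_mono) auto
    also have "\<dots> \<le> real K * c * ?s" using b1 by (simp only: of_nat_mult[symmetric] of_nat_le_iff)
    also have "\<dots> \<le> (?r + h * 4 ^ h) * c * ?s" using K1 by (intro mult_right_mono) auto
    finally have a1: "real (card A1) / ?s \<le> 2 * c * (?r + h * 4 ^ h) / real n" using s npos by (simp add: field_simps)
    have "real (card A2) * (?r * (real n / 2)) \<le> real (card A2) * (real (Suc K - h * 4 ^ h) * real (n - 2 * h))"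
      using nh K2 r by (intro mult_left_mono mult_mono) auto
    also have "\<dots> \<le> real (D * n * card Gs)"
      using b2 by (simp only: of_nat_mult[symmetric] of_nat_le_iff D_def mult_ac)
    finally have a2: "real (card A2) / ?s \<le> 2 * D / ?r" using s npos r by (simp add: field_simps)
    have "measure (random_genus_graph g n m) ?B \<le> (real (card A1) + real (card A2)) / ?s"
      unfolding ms cS using cB s by (intro divide_right_mono) auto
    also have "\<dots> \<le> 2 * c * (?r + h * 4 ^ h) / real n + 2 * D / ?r" using a1 a2 by (simp add: add_divide_distrib)
    finally show ?thesis unfolding sp D_def c_def by simp
  qed
qed

theorem theorem1p1:
  fixes H :: "'a graph" and g :: nat and m :: "nat \<Rightarrow> nat"
  assumes "simple_graph H"
    and "connected_graph H"
    and "\<not> planar H"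
    and "\<And>n. n \<ge> 2 \<Longrightarrow> int (m n) \<le> 3 * int n - 6 + 6 * int g"
  shows "(\<lambda>n. measure (random_genus_graph g n (m n))
            {G \<in> space (random_genus_graph g n (m n)). has_component_iso G H}) \<longlonglongrightarrow> 0"
proof -
  let ?h = "card (verts H)"
  \<comment> \<open>None of the three constants involves \<open>m\<close>, so the convergence is
    uniform in the number of edges.\<close>
  define a b d :: real where "a = 2 * 2 ^ 2 ^ ?h" and "b = ?h * 4 ^ ?h"
    and "d = 2 * ((2 * g * ?h * 4 ^ ?h) * (4 ^ ?h * 2 ^ 2 ^ ?h))"
  let ?B = "\<lambda>n. a * (sqrt (real n) + b) / real n + d / sqrt (real n)"
  have inv: "(\<lambda>n. 1 / sqrt (real n)) \<longlonglongrightarrow> 0" "(\<lambda>n. 1 / real n) \<longlonglongrightarrow> 0"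
    using tendsto_real_sqrt[OF lim_1_over_n[where 'a = real]] lim_1_over_n[where 'a = real] by (simp_all add: real_sqrt_divide)
  have "(\<lambda>n. (a + d) * (1 / sqrt (real n)) + a * b * (1 / real n)) \<longlonglongrightarrow> (a + d) * 0 + a * b * 0"
    by (intro tendsto_intros inv)
  moreover have "(a + d) * (1 / sqrt (real n)) + a * b * (1 / real n) = ?B n" for n
    using real_div_sqrt[of "real n"] by (cases "n = 0") (auto simp: field_simps)
  ultimately have lim: "?B \<longlonglongrightarrow> 0" by simp
  show ?thesis
  proof (rule tendsto_sandwich[OF _ _ tendsto_const lim])
    show "\<forall>\<^sub>F n in sequentially. 0 \<le> measure (random_genus_graph g n (m n))
        {G \<in> space (random_genus_graph g n (m n)). has_component_iso G H}" by simp
    show "\<forall>\<^sub>F n in sequentially. measure (random_genus_graph g n (m n))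
        {G \<in> space (random_genus_graph g n (m n)). has_component_iso G H} \<le> ?B n"
      using eventually_ge_at_top[of "4 * ?h"]
    proof (rule eventually_mono)
      fix n assume "4 * ?h \<le> n"
      from component_probability_bound[OF assms(1-3) this, of g "m n"]
      show "measure (random_genus_graph g n (m n)) {G \<in> space (random_genus_graph g n (m n)). has_component_iso G H} \<le> ?B n"
        unfolding a_def b_def d_def by simp
    qed
  qed
qed

end
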